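(* Consider the $r$-factor model $X=FB^\top+E$ with $X,E\in\mathbb{R}^{T\times N}$, $F=(f_{tl})\in\mathbb{R}^{T\times r}$ with rows $f_t^\top$, $B=(b_{jl})\in\mathbb{R}^{N\times r}$, where $e_t^\top$ is the $t$-th row of $E$, and the penalized PCA (PPCA) estimator $\hat F$ (rows $\hat f_t^\top$) with tuning parameter $\lambda>0$ (all as in the context). Let $\Omega=N^{-1}B^\top D^{-1}B$ with spectral decomposition $\Omega=\Gamma_\Omega\Lambda_\Omega\Gamma_\Omega^\top$, and $H=\Omega(F^\top\hat F/T)\Lambda_r^{-1}$, where $\Lambda_r$ is the diagonal matrix of the $r$ leading eigenvalues of $XD^{-1}X^\top/(NT)$. Suppose: (A1) For all $t\le T$, $l\le r$: $E(f_{tl})=0$, $E(f_{tl}^2)=1$, $E(f_{tl}^4)\le M$ for some constant $M>0$. Moreover $F^\top F/T=I_r$ almost surely, and $E\|v^\top F\|^2\le M$ for every $v\in\mathbb{R}^T$ with $\|v\|=1$. (A2) $|b_{jl}|\le M$ for all $j\le N$, $l\le r$. Moreover $N^{-1}B^\top B\to\Sigma_B$, with $c_1\ge\lambda_1(\Sigma_B)>\dots>\lambda_r(\Sigma_B)\ge c_2$ for some constants $c_1,c_2>0$. (A3) $E=P_1SP_2$, where $S=(\epsilon_{tj})_{T\times N}$ has independent entries with $E(\epsilon_{tj})=0$, $E(\epsilon_{tj}^2)=1$, $E(\epsilon_{tj}^4)\le M$, and $P_1\in\mathbb{R}^{T\times T}$, $P_2\in\mathbb{R}^{N\times N}$ are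 deterministic. There are positive constants $c_1,c_2$ with $c_2\le\lambda_t(P_1^\top P_1)\le c_1$ for all $t\le T$ and $c_2\le\lambda_j(P_2^\top P_2)\le c_1$ for all $j\le N$. In addition, $S$ and $F$ are independent. (A4) For any $t\le T$, $\frac1{\sqrt N}B^\top D^{-1}e_t\xrightarrow{d}\mathcal N(0,V_t)$, where $V_t=\lim_{N,T\to\infty}N^{-1}\|p_{1,t}\|^2\,B^\top D^{-1}P_2^\top P_2D^{-1}B$ and $p_{1,t}$ is the $t$-th row of $P_1$. Then, for the estimated factor scores, as $N,T\to\infty$: 1. If $\|D^{-1}\|_F/\min\{T,\sqrt{NT}\}=o(1)$, then $$\sqrt N(\hat f_t-H^\top f_t)\xrightarrow{d}\mathcal N\!\left(0,\ \Lambda_\Omega^{-1}\Gamma_\Omega^\top V_t\Gamma_\Omega\Lambda_\Omega^{-1}\right).$$ 2. Otherwise, if there exists a constant $c>0$ such that $\|D^{-1}\|_F/\min\{T,\sqrt{NT}\}>c$, then $$\hat f_t-H^\top f_t=O_p\!\left(\frac{\|D^{-1}\|_F}{\sqrt N\,\min\{T,\sqrt{NT}\}}\right).$$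
   Context: Asymptotics are as $N,T\to\infty$; the number of factors $r$ is fixed and given. Only $X$ is observed; $B$ is deterministic. $\|\cdot\|_F$ is the Frobenius norm, $\|\cdot\|$ the spectral norm (Euclidean norm for vectors), and $\lambda_j(\cdot)$ the $j$-th largest eigenvalue. The tuning parameter $\lambda>0$ may depend on $N,T$. Let $A$ be the $N\times N$ all-ones matrix, $\Pi_N=I_N-N^{-1}A$ and $D=I_N+\lambda\Pi_N$. PPCA estimators: $\hat F$ is $\sqrt T$ times the matrix whose columns are orthonormal eigenvectors of $XD^{-1}X^\top$ associated with its $r$ largest eigenvalues (in descending order), and $\hat B=T^{-1}D^{-1}X^\top\hat F$. (Equivalently, $(\hat B,\hat F)$ minimizes $\frac1{TN}\|X-FB^\top\|_F^2+\frac{\lambda}{N}\mathrm{Tr}(B^\top\Pi_NB)$ subject to $F^\top F/T=I_r$.) Eigenvalues in $\Lambda_r$ and $\Lambda_\Omega$ are in descending order. Convention: $\Omega$ depends on $N$ and $\lambda$; in the limiting covariance $\Lambda_\Omega$ and $\Gamma_\Omega$ are understood through their limits as $N,T\to\infty$, with the signs of the columns of $\hat F$ and $\Gamma_\Omega$ (eigenvectors being defined up to sign) chosen compatibly.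
   Formalization: Added: the smallest eigenvalue of Ω stays bounded away from 0 (this can fail only along λ→∞, where Λ_Ω^{-1} has no limit and part 2 is false); in part 1, the limiting eigenvalues of Ω are distinct (otherwise the stated normal limit can fail). *)

theory Defs
  imports
    "HOL-Probability.Probability"
    "Jordan_Normal_Form.Gauss_Jordan_Elimination"
    "Jordan_Normal_Form.Char_Poly"
begin

text \<open>
  Matrices and vectors are those of Jordan_Normal_Form, since the dimensions \<open>N\<close> and \<open>T\<close> grow.
  All indices start at 0: row \<open>t < T\<close>, column \<open>j < N\<close>, factor \<open>l < r\<close>.
\<close>

section \<open>Matrices\<close>

definition eucl_norm :: "real Matrix.vec \<Rightarrow> real" where
  "eucl_norm v = sqrt (\<Sum>i<dim_vec v. (vec_index v i)\<^sup>2)"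

definition frob_norm :: "real Matrix.mat \<Rightarrow> real" where
  "frob_norm A = sqrt (\<Sum>i<dim_row A. \<Sum>j<dim_col A. (A $$ (i, j))\<^sup>2)"

text \<open>Matrix inverse; by convention the zero matrix if \<open>A\<close> is singular.\<close>

definition inv_mat :: "real Matrix.mat \<Rightarrow> real Matrix.mat" where
  "inv_mat A = (case mat_inverse A of Some A' \<Rightarrow> A' | None \<Rightarrow> 0\<^sub>m (dim_row A) (dim_col A))"

text \<open>
  \<open>nth_eigenvalue A j\<close> is the \<open>(j+1)\<close>-st largest real eigenvalue of \<open>A\<close>, counted with multiplicity.
  It is only used for symmetric \<open>A\<close>, for which all roots of the characteristic polynomial are real.
\<close>

definition nth_eigenvalue :: "real Matrix.mat \<Rightarrow> nat \<Rightarrow> real" where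
  "nth_eigenvalue A j = rev (sorted_list_of_multiset (proots (char_poly A))) ! j"

definition mat_tendsto :: "(nat \<Rightarrow> real Matrix.mat) \<Rightarrow> real Matrix.mat \<Rightarrow> bool" where
  "mat_tendsto A L \<longleftrightarrow>
     (\<forall>i<dim_row L. \<forall>j<dim_col L. (\<lambda>n. A n $$ (i, j)) \<longlonglongrightarrow> L $$ (i, j))"

section \<open>Random matrices, convergence in distribution, stochastic order\<close>

definition random_matrix :: "'a measure \<Rightarrow> nat \<Rightarrow> nat \<Rightarrow> ('a \<Rightarrow> real Matrix.mat) \<Rightarrow> bool" where
  "random_matrix M m k A \<longleftrightarrow>
     (\<forall>\<omega>\<in>space M. A \<omega> \<in> carrier_mat m k) \<and>
     (\<forall>i<m. \<forall>j<k. (\<lambda>\<omega>. A \<omega> $$ (i, j)) \<in> borel_measurable M)"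

text \<open>
  The type of vectors carries no topology, so a vector is identified with its coordinate function,
  padded with zeros. Bounded continuous functions on \<open>nat \<Rightarrow> real\<close> (product topology) restrict to
  exactly the bounded continuous functions on the \<open>r\<close>-dimensional Euclidean space.
\<close>

definition coords :: "real Matrix.vec \<Rightarrow> nat \<Rightarrow> real" where
  "coords v = (\<lambda>i. if i < dim_vec v then vec_index v i else 0)"

definition weakly_converges ::
    "(nat \<Rightarrow> 'b::topological_space measure) \<Rightarrow> 'b measure \<Rightarrow> bool" where
  "weakly_converges \<mu> \<nu> \<longleftrightarrow>
     (\<forall>g :: 'b \<Rightarrow> real. continuous_on UNIV g \<and> bounded (range g) \<longrightarrow>
        (\<lambda>n. integral\<^sup>L (\<mu> n) g) \<longlonglongrightarrow> integral\<^sup>L \<nu> g)"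

text \<open>
  \<open>\<nu>\<close> is the centered normal law with covariance \<open>V\<close> on \<open>r\<close>-dimensional space: the law of \<open>A z\<close> where \<open>z\<close> has independent
  standard normal coordinates and \<open>A A\<^sup>T = V\<close>. The law does not depend on the choice of \<open>A\<close>;
  \<open>V\<close> may be singular.
\<close>

definition centered_normal_law :: "nat \<Rightarrow> real Matrix.mat \<Rightarrow> (nat \<Rightarrow> real) measure \<Rightarrow> bool" where
  "centered_normal_law r V \<nu> \<longleftrightarrow>
     (\<exists>A\<in>carrier_mat r r. A * transpose_mat A = V \<and>
        \<nu> = distr (Pi\<^sub>M {..<r} (\<lambda>_. std_normal_distribution)) borel
              (\<lambda>z. coords (A *\<^sub>v Matrix.vec r z)))"

definition converges_to_normal ::
    "'a measure \<Rightarrow> nat \<Rightarrow> (nat \<Rightarrow> 'a \<Rightarrow> real Matrix.vec) \<Rightarrow> real Matrix.mat \<Rightarrow> bool" where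
  "converges_to_normal M r Y V \<longleftrightarrow>
     (\<exists>\<nu>. centered_normal_law r V \<nu> \<and>
        weakly_converges (\<lambda>n. distr M borel (\<lambda>\<omega>. coords (Y n \<omega>))) \<nu>)"

definition big_O_prob ::
    "'a measure \<Rightarrow> (nat \<Rightarrow> 'a \<Rightarrow> real Matrix.vec) \<Rightarrow> (nat \<Rightarrow> real) \<Rightarrow> bool" where
  "big_O_prob M Y a \<longleftrightarrow>
     (\<forall>\<epsilon>>0. \<exists>K. \<forall>\<^sub>F n in sequentially.
        measure M {\<omega>\<in>space M. eucl_norm (Y n \<omega>) > K * a n} \<le> \<epsilon>)"

section \<open>Penalized principal components\<close>

definition centering_mat :: "nat \<Rightarrow> real Matrix.mat" where
  "centering_mat N = 1\<^sub>m N - (1 / real N) \<cdot>\<^sub>m Matrix.mat N N (\<lambda>_. 1)"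

definition penalty_mat :: "nat \<Rightarrow> real \<Rightarrow> real Matrix.mat" where
  "penalty_mat N lam = 1\<^sub>m N + lam \<cdot>\<^sub>m centering_mat N"

definition penalty_inv :: "nat \<Rightarrow> real \<Rightarrow> real Matrix.mat" where
  "penalty_inv N lam = inv_mat (penalty_mat N lam)"

definition ppca_gram :: "real \<Rightarrow> real Matrix.mat \<Rightarrow> real Matrix.mat" where
  "ppca_gram lam X = X * penalty_inv (dim_col X) lam * transpose_mat X"

text \<open>
  \<open>Fh\<close> is a PPCA factor estimate for the data \<open>X\<close>. Eigenvectors are not unique, so this is a
  predicate.
\<close>

definition ppca_factors :: "nat \<Rightarrow> real \<Rightarrow> real Matrix.mat \<Rightarrow> real Matrix.mat \<Rightarrow> bool" where
  "ppca_factors r lam X Fh \<longleftrightarrow>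
     (\<exists>U\<in>carrier_mat (dim_row X) r.
        transpose_mat U * U = 1\<^sub>m r \<and>
        (\<forall>l<r. eigenvector (ppca_gram lam X) (col U l) (nth_eigenvalue (ppca_gram lam X) l)) \<and>
        Fh = sqrt (real (dim_row X)) \<cdot>\<^sub>m U)"

definition Omega_mat :: "nat \<Rightarrow> real \<Rightarrow> real Matrix.mat \<Rightarrow> real Matrix.mat" where
  "Omega_mat N lam B = (1 / real N) \<cdot>\<^sub>m (transpose_mat B * penalty_inv N lam * B)"

definition leading_eigenvalues :: "nat \<Rightarrow> real Matrix.mat \<Rightarrow> real Matrix.mat" where
  "leading_eigenvalues r A = mat_diag r (nth_eigenvalue A)"

definition spectral_decomposition :: "nat \<Rightarrow> real Matrix.mat \<Rightarrow> real Matrix.mat \<Rightarrow> bool" where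
  "spectral_decomposition r A Gam \<longleftrightarrow>
     Gam \<in> carrier_mat r r \<and> transpose_mat Gam * Gam = 1\<^sub>m r \<and>
     A = Gam * leading_eigenvalues r A * transpose_mat Gam"

definition rotation_mat ::
    "nat \<Rightarrow> real \<Rightarrow> real Matrix.mat \<Rightarrow> real Matrix.mat \<Rightarrow> real Matrix.mat \<Rightarrow> real Matrix.mat
      \<Rightarrow> real Matrix.mat" where
  "rotation_mat r lam X B F Fh =
     (let T = real (dim_row X); N = real (dim_col X) in
      Omega_mat (dim_col X) lam B * ((1 / T) \<cdot>\<^sub>m (transpose_mat F * Fh)) *
      inv_mat (leading_eigenvalues r ((1 / (N * T)) \<cdot>\<^sub>m ppca_gram lam X)))"

section \<open>Standing assumptions\<close>

text \<open>
  Everything is a triangular array: \<open>N n\<close> and \<open>T n\<close> both tend to infinity with \<open>n\<close>, and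
  all matrices (and \<open>\<lambda>\<close>) may change with \<open>n\<close>. Constants do not depend on \<open>n\<close>.
\<close>

definition factor_assumption ::
    "'a measure \<Rightarrow> (nat \<Rightarrow> nat) \<Rightarrow> nat \<Rightarrow> real \<Rightarrow> (nat \<Rightarrow> 'a \<Rightarrow> real Matrix.mat) \<Rightarrow> bool" where
  "factor_assumption M T r C F \<longleftrightarrow>
     (\<forall>n. random_matrix M (T n) r (F n) \<and>
        (\<forall>t<T n. \<forall>l<r.
           integrable M (\<lambda>\<omega>. (F n \<omega> $$ (t, l)) ^ 4) \<and>
           (\<integral>\<omega>. F n \<omega> $$ (t, l) \<partial>M) = 0 \<and>
           (\<integral>\<omega>. (F n \<omega> $$ (t, l))\<^sup>2 \<partial>M) = 1 \<and>
           (\<integral>\<omega>. (F n \<omega> $$ (t, l)) ^ 4 \<partial>M) \<le> C) \<and>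
        (AE \<omega> in M. (1 / real (T n)) \<cdot>\<^sub>m (transpose_mat (F n \<omega>) * F n \<omega>) = 1\<^sub>m r) \<and>
        (\<forall>v\<in>carrier_vec (T n). eucl_norm v = 1 \<longrightarrow>
           (\<integral>\<omega>. (eucl_norm (transpose_mat (F n \<omega>) *\<^sub>v v))\<^sup>2 \<partial>M) \<le> C))"

definition loading_assumption ::
    "(nat \<Rightarrow> nat) \<Rightarrow> nat \<Rightarrow> real \<Rightarrow> (nat \<Rightarrow> real Matrix.mat) \<Rightarrow> real Matrix.mat \<Rightarrow> bool" where
  "loading_assumption N r C B SigB \<longleftrightarrow>
     (\<forall>n. B n \<in> carrier_mat (N n) r \<and> (\<forall>j<N n. \<forall>l<r. \<bar>B n $$ (j, l)\<bar> \<le> C)) \<and>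
     SigB \<in> carrier_mat r r \<and>
     mat_tendsto (\<lambda>n. (1 / real (N n)) \<cdot>\<^sub>m (transpose_mat (B n) * B n)) SigB \<and>
     (\<exists>c1>0. \<exists>c2>0.
        nth_eigenvalue SigB 0 \<le> c1 \<and>
        (\<forall>l. Suc l < r \<longrightarrow> nth_eigenvalue SigB (Suc l) < nth_eigenvalue SigB l) \<and>
        c2 \<le> nth_eigenvalue SigB (r - 1))"

definition noise_assumption ::
    "'a measure \<Rightarrow> (nat \<Rightarrow> nat) \<Rightarrow> (nat \<Rightarrow> nat) \<Rightarrow> nat \<Rightarrow> real \<Rightarrow> (nat \<Rightarrow> real Matrix.mat) \<Rightarrow>
      (nat \<Rightarrow> real Matrix.mat) \<Rightarrow> (nat \<Rightarrow> 'a \<Rightarrow> real Matrix.mat) \<Rightarrow> (nat \<Rightarrow> 'a \<Rightarrow> real Matrix.mat)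
      \<Rightarrow> bool" where
  "noise_assumption M N T r C P1 P2 S F \<longleftrightarrow>
     (\<forall>n. P1 n \<in> carrier_mat (T n) (T n) \<and> P2 n \<in> carrier_mat (N n) (N n) \<and>
        random_matrix M (T n) (N n) (S n) \<and>
        prob_space.indep_vars M (\<lambda>_. borel) (\<lambda>p \<omega>. S n \<omega> $$ p) ({..<T n} \<times> {..<N n}) \<and>
        (\<forall>t<T n. \<forall>j<N n.
           integrable M (\<lambda>\<omega>. (S n \<omega> $$ (t, j)) ^ 4) \<and>
           (\<integral>\<omega>. S n \<omega> $$ (t, j) \<partial>M) = 0 \<and>
           (\<integral>\<omega>. (S n \<omega> $$ (t, j))\<^sup>2 \<partial>M) = 1 \<and>
           (\<integral>\<omega>. (S n \<omega> $$ (t, j)) ^ 4 \<partial>M) \<le> C) \<and>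
        prob_space.indep_var M
          (Pi\<^sub>M ({..<T n} \<times> {..<N n}) (\<lambda>_. borel))
          (\<lambda>\<omega>. \<lambda>p\<in>{..<T n} \<times> {..<N n}. S n \<omega> $$ p)
          (Pi\<^sub>M ({..<T n} \<times> {..<r}) (\<lambda>_. borel))
          (\<lambda>\<omega>. \<lambda>p\<in>{..<T n} \<times> {..<r}. F n \<omega> $$ p)) \<and>
     (\<exists>c1>0. \<exists>c2>0. \<forall>n.
        (\<forall>t<T n. c2 \<le> nth_eigenvalue (transpose_mat (P1 n) * P1 n) t \<and>
                 nth_eigenvalue (transpose_mat (P1 n) * P1 n) t \<le> c1) \<and>
        (\<forall>j<N n. c2 \<le> nth_eigenvalue (transpose_mat (P2 n) * P2 n) j \<and>
                 nth_eigenvalue (transpose_mat (P2 n) * P2 n) j \<le> c1))"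

definition clt_assumption ::
    "'a measure \<Rightarrow> (nat \<Rightarrow> nat) \<Rightarrow> nat \<Rightarrow> (nat \<Rightarrow> real) \<Rightarrow> (nat \<Rightarrow> real Matrix.mat) \<Rightarrow>
      (nat \<Rightarrow> real Matrix.mat) \<Rightarrow> (nat \<Rightarrow> real Matrix.mat) \<Rightarrow> (nat \<Rightarrow> 'a \<Rightarrow> real Matrix.mat) \<Rightarrow>
      (nat \<Rightarrow> real Matrix.mat) \<Rightarrow> bool" where
  "clt_assumption M N r lam B P1 P2 E V \<longleftrightarrow>
     (\<forall>t. V t \<in> carrier_mat r r \<and>
        mat_tendsto (\<lambda>n. ((eucl_norm (row (P1 n) t))\<^sup>2 / real (N n)) \<cdot>\<^sub>m
           (transpose_mat (B n) * penalty_inv (N n) (lam n) * transpose_mat (P2 n) * P2 n *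
            penalty_inv (N n) (lam n) * B n)) (V t) \<and>
        converges_to_normal M r
          (\<lambda>n \<omega>. (1 / sqrt (real (N n))) \<cdot>\<^sub>v
             ((transpose_mat (B n) * penalty_inv (N n) (lam n)) *\<^sub>v row (E n \<omega>) t)) (V t))"

text \<open>
  The reading of \<open>\<Lambda>\<^sub>\<Omega>\<close> and \<open>\<Gamma>\<^sub>\<Omega>\<close> in a limiting covariance. The limits exist, and
  the limiting eigenvalues are distinct: only then are eigenvectors determined up to sign. The
  signs of \<open>\<Gamma>\<^sub>\<Omega>\<close> are chosen along the convergent sequence \<open>Gam\<close>, and each column of
  the estimate is oriented by its inner product with the corresponding column of \<open>F \<Gamma>\<^sub>\<Omega>\<close>.
\<close>

definition limiting_eigensystem ::
    "nat \<Rightarrow> (nat \<Rightarrow> real Matrix.mat) \<Rightarrow> (nat \<Rightarrow> real Matrix.mat) \<Rightarrow> real Matrix.mat \<Rightarrow>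
      real Matrix.mat \<Rightarrow> bool" where
  "limiting_eigensystem r Om Gam GamLim LamLim \<longleftrightarrow>
     (\<forall>n. spectral_decomposition r (Om n) (Gam n)) \<and>
     GamLim \<in> carrier_mat r r \<and> mat_tendsto Gam GamLim \<and>
     LamLim \<in> carrier_mat r r \<and> mat_tendsto (\<lambda>n. leading_eigenvalues r (Om n)) LamLim \<and>
     (\<forall>l. Suc l < r \<longrightarrow> LamLim $$ (Suc l, Suc l) < LamLim $$ (l, l))"

definition compatible_signs ::
    "'a measure \<Rightarrow> nat \<Rightarrow> (nat \<Rightarrow> 'a \<Rightarrow> real Matrix.mat) \<Rightarrow> (nat \<Rightarrow> 'a \<Rightarrow> real Matrix.mat) \<Rightarrow>
      (nat \<Rightarrow> real Matrix.mat) \<Rightarrow> bool" where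
  "compatible_signs M r Fh F Gam \<longleftrightarrow>
     (\<forall>n. \<forall>\<omega>\<in>space M. \<forall>l<r. 0 \<le> (transpose_mat (Fh n \<omega>) * (F n \<omega> * Gam n)) $$ (l, l))"

end

theory Submission
  imports Defs
begin

text \<open>
  Let \<open>S\<close> be \<open>X D\<^sup>-\<^sup>1 X\<^sup>T / (N T)\<close>. Then \<open>S = F \<Omega> F\<^sup>T / T + \<Delta>\<close>, where \<open>\<Delta>\<close> has
  Frobenius norm \<open>O\<^sub>p(N\<^bsup>-1/2\<^esup> + T\<^bsup>-1/2\<^esup>)\<close> by second moment bounds for linear and quadratic forms in the noise,
  so the leading eigenvalues of \<open>S\<close> stay away from 0. With \<open>K = F\<^sup>T Fh / T\<close> the eigenvector equation gives
  \<open>Fh - F H = \<Delta> Fh \<Lambda>\<^sub>r\<^sup>-\<^sup>1\<close>, and the \<open>t\<close>-th row of the right hand side, scaled by \<open>\<surd>N\<close>, is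
  \<open>\<Lambda>\<^sub>r\<^sup>-\<^sup>1 K\<^sup>T Z\<close> with \<open>Z = N\<^bsup>-1/2\<^esup> B\<^sup>T D\<^sup>-\<^sup>1 e\<^sub>t\<close>, up to a remainder. Replacing \<open>Fh\<close> by \<open>F H\<close> inside the remainder
  makes only forms in the noise with independent or deterministic coefficients appear; it is
  \<open>O\<^sub>p(ratio + N\<^bsup>-1/2\<^esup> + T\<^bsup>-1/2\<^esup>)\<close>. As \<open>Z = O\<^sub>p(1)\<close>, this is the second claim. For the first one,
  \<open>J = \<Gamma>\<^sub>\<Omega>\<^sup>T K\<close> nearly satisfies \<open>\<Lambda>\<^sub>\<Omega> J = J \<Lambda>\<^sub>r\<close> and \<open>J\<^sup>T J = I\<close>; the spectral gap and the choice of signs force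
  \<open>J\<close> to be close to \<open>I\<close>, so \<open>\<Lambda>\<^sub>r\<^sup>-\<^sup>1 K\<^sup>T\<close> converges in probability to \<open>\<Lambda>\<^sub>\<Omega>\<^sup>-\<^sup>1 \<Gamma>\<^sub>\<Omega>\<^sup>T\<close> and Slutsky's
  theorem applies.
\<close>

text \<open>The obstacle is that \<open>Fh\<close> depends on all of the noise: no moment bound
  applies to a product of \<open>Fh\<close> with a noise term, and bounding by norms loses a factor
  \<surd>T. After the replacement by F H the loss only hits a term that already carries the small
  factor \<Delta>. The rate has this origin: with G = P2 D^-1 P2^T and d = |D^-1|_F, column t of E
  D^-1 E^T has a mean part tr(G) P1 P1^T u_t, where tr(G) is at most of order \<surd>N d, and
  fluctuations of order \<surd>T d. Independence and E|v^T F|^2 \<le> C keep this order after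
  multiplication by F^T, and d max(\<surd>N, \<surd>T) / (\<surd>N T) is exactly the ratio of the
  theorem. The bound \<kappa> on the eigenvalues of \<Omega> is a hypothesis of its own because D^-1
  tends to a rank one projection as \<lambda> grows, so that a nondegenerate limit of B^T B / N does
  not control \<Omega>. Measurability is delicate in one place: \<open>Fh\<close> is an arbitrary
  measurable choice of eigenvectors, and the eigenvalues become measurable by being written as
  quadratic forms in it.\<close>

unbundle no vec_syntax and no inner_syntax

section \<open>Real symmetric matrices\<close>

text \<open>Over the complex numbers the characteristic polynomial factors, which gives an
  eigenvalue z with eigenvector x + i y. Symmetry equates y^T A x with x^T A y, hence Im z (|x|^2 +
  |y|^2) = 0. So z is real, and x or y, whichever is nonzero, is a real eigenvector.\<close>

lemma symmetric_real_eigenvector: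
  fixes A :: "real Matrix.mat"
  assumes A: "A \<in> carrier_mat n n" and sym: "transpose_mat A = A" and n: "0 < n"
  shows "\<exists>e v. v \<in> carrier_vec n \<and> v \<noteq> 0\<^sub>v n \<and> A *\<^sub>v v = e \<cdot>\<^sub>v v"
proof -
  let ?C = "map_mat complex_of_real A"
  have C: "?C \<in> carrier_mat n n" using A by auto
  obtain as where as: "char_poly ?C = (\<Prod>a\<leftarrow>as. [:- a, 1:])" "length as = n"
    using char_poly_factorized[OF C] by blast
  with n obtain z where "z \<in> set as" by (cases as) auto
  then have "poly (char_poly ?C) z = 0"
    by (auto simp: as(1) poly_prod_list o_def)
  then have "eigenvalue ?C z" using eigenvalue_root_char_poly[OF C] by simp
  then obtain w where w: "w \<in> carrier_vec n" "w \<noteq> 0\<^sub>v n" "?C *\<^sub>v w = z \<cdot>\<^sub>v w"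
    unfolding eigenvalue_def eigenvector_def using A by auto
  define x where "x i = Re (vec_index w i)" for i
  define y where "y i = Im (vec_index w i)" for i
  have entry: "(\<Sum>j<n. complex_of_real (A $$ (i,j)) * vec_index w j) = z * vec_index w i" if "i < n" for i
  proof -
    have "vec_index (?C *\<^sub>v w) i = (\<Sum>j<n. complex_of_real (A $$ (i,j)) * vec_index w j)"
      using that A w(1) by (auto simp: scalar_prod_def atLeast0LessThan intro!: sum.cong)
    then show ?thesis using that w by simp
  qed
  have Ax: "(\<Sum>j<n. A $$ (i,j) * x j) = Re z * x i - Im z * y i" if "i < n" for i
    using arg_cong[OF entry[OF that], of Re] by (simp add: x_def y_def)
  have Ay: "(\<Sum>j<n. A $$ (i,j) * y j) = Re z * y i + Im z * x i" if "i < n" for i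
    using arg_cong[OF entry[OF that], of Im] by (simp add: x_def y_def algebra_simps)
  have symm: "A $$ (i,j) = A $$ (j,i)" if "i < n" "j < n" for i j
    using arg_cong[OF sym, of "\<lambda>B. B $$ (i,j)"] A that by simp
  have "(\<Sum>i<n. y i * (\<Sum>j<n. A $$ (i,j) * x j)) = (\<Sum>j<n. \<Sum>i<n. y i * (A $$ (i,j) * x j))"
    by (simp add: sum_distrib_left) (rule sum.swap)
  also have "\<dots> = (\<Sum>j<n. x j * (\<Sum>i<n. A $$ (j,i) * y i))"
    by (auto simp: sum_distrib_left symm intro!: sum.cong)
  finally have "(\<Sum>i<n. y i * (Re z * x i - Im z * y i)) = (\<Sum>i<n. x i * (Re z * y i + Im z * x i))"
    by (simp add: Ax Ay)
  then have "(\<Sum>i<n. Im z * ((x i)\<^sup>2 + (y i)\<^sup>2)) = 0"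
    by (simp add: algebra_simps power2_eq_square sum.distrib sum_subtractf)
  then have "Im z * (\<Sum>i<n. (x i)\<^sup>2 + (y i)\<^sup>2) = 0" by (simp add: sum_distrib_left)
  moreover have "(\<Sum>i<n. (x i)\<^sup>2 + (y i)\<^sup>2) \<noteq> 0"
  proof
    assume "(\<Sum>i<n. (x i)\<^sup>2 + (y i)\<^sup>2) = 0"
    then have "\<forall>i<n. (x i)\<^sup>2 + (y i)\<^sup>2 = 0"
      by (subst (asm) sum_nonneg_eq_0_iff) auto
    then have "\<forall>i<n. vec_index w i = 0"
      by (auto simp: x_def y_def complex_eq_iff sum_power2_eq_zero_iff)
    then show False using w(1,2) by auto
  qed
  ultimately have im: "Im z = 0" by simp
  have ex: "\<exists>i<n. x i \<noteq> 0 \<or> y i \<noteq> 0"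
  proof (rule ccontr)
    assume "\<not> ?thesis"
    then have "\<forall>i<n. vec_index w i = 0" by (auto simp: x_def y_def complex_eq_iff)
    then show False using w(1,2) by auto
  qed
  have "\<exists>u. (\<exists>i<n. u i \<noteq> 0) \<and> (\<forall>i<n. (\<Sum>j<n. A $$ (i,j) * u j) = Re z * u i)"
  proof (cases "\<exists>i<n. x i \<noteq> 0")
    case True
    then show ?thesis using Ax im by (intro exI[of _ x]) auto
  next
    case False
    then show ?thesis using Ay im ex by (intro exI[of _ y]) auto
  qed
  then obtain u where u: "\<exists>i<n. u i \<noteq> 0" "\<forall>i<n. (\<Sum>j<n. A $$ (i,j) * u j) = Re z * u i"
    by blast
  have "Matrix.vec n u \<noteq> 0\<^sub>v n" using u(1) by (metis index_vec index_zero_vec(1))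
  moreover have "A *\<^sub>v Matrix.vec n u = Re z \<cdot>\<^sub>v Matrix.vec n u"
    using A u(2) by (intro eq_vecI) (auto simp: scalar_prod_def atLeast0LessThan)
  ultimately show ?thesis by (intro exI[of _ "Re z"] exI[of _ "Matrix.vec n u"]) auto
qed

lemma mat_mult_unit_vec:
  fixes A :: "real Matrix.mat"
  assumes "A \<in> carrier_mat m n" "j < n"
  shows "A *\<^sub>v unit_vec n j = col A j"
  using assms by (intro eq_vecI) auto

lemma unit_vector_orthogonal_matrix:
  fixes v :: "real Matrix.vec"
  assumes v: "v \<in> carrier_vec n" "v \<bullet> v = 1" and n: "0 < n"
  shows "\<exists>Q\<in>carrier_mat n n. transpose_mat Q * Q = 1\<^sub>m n \<and> col Q 0 = v"
proof (cases "v = unit_vec n 0")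
  case True
  then show ?thesis using n by (intro bexI[of _ "1\<^sub>m n"]) auto
next
  case False
  text \<open>The Householder reflection that exchanges \<open>v\<close> and the first unit vector.\<close>
  define w where "w i = vec_index v i - (if i = 0 then 1 else 0)" for i
  define q where "q i j = (if i = j then 1 else 0) - w i * w j / (1 - vec_index v 0)" for i j
  have sv: "(\<Sum>i<n. (vec_index v i)\<^sup>2) = 1"
    using v by (simp add: scalar_prod_def atLeast0LessThan power2_eq_square)
  have ne: "vec_index v 0 \<noteq> 1"
  proof
    assume 1: "vec_index v 0 = 1"
    have "(\<Sum>i\<in>{..<n}-{0}. (vec_index v i)\<^sup>2) = 0"
      using sv n 1 by (simp add: sum_diff1)
    then have "\<forall>i\<in>{..<n}-{0}. vec_index v i = 0"
      by (subst (asm) sum_nonneg_eq_0_iff) auto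
    then have "v = unit_vec n 0" using v(1) 1 n by (intro eq_vecI) auto
    then show False using False by simp
  qed
  \<comment> \<open>This identifies \<open>q\<close> as I - 2 w w^T / |w|^2, the reflection along
    \<open>w\<close>.\<close>
  have sw: "(\<Sum>i<n. w i * w i) = 2 * (1 - vec_index v 0)"
  proof -
    have "(\<Sum>i<n. w i * w i) = (\<Sum>i<n. (vec_index v i)\<^sup>2 - (if i = 0 then 2 * vec_index v 0 - 1 else 0))"
      by (rule sum.cong) (auto simp: w_def power2_eq_square algebra_simps)
    also have "\<dots> = 1 - (2 * vec_index v 0 - 1)" using sv n by (simp add: sum_subtractf)
    finally show ?thesis by simp
  qed
  let ?Q = "Matrix.mat n n (\<lambda>(i,j). q i j)"
  have "transpose_mat ?Q * ?Q = 1\<^sub>m n"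
  proof (rule eq_matI)
    fix i j assume "i < dim_row (1\<^sub>m n)" "j < dim_col (1\<^sub>m n)"
    then have ij: "i < n" "j < n" by auto
    define c where "c = 1 - vec_index v 0"
    have c: "c \<noteq> 0" using ne c_def by simp
    have "(transpose_mat ?Q * ?Q) $$ (i,j) = (\<Sum>k<n. q k i * q k j)"
      using ij by (simp add: scalar_prod_def atLeast0LessThan)
    also have "\<dots> = (\<Sum>k<n. (if k = i then (if k = j then 1 else 0) else 0)
         - (if k = i then w k * w j / c else 0) - (if k = j then w k * w i / c else 0)
         + w i * w j / c\<^sup>2 * (w k * w k))"
      using c by (intro sum.cong) (auto simp: q_def c_def[symmetric] field_simps power2_eq_square)
    also have "\<dots> = (if i = j then 1 else 0) - w i * w j / c - w j * w i / c + w i * w j / c\<^sup>2 * (2 * c)"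
      using ij sw unfolding c_def[symmetric]
      by (simp add: sum.distrib sum_subtractf sum_distrib_left[symmetric] sum_divide_distrib[symmetric])
    also have "\<dots> = (if i = j then 1 else 0)" using c by (simp add: field_simps power2_eq_square)
    finally show "(transpose_mat ?Q * ?Q) $$ (i,j) = 1\<^sub>m n $$ (i,j)" using ij by simp
  qed auto
  moreover have "col ?Q 0 = v"
    using v(1) n ne by (intro eq_vecI) (auto simp: q_def w_def field_simps)
  ultimately show ?thesis by (intro bexI[of _ ?Q]) auto
qed

text \<open>Deflation. An orthogonal matrix whose first column is a unit eigenvector conjugates
  \<open>A\<close> to a block diagonal matrix with the eigenvalue in the corner; the induction
  hypothesis diagonalizes the remaining symmetric block.\<close>

lemma symmetric_orthogonal_diagonalization:
  fixes A :: "real Matrix.mat"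
  assumes "A \<in> carrier_mat n n" "transpose_mat A = A"
  shows "\<exists>U\<in>carrier_mat n n. \<exists>d. transpose_mat U * U = 1\<^sub>m n \<and> A * U = U * mat_diag n d"
  using assms
proof (induction n arbitrary: A)
  case 0
  then show ?case by (intro bexI[of _ "1\<^sub>m 0"]) (auto simp: mat_diag_def intro!: eq_matI)
next
  case (Suc n)
  obtain e v where v: "v \<in> carrier_vec (Suc n)" "v \<noteq> 0\<^sub>v (Suc n)" "A *\<^sub>v v = e \<cdot>\<^sub>v v"
    using symmetric_real_eigenvector[OF Suc.prems] by blast
  define u where "u = (1 / sqrt (v \<bullet> v)) \<cdot>\<^sub>v v"
  have vv: "v \<bullet> v > 0"
  proof -
    obtain i where "i < Suc n" "vec_index v i \<noteq> 0"
      using v(1,2) by (metis carrier_vecD eq_vecI index_zero_vec)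
    then have "(\<Sum>i<Suc n. vec_index v i * vec_index v i) > 0" by (intro sum_pos2[of _ i]) (auto simp: zero_less_mult_iff)
    then show ?thesis using v(1) by (simp add: scalar_prod_def atLeast0LessThan)
  qed
  have u: "u \<in> carrier_vec (Suc n)" "u \<bullet> u = 1" "A *\<^sub>v u = e \<cdot>\<^sub>v u"
    using v vv Suc.prems(1) by (auto simp: u_def mult_mat_vec smult_smult_assoc mult.commute)
  obtain Q where Q: "Q \<in> carrier_mat (Suc n) (Suc n)" "transpose_mat Q * Q = 1\<^sub>m (Suc n)" "col Q 0 = u"
    using unit_vector_orthogonal_matrix[OF u(1,2)] by auto
  have Q': "Q * transpose_mat Q = 1\<^sub>m (Suc n)"
    using mat_mult_left_right_inverse[OF _ Q(1) Q(2)] Q(1) by simp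
  define B where "B = transpose_mat Q * A * Q"
  have B: "B \<in> carrier_mat (Suc n) (Suc n)" using Q Suc.prems by (simp add: B_def)
  have Bsym: "transpose_mat B = B"
    unfolding B_def using Q(1) Suc.prems
    by (simp add: transpose_mult[of _ "Suc n" "Suc n" _ "Suc n"] assoc_mult_mat[of _ "Suc n" "Suc n" _ "Suc n" _ "Suc n"])
  have "B *\<^sub>v unit_vec (Suc n) 0 = transpose_mat Q *\<^sub>v (A *\<^sub>v (Q *\<^sub>v unit_vec (Suc n) 0))"
    unfolding B_def using Q(1) Suc.prems(1) by (simp add: assoc_mult_mat_vec[of _ "Suc n" "Suc n" _ "Suc n"])
  also have "Q *\<^sub>v unit_vec (Suc n) 0 = u" using Q(1) Q(3) by (simp add: mat_mult_unit_vec)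
  also have "A *\<^sub>v u = e \<cdot>\<^sub>v u" by fact
  also have "transpose_mat Q *\<^sub>v (e \<cdot>\<^sub>v u) = e \<cdot>\<^sub>v (transpose_mat Q *\<^sub>v (Q *\<^sub>v unit_vec (Suc n) 0))"
    using Q u by (simp add: mult_mat_vec mat_mult_unit_vec)
  also have "transpose_mat Q *\<^sub>v (Q *\<^sub>v unit_vec (Suc n) 0) = unit_vec (Suc n) 0"
    using Q by (simp add: assoc_mult_mat_vec[of _ "Suc n" "Suc n" _ "Suc n", symmetric])
  finally have Bcol: "col B 0 = e \<cdot>\<^sub>v unit_vec (Suc n) 0" using B by (simp add: mat_mult_unit_vec)
  have B0: "B $$ (i, 0) = (if i = 0 then e else 0)" if "i < Suc n" for i
    using arg_cong[OF Bcol, of "\<lambda>v. vec_index v i"] B that by simp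
  have Bs: "B $$ (i, j) = B $$ (j, i)" if "i < Suc n" "j < Suc n" for i j
    using arg_cong[OF Bsym, of "\<lambda>B. B $$ (i,j)"] B that by simp
  \<comment> \<open>The first column of \<open>B\<close> is \<open>e\<close> times the first unit
    vector; by symmetry so is the first row. Hence \<open>A3\<close> carries all the rest of
    \<open>B\<close>.\<close>
  define A3 where "A3 = Matrix.mat n n (\<lambda>(i,j). B $$ (Suc i, Suc j))"
  have "A3 \<in> carrier_mat n n" "transpose_mat A3 = A3" by (auto simp: A3_def Bs intro!: eq_matI)
  then obtain U d where U: "U \<in> carrier_mat n n" "transpose_mat U * U = 1\<^sub>m n" "A3 * U = U * mat_diag n d"
    using Suc.IH by blast
  let ?f = "\<lambda>P. four_block_mat (1\<^sub>m 1) (0\<^sub>m 1 n) (0\<^sub>m n 1) P"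
  define d' where "d' i = (if i = 0 then e else d (i - 1))" for i
  have Bblock: "B = four_block_mat (mat_diag 1 (\<lambda>_. e)) (0\<^sub>m 1 n) (0\<^sub>m n 1) A3"
    using B by (intro eq_matI) (auto simp: A3_def B0 Bs[of 0] mat_diag_def)
  have Dblock: "mat_diag (Suc n) d' = four_block_mat (mat_diag 1 (\<lambda>_. e)) (0\<^sub>m 1 n) (0\<^sub>m n 1) (mat_diag n d)"
    by (intro eq_matI) (auto simp: mat_diag_def d'_def)
  define R where "R = ?f U"
  have R: "R \<in> carrier_mat (Suc n) (Suc n)" using U by (auto simp: R_def)
  have RR: "transpose_mat R * R = 1\<^sub>m (Suc n)"
    unfolding R_def using U
    by (subst transpose_four_block_mat[of _ 1 1 _ n _ n], simp_all)
      (subst mult_four_block_mat[of _ 1 1 _ n _ n _ _ 1 _ n], auto intro!: eq_matI)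
  have prod: "four_block_mat (mat_diag 1 a) (0\<^sub>m 1 n) (0\<^sub>m n 1) X * four_block_mat (mat_diag 1 b) (0\<^sub>m 1 n) (0\<^sub>m n 1) Y = four_block_mat (mat_diag 1 a * mat_diag 1 b) (0\<^sub>m 1 n) (0\<^sub>m n 1) (X * Y)"
    if "X \<in> carrier_mat n n" "Y \<in> carrier_mat n n" for X Y :: "real Matrix.mat" and a b
    using that by (subst mult_four_block_mat[of _ 1 1 _ n _ n _ _ 1 _ n]) (auto simp: right_mult_zero_mat[OF mat_diag_dim] left_mult_zero_mat[OF mat_diag_dim])
  have one: "mat_diag 1 (\<lambda>_. 1) = (1\<^sub>m 1 :: real Matrix.mat)" by (simp add: mat_diag_one)
  have BR: "B * R = R * mat_diag (Suc n) d'"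
    unfolding Bblock Dblock R_def using U \<open>A3 \<in> carrier_mat n n\<close>
      prod[of A3 U "\<lambda>_. e" "\<lambda>_. 1"] prod[of U "mat_diag n d" "\<lambda>_. 1" "\<lambda>_. e"] one
    by (simp add: right_mult_one_mat[OF mat_diag_dim] left_mult_one_mat[OF mat_diag_dim])
  have QRc: "Q * R \<in> carrier_mat (Suc n) (Suc n)" using Q R by simp
  have "transpose_mat (Q * R) * (Q * R) = transpose_mat R * (transpose_mat Q * Q) * R"
    using Q(1) R by (simp add: transpose_mult[of _ "Suc n" "Suc n" _ "Suc n"] assoc_mult_mat[of _ "Suc n" "Suc n" _ "Suc n" _ "Suc n"])
  then have 1: "transpose_mat (Q * R) * (Q * R) = 1\<^sub>m (Suc n)" using Q(2) R RR by simp
  have "A * (Q * R) = (Q * transpose_mat Q) * A * (Q * R)" using Q Q' Suc.prems(1) by simp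
  also have "\<dots> = Q * (B * R)"
    unfolding B_def using Q(1) R Suc.prems(1) by (simp add: assoc_mult_mat[of _ "Suc n" "Suc n" _ "Suc n" _ "Suc n"])
  also have "\<dots> = Q * R * mat_diag (Suc n) d'"
    unfolding BR using Q(1) R by (simp add: assoc_mult_mat[of _ "Suc n" "Suc n" _ "Suc n" _ "Suc n"])
  finally show ?case using QRc 1 by blast
qed

lemma proots_linear_factors: "proots (\<Prod>a\<leftarrow>as. [:- a, 1 :: real:]) = mset as"
proof (induction as)
  case (Cons a as)
  have "[:- a, 1:] * (\<Prod>a\<leftarrow>as. [:- a, 1:]) \<noteq> 0" by (auto simp: prod_list_zero_iff simp del: mult_pCons_left)
  then have "proots ([:- a, 1:] * (\<Prod>a\<leftarrow>as. [:- a, 1:])) = proots [:- a, 1:] + proots (\<Prod>a\<leftarrow>as. [:- a, 1:])"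
    by (intro proots_mult) auto
  then show ?case using Cons by (simp del: mult_pCons_left)
qed simp

lemma orthogonal_matD:
  fixes U :: "real Matrix.mat"
  assumes U: "U \<in> carrier_mat n n" "transpose_mat U * U = 1\<^sub>m n"
  shows "U * transpose_mat U = 1\<^sub>m n"
  using mat_mult_left_right_inverse[OF _ U] U(1) by simp

text \<open>\<open>nth_eigenvalue\<close> is read off the multiset of roots of the characteristic
  polynomial. Similarity makes this the multiset of diagonal entries, and since \<open>d\<close> is
  already descending, sorting and reversing gives it back.\<close>

lemma nth_eigenvalue_diagonalized:
  assumes U: "U \<in> carrier_mat n n" "transpose_mat U * U = 1\<^sub>m n"
    and A: "A = U * mat_diag n d * transpose_mat U"
    and d: "\<And>i j. i \<le> j \<Longrightarrow> j < n \<Longrightarrow> d j \<le> d i" and j: "j < n"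
  shows "nth_eigenvalue A j = d j"
proof -
  have "similar_mat_wit A (mat_diag n d) U (transpose_mat U)"
    using U A orthogonal_matD[OF U] unfolding similar_mat_wit_def Let_def by auto
  then have "char_poly A = char_poly (mat_diag n d)"
    by (intro char_poly_similar) (auto simp: similar_mat_def)
  also have "\<dots> = (\<Prod>a\<leftarrow>diag_mat (mat_diag n d). [:- a, 1:])"
    by (intro char_poly_upper_triangular[of _ n]) (auto simp: mat_diag_def)
  also have "diag_mat (mat_diag n d) = map d [0..<n]" by (auto simp: diag_mat_def mat_diag_def)
  finally have c: "proots (char_poly A) = mset (map d [0..<n])" by (simp only: proots_linear_factors)
  have "sort (map d [0..<n]) = rev (map d [0..<n])"
  proof (rule properties_for_sort)
    show "sorted (rev (map d [0..<n]))"
      using d by (auto simp: sorted_iff_nth_mono rev_nth)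
  qed auto
  then show ?thesis using j unfolding nth_eigenvalue_def c sorted_list_of_multiset_mset by simp
qed

text \<open>An orthogonal diagonalization lists the eigenvalues in an arbitrary order. Permuting the
  columns of \<open>U\<close> sorts them, after which they must agree with
  \<open>nth_eigenvalue\<close>.\<close>

theorem spectral_theorem_nth_eigenvalue:
  assumes A: "A \<in> carrier_mat n n" and sym: "transpose_mat A = A"
  obtains U where "U \<in> carrier_mat n n" "transpose_mat U * U = 1\<^sub>m n"
    "A = U * mat_diag n (nth_eigenvalue A) * transpose_mat U"
    "\<And>i j. i \<le> j \<Longrightarrow> j < n \<Longrightarrow> nth_eigenvalue A j \<le> nth_eigenvalue A i"
proof -
  obtain U d where U: "U \<in> carrier_mat n n" "transpose_mat U * U = 1\<^sub>m n" "A * U = U * mat_diag n d"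
    using symmetric_orthogonal_diagonalization[OF A sym] by blast
  let ?ds = "map d [0..<n]"
  have "mset (rev (sort ?ds)) = mset ?ds" by simp
  then obtain p where p: "p permutes {..<n}" "permute_list p ?ds = rev (sort ?ds)"
    by (metis mset_eq_permutation length_map length_upt diff_zero)
  have pn: "p j < n" if "j < n" for j using p(1) that by (metis permutes_in_image lessThan_iff)
  have pinj: "p i = p j \<longleftrightarrow> i = j" for i j using p(1) by (metis permutes_inj injD)
  define e where "e j = d (p j)" for j
  have e: "e j = rev (sort ?ds) ! j" if "j < n" for j
    using p pn that unfolding p(2)[symmetric] e_def by (subst permute_list_nth) auto
  have mono: "e j \<le> e i" if "i \<le> j" "j < n" for i j
    using that by (auto simp: e rev_nth intro!: sorted_nth_mono)
  let ?W = "Matrix.mat n n (\<lambda>(i,j). U $$ (i, p j))"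
  have W: "?W \<in> carrier_mat n n" by simp
  have WW: "transpose_mat ?W * ?W = 1\<^sub>m n"
  proof (rule eq_matI)
    fix i j assume "i < dim_row (1\<^sub>m n)" "j < dim_col (1\<^sub>m n)"
    then have ij: "i < n" "j < n" by auto
    have "(transpose_mat ?W * ?W) $$ (i,j) = (transpose_mat U * U) $$ (p i, p j)"
      using ij pn U(1) by (auto simp: scalar_prod_def)
    then show "(transpose_mat ?W * ?W) $$ (i,j) = 1\<^sub>m n $$ (i,j)"
      using ij pn U(2) by (simp add: pinj)
  qed auto
  have AW: "A * ?W = ?W * mat_diag n e"
  proof (rule eq_matI)
    fix i j assume "i < dim_row (?W * mat_diag n e)" "j < dim_col (?W * mat_diag n e)"
    then have ij: "i < n" "j < n" by (auto simp: mat_diag_def)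
    have "(A * ?W) $$ (i,j) = (A * U) $$ (i, p j)"
      using ij pn U(1) A by (auto simp: scalar_prod_def)
    also have "\<dots> = U $$ (i, p j) * d (p j)"
      unfolding U(3) mat_diag_mult_right[OF U(1)] using ij pn by simp
    finally show "(A * ?W) $$ (i,j) = (?W * mat_diag n e) $$ (i,j)"
      unfolding mat_diag_mult_right[OF W] using ij by (simp add: e_def)
  qed (use A in \<open>auto simp: mat_diag_def\<close>)
  have "A = A * (?W * transpose_mat ?W)" using orthogonal_matD[OF W WW] A by simp
  also have "\<dots> = A * ?W * transpose_mat ?W" using A by (intro assoc_mult_mat[symmetric]) auto
  finally have A': "A = ?W * mat_diag n e * transpose_mat ?W" unfolding AW .
  have nth: "nth_eigenvalue A j = e j" if "j < n" for j
    by (rule nth_eigenvalue_diagonalized[OF W WW A' mono that])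
  have "mat_diag n e = mat_diag n (nth_eigenvalue A)"
    by (intro eq_matI) (auto simp: mat_diag_def nth)
  then show thesis using that[OF W WW] A' nth mono by simp
qed

lemma nth_eigenvalue_smult:
  assumes A: "A \<in> carrier_mat n n" "transpose_mat A = A" and c: "0 \<le> c" and j: "j < n"
  shows "nth_eigenvalue (c \<cdot>\<^sub>m A) j = c * nth_eigenvalue A j"
proof -
  obtain U where U: "U \<in> carrier_mat n n" "transpose_mat U * U = 1\<^sub>m n"
    "A = U * mat_diag n (nth_eigenvalue A) * transpose_mat U"
    "\<And>i j. i \<le> j \<Longrightarrow> j < n \<Longrightarrow> nth_eigenvalue A j \<le> nth_eigenvalue A i"
    using spectral_theorem_nth_eigenvalue[OF A] by blast
  have "c \<cdot>\<^sub>m mat_diag n (nth_eigenvalue A) = mat_diag n (\<lambda>j. c * nth_eigenvalue A j)"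
    by (intro eq_matI) (auto simp: mat_diag_def)
  moreover have "c \<cdot>\<^sub>m A = U * (c \<cdot>\<^sub>m mat_diag n (nth_eigenvalue A)) * transpose_mat U"
    by (subst U(3)) (use U(1) in \<open>simp add: mult_smult_distrib[OF _ mat_diag_dim] mult_smult_assoc_mat[of _ n n _ n]\<close>)
  ultimately show ?thesis
    by (intro nth_eigenvalue_diagonalized[OF U(1,2) _ _ j]) (simp, intro mult_left_mono U(4) c)
qed

section \<open>Euclidean and Frobenius norms\<close>

lemma eucl_norm_L2: "eucl_norm v = L2_set (vec_index v) {..<dim_vec v}"
  by (simp add: eucl_norm_def L2_set_def)

lemma eucl_norm_power2: "(eucl_norm v)\<^sup>2 = (\<Sum>i<dim_vec v. (vec_index v i)\<^sup>2)"
  by (simp add: eucl_norm_def sum_nonneg)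

lemma eucl_norm_scalar_prod: "(eucl_norm v)\<^sup>2 = v \<bullet> v"
  unfolding eucl_norm_power2 by (simp add: scalar_prod_def power2_eq_square atLeast0LessThan)

lemma eucl_norm_nonneg[simp]: "0 \<le> eucl_norm v"
  by (simp add: eucl_norm_def sum_nonneg)

lemma eucl_norm_smult: "eucl_norm (c \<cdot>\<^sub>v v) = \<bar>c\<bar> * eucl_norm v"
  by (simp add: eucl_norm_def power_mult_distrib sum_distrib_left[symmetric] real_sqrt_mult)

lemma eucl_norm_add_le:
  assumes "v \<in> carrier_vec n" "w \<in> carrier_vec n"
  shows "eucl_norm (v + w) \<le> eucl_norm v + eucl_norm w"
proof -
  have "eucl_norm (v + w) = L2_set (\<lambda>i. vec_index v i + vec_index w i) {..<n}"
    using assms unfolding eucl_norm_L2 by (intro L2_set_cong) auto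
  then show ?thesis using assms L2_set_triangle_ineq[of "vec_index v" "vec_index w" "{..<n}"]
    by (auto simp: eucl_norm_L2)
qed

lemma abs_index_le_eucl_norm: "i < dim_vec v \<Longrightarrow> \<bar>vec_index v i\<bar> \<le> eucl_norm v"
  unfolding eucl_norm_def by (rule real_le_rsqrt) (auto intro: member_le_sum[of i])

lemma abs_scalar_prod_le:
  assumes "v \<in> carrier_vec n" "w \<in> carrier_vec n"
  shows "\<bar>v \<bullet> w\<bar> \<le> eucl_norm v * eucl_norm w"
proof -
  have "\<bar>v \<bullet> w\<bar> \<le> (\<Sum>i<n. \<bar>vec_index v i\<bar> * \<bar>vec_index w i\<bar>)"
    using assms by (auto simp: scalar_prod_def atLeast0LessThan abs_mult[symmetric] intro!: sum_abs)
  also have "\<dots> \<le> eucl_norm v * eucl_norm w"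
    using assms L2_set_mult_ineq[of "vec_index v" "vec_index w" "{..<n}"] by (auto simp: eucl_norm_L2)
  finally show ?thesis .
qed

lemma frob_norm_nonneg[simp]: "0 \<le> frob_norm A"
  by (simp add: frob_norm_def sum_nonneg)

lemma frob_norm_power2: "A \<in> carrier_mat m n \<Longrightarrow> (frob_norm A)\<^sup>2 = (\<Sum>i<m. \<Sum>j<n. (A $$ (i,j))\<^sup>2)"
  by (auto simp: frob_norm_def sum_nonneg)

lemma frob_norm_L2: "A \<in> carrier_mat m n \<Longrightarrow> frob_norm A = L2_set (\<lambda>p. A $$ p) ({..<m} \<times> {..<n})"
  by (auto simp: frob_norm_def L2_set_def sum.cartesian_product)

lemma frob_norm_transpose[simp]: "frob_norm (transpose_mat A) = frob_norm A"
  unfolding frob_norm_def by (subst sum.swap) simp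

lemma frob_norm_smult: "frob_norm (c \<cdot>\<^sub>m A) = \<bar>c\<bar> * frob_norm A"
  by (simp add: frob_norm_def power_mult_distrib sum_distrib_left[symmetric] real_sqrt_mult)

lemma frob_norm_add_le:
  assumes "A \<in> carrier_mat m n" "B \<in> carrier_mat m n"
  shows "frob_norm (A + B) \<le> frob_norm A + frob_norm B"
proof -
  have "frob_norm (A + B) = L2_set (\<lambda>p. A $$ p + B $$ p) ({..<m} \<times> {..<n})"
    using assms by (subst frob_norm_L2[of _ m n]) (auto intro!: L2_set_cong)
  then show ?thesis using assms L2_set_triangle_ineq[of "($$) A" "($$) B" "{..<m} \<times> {..<n}"]
    by (simp add: frob_norm_L2)
qed

lemma frob_norm_col_sum: "A \<in> carrier_mat m n \<Longrightarrow> (frob_norm A)\<^sup>2 = (\<Sum>j<n. (eucl_norm (col A j))\<^sup>2)"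
  by (simp add: frob_norm_power2 eucl_norm_power2) (subst sum.swap, auto intro!: sum.cong)

lemma frob_norm_row_sum: "A \<in> carrier_mat m n \<Longrightarrow> (frob_norm A)\<^sup>2 = (\<Sum>i<m. (eucl_norm (Matrix.row A i))\<^sup>2)"
  by (simp add: frob_norm_power2 eucl_norm_power2)

lemma eucl_norm_row_le:
  assumes i: "i < dim_row A"
  shows "eucl_norm (Matrix.row A i) \<le> frob_norm A"
proof (rule power2_le_imp_le)
  have "A \<in> carrier_mat (dim_row A) (dim_col A)" by simp
  then show "(eucl_norm (Matrix.row A i))\<^sup>2 \<le> (frob_norm A)\<^sup>2"
    using i unfolding frob_norm_row_sum[OF \<open>A \<in> carrier_mat (dim_row A) (dim_col A)\<close>] by (intro member_le_sum) auto
qed simp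

lemma abs_entry_le_frob_norm: "i < dim_row A \<Longrightarrow> j < dim_col A \<Longrightarrow> \<bar>A $$ (i,j)\<bar> \<le> frob_norm A"
  using abs_index_le_eucl_norm[of j "Matrix.row A i"] eucl_norm_row_le[of i A] by simp

lemma eucl_norm_mult_mat_vec_le:
  assumes "A \<in> carrier_mat m n" "v \<in> carrier_vec n"
  shows "eucl_norm (A *\<^sub>v v) \<le> frob_norm A * eucl_norm v"
proof (rule power2_le_imp_le)
  have "(eucl_norm (A *\<^sub>v v))\<^sup>2 = (\<Sum>i<m. (Matrix.row A i \<bullet> v)\<^sup>2)"
    using assms by (simp add: eucl_norm_power2)
  also have "\<dots> \<le> (\<Sum>i<m. (eucl_norm (Matrix.row A i) * eucl_norm v)\<^sup>2)"
    using assms by (intro sum_mono abs_le_square_iff[THEN iffD1]) (auto simp: abs_mult intro!: abs_scalar_prod_le[of _ n])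
  also have "\<dots> = (frob_norm A * eucl_norm v)\<^sup>2"
    using assms by (simp add: power_mult_distrib frob_norm_row_sum sum_distrib_right)
  finally show "(eucl_norm (A *\<^sub>v v))\<^sup>2 \<le> (frob_norm A * eucl_norm v)\<^sup>2" .
qed simp

text \<open>Applied column by column. The gain over submultiplicativity is that \<open>c\<close> may
  be an operator bound: for \<open>P1\<close> this stays bounded, whereas its Frobenius norm grows
  like the square root of the dimension.\<close>

lemma frob_norm_mult_le_op:
  assumes A: "A \<in> carrier_mat m n" and B: "B \<in> carrier_mat n k" and c: "0 \<le> c"
    and op: "\<And>v. v \<in> carrier_vec n \<Longrightarrow> eucl_norm (A *\<^sub>v v) \<le> c * eucl_norm v"
  shows "frob_norm (A * B) \<le> c * frob_norm B"
proof (rule power2_le_imp_le)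
  have "(frob_norm (A * B))\<^sup>2 = (\<Sum>j<k. (eucl_norm (A *\<^sub>v col B j))\<^sup>2)"
    using A B by (subst frob_norm_col_sum[of _ m k]) (auto intro!: sum.cong arg_cong[of _ _ eucl_norm] eq_vecI)
  also have "\<dots> \<le> (\<Sum>j<k. (c * eucl_norm (col B j))\<^sup>2)"
    using B by (intro sum_mono power_mono op) auto
  also have "\<dots> = (c * frob_norm B)\<^sup>2"
    using B by (simp add: power_mult_distrib frob_norm_col_sum sum_distrib_left)
  finally show "(frob_norm (A * B))\<^sup>2 \<le> (c * frob_norm B)\<^sup>2" .
qed (use c in simp)

lemma frob_norm_mult_le:
  assumes "A \<in> carrier_mat m n" "B \<in> carrier_mat n k"
  shows "frob_norm (A * B) \<le> frob_norm A * frob_norm B"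
  using assms by (intro frob_norm_mult_le_op[of _ m n _ k] eucl_norm_mult_mat_vec_le) auto

text \<open>With x = A^T w one has |x|^2 = w . A x \<le> |w| c |x|; cancelling |x| leaves the
  bound.\<close>

lemma eucl_norm_transpose_le_op:
  assumes A: "A \<in> carrier_mat m n" and c: "0 \<le> c" and w: "w \<in> carrier_vec m"
    and op: "\<And>v. v \<in> carrier_vec n \<Longrightarrow> eucl_norm (A *\<^sub>v v) \<le> c * eucl_norm v"
  shows "eucl_norm (transpose_mat A *\<^sub>v w) \<le> c * eucl_norm w"
proof -
  let ?x = "transpose_mat A *\<^sub>v w"
  have x: "?x \<in> carrier_vec n" using A w by simp
  have "(eucl_norm ?x)\<^sup>2 = w \<bullet> (A *\<^sub>v ?x)"
    unfolding eucl_norm_scalar_prod using A w x by (simp add: transpose_vec_mult_scalar[of _ m n])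
  also have "\<dots> \<le> eucl_norm w * eucl_norm (A *\<^sub>v ?x)"
    using abs_scalar_prod_le[of w m "A *\<^sub>v ?x"] A w x by auto
  also have "\<dots> \<le> eucl_norm w * (c * eucl_norm ?x)" by (intro mult_left_mono op x) simp
  finally have *: "eucl_norm ?x * eucl_norm ?x \<le> (c * eucl_norm w) * eucl_norm ?x"
    by (simp add: power2_eq_square mult_ac)
  show ?thesis
  proof (cases "eucl_norm ?x = 0")
    case True
    then show ?thesis using c by simp
  next
    case False
    then show ?thesis using * by (metis eucl_norm_nonneg mult_le_cancel_right_pos order_le_less)
  qed
qed

lemma index_mult_mat_vec_sum:
  "A \<in> carrier_mat m n \<Longrightarrow> v \<in> carrier_vec n \<Longrightarrow> i < m \<Longrightarrow>
    vec_index (A *\<^sub>v v) i = (\<Sum>j<n. A $$ (i,j) * vec_index v j)"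
  by (auto simp: scalar_prod_def atLeast0LessThan intro!: sum.cong)

lemma smult_mult_mat_vec:
  fixes A :: "'b::comm_semiring_0 Matrix.mat"
  assumes "A \<in> carrier_mat m n" "v \<in> carrier_vec n"
  shows "(c \<cdot>\<^sub>m A) *\<^sub>v v = c \<cdot>\<^sub>v (A *\<^sub>v v)"
proof (rule eq_vecI)
  fix i assume "i < dim_vec (c \<cdot>\<^sub>v (A *\<^sub>v v))"
  then have i: "i < m" using assms by simp
  have "c \<cdot>\<^sub>m A \<in> carrier_mat m n" using assms by simp
  then show "vec_index ((c \<cdot>\<^sub>m A) *\<^sub>v v) i = vec_index (c \<cdot>\<^sub>v (A *\<^sub>v v)) i"
    using assms i by (simp add: index_mult_mat_vec_sum[of _ m n] sum_distrib_left mult.assoc del: index_mult_mat_vec)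
qed (use assms in auto)

lemma index_mult_mat_sum:
  "A \<in> carrier_mat m n \<Longrightarrow> B \<in> carrier_mat n k \<Longrightarrow> i < m \<Longrightarrow> j < k \<Longrightarrow>
    (A * B) $$ (i,j) = (\<Sum>l<n. A $$ (i,l) * B $$ (l,j))"
  by (auto simp: scalar_prod_def atLeast0LessThan intro!: sum.cong)

section \<open>Quadratic forms and the min-max principle\<close>

lemma quad_form_diagonalized:
  fixes U :: "real Matrix.mat"
  assumes U: "U \<in> carrier_mat n n" and A: "A = U * mat_diag n d * transpose_mat U"
    and v: "v \<in> carrier_vec n"
  shows "v \<bullet> (A *\<^sub>v v) = (\<Sum>j<n. d j * (vec_index (transpose_mat U *\<^sub>v v) j)\<^sup>2)"
proof -
  let ?w = "transpose_mat U *\<^sub>v v"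
  have w: "?w \<in> carrier_vec n" using U v by simp
  have D: "mat_diag n d *\<^sub>v ?w \<in> carrier_vec n" using mult_mat_vec_carrier[OF mat_diag_dim w] .
  have "A *\<^sub>v v = U *\<^sub>v (mat_diag n d *\<^sub>v ?w)"
    unfolding A using U v w by (simp add: assoc_mult_mat_vec[of _ n n _ n] mult_carrier_mat[OF U mat_diag_dim])
  then have "v \<bullet> (A *\<^sub>v v) = ?w \<bullet> (mat_diag n d *\<^sub>v ?w)"
    using transpose_vec_mult_scalar[OF U D v] by simp
  also have "mat_diag n d *\<^sub>v ?w = Matrix.vec n (\<lambda>i. d i * vec_index ?w i)"
  proof (rule eq_vecI)
    fix i assume "i < dim_vec (Matrix.vec n (\<lambda>i. d i * vec_index ?w i))"
    then have i: "i < n" by simp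
    have "vec_index (mat_diag n d *\<^sub>v ?w) i = (\<Sum>j<n. if i = j then d j * vec_index ?w j else 0)"
      unfolding index_mult_mat_vec_sum[OF mat_diag_dim w i] using i
      by (intro sum.cong) (auto simp: mat_diag_def)
    then show "vec_index (mat_diag n d *\<^sub>v ?w) i = vec_index (Matrix.vec n (\<lambda>i. d i * vec_index ?w i)) i"
      using i by simp
  qed (simp add: mat_diag_def)
  also have "?w \<bullet> Matrix.vec n (\<lambda>i. d i * vec_index ?w i) = (\<Sum>j<n. d j * (vec_index ?w j)\<^sup>2)"
    unfolding scalar_prod_def
    by (intro sum.cong) (simp_all add: atLeast0LessThan power2_eq_square mult_ac del: index_mult_mat_vec)
  finally show ?thesis .
qed

lemma eucl_norm_isometry:
  fixes V :: "real Matrix.mat"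
  assumes V: "V \<in> carrier_mat n r" "transpose_mat V * V = 1\<^sub>m r" and a: "a \<in> carrier_vec r"
  shows "eucl_norm (V *\<^sub>v a) = eucl_norm a"
proof (rule power2_eq_imp_eq)
  have "(eucl_norm (V *\<^sub>v a))\<^sup>2 = (transpose_mat V *\<^sub>v (V *\<^sub>v a)) \<bullet> a"
    unfolding eucl_norm_scalar_prod using V a
    by (subst transpose_vec_mult_scalar[of V n r]) auto
  also have "transpose_mat V *\<^sub>v (V *\<^sub>v a) = a"
    using V a by (subst assoc_mult_mat_vec[symmetric, of _ r n _ r]) auto
  finally show "(eucl_norm (V *\<^sub>v a))\<^sup>2 = (eucl_norm a)\<^sup>2" by (simp add: eucl_norm_scalar_prod)
qed auto

lemma sum_sq_orthogonal:
  assumes U: "U \<in> carrier_mat n n" "transpose_mat U * U = 1\<^sub>m n" and v: "v \<in> carrier_vec n"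
  shows "(\<Sum>j<n. (vec_index (transpose_mat U *\<^sub>v v) j)\<^sup>2) = (eucl_norm v)\<^sup>2"
proof -
  have "eucl_norm (transpose_mat U *\<^sub>v v) = eucl_norm v"
    using U v orthogonal_matD[OF U] by (intro eucl_norm_isometry[of _ n n]) auto
  then show ?thesis using U by (metis eucl_norm_power2 dim_mult_mat_vec index_transpose_mat(2) carrier_matD(2))
qed

text \<open>|P v|^2 is the quadratic form of P^T P, a weighted sum of squared coordinates in an
  eigenbasis. In this form the eigenvalue bounds on P1^T P1 and P2^T P2 become operator
  bounds.\<close>

lemma eucl_norm_le_of_gram_eigenvalues:
  assumes P: "P \<in> carrier_mat m n" and c: "0 \<le> c"
    and le: "\<And>j. j < n \<Longrightarrow> nth_eigenvalue (transpose_mat P * P) j \<le> c"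
    and v: "v \<in> carrier_vec n"
  shows "eucl_norm (P *\<^sub>v v) \<le> sqrt c * eucl_norm v"
proof (rule power2_le_imp_le)
  let ?A = "transpose_mat P * P"
  have A: "?A \<in> carrier_mat n n" "transpose_mat ?A = ?A" using P by (auto simp: transpose_mult[of _ n m _ n])
  obtain U where U: "U \<in> carrier_mat n n" "transpose_mat U * U = 1\<^sub>m n"
    "?A = U * mat_diag n (nth_eigenvalue ?A) * transpose_mat U"
    "\<And>i j. i \<le> j \<Longrightarrow> j < n \<Longrightarrow> nth_eigenvalue ?A j \<le> nth_eigenvalue ?A i"
    using spectral_theorem_nth_eigenvalue[OF A] by blast
  have "(eucl_norm (P *\<^sub>v v))\<^sup>2 = v \<bullet> (?A *\<^sub>v v)"
  proof -
    have Pv: "P *\<^sub>v v \<in> carrier_vec m" using P v by simp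
    have "(P *\<^sub>v v) \<bullet> (P *\<^sub>v v) = (transpose_mat P *\<^sub>v (P *\<^sub>v v)) \<bullet> v"
      by (rule transpose_vec_mult_scalar[OF P v Pv, symmetric])
    also have "\<dots> = v \<bullet> (transpose_mat P *\<^sub>v (P *\<^sub>v v))"
      using P v Pv by (intro comm_scalar_prod[of _ n]) auto
    also have "transpose_mat P *\<^sub>v (P *\<^sub>v v) = ?A *\<^sub>v v"
      using P v by (intro assoc_mult_mat_vec[symmetric]) auto
    finally show ?thesis unfolding eucl_norm_scalar_prod .
  qed
  also have "\<dots> = (\<Sum>j<n. nth_eigenvalue ?A j * (vec_index (transpose_mat U *\<^sub>v v) j)\<^sup>2)"
    using U v by (intro quad_form_diagonalized) auto
  also have "\<dots> \<le> (\<Sum>j<n. c * (vec_index (transpose_mat U *\<^sub>v v) j)\<^sup>2)"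
    by (intro sum_mono mult_right_mono le) auto
  also have "\<dots> = (sqrt c * eucl_norm v)\<^sup>2"
    using sum_sq_orthogonal[OF U(1,2) v] c by (simp add: sum_distrib_left[symmetric] power_mult_distrib)
  finally show "(eucl_norm (P *\<^sub>v v))\<^sup>2 \<le> (sqrt c * eucl_norm v)\<^sup>2" .
qed (use c in simp)

lemma quad_form_ge_last_eigenvalue:
  assumes A: "A \<in> carrier_mat n n" "transpose_mat A = A" and v: "v \<in> carrier_vec n"
    and k: "k \<le> nth_eigenvalue A (n - 1)"
  shows "k * (eucl_norm v)\<^sup>2 \<le> v \<bullet> (A *\<^sub>v v)"
proof -
  obtain U where U: "U \<in> carrier_mat n n" "transpose_mat U * U = 1\<^sub>m n"
    "A = U * mat_diag n (nth_eigenvalue A) * transpose_mat U"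
    "\<And>i j. i \<le> j \<Longrightarrow> j < n \<Longrightarrow> nth_eigenvalue A j \<le> nth_eigenvalue A i"
    using spectral_theorem_nth_eigenvalue[OF A] by blast
  have ge: "k \<le> nth_eigenvalue A j" if "j < n" for j
    using U(4)[of j "n - 1"] that k by (simp add: le_diff_conv2 Suc_le_eq)
  have "k * (eucl_norm v)\<^sup>2 = (\<Sum>j<n. k * (vec_index (transpose_mat U *\<^sub>v v) j)\<^sup>2)"
    using sum_sq_orthogonal[OF U(1,2) v] by (simp add: sum_distrib_left[symmetric])
  also have "\<dots> \<le> (\<Sum>j<n. nth_eigenvalue A j * (vec_index (transpose_mat U *\<^sub>v v) j)\<^sup>2)"
    by (intro sum_mono mult_right_mono ge) auto
  also have "\<dots> = v \<bullet> (A *\<^sub>v v)"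
    using U v by (intro quad_form_diagonalized[symmetric]) auto
  finally show ?thesis .
qed

text \<open>Padding \<open>A\<close> with zero rows to a square matrix makes the determinant vanish;
  a null vector of the padded matrix is one of \<open>A\<close>.\<close>

lemma ex_nonzero_kernel_vec:
  fixes A :: "real Matrix.mat"
  assumes A: "A \<in> carrier_mat m n" and mn: "m < n"
  shows "\<exists>v\<in>carrier_vec n. v \<noteq> 0\<^sub>v n \<and> A *\<^sub>v v = 0\<^sub>v m"
proof -
  let ?B = "mat\<^sub>r n n (\<lambda>i. if i = m then 0\<^sub>v n else if i < m then Matrix.row A i else 0\<^sub>v n)"
  have "Determinant.det ?B = 0" using A mn by (intro det_row_0) auto
  then obtain v where v: "v \<in> carrier_vec n" "v \<noteq> 0\<^sub>v n" "?B *\<^sub>v v = 0\<^sub>v n"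
    using det_0_iff_vec_prod_zero_field[of ?B n] by auto
  have "A *\<^sub>v v = 0\<^sub>v m"
  proof (rule eq_vecI)
    fix i assume "i < dim_vec (0\<^sub>v m)"
    then have "vec_index (A *\<^sub>v v) i = vec_index (?B *\<^sub>v v) i" "i < m"
      using A mn v(1) by (auto simp: scalar_prod_def intro!: sum.cong)
    then show "vec_index (A *\<^sub>v v) i = vec_index (0\<^sub>v m) i" unfolding v(3) using mn by simp
  qed (use A in simp)
  then show ?thesis using v by auto
qed

text \<open>Lower half of Courant-Fischer. The r-dimensional range of \<open>V\<close> contains a
  nonzero vector orthogonal to the r - 1 leading eigenvectors. There the quadratic form is at most
  the r-th largest eigenvalue (index \<open>r - 1\<close>) times the squared norm, and by hypothesis
  it is at least \<open>k\<close> times it.\<close>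

lemma nth_eigenvalue_ge:
  assumes A: "A \<in> carrier_mat n n" "transpose_mat A = A"
    and V: "V \<in> carrier_mat n r" "transpose_mat V * V = 1\<^sub>m r" and r: "1 \<le> r" "r \<le> n"
    and k: "\<And>a. a \<in> carrier_vec r \<Longrightarrow> k * (eucl_norm a)\<^sup>2 \<le> (V *\<^sub>v a) \<bullet> (A *\<^sub>v (V *\<^sub>v a))"
  shows "k \<le> nth_eigenvalue A (r - 1)"
proof -
  obtain U where U: "U \<in> carrier_mat n n" "transpose_mat U * U = 1\<^sub>m n"
    "A = U * mat_diag n (nth_eigenvalue A) * transpose_mat U"
    "\<And>i j. i \<le> j \<Longrightarrow> j < n \<Longrightarrow> nth_eigenvalue A j \<le> nth_eigenvalue A i"
    using spectral_theorem_nth_eigenvalue[OF A] by blast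
  let ?W = "transpose_mat U * V"
  \<comment> \<open>The first r - 1 rows of U^T V: a null vector \<open>a\<close> makes
    \<open>V a\<close> orthogonal to the r - 1 leading eigenvectors.\<close>
  let ?B = "Matrix.mat (r - 1) r (\<lambda>p. ?W $$ p)"
  have W: "?W \<in> carrier_mat n r" using U V by simp
  obtain a where a: "a \<in> carrier_vec r" "a \<noteq> 0\<^sub>v r" "?B *\<^sub>v a = 0\<^sub>v (r - 1)"
    using ex_nonzero_kernel_vec[of ?B "r - 1" r] r by auto
  let ?x = "V *\<^sub>v a"
  have x: "?x \<in> carrier_vec n" using V a by simp
  have Wa: "transpose_mat U *\<^sub>v ?x = ?W *\<^sub>v a"
    using U V a by (simp add: assoc_mult_mat_vec[of _ n n _ r])
  have 0: "vec_index (transpose_mat U *\<^sub>v ?x) j = 0" if "j < r - 1" for j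
  proof -
    have jn: "j < n" and Bc: "?B \<in> carrier_mat (r - 1) r" using that r by auto
    have "vec_index (?W *\<^sub>v a) j = vec_index (?B *\<^sub>v a) j"
      unfolding index_mult_mat_vec_sum[OF W a(1) jn] index_mult_mat_vec_sum[OF Bc a(1) that]
      using that by simp
    then show ?thesis unfolding Wa a(3) using that by simp
  qed
  have pos: "(eucl_norm a)\<^sup>2 > 0"
  proof -
    obtain i where i: "i < r" "vec_index a i \<noteq> 0"
      using a(1,2) by (metis carrier_vecD eq_vecI index_zero_vec)
    then have "eucl_norm a > 0" using abs_index_le_eucl_norm[of i a] a(1) by auto
    then show ?thesis by simp
  qed
  have "k * (eucl_norm a)\<^sup>2 \<le> ?x \<bullet> (A *\<^sub>v ?x)" by (rule k[OF a(1)])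
  also have "\<dots> = (\<Sum>j<n. nth_eigenvalue A j * (vec_index (transpose_mat U *\<^sub>v ?x) j)\<^sup>2)"
    using U x by (intro quad_form_diagonalized) auto
  also have "\<dots> \<le> (\<Sum>j<n. nth_eigenvalue A (r - 1) * (vec_index (transpose_mat U *\<^sub>v ?x) j)\<^sup>2)"
  proof (rule sum_mono)
    fix j assume j: "j \<in> {..<n}"
    show "nth_eigenvalue A j * (vec_index (transpose_mat U *\<^sub>v ?x) j)\<^sup>2
      \<le> nth_eigenvalue A (r - 1) * (vec_index (transpose_mat U *\<^sub>v ?x) j)\<^sup>2"
      using 0[of j] U(4)[of "r - 1" j] j by (cases "j < r - 1") (auto intro!: mult_right_mono)
  qed
  also have "\<dots> = nth_eigenvalue A (r - 1) * (eucl_norm a)\<^sup>2"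
    using sum_sq_orthogonal[OF U(1,2) x] eucl_norm_isometry[OF V a(1)]
    by (simp add: sum_distrib_left[symmetric])
  finally show ?thesis using pos by simp
qed

section \<open>Inverses and the explicit inverse of the penalty matrix\<close>

lemma inv_mat_eqI:
  assumes A: "A \<in> carrier_mat n n" and B: "B \<in> carrier_mat n n" and AB: "A * B = 1\<^sub>m n"
  shows "inv_mat A = B"
proof (cases "mat_inverse A")
  case None
  then show ?thesis
    using mat_inverse(1)[OF A None] A B AB mat_mult_left_right_inverse[OF A B AB]
    unfolding Units_def ring_mat_def by auto
next
  case (Some C)
  then have C: "A * C = 1\<^sub>m n" "C * A = 1\<^sub>m n" "C \<in> carrier_mat n n" using mat_inverse(2)[OF A] by auto
  have "C = C * (A * B)" using AB C by simp
  also have "\<dots> = C * A * B" by (rule assoc_mult_mat[symmetric, OF C(3) A B])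
  also have "\<dots> = B" using C B by simp
  finally show ?thesis using Some by (simp add: inv_mat_def)
qed

text \<open>The singular case is kept because \<open>rotation_mat\<close> is studied at every sample
  point: a formula valid everywhere, by cases on vanishing eigenvalues, is what its measurability
  rests on.\<close>

lemma inv_mat_diag:
  "inv_mat (mat_diag r d) = (if \<forall>i<r. d i \<noteq> 0 then mat_diag r (\<lambda>i. 1 / d i) else 0\<^sub>m r r)"
proof (cases "\<forall>i<r. d i \<noteq> 0")
  case True
  then have "mat_diag r d * mat_diag r (\<lambda>i. 1 / d i) = 1\<^sub>m r" unfolding mat_diag_diag by (intro eq_matI) (auto simp: mat_diag_def)
  then show ?thesis using True inv_mat_eqI[OF mat_diag_dim mat_diag_dim] by simp
next
  case False
  then obtain i where i: "i < r" "d i = 0" by auto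
  have "mat_inverse (mat_diag r d) = None"
  proof (rule ccontr)
    assume "mat_inverse (mat_diag r d) \<noteq> None"
    then obtain C where "mat_inverse (mat_diag r d) = Some C" by auto
    then have C: "mat_diag r d * C = 1\<^sub>m r" "C \<in> carrier_mat r r"
      using mat_inverse(2)[OF mat_diag_dim] by auto
    have "(mat_diag r d * C) $$ (i,i) = 0" using i C(2) by (simp add: mat_diag_mult_left)
    then show False using C(1) i by simp
  qed
  then show ?thesis using False by (auto simp: inv_mat_def mat_diag_def)
qed

text \<open>With J the averaging projection (all entries 1/N), the penalty matrix is (1 +
  \<lambda>)(I - J) + J, with complementary projections I - J and J. Its inverse is therefore
  \<delta> (I - J) + J.\<close>

lemma penalty_inv_eq:
  fixes lam :: real
  assumes N: "0 < N" and lam: "0 < lam"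
  defines "\<delta> \<equiv> 1 / (1 + lam)"
  shows "penalty_inv N lam = \<delta> \<cdot>\<^sub>m 1\<^sub>m N + (1 - \<delta>) \<cdot>\<^sub>m Matrix.mat N N (\<lambda>_. 1 / real N)" (is "_ = ?R")
  unfolding penalty_inv_def
proof (rule inv_mat_eqI[of _ N])
  show "penalty_mat N lam * ?R = 1\<^sub>m N"
  proof (rule eq_matI)
    fix i j assume "i < dim_row (1\<^sub>m N)" "j < dim_col (1\<^sub>m N)"
    then have ij: "i < N" "j < N" by auto
    have \<delta>: "(1 + lam) * \<delta> = 1" using lam by (simp add: \<delta>_def)
    have "(penalty_mat N lam * ?R) $$ (i,j) = (\<Sum>k<N. ((if i = k then 1 + lam else 0) - lam / N) * ((if k = j then \<delta> else 0) + (1 - \<delta>) / N))"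
      using ij by (auto simp: penalty_mat_def centering_mat_def scalar_prod_def atLeast0LessThan algebra_simps add_divide_distrib diff_divide_distrib intro!: sum.cong)
    also have "\<dots> = (\<Sum>k<N. (if k = i then (if i = j then (1 + lam) * \<delta> else 0) else 0) + (if k = i then (1 + lam) * (1 - \<delta>) / N else 0)
        - (if k = j then lam / N * \<delta> else 0) - lam / N * ((1 - \<delta>) / N))"
      by (rule sum.cong) (auto simp: algebra_simps)
    also have "\<dots> = (if i = j then (1 + lam) * \<delta> else 0) + (1 + lam) * (1 - \<delta>) / N - lam / N * \<delta> - lam / N * (1 - \<delta>)"
      using ij by (simp add: sum.distrib sum_subtractf)
    also have "\<dots> = (if i = j then 1 else 0)"
    proof -
      have "(1 + lam) * (1 - \<delta>) / N - lam / N * \<delta> - lam / N * (1 - \<delta>) = 0"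
        using N \<delta> by (simp add: field_simps)
      then show ?thesis unfolding \<delta> by (simp only: diff_diff_eq[symmetric] add_diff_eq[symmetric])
    qed
    finally show "(penalty_mat N lam * ?R) $$ (i,j) = 1\<^sub>m N $$ (i,j)" using ij by simp
  qed (auto simp: penalty_mat_def centering_mat_def)
qed (auto simp: penalty_mat_def centering_mat_def)

lemma penalty_inv_carrier:
  assumes "0 < N" "0 < lam" shows "penalty_inv N lam \<in> carrier_mat N N"
  using assms by (simp add: penalty_inv_eq)

lemma penalty_inv_symmetric:
  assumes "0 < N" "0 < lam" shows "transpose_mat (penalty_inv N lam) = penalty_inv N lam"
  using assms by (intro eq_matI) (auto simp: penalty_inv_eq)

text \<open>The inverse is a convex combination of the identity and the averaging matrix, and the
  latter has Frobenius norm 1. The explicit factor 1 fits the shape of the operator bound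
  lemmas.\<close>

lemma eucl_norm_penalty_inv_le:
  assumes N: "0 < N" and lam: "0 < lam" and v: "v \<in> carrier_vec N"
  shows "eucl_norm (penalty_inv N lam *\<^sub>v v) \<le> 1 * eucl_norm v"
proof -
  define \<delta> where "\<delta> = 1 / (1 + lam)"
  have \<delta>: "0 \<le> \<delta>" "\<delta> \<le> 1" using lam by (auto simp: \<delta>_def)
  let ?K = "Matrix.mat N N (\<lambda>_. 1 / real N)"
  have K: "frob_norm ?K = 1"
    using N by (simp add: frob_norm_def power2_eq_square)
  have "penalty_inv N lam *\<^sub>v v = (\<delta> \<cdot>\<^sub>m 1\<^sub>m N) *\<^sub>v v + ((1 - \<delta>) \<cdot>\<^sub>m ?K) *\<^sub>v v"
    unfolding penalty_inv_eq[OF N lam] \<delta>_def[symmetric] using v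
    by (intro add_mult_distrib_mat_vec) auto
  also have "(\<delta> \<cdot>\<^sub>m 1\<^sub>m N) *\<^sub>v v = \<delta> \<cdot>\<^sub>v v" using v by (simp add: smult_mult_mat_vec[of _ N N])
  also have "((1 - \<delta>) \<cdot>\<^sub>m ?K) *\<^sub>v v = (1 - \<delta>) \<cdot>\<^sub>v (?K *\<^sub>v v)" using v by (simp add: smult_mult_mat_vec[of _ N N])
  finally have "eucl_norm (penalty_inv N lam *\<^sub>v v) = eucl_norm (\<delta> \<cdot>\<^sub>v v + (1 - \<delta>) \<cdot>\<^sub>v (?K *\<^sub>v v))" by simp
  also have "\<dots> \<le> eucl_norm (\<delta> \<cdot>\<^sub>v v) + eucl_norm ((1 - \<delta>) \<cdot>\<^sub>v (?K *\<^sub>v v))"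
    using v by (intro eucl_norm_add_le[of _ N]) (auto intro!: mult_mat_vec_carrier[of _ N N])
  also have "\<dots> \<le> \<delta> * eucl_norm v + (1 - \<delta>) * (1 * eucl_norm v)"
    using eucl_norm_mult_mat_vec_le[of ?K N N v] v \<delta> K
    by (auto simp: eucl_norm_smult intro!: mult_left_mono)
  finally show ?thesis by (simp add: algebra_simps)
qed

lemma frob_norm_penalty_inv_le:
  assumes N: "0 < N" and lam: "0 < lam"
  shows "frob_norm (penalty_inv N lam) \<le> sqrt (real N)"
proof -
  have D: "penalty_inv N lam \<in> carrier_mat N N" by (rule penalty_inv_carrier[OF N lam])
  have "frob_norm (penalty_inv N lam * 1\<^sub>m N) \<le> 1 * frob_norm (1\<^sub>m N)"
    using D eucl_norm_penalty_inv_le[OF N lam] by (intro frob_norm_mult_le_op[of _ N N _ N]) auto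
  moreover have "frob_norm (1\<^sub>m N) = sqrt (real N)"
    by (simp add: frob_norm_def if_distrib[of "\<lambda>x. x\<^sup>2"] cong: if_cong)
  ultimately show ?thesis using D by simp
qed

lemma frob_norm_penalty_inv_pos:
  assumes N: "0 < N" and lam: "0 < lam"
  shows "0 < frob_norm (penalty_inv N lam)"
proof -
  have "0 < penalty_inv N lam $$ (0,0)"
    using N lam by (simp add: penalty_inv_eq add_pos_nonneg)
  also have "\<dots> \<le> frob_norm (penalty_inv N lam)"
    using abs_entry_le_frob_norm[of 0 "penalty_inv N lam" 0] penalty_inv_carrier[OF N lam] N by auto
  finally show ?thesis .
qed

section \<open>Perturbation of eigenvectors\<close>

text \<open>Strict increase by at least 1 per step gives c j \<ge> j from below and, counted back
  from c (r - 1) \<le> r - 1, also c j \<le> j.\<close>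

lemma strict_mono_on_lessThan_eq_id:
  fixes c :: "nat \<Rightarrow> nat"
  assumes mono: "\<And>j k. j < k \<Longrightarrow> k < r \<Longrightarrow> c j < c k" and lt: "\<And>j. j < r \<Longrightarrow> c j < r" and j: "j < r"
  shows "c j = j"
proof -
  have *: "c i + n \<le> c (i + n)" if "i + n < r" for i n
    using that
  proof (induction n)
    case (Suc n)
    then show ?case using mono[of "i + n" "i + Suc n"] by simp
  qed simp
  show ?thesis using *[of 0 j] *[of j "r - 1 - j"] lt[of "r - 1"] j by simp
qed

text \<open>An entrywise Davis-Kahan argument: \<open>w\<close> are the eigenvalues of \<Omega>,
  \<open>l\<close> those of the sample matrix, and \<open>J\<close> is the matrix of overlaps of
  eigenvectors. Every column of \<open>J\<close> has one substantial entry, in row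
  \<open>c j\<close>; the commutator bound puts \<open>l j\<close> close to \<open>w (c j)\<close>,
  and the gap makes all other entries of the column small. Near orthogonality makes \<open>c\<close>
  injective, the ordering makes it increasing, hence the identity, and the sign condition selects +1
  on the diagonal.\<close>

lemma eigenvector_perturbation:
  fixes w l :: "nat \<Rightarrow> real" and J :: "nat \<Rightarrow> nat \<Rightarrow> real"
  assumes g: "0 < g" and small: "8 * real r * d \<le> g" "8 * d \<le> 1"
    and com: "\<And>i j. i < r \<Longrightarrow> j < r \<Longrightarrow> \<bar>(w i - l j) * J i j\<bar> \<le> d"
    and orth: "\<And>j k. j < r \<Longrightarrow> k < r \<Longrightarrow> \<bar>(\<Sum>i<r. J i j * J i k) - (if j = k then 1 else 0)\<bar> \<le> d"
    and gap: "\<And>i k. i < k \<Longrightarrow> k < r \<Longrightarrow> w k + g \<le> w i"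
    and sorted: "\<And>j k. j \<le> k \<Longrightarrow> k < r \<Longrightarrow> l k \<le> l j"
    and sign: "\<And>j. j < r \<Longrightarrow> 0 \<le> J j j"
  shows "\<And>i j. i < r \<Longrightarrow> j < r \<Longrightarrow> \<bar>J i j - (if i = j then 1 else 0)\<bar> \<le> d + 2 * d / g"
    and "\<And>j. j < r \<Longrightarrow> \<bar>l j - w j\<bar> \<le> 2 * real r * d"
proof -
  define q where "q = 2 * d / g"
  have ex: "\<exists>i<r. \<bar>w i - l j\<bar> \<le> 2 * real r * d \<and> (\<forall>k<r. k \<noteq> i \<longrightarrow> \<bar>J k j\<bar> \<le> q) \<and>
      1 - d - real r * q\<^sup>2 \<le> (J i j)\<^sup>2" if j: "j < r" for j
  proof -
    have d0: "0 \<le> d" using orth[OF j j] by linarith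
    have sq: "\<bar>(\<Sum>i<r. (J i j)\<^sup>2) - 1\<bar> \<le> d" using orth[OF j j] by (simp add: power2_eq_square)
    \<comment> \<open>The squared entries of a column sum to at least 1 - d \<ge> 7/8, so they
      cannot all be below half of the average 1/r.\<close>
    have "\<exists>i<r. 1 / (2 * real r) \<le> (J i j)\<^sup>2"
    proof (rule ccontr)
      assume "\<not> ?thesis"
      then have "(\<Sum>i<r. (J i j)\<^sup>2) \<le> (\<Sum>i<r. 1 / (2 * real r))" by (intro sum_mono) (auto simp: not_le less_imp_le)
      also have "\<dots> = 1 / 2" using j by simp
      finally show False using sq small by linarith
    qed
    then obtain i where i: "i < r" "1 / (2 * real r) \<le> (J i j)\<^sup>2" by blast
    have Jge: "1 / (2 * real r) \<le> \<bar>J i j\<bar>"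
    proof (rule power2_le_imp_le)
      have "(1 / (2 * real r))\<^sup>2 \<le> 1 / (2 * real r)" using j
        by (simp add: power2_eq_square field_simps)
      then show "(1 / (2 * real r))\<^sup>2 \<le> \<bar>J i j\<bar>\<^sup>2" using i by simp
    qed simp
    have "\<bar>w i - l j\<bar> * (1 / (2 * real r)) \<le> d"
      using com[OF i(1) j] mult_left_mono[OF Jge, of "\<bar>w i - l j\<bar>"] by (simp add: abs_mult)
    then have near: "\<bar>w i - l j\<bar> \<le> 2 * real r * d" using j by (simp add: field_simps)
    have far: "\<bar>J k j\<bar> \<le> q" if k: "k < r" "k \<noteq> i" for k
    proof -
      have "g \<le> \<bar>w k - w i\<bar>" using gap[of i k] gap[of k i] k i(1) g by (cases "i < k") auto
      \<comment> \<open>\<open>l j\<close> is within 2 r d \<le> g/4 of \<open>w i\<close>, while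
        \<open>w k\<close> is at least \<open>g\<close> away from \<open>w i\<close>.\<close>
      then have "g / 2 \<le> \<bar>w k - l j\<bar>" using near small by linarith
      then have "g / 2 * \<bar>J k j\<bar> \<le> \<bar>w k - l j\<bar> * \<bar>J k j\<bar>" by (intro mult_right_mono) auto
      also have "\<dots> \<le> d" using com[OF k(1) j] by (simp add: abs_mult)
      finally show ?thesis using g by (simp add: q_def field_simps)
    qed
    have "(J k j)\<^sup>2 \<le> q\<^sup>2" if "k < r" "k \<noteq> i" for k
      using power_mono[OF far[OF that], of 2] by simp
    then have "(\<Sum>k\<in>{..<r}-{i}. (J k j)\<^sup>2) \<le> (\<Sum>k\<in>{..<r}-{i}. q\<^sup>2)"
      by (intro sum_mono) auto
    also have "\<dots> \<le> real r * q\<^sup>2" using i by (simp add: mult_right_mono)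
    finally have "(\<Sum>k<r. (J k j)\<^sup>2) - (J i j)\<^sup>2 \<le> real r * q\<^sup>2" using i by (simp add: sum_diff1)
    then have "1 - d - real r * q\<^sup>2 \<le> (J i j)\<^sup>2" using sq by linarith
    then show ?thesis using i near far by blast
  qed
  then obtain c where c: "\<And>j. j < r \<Longrightarrow> c j < r" "\<And>j. j < r \<Longrightarrow> \<bar>w (c j) - l j\<bar> \<le> 2 * real r * d"
      "\<And>j k. j < r \<Longrightarrow> k < r \<Longrightarrow> k \<noteq> c j \<Longrightarrow> \<bar>J k j\<bar> \<le> q"
      "\<And>j. j < r \<Longrightarrow> 1 - d - real r * q\<^sup>2 \<le> (J (c j) j)\<^sup>2" by metis
  have rq: "0 \<le> q" "real r * q \<le> 1 / 4" "real r * q\<^sup>2 \<le> 1 / 16" "real r * q\<^sup>2 \<le> q" "0 \<le> d" if "0 < r"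
  proof -
    show d: "0 \<le> d" using orth[OF that that] by linarith
    show q: "0 \<le> q" using d g by (simp add: q_def)
    show 4: "real r * q \<le> 1 / 4" using small g by (simp add: q_def field_simps)
    have "q \<le> real r * q" using that q by (simp add: mult_le_cancel_right1)
    then have "q \<le> 1 / 4" using 4 by linarith
    then have "real r * q * q \<le> 1 / 4 * (1 / 4)" using 4 q by (intro mult_mono) auto
    then show "real r * q\<^sup>2 \<le> 1 / 16" by (simp add: power2_eq_square mult_ac)
    have "real r * q * q \<le> 1 * q" using 4 q by (intro mult_right_mono) auto
    then show "real r * q\<^sup>2 \<le> q" by (simp add: power2_eq_square mult_ac)
  qed
  \<comment> \<open>Two columns peaking in the same row would have an inner product of at least 3/4
    - 1/16 in absolute value, but near orthogonality allows only d \<le> 1/8.\<close>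
  have inj: "c j \<noteq> c k" if jk: "j < k" "k < r" for j k
  proof
    assume eq: "c j = c k"
    have j: "j < r" using jk by simp
    note rq' = rq[OF less_trans[OF _ jk(2)]] 
    have r0: "0 < r" using jk by simp
    have J: "3 / 4 \<le> (J (c j) j)\<^sup>2" "3 / 4 \<le> (J (c j) k)\<^sup>2"
      using c(4)[OF j] c(4)[OF jk(2)] rq[OF r0] small eq by (auto simp: algebra_simps)
    have "(3 / 4)\<^sup>2 \<le> (J (c j) j * J (c j) k)\<^sup>2"
      unfolding power_mult_distrib power2_eq_square[of "3/4::real"] using J by (intro mult_mono) auto
    then have big: "3 / 4 \<le> \<bar>J (c j) j * J (c j) k\<bar>" by (intro power2_le_imp_le[of "3/4" "\<bar>J (c j) j * J (c j) k\<bar>"]) auto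
    have "\<bar>\<Sum>i\<in>{..<r}-{c j}. J i j * J i k\<bar> \<le> (\<Sum>i\<in>{..<r}-{c j}. q * q)"
      using c(3)[OF j] c(3)[OF jk(2)] eq rq[OF r0]
      by (intro sum_abs[THEN order_trans] sum_mono) (auto simp: abs_mult intro!: mult_mono)
    also have "\<dots> \<le> real r * q\<^sup>2" by (simp add: power2_eq_square mult_right_mono c(1)[OF j])
    also have "\<dots> \<le> 1 / 16" by (rule rq[OF r0])
    finally have "\<bar>(\<Sum>i<r. J i j * J i k) - J (c j) j * J (c j) k\<bar> \<le> 1 / 16"
      using c(1)[OF j] by (simp add: sum_diff1)
    moreover have "\<bar>\<Sum>i<r. J i j * J i k\<bar> \<le> d" using orth[OF j jk(2)] jk by simp
    ultimately show False using big small by linarith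
  qed
  \<comment> \<open>A crossing would order \<open>l j\<close> and \<open>l k\<close> like
    \<open>w (c j)\<close> and \<open>w (c k)\<close>, which are \<open>g\<close> apart in the wrong
    direction; the total error 4 r d \<le> g/2 cannot compensate.\<close>
  have mono: "c j < c k" if jk: "j < k" "k < r" for j k
  proof (rule ccontr)
    assume "\<not> ?thesis"
    then have lt: "c k < c j" using inj[OF jk] by simp
    have j: "j < r" using jk by simp
    have "w (c j) + g \<le> w (c k)" by (rule gap[OF lt c(1)[OF j]])
    moreover have "l k \<le> l j" using sorted[of j k] jk by simp
    ultimately show False using c(2)[OF j] c(2)[OF jk(2)] small g by linarith
  qed
  have id: "c j = j" if "j < r" for j
    using strict_mono_on_lessThan_eq_id[of r c j, OF mono c(1) that] .
  show "\<bar>l j - w j\<bar> \<le> 2 * real r * d" if "j < r" for j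
    using c(2)[OF that] id[OF that] by (simp add: abs_minus_commute)
  show "\<bar>J i j - (if i = j then 1 else 0)\<bar> \<le> d + 2 * d / g" if i: "i < r" and j: "j < r" for i j
  proof (cases "i = j")
    case True
    have r0: "0 < r" using i by simp
    have "(J j j)\<^sup>2 \<le> (\<Sum>i<r. (J i j)\<^sup>2)" using j by (intro member_le_sum) auto
    then have "\<bar>(J j j)\<^sup>2 - 1\<bar> \<le> d + q"
      using c(4)[OF j] id[OF j] orth[OF j j] rq[OF r0] by (auto simp: power2_eq_square abs_le_iff)
    moreover have "(J j j)\<^sup>2 - 1 = (J j j - 1) * (J j j + 1)" by (simp add: algebra_simps power2_eq_square)
    \<comment> \<open>The sign condition enters here: J j j + 1 \<ge> 1 turns closeness of the
      square to 1 into closeness of the entry.\<close>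
    moreover have "\<bar>J j j - 1\<bar> * 1 \<le> \<bar>J j j - 1\<bar> * \<bar>J j j + 1\<bar>" using sign[OF j] by (intro mult_left_mono) auto
    ultimately show ?thesis using True by (simp add: abs_mult q_def)
  next
    case False
    then show ?thesis using c(3)[OF j i] id[OF j] rq(5) i by (simp add: q_def)
  qed
qed

section \<open>Moments of linear and quadratic forms in the noise\<close>

lemma integrable_mult_square_integrable:
  fixes f g :: "'a \<Rightarrow> real"
  assumes [measurable]: "f \<in> borel_measurable M" "g \<in> borel_measurable M"
    and "integrable M (\<lambda>x. (f x)\<^sup>2)" "integrable M (\<lambda>x. (g x)\<^sup>2)"
  shows "integrable M (\<lambda>x. f x * g x)"
proof (rule Bochner_Integration.integrable_bound)
  show "integrable M (\<lambda>x. (f x)\<^sup>2 + (g x)\<^sup>2)" using assms by simp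
  have "\<bar>a * b\<bar> \<le> a\<^sup>2 + b\<^sup>2" for a b :: real
  proof -
    have "0 \<le> (\<bar>a\<bar> - \<bar>b\<bar>)\<^sup>2" by simp
    then have "2 * (\<bar>a\<bar> * \<bar>b\<bar>) \<le> a\<^sup>2 + b\<^sup>2" by (simp add: power2_diff)
    moreover have "0 \<le> \<bar>a\<bar> * \<bar>b\<bar>" by simp
    ultimately show ?thesis unfolding abs_mult by linarith
  qed
  then show "AE x in M. norm (f x * g x) \<le> norm ((f x)\<^sup>2 + (g x)\<^sup>2)" by simp
qed simp

lemma (in finite_measure) integrable_of_square_integrable:
  fixes f :: "'a \<Rightarrow> real"
  assumes "f \<in> borel_measurable M" "integrable M (\<lambda>x. (f x)\<^sup>2)"
  shows "integrable M f"
  using integrable_mult_square_integrable[of f M "\<lambda>_. 1"] assms by simp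

lemma (in finite_measure) square_integrable_of_power4:
  fixes f :: "'a \<Rightarrow> real"
  assumes [measurable]: "f \<in> borel_measurable M" and "integrable M (\<lambda>x. f x ^ 4)"
  shows "integrable M (\<lambda>x. (f x)\<^sup>2)"
proof (rule integrable_of_square_integrable)
  show "integrable M (\<lambda>x. ((f x)\<^sup>2)\<^sup>2)" using assms by (simp add: power_mult[symmetric])
qed simp

lemma square_integrable_add:
  fixes f g :: "'a \<Rightarrow> real"
  assumes [measurable]: "f \<in> borel_measurable M" "g \<in> borel_measurable M"
    and "integrable M (\<lambda>x. (f x)\<^sup>2)" "integrable M (\<lambda>x. (g x)\<^sup>2)"
  shows "integrable M (\<lambda>x. (f x + g x)\<^sup>2)"
proof -
  have "integrable M (\<lambda>x. (f x)\<^sup>2 + (g x)\<^sup>2 + 2 * (f x * g x))"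
    using assms integrable_mult_square_integrable[of f M g] by (intro Bochner_Integration.integrable_add integrable_mult_right) auto
  then show ?thesis by (simp add: power2_sum mult.assoc)
qed

lemma integral_add6:
  fixes f1 :: "'a \<Rightarrow> real"
  assumes "integrable M f1" "integrable M f2" "integrable M f3" "integrable M f4" "integrable M f5" "integrable M f6"
  shows "integrable M (\<lambda>x. f1 x + a2 * f2 x + f3 x + a4 * f4 x + a5 * f5 x + a6 * f6 x)"
    "(\<integral>x. f1 x + a2 * f2 x + f3 x + a4 * f4 x + a5 * f5 x + a6 * f6 x \<partial>M) =
      integral\<^sup>L M f1 + a2 * integral\<^sup>L M f2 + integral\<^sup>L M f3 + a4 * integral\<^sup>L M f4 + a5 * integral\<^sup>L M f5 + a6 * integral\<^sup>L M f6"
  using assms by simp_all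

context prob_space
begin

text \<open>The form in which independence enters the two inductions below: a function of one
  variable against an arbitrary measurable function of others.\<close>

lemma indep_var_of_indep_vars_insert:
  fixes e :: "'i \<Rightarrow> 'a \<Rightarrow> real"
  assumes "indep_vars (\<lambda>_. borel) e I" "i \<in> I" "J \<subseteq> I" "i \<notin> J"
    and "f \<in> borel_measurable borel" "g \<in> borel_measurable (Pi\<^sub>M J (\<lambda>_. borel))"
  shows "indep_var borel (\<lambda>\<omega>. f (e i \<omega>) :: real) borel (\<lambda>\<omega>. g (\<lambda>j\<in>J. e j \<omega>) :: real)"
proof -
  have r: "indep_var (Pi\<^sub>M {i} (\<lambda>_. borel)) (\<lambda>\<omega>. \<lambda>j\<in>{i}. e j \<omega>) (Pi\<^sub>M J (\<lambda>_. borel)) (\<lambda>\<omega>. \<lambda>j\<in>J. e j \<omega>)"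
    using assms by (intro indep_var_restrict[of _ _ I]) auto
  have "indep_var borel ((\<lambda>x. f (x i)) \<circ> (\<lambda>\<omega>. \<lambda>j\<in>{i}. e j \<omega>)) borel (g \<circ> (\<lambda>\<omega>. \<lambda>j\<in>J. e j \<omega>))"
    using assms by (intro indep_var_compose[OF r] measurable_compose[OF measurable_component_singleton]) auto
  then show ?thesis by (simp add: comp_def)
qed

text \<open>Induction on the index set: the new variable is centered and independent of the partial
  sum, so the cross term has expectation 0.\<close>

lemma linear_form_second_moment:
  fixes e :: "'i \<Rightarrow> 'a \<Rightarrow> real"
  assumes fin: "finite I" and indep: "indep_vars (\<lambda>_. borel) e I"
    and sq: "\<And>p. p \<in> I \<Longrightarrow> integrable M (\<lambda>\<omega>. (e p \<omega>)\<^sup>2)"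
    and mean: "\<And>p. p \<in> I \<Longrightarrow> expectation (e p) = 0"
    and var: "\<And>p. p \<in> I \<Longrightarrow> expectation (\<lambda>\<omega>. (e p \<omega>)\<^sup>2) = 1"
  shows "integrable M (\<lambda>\<omega>. (\<Sum>p\<in>I. a p * e p \<omega>)\<^sup>2) \<and>
    expectation (\<lambda>\<omega>. (\<Sum>p\<in>I. a p * e p \<omega>)\<^sup>2) = (\<Sum>p\<in>I. (a p)\<^sup>2) \<and>
    expectation (\<lambda>\<omega>. \<Sum>p\<in>I. a p * e p \<omega>) = 0"
proof -
  have meas[measurable]: "e p \<in> borel_measurable M" if "p \<in> I" for p
    using indep that unfolding indep_vars_def by auto
  have int: "integrable M (e p)" if "p \<in> I" for p
    by (rule integrable_of_square_integrable[OF meas[OF that] sq[OF that]])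
  have "integrable M (\<lambda>\<omega>. (\<Sum>p\<in>J. a p * e p \<omega>)\<^sup>2) \<and>
    expectation (\<lambda>\<omega>. (\<Sum>p\<in>J. a p * e p \<omega>)\<^sup>2) = (\<Sum>p\<in>J. (a p)\<^sup>2)" if "finite J" "J \<subseteq> I" for J
    using that
  proof (induction J rule: finite_induct)
    case (insert i J)
    let ?L = "\<lambda>\<omega>. \<Sum>p\<in>J. a p * e p \<omega>"
    have i: "i \<in> I" "J \<subseteq> I" using insert by auto
    have [measurable]: "e i \<in> borel_measurable M" "?L \<in> borel_measurable M" using i by (auto intro!: borel_measurable_sum)
    have IH: "integrable M (\<lambda>\<omega>. (?L \<omega>)\<^sup>2)" "expectation (\<lambda>\<omega>. (?L \<omega>)\<^sup>2) = (\<Sum>p\<in>J. (a p)\<^sup>2)"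
      using insert.IH i by auto
    have iv: "indep_var borel (\<lambda>\<omega>. e i \<omega>) borel (\<lambda>\<omega>. \<Sum>p\<in>J. a p * (\<lambda>j\<in>J. e j \<omega>) p)"
      using insert i by (intro indep_var_of_indep_vars_insert[OF indep i, where f="\<lambda>x. x" and g="\<lambda>x. \<Sum>p\<in>J. a p * x p"]) auto
    then have iv: "indep_var borel (e i) borel ?L" by simp
    have Lint: "integrable M ?L" using IH by (auto intro: integrable_of_square_integrable)
    have cross: "integrable M (\<lambda>\<omega>. e i \<omega> * ?L \<omega>)" "expectation (\<lambda>\<omega>. e i \<omega> * ?L \<omega>) = 0"
      using indep_var_integrable[OF iv int[OF i(1)] Lint] indep_var_lebesgue_integral[OF iv int[OF i(1)] Lint] mean[OF i(1)] by auto
    have eq: "(\<Sum>p\<in>insert i J. a p * e p \<omega>)\<^sup>2 = (a i)\<^sup>2 * (e i \<omega>)\<^sup>2 + (?L \<omega>)\<^sup>2 + 2 * a i * (e i \<omega> * ?L \<omega>)" for \<omega>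
      using insert by (simp add: power2_eq_square algebra_simps)
    show ?case unfolding eq using IH cross sq[OF i(1)] var[OF i(1)] insert by simp
  qed simp
  moreover have "expectation (\<lambda>\<omega>. \<Sum>p\<in>I. a p * e p \<omega>) = 0" using int mean by (simp add: Bochner_Integration.integral_sum)
  ultimately show ?thesis using fin by blast
qed

text \<open>Subtracting the Kronecker delta centers the diagonal products. Adding an index i changes
  the form X to X + c_ii (e_i^2 - 1) + e_i L with L linear in the earlier variables, and all three
  cross terms have expectation 0. In the constant, \<open>K\<close> bounds the second moment of
  e_i^2 - 1, and 2 comes from (a + b)^2 \<le> 2 (a^2 + b^2) applied to the coefficients of
  L.\<close>

lemma quadratic_form_second_moment:
  fixes e :: "'i \<Rightarrow> 'a \<Rightarrow> real" and c :: "'i \<Rightarrow> 'i \<Rightarrow> real"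
  assumes fin: "finite I" and indep: "indep_vars (\<lambda>_. borel) e I"
    and int4: "\<And>p. p \<in> I \<Longrightarrow> integrable M (\<lambda>\<omega>. e p \<omega> ^ 4)"
    and mean: "\<And>p. p \<in> I \<Longrightarrow> expectation (e p) = 0"
    and var: "\<And>p. p \<in> I \<Longrightarrow> expectation (\<lambda>\<omega>. (e p \<omega>)\<^sup>2) = 1"
    and m4: "\<And>p. p \<in> I \<Longrightarrow> expectation (\<lambda>\<omega>. e p \<omega> ^ 4) \<le> K" and K: "0 \<le> K"
  shows "integrable M (\<lambda>\<omega>. (\<Sum>p\<in>I. \<Sum>q\<in>I. c p q * (e p \<omega> * e q \<omega> - (if p = q then 1 else 0)))\<^sup>2) \<and>
    expectation (\<lambda>\<omega>. (\<Sum>p\<in>I. \<Sum>q\<in>I. c p q * (e p \<omega> * e q \<omega> - (if p = q then 1 else 0)))\<^sup>2)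
      \<le> (K + 2) * (\<Sum>p\<in>I. \<Sum>q\<in>I. (c p q)\<^sup>2)"
proof -
  have meas[measurable]: "e p \<in> borel_measurable M" if "p \<in> I" for p
    using indep that unfolding indep_vars_def by auto
  have sq: "integrable M (\<lambda>\<omega>. (e p \<omega>)\<^sup>2)" if "p \<in> I" for p
    by (rule square_integrable_of_power4[OF meas[OF that] int4[OF that]])
  have int: "integrable M (e p)" if "p \<in> I" for p
    by (rule integrable_of_square_integrable[OF meas[OF that] sq[OF that]])
  define Q where "Q J x = (\<Sum>p\<in>J. \<Sum>q\<in>J. c p q * (x p * x q - (if p = q then 1 else 0)))" for J and x :: "'i \<Rightarrow> real"
  have Qm: "Q J \<in> borel_measurable (Pi\<^sub>M J (\<lambda>_. borel))" for J unfolding Q_def by measurable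
  have Qr: "Q J (\<lambda>j\<in>J. e j \<omega>) = Q J (\<lambda>j. e j \<omega>)" for J \<omega> unfolding Q_def by (intro sum.cong) auto
  have "integrable M (\<lambda>\<omega>. (Q J (\<lambda>j. e j \<omega>))\<^sup>2) \<and> expectation (\<lambda>\<omega>. (Q J (\<lambda>j. e j \<omega>))\<^sup>2)
      \<le> (K + 2) * (\<Sum>p\<in>J. \<Sum>q\<in>J. (c p q)\<^sup>2)" if "finite J" "J \<subseteq> I" for J
    using that
  proof (induction J rule: finite_induct)
    case empty
    show ?case by (simp add: Q_def)
  next
    case (insert i J)
    have i: "i \<in> I" "J \<subseteq> I" using insert by auto
    let ?X = "\<lambda>\<omega>. Q J (\<lambda>j. e j \<omega>)"
    let ?L = "\<lambda>\<omega>. \<Sum>q\<in>J. (c i q + c q i) * e q \<omega>"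
    let ?d = "\<lambda>\<omega>. (e i \<omega>)\<^sup>2 - 1"
    have [measurable]: "e i \<in> borel_measurable M" "?L \<in> borel_measurable M" using i by (auto intro!: borel_measurable_sum)
    have [measurable]: "?X \<in> borel_measurable M"
      unfolding Q_def using i by (intro borel_measurable_sum borel_measurable_times borel_measurable_diff meas borel_measurable_const) auto
    have IH: "integrable M (\<lambda>\<omega>. (?X \<omega>)\<^sup>2)" "expectation (\<lambda>\<omega>. (?X \<omega>)\<^sup>2) \<le> (K + 2) * (\<Sum>p\<in>J. \<Sum>q\<in>J. (c p q)\<^sup>2)"
      using insert.IH i by auto
    have lin: "integrable M (\<lambda>\<omega>. (?L \<omega>)\<^sup>2)" "expectation (\<lambda>\<omega>. (?L \<omega>)\<^sup>2) = (\<Sum>q\<in>J. (c i q + c q i)\<^sup>2)" "expectation ?L = 0"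
      using linear_form_second_moment[of J e "\<lambda>q. c i q + c q i"] insert(1) indep_vars_subset[OF indep i(2)] i sq mean var by auto
    have d4: "integrable M (\<lambda>\<omega>. (?d \<omega>)\<^sup>2)" "expectation (\<lambda>\<omega>. (?d \<omega>)\<^sup>2) \<le> K"
    proof -
      have eq: "(?d \<omega>)\<^sup>2 = e i \<omega> ^ 4 - 2 * (e i \<omega>)\<^sup>2 + 1" for \<omega> by (simp add: power2_eq_square eval_nat_numeral algebra_simps)
      show "integrable M (\<lambda>\<omega>. (?d \<omega>)\<^sup>2)" unfolding eq using int4[OF i(1)] sq[OF i(1)] by simp
      show "expectation (\<lambda>\<omega>. (?d \<omega>)\<^sup>2) \<le> K" unfolding eq using int4[OF i(1)] sq[OF i(1)] var[OF i(1)] m4[OF i(1)] by (simp add: prob_space)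
    qed
    have dint: "integrable M ?d" "expectation ?d = 0" using sq[OF i(1)] var[OF i(1)] by (auto simp: prob_space)
    have Xint: "integrable M ?X" using IH by (auto intro: integrable_of_square_integrable)
    have Lint: "integrable M ?L" using lin by (auto intro: integrable_of_square_integrable)
    have iv: "indep_var borel (\<lambda>\<omega>. f (e i \<omega>)) borel (\<lambda>\<omega>. g (\<lambda>j\<in>J. e j \<omega>))"
      if "f \<in> borel_measurable borel" "g \<in> borel_measurable (Pi\<^sub>M J (\<lambda>_. borel))" for f g :: "_ \<Rightarrow> real"
      using insert i that by (intro indep_var_of_indep_vars_insert[OF indep i]) auto
    have prodE: "integrable M (\<lambda>\<omega>. f (e i \<omega>) * g (\<lambda>j\<in>J. e j \<omega>)) \<and>
       expectation (\<lambda>\<omega>. f (e i \<omega>) * g (\<lambda>j\<in>J. e j \<omega>)) = expectation (\<lambda>\<omega>. f (e i \<omega>)) * expectation (\<lambda>\<omega>. g (\<lambda>j\<in>J. e j \<omega>))"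
      if "f \<in> borel_measurable borel" "g \<in> borel_measurable (Pi\<^sub>M J (\<lambda>_. borel))"
        "integrable M (\<lambda>\<omega>. f (e i \<omega>))" "integrable M (\<lambda>\<omega>. g (\<lambda>j\<in>J. e j \<omega>))" for f g :: "_ \<Rightarrow> real"
      using indep_var_integrable[OF iv[OF that(1,2)] that(3,4)] indep_var_lebesgue_integral[OF iv[OF that(1,2)] that(3,4)] by auto
    have Lr: "(\<Sum>q\<in>J. (c i q + c q i) * (\<lambda>j\<in>J. e j \<omega>) q) = ?L \<omega>" for \<omega> by simp
    let ?l = "\<lambda>x. \<Sum>q\<in>J. (c i q + c q i) * x q"
    have lm: "?l \<in> borel_measurable (Pi\<^sub>M J (\<lambda>_. borel))" by measurable
    have 1: "integrable M (\<lambda>\<omega>. ?d \<omega> * ?X \<omega>)" "expectation (\<lambda>\<omega>. ?d \<omega> * ?X \<omega>) = 0"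
      using prodE[of "\<lambda>x. x\<^sup>2 - 1" "Q J"] Qm dint Xint by (simp_all add: Qr)
    have XL: "integrable M (\<lambda>\<omega>. ?X \<omega> * ?L \<omega>)" using IH lin by (intro integrable_mult_square_integrable) auto
    have 2: "integrable M (\<lambda>\<omega>. e i \<omega> * (?X \<omega> * ?L \<omega>))" "expectation (\<lambda>\<omega>. e i \<omega> * (?X \<omega> * ?L \<omega>)) = 0"
      using prodE[of "\<lambda>x. x" "\<lambda>x. Q J x * ?l x"] Qm lm XL int[OF i(1)] mean[OF i(1)] by (simp_all add: Qr)
    have de: "integrable M (\<lambda>\<omega>. ?d \<omega> * e i \<omega>)" using d4 sq[OF i(1)] by (intro integrable_mult_square_integrable) auto
    \<comment> \<open>Here it is the mean of L that vanishes; the factor (e_i^2 - 1) e_i may have a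
      nonzero mean, the third moment.\<close>
    have 3: "integrable M (\<lambda>\<omega>. (?d \<omega> * e i \<omega>) * ?L \<omega>)" "expectation (\<lambda>\<omega>. (?d \<omega> * e i \<omega>) * ?L \<omega>) = 0"
      using prodE[of "\<lambda>x. (x\<^sup>2 - 1) * x" ?l] lm de Lint lin(3) by (simp_all)
    have 4: "integrable M (\<lambda>\<omega>. (e i \<omega>)\<^sup>2 * (?L \<omega>)\<^sup>2)" "expectation (\<lambda>\<omega>. (e i \<omega>)\<^sup>2 * (?L \<omega>)\<^sup>2) = (\<Sum>q\<in>J. (c i q + c q i)\<^sup>2)"
      using prodE[of "\<lambda>x. x\<^sup>2" "\<lambda>x. (?l x)\<^sup>2"] lm sq[OF i(1)] lin(1,2) var[OF i(1)] by (simp_all)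
    have eqQ: "Q (insert i J) (\<lambda>j. e j \<omega>) = ?X \<omega> + c i i * ?d \<omega> + e i \<omega> * ?L \<omega>" for \<omega>
    proof -
      define h where "h p q = c p q * (e p \<omega> * e q \<omega> - (if p = q then 1 else 0))" for p q
      have "(\<Sum>p\<in>insert i J. \<Sum>q\<in>insert i J. h p q) = (\<Sum>p\<in>J. \<Sum>q\<in>J. h p q) + h i i + ((\<Sum>q\<in>J. h i q) + (\<Sum>q\<in>J. h q i))"
        using insert(1,2) by (simp add: sum.distrib)
      also have "(\<Sum>q\<in>J. h i q) + (\<Sum>q\<in>J. h q i) = e i \<omega> * ?L \<omega>"
        unfolding sum.distrib[symmetric] sum_distrib_left
        using insert(2) by (intro sum.cong) (auto simp: h_def algebra_simps)
      also have "h i i = c i i * ?d \<omega>" by (simp add: h_def power2_eq_square)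
      finally show ?thesis unfolding Q_def h_def .
    qed
    have sq6: "(X + a * d + x * L)\<^sup>2 = X\<^sup>2 + a\<^sup>2 * d\<^sup>2 + x\<^sup>2 * L\<^sup>2 + 2 * a * (d * X) + 2 * (x * (X * L)) + 2 * a * ((d * x) * L)"
      for X a d x L :: real by (simp add: power2_eq_square algebra_simps)
    note I6 = integral_add6[OF IH(1) d4(1) 4(1) 1(1) 2(1) 3(1), of "(c i i)\<^sup>2" "2 * c i i" 2 "2 * c i i"]
    have I: "integrable M (\<lambda>\<omega>. (Q (insert i J) (\<lambda>j. e j \<omega>))\<^sup>2)"
      unfolding eqQ sq6 by (rule I6(1))
    have "expectation  (\<lambda>\<omega>. (Q (insert i J) (\<lambda>j. e j \<omega>))\<^sup>2)
       = expectation (\<lambda>\<omega>. (?X \<omega>)\<^sup>2) + (c i i)\<^sup>2 * expectation (\<lambda>\<omega>. (?d \<omega>)\<^sup>2) + (\<Sum>q\<in>J. (c i q + c q i)\<^sup>2)"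
      unfolding eqQ sq6 I6(2) 1(2) 2(2) 3(2) 4(2) by simp
    also have "\<dots> \<le> (K + 2) * (\<Sum>p\<in>J. \<Sum>q\<in>J. (c p q)\<^sup>2) + (c i i)\<^sup>2 * K + (\<Sum>q\<in>J. (K + 2) * ((c i q)\<^sup>2 + (c q i)\<^sup>2))"
    proof -
      have "(c i q + c q i)\<^sup>2 \<le> (K + 2) * ((c i q)\<^sup>2 + (c q i)\<^sup>2)" for q
      proof -
        have "0 \<le> (c i q - c q i)\<^sup>2" by simp
        then have "(c i q + c q i)\<^sup>2 \<le> 2 * ((c i q)\<^sup>2 + (c q i)\<^sup>2)" by (simp add: power2_sum power2_diff)
        also have "\<dots> \<le> (K + 2) * ((c i q)\<^sup>2 + (c q i)\<^sup>2)" using K by (intro mult_right_mono) auto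
        finally show ?thesis .
      qed
      then have "(\<Sum>q\<in>J. (c i q + c q i)\<^sup>2) \<le> (\<Sum>q\<in>J. (K + 2) * ((c i q)\<^sup>2 + (c q i)\<^sup>2))" by (rule sum_mono)
      moreover have "(c i i)\<^sup>2 * expectation (\<lambda>\<omega>. (?d \<omega>)\<^sup>2) \<le> (c i i)\<^sup>2 * K" using d4(2) by (rule mult_left_mono) simp
      ultimately show ?thesis using IH(2) by linarith
    qed
    also have "\<dots> \<le> (K + 2) * (\<Sum>p\<in>J. \<Sum>q\<in>J. (c p q)\<^sup>2) + (K + 2) * (c i i)\<^sup>2 + (\<Sum>q\<in>J. (K + 2) * ((c i q)\<^sup>2 + (c q i)\<^sup>2))"
      by (simp add: algebra_simps)
    also have "\<dots> = (K + 2) * (\<Sum>p\<in>insert i J. \<Sum>q\<in>insert i J. (c p q)\<^sup>2)"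
    proof -
      have "(\<Sum>p\<in>insert i J. \<Sum>q\<in>insert i J. (c p q)\<^sup>2) = (\<Sum>p\<in>J. \<Sum>q\<in>J. (c p q)\<^sup>2) + (c i i)\<^sup>2 + (\<Sum>q\<in>J. (c i q)\<^sup>2 + (c q i)\<^sup>2)"
        using insert(1,2) by (simp add: sum.distrib)
      then show ?thesis unfolding sum_distrib_left[symmetric] by (simp only: distrib_left)
    qed
    finally show ?case using I by blast
  qed
  from this[OF fin] show ?thesis unfolding Q_def by blast
qed

text \<open>Conditioning on \<open>X\<close> in terms of laws: the joint law is a product, Tonelli
  isolates the integral over \<open>Y\<close>, and there \<open>X\<close> is frozen at a value x.
  With nonnegative integrals no integrability has to be checked in advance.\<close>

lemma indep_var_nn_integral_le:
  assumes iv: "indep_var MY Y MX X"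
    and g[measurable]: "(\<lambda>(y, x). g x y) \<in> borel_measurable (MY \<Otimes>\<^sub>M MX)" and h[measurable]: "h \<in> borel_measurable MX"
    and le: "\<And>x. x \<in> space MX \<Longrightarrow> (\<integral>\<^sup>+ \<omega>. g x (Y \<omega>) \<partial>M) \<le> h x"
  shows "(\<integral>\<^sup>+ \<omega>. g (X \<omega>) (Y \<omega>) \<partial>M) \<le> (\<integral>\<^sup>+ \<omega>. h (X \<omega>) \<partial>M)"
proof -
  have X[measurable]: "X \<in> measurable M MX" and Y[measurable]: "Y \<in> measurable M MY"
    and eq: "distr M MY Y \<Otimes>\<^sub>M distr M MX X = distr M (MY \<Otimes>\<^sub>M MX) (\<lambda>\<omega>. (Y \<omega>, X \<omega>))"
    using iv unfolding indep_var_distribution_eq by auto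
  interpret X: prob_space "distr M MX X" by (rule prob_space_distr) simp
  interpret Y: prob_space "distr M MY Y" by (rule prob_space_distr) simp
  interpret YX: pair_sigma_finite "distr M MY Y" "distr M MX X" ..
  have "(\<integral>\<^sup>+ \<omega>. g (X \<omega>) (Y \<omega>) \<partial>M) = (\<integral>\<^sup>+ z. (\<lambda>(y,x). g x y) z \<partial>(distr M (MY \<Otimes>\<^sub>M MX) (\<lambda>\<omega>. (Y \<omega>, X \<omega>))))"
    by (subst nn_integral_distr) auto
  also have "\<dots> = (\<integral>\<^sup>+ x. \<integral>\<^sup>+ y. g x y \<partial>distr M MY Y \<partial>distr M MX X)"
    unfolding eq[symmetric] by (subst YX.nn_integral_snd[symmetric]) auto
  also have "\<dots> = (\<integral>\<^sup>+ x. \<integral>\<^sup>+ \<omega>. g x (Y \<omega>) \<partial>M \<partial>distr M MX X)"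
    by (intro nn_integral_cong) (simp add: nn_integral_distr)
  also have "\<dots> \<le> (\<integral>\<^sup>+ x. h x \<partial>distr M MX X)"
    using le by (intro nn_integral_mono) simp
  also have "\<dots> = (\<integral>\<^sup>+ \<omega>. h (X \<omega>) \<partial>M)" by (subst nn_integral_distr) auto
  finally show ?thesis .
qed

end

section \<open>Matrices with random entries\<close>

lemma random_matrixD:
  assumes "random_matrix M m k A"
  shows "\<omega> \<in> space M \<Longrightarrow> A \<omega> \<in> carrier_mat m k"
    and "i < m \<Longrightarrow> j < k \<Longrightarrow> (\<lambda>\<omega>. A \<omega> $$ (i, j)) \<in> borel_measurable M"
  using assms by (auto simp: random_matrix_def)

lemma random_matrix_const: "A \<in> carrier_mat m k \<Longrightarrow> random_matrix M m k (\<lambda>_. A)"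
  by (simp add: random_matrix_def)

lemma random_matrix_transpose:
  assumes "random_matrix M m k A"
  shows "random_matrix M k m (\<lambda>\<omega>. transpose_mat (A \<omega>))"
  unfolding random_matrix_def
proof (intro conjI ballI allI impI)
  fix i j assume "i < k" "j < m"
  then show "(\<lambda>\<omega>. transpose_mat (A \<omega>) $$ (i, j)) \<in> borel_measurable M"
    using random_matrixD[OF assms]
    by (subst measurable_cong[where g="\<lambda>\<omega>. A \<omega> $$ (j, i)"]) fastforce+
qed (use random_matrixD[OF assms] in auto)

lemma random_matrix_mult:
  assumes A: "random_matrix M m n A" and B: "random_matrix M n k B"
  shows "random_matrix M m k (\<lambda>\<omega>. A \<omega> * B \<omega>)"
  unfolding random_matrix_def
proof (intro conjI ballI allI impI)
  fix i j assume ij: "i < m" "j < k"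
  have "(\<lambda>\<omega>. \<Sum>l<n. A \<omega> $$ (i,l) * B \<omega> $$ (l,j)) \<in> borel_measurable M"
    using random_matrixD(2)[OF A] random_matrixD(2)[OF B] ij
    by (intro borel_measurable_sum borel_measurable_times) auto
  then show "(\<lambda>\<omega>. (A \<omega> * B \<omega>) $$ (i, j)) \<in> borel_measurable M"
    by (rule measurable_cong[THEN iffD1, rotated])
      (use index_mult_mat_sum[OF random_matrixD(1)[OF A] random_matrixD(1)[OF B]] ij in auto)
qed (rule mult_carrier_mat[OF random_matrixD(1)[OF A] random_matrixD(1)[OF B]])

lemma random_matrix_add:
  assumes A: "random_matrix M m k A" and B: "random_matrix M m k B"
  shows "random_matrix M m k (\<lambda>\<omega>. A \<omega> + B \<omega>)"
  unfolding random_matrix_def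
proof (intro conjI ballI allI impI)
  fix i j assume ij: "i < m" "j < k"
  have "(\<lambda>\<omega>. A \<omega> $$ (i,j) + B \<omega> $$ (i,j)) \<in> borel_measurable M"
    using random_matrixD(2)[OF A] random_matrixD(2)[OF B] ij by auto
  then show "(\<lambda>\<omega>. (A \<omega> + B \<omega>) $$ (i, j)) \<in> borel_measurable M"
    by (rule measurable_cong[THEN iffD1, rotated])
      (use random_matrixD(1)[OF A] random_matrixD(1)[OF B] ij in fastforce)
qed (use random_matrixD[OF A] random_matrixD[OF B] in auto)

lemma random_matrix_smult:
  assumes A: "random_matrix M m k A"
  shows "random_matrix M m k (\<lambda>\<omega>. c \<cdot>\<^sub>m A \<omega>)"
  unfolding random_matrix_def
proof (intro conjI ballI allI impI)
  fix i j assume ij: "i < m" "j < k"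
  have "(\<lambda>\<omega>. c * A \<omega> $$ (i,j)) \<in> borel_measurable M"
    using random_matrixD(2)[OF A] ij by auto
  then show "(\<lambda>\<omega>. (c \<cdot>\<^sub>m A \<omega>) $$ (i, j)) \<in> borel_measurable M"
    by (rule measurable_cong[THEN iffD1, rotated])
      (use random_matrixD(1)[OF A] ij in fastforce)
qed (use random_matrixD[OF A] in auto)

lemma random_matrix_of_fun:
  assumes "\<And>p. p \<in> {..<m} \<times> {..<k} \<Longrightarrow> (\<lambda>\<omega>. f \<omega> p) \<in> borel_measurable M"
  shows "random_matrix M m k (\<lambda>\<omega>. Matrix.mat m k (f \<omega>))"
  using assms by (auto simp: random_matrix_def)

lemma measurable_frob_norm_power2:
  assumes A: "random_matrix M m k A"
  shows "(\<lambda>\<omega>. (frob_norm (A \<omega>))\<^sup>2) \<in> borel_measurable M"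
proof -
  have "(\<lambda>\<omega>. \<Sum>i<m. \<Sum>j<k. (A \<omega> $$ (i,j))\<^sup>2) \<in> borel_measurable M"
    using random_matrixD(2)[OF A] by (intro borel_measurable_sum borel_measurable_power) auto
  then show ?thesis
    by (rule measurable_cong[THEN iffD1, rotated]) (use frob_norm_power2[OF random_matrixD(1)[OF A]] in auto)
qed

lemma nn_integral_frob_norm_le:
  assumes A: "random_matrix M m k A"
    and int: "\<And>i j. i < m \<Longrightarrow> j < k \<Longrightarrow> integrable M (\<lambda>\<omega>. (A \<omega> $$ (i,j))\<^sup>2)"
    and le: "\<And>i j. i < m \<Longrightarrow> j < k \<Longrightarrow> (\<integral>\<omega>. (A \<omega> $$ (i,j))\<^sup>2 \<partial>M) \<le> b i j"
  shows "(\<integral>\<^sup>+\<omega>. ennreal ((frob_norm (A \<omega>))\<^sup>2) \<partial>M) \<le> ennreal (\<Sum>i<m. \<Sum>j<k. b i j)"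
proof -
  have I: "integrable M (\<lambda>\<omega>. \<Sum>i<m. \<Sum>j<k. (A \<omega> $$ (i,j))\<^sup>2)"
    using int by (intro Bochner_Integration.integrable_sum) auto
  have "(\<integral>\<^sup>+\<omega>. ennreal ((frob_norm (A \<omega>))\<^sup>2) \<partial>M) = (\<integral>\<^sup>+\<omega>. ennreal (\<Sum>i<m. \<Sum>j<k. (A \<omega> $$ (i,j))\<^sup>2) \<partial>M)"
    by (intro nn_integral_cong) (simp add: frob_norm_power2[OF random_matrixD(1)[OF A]])
  also have "\<dots> = ennreal (\<integral>\<omega>. (\<Sum>i<m. \<Sum>j<k. (A \<omega> $$ (i,j))\<^sup>2) \<partial>M)"
    using I by (intro nn_integral_eq_integral) (auto intro!: sum_nonneg)
  also have "(\<integral>\<omega>. (\<Sum>i<m. \<Sum>j<k. (A \<omega> $$ (i,j))\<^sup>2) \<partial>M) = (\<Sum>i<m. \<Sum>j<k. (\<integral>\<omega>. (A \<omega> $$ (i,j))\<^sup>2 \<partial>M))"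
    using int by (subst Bochner_Integration.integral_sum, fastforce intro: Bochner_Integration.integrable_sum,
      intro sum.cong refl, subst Bochner_Integration.integral_sum) auto
  also have "ennreal \<dots> \<le> ennreal (\<Sum>i<m. \<Sum>j<k. b i j)"
    using le by (intro ennreal_leI sum_mono) auto
  finally show ?thesis .
qed

lemma sum_Times: "sum f (A \<times> B) = (\<Sum>x\<in>A. \<Sum>y\<in>B. f (x, y))"
  by (simp add: sum.cartesian_product)

text \<open>Cauchy-Schwarz against the constant 1. The trace of \<open>G\<close> is the mean of the
  quadratic form in the noise, so this is where the factor N of the mean part comes from.\<close>

lemma trace_power2_le:
  assumes G: "G \<in> carrier_mat N N"
  shows "(\<Sum>j<N. G $$ (j,j))\<^sup>2 \<le> real N * (frob_norm G)\<^sup>2"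
proof -
  have "(\<Sum>j<N. 1 * G $$ (j,j))\<^sup>2 \<le> (\<Sum>j<N. 1\<^sup>2) * (\<Sum>j<N. (G $$ (j,j))\<^sup>2)"
    by (rule Cauchy_Schwarz_ineq_sum)
  also have "\<dots> \<le> real N * (\<Sum>j<N. \<Sum>k<N. (G $$ (j,k))\<^sup>2)"
    by (auto intro!: mult_left_mono sum_mono member_le_sum)
  finally show ?thesis by (simp add: frob_norm_power2[OF G])
qed

text \<open>The moment and independence conditions at one fixed pair of dimensions, so that the
  bounds below are non-asymptotic and have explicit constants.\<close>

locale noise_matrix = prob_space M for M :: "'a measure" +
  fixes T N :: nat and K :: real and S :: "'a \<Rightarrow> real Matrix.mat"
  assumes S: "random_matrix M T N S"
    and indep: "indep_vars (\<lambda>_. borel) (\<lambda>p \<omega>. S \<omega> $$ p) ({..<T} \<times> {..<N})"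
    and int4: "\<And>t j. t < T \<Longrightarrow> j < N \<Longrightarrow> integrable M (\<lambda>\<omega>. (S \<omega> $$ (t, j)) ^ 4)"
    and mean: "\<And>t j. t < T \<Longrightarrow> j < N \<Longrightarrow> expectation (\<lambda>\<omega>. S \<omega> $$ (t, j)) = 0"
    and var: "\<And>t j. t < T \<Longrightarrow> j < N \<Longrightarrow> expectation (\<lambda>\<omega>. (S \<omega> $$ (t, j))\<^sup>2) = 1"
    and m4: "\<And>t j. t < T \<Longrightarrow> j < N \<Longrightarrow> expectation (\<lambda>\<omega>. (S \<omega> $$ (t, j)) ^ 4) \<le> K"
    and K: "0 \<le> K"
begin

lemma S_carrier: "\<omega> \<in> space M \<Longrightarrow> S \<omega> \<in> carrier_mat T N"
  using S by (simp add: random_matrix_def)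

lemma int2: "t < T \<Longrightarrow> j < N \<Longrightarrow> integrable M (\<lambda>\<omega>. (S \<omega> $$ (t, j))\<^sup>2)"
  by (rule square_integrable_of_power4[OF random_matrixD(2)[OF S] int4])

text \<open>Entry (i, l) of A S Y is a linear form with coefficients A_it Y_jl; the sum of their
  squares over all indices factors into the two Frobenius norms.\<close>

lemma nn_integral_linear_form_le:
  assumes A: "A \<in> carrier_mat m T" and Y: "Y \<in> carrier_mat N k"
  shows "(\<integral>\<^sup>+\<omega>. ennreal ((frob_norm (A * S \<omega> * Y))\<^sup>2) \<partial>M) \<le> ennreal ((frob_norm A)\<^sup>2 * (frob_norm Y)\<^sup>2)"
proof -
  let ?I = "{..<T} \<times> {..<N}"
  have R: "random_matrix M m k (\<lambda>\<omega>. A * S \<omega> * Y)"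
    by (intro random_matrix_mult[where n=N] random_matrix_mult[where n=T] random_matrix_const A Y S)
  have entry: "(A * S \<omega> * Y) $$ (i,l) = (\<Sum>p\<in>?I. (A $$ (i, fst p) * Y $$ (snd p, l)) * S \<omega> $$ p)"
    if "\<omega> \<in> space M" "i < m" "l < k" for \<omega> i l
  proof -
    have "(A * S \<omega> * Y) $$ (i,l) = (\<Sum>j<N. (\<Sum>t<T. A $$ (i,t) * S \<omega> $$ (t,j)) * Y $$ (j,l))"
      using that A Y S_carrier[OF that(1)]
      by (subst index_mult_mat_sum[of _ m N _ k]) (auto simp: index_mult_mat_sum[of A m T] simp del: index_mult_mat(1))
    also have "\<dots> = (\<Sum>t<T. \<Sum>j<N. (A $$ (i,t) * Y $$ (j, l)) * S \<omega> $$ (t,j))"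
      unfolding sum_distrib_right by (subst sum.swap) (simp add: mult_ac)
    finally show ?thesis by (simp add: sum.cartesian_product case_prod_beta)
  qed
  have lin: "integrable M (\<lambda>\<omega>. (\<Sum>p\<in>?I. a p * S \<omega> $$ p)\<^sup>2) \<and>
    expectation (\<lambda>\<omega>. (\<Sum>p\<in>?I. a p * S \<omega> $$ p)\<^sup>2) = (\<Sum>p\<in>?I. (a p)\<^sup>2)" for a
    using linear_form_second_moment[OF _ indep, of a] int2 mean var by auto
  have "(\<integral>\<^sup>+\<omega>. ennreal ((frob_norm (A * S \<omega> * Y))\<^sup>2) \<partial>M)
     \<le> ennreal (\<Sum>i<m. \<Sum>l<k. \<Sum>p\<in>?I. (A $$ (i, fst p) * Y $$ (snd p, l))\<^sup>2)"
  proof (rule nn_integral_frob_norm_le[OF R])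
    fix i l assume il: "i < m" "l < k"
    note L = lin[of "\<lambda>p. A $$ (i, fst p) * Y $$ (snd p, l)"]
    show "integrable M (\<lambda>\<omega>. ((A * S \<omega> * Y) $$ (i,l))\<^sup>2)"
      using L il by (subst Bochner_Integration.integrable_cong[OF refl]) (auto simp: entry simp del: index_mult_mat(1))
    show "(\<integral>\<omega>. ((A * S \<omega> * Y) $$ (i,l))\<^sup>2 \<partial>M) \<le> (\<Sum>p\<in>?I. (A $$ (i, fst p) * Y $$ (snd p, l))\<^sup>2)"
      using L il by (subst Bochner_Integration.integral_cong[OF refl]) (auto simp: entry simp del: index_mult_mat(1))
  qed
  also have "(\<Sum>i<m. \<Sum>l<k. \<Sum>p\<in>?I. (A $$ (i, fst p) * Y $$ (snd p, l))\<^sup>2)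
     = (\<Sum>i<m. \<Sum>l<k. (\<Sum>t<T. (A $$ (i,t))\<^sup>2) * (\<Sum>j<N. (Y $$ (j,l))\<^sup>2))"
    by (simp add: power_mult_distrib sum_product sum.cartesian_product[symmetric] case_prod_beta sum.cartesian_product')
  also have "\<dots> = (frob_norm A)\<^sup>2 * (frob_norm Y)\<^sup>2"
    unfolding frob_norm_power2[OF A] frob_norm_power2[OF Y] sum_product[symmetric]
    by (subst (4) sum.swap) simp
  finally show ?thesis .
qed

text \<open>Entry (i, l) is a centered quadratic form plus its mean tr(G) (A Y)_il. The first
  summand of the bound is the fluctuation, the second the mean, with the trace estimated by
  Cauchy-Schwarz. Keeping A Y together in the second summand is essential: it can be far smaller
  than the product of the norms of A and Y.\<close>

lemma nn_integral_quadratic_form_le: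
  assumes A: "A \<in> carrier_mat m T" and G: "G \<in> carrier_mat N N" and Y: "Y \<in> carrier_mat T k"
  shows "(\<integral>\<^sup>+\<omega>. ennreal ((frob_norm (A * S \<omega> * G * transpose_mat (S \<omega>) * Y))\<^sup>2) \<partial>M)
    \<le> ennreal (2 * (K + 2) * (frob_norm G)\<^sup>2 * ((frob_norm A)\<^sup>2 * (frob_norm Y)\<^sup>2)
        + 2 * (real N * (frob_norm G)\<^sup>2) * (frob_norm (A * Y))\<^sup>2)"
proof -
  let ?I = "{..<T} \<times> {..<N}"
  let ?Q = "\<lambda>\<omega>. A * S \<omega> * G * transpose_mat (S \<omega>) * Y"
  define tr where "tr = (\<Sum>j<N. G $$ (j,j))"
  have R: "random_matrix M m k ?Q"
    by (intro random_matrix_mult[where n=T and A="\<lambda>\<omega>. A * S \<omega> * G * transpose_mat (S \<omega>)"]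
        random_matrix_mult[where n=N and A="\<lambda>\<omega>. A * S \<omega> * G"] random_matrix_mult[where n=N and A="\<lambda>\<omega>. A * S \<omega>"]
        random_matrix_mult[where n=T and A="\<lambda>\<omega>. A"] random_matrix_transpose random_matrix_const A G Y S)
  define c where "c i l p q = A $$ (i, fst p) * Y $$ (fst q, l) * G $$ (snd p, snd q)" for i l :: nat and p q :: "nat \<times> nat"
  have entry: "?Q \<omega> $$ (i,l) = (\<Sum>p\<in>?I. \<Sum>q\<in>?I. c i l p q * (S \<omega> $$ p * S \<omega> $$ q - (if p = q then 1 else 0))) + tr * (A * Y) $$ (i,l)"
    if "\<omega> \<in> space M" "i < m" "l < k" for \<omega> i l
  proof -
    have Sc: "S \<omega> \<in> carrier_mat T N" using that S_carrier by simp
    have c1: "A * S \<omega> \<in> carrier_mat m N" using A Sc by simp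
    have c2: "A * S \<omega> * G \<in> carrier_mat m N" using c1 G by simp
    have c3: "A * S \<omega> * G * transpose_mat (S \<omega>) \<in> carrier_mat m T" using mult_carrier_mat[OF c2] Sc by simp
    have St: "transpose_mat (S \<omega>) \<in> carrier_mat N T" using Sc by simp
    have "?Q \<omega> $$ (i,l) = (\<Sum>s'<T. (\<Sum>j'<N. (\<Sum>j<N. (\<Sum>s<T. A $$ (i,s) * S \<omega> $$ (s,j)) * G $$ (j,j')) * S \<omega> $$ (s',j')) * Y $$ (s',l))"
      unfolding index_mult_mat_sum[OF c3 Y that(2,3)]
    proof (intro sum.cong refl arg_cong2[of _ _ _ _ "(*)"])
      fix s' assume "s' \<in> {..<T}"
      then have s': "s' < T" by simp
      show "(A * S \<omega> * G * transpose_mat (S \<omega>)) $$ (i,s') = (\<Sum>j'<N. (\<Sum>j<N. (\<Sum>s<T. A $$ (i,s) * S \<omega> $$ (s,j)) * G $$ (j,j')) * S \<omega> $$ (s',j'))"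
        unfolding index_mult_mat_sum[OF c2 St that(2) s']
      proof (intro sum.cong refl arg_cong2[of _ _ _ _ "(*)"])
        fix j' assume "j' \<in> {..<N}"
        then have j': "j' < N" by simp
        show "transpose_mat (S \<omega>) $$ (j',s') = S \<omega> $$ (s',j')" using Sc s' j' by simp
        show "(A * S \<omega> * G) $$ (i,j') = (\<Sum>j<N. (\<Sum>s<T. A $$ (i,s) * S \<omega> $$ (s,j)) * G $$ (j,j'))"
          unfolding index_mult_mat_sum[OF c1 G that(2) j']
          by (intro sum.cong refl arg_cong2[of _ _ _ _ "(*)"] index_mult_mat_sum[OF A Sc that(2)]) simp
      qed
    qed
    also have "\<dots> = (\<Sum>s'<T. \<Sum>j'<N. \<Sum>j<N. \<Sum>s<T. c i l (s,j) (s',j') * (S \<omega> $$ (s,j) * S \<omega> $$ (s',j')))"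
      by (simp add: sum_distrib_right sum_distrib_left c_def mult_ac)
    also have "\<dots> = (\<Sum>s'<T. \<Sum>j'<N. \<Sum>s<T. \<Sum>j<N. c i l (s,j) (s',j') * (S \<omega> $$ (s,j) * S \<omega> $$ (s',j')))"
      by (intro sum.cong refl sum.swap)
    also have "\<dots> = (\<Sum>q\<in>?I. \<Sum>p\<in>?I. c i l p q * (S \<omega> $$ p * S \<omega> $$ q))"
      by (simp only: sum_Times)
    also have "\<dots> = (\<Sum>p\<in>?I. \<Sum>q\<in>?I. c i l p q * (S \<omega> $$ p * S \<omega> $$ q))" by (rule sum.swap)
    finally have 1: "?Q \<omega> $$ (i,l) = (\<Sum>p\<in>?I. \<Sum>q\<in>?I. c i l p q * (S \<omega> $$ p * S \<omega> $$ q))" .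
    \<comment> \<open>The diagonal coefficients, which the centering subtracts, add up to the trace
      of \<open>G\<close> times the entry of A Y.\<close>
    have "(\<Sum>p\<in>?I. \<Sum>q\<in>?I. c i l p q * (if p = q then 1 else 0)) = (\<Sum>p\<in>?I. \<Sum>q\<in>?I. if p = q then c i l p p else 0)"
      by (intro sum.cong refl) auto
    also have "\<dots> = (\<Sum>p\<in>?I. c i l p p)" by (intro sum.cong refl) simp
    also have "\<dots> = (\<Sum>s<T. \<Sum>j<N. A $$ (i,s) * Y $$ (s,l) * G $$ (j,j))"
      by (simp add: c_def sum_Times)
    also have "\<dots> = (A * Y) $$ (i,l) * tr"
      unfolding index_mult_mat_sum[OF A Y that(2,3)] tr_def sum_product ..
    also have "\<dots> = tr * (A * Y) $$ (i,l)" by (rule mult.commute)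
    finally show ?thesis unfolding 1 by (simp add: algebra_simps sum_subtractf)
  qed
  have quad: "integrable M (\<lambda>\<omega>. (\<Sum>p\<in>?I. \<Sum>q\<in>?I. c i l p q * (S \<omega> $$ p * S \<omega> $$ q - (if p = q then 1 else 0)))\<^sup>2) \<and>
    expectation (\<lambda>\<omega>. (\<Sum>p\<in>?I. \<Sum>q\<in>?I. c i l p q * (S \<omega> $$ p * S \<omega> $$ q - (if p = q then 1 else 0)))\<^sup>2)
      \<le> (K + 2) * (\<Sum>p\<in>?I. \<Sum>q\<in>?I. (c i l p q)\<^sup>2)" for i l
    using quadratic_form_second_moment[OF _ indep _ _ _ _ K, of "c i l"] int4 mean var m4 by auto
  have cs: "(\<Sum>p\<in>?I. \<Sum>q\<in>?I. (c i l p q)\<^sup>2) = (\<Sum>s<T. (A $$ (i,s))\<^sup>2) * (\<Sum>s<T. (Y $$ (s,l))\<^sup>2) * (frob_norm G)\<^sup>2" for i l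
  proof -
    have "(\<Sum>p\<in>?I. \<Sum>q\<in>?I. (c i l p q)\<^sup>2) = (\<Sum>s<T. \<Sum>j<N. \<Sum>s'<T. \<Sum>j'<N. (A $$ (i,s))\<^sup>2 * (Y $$ (s',l))\<^sup>2 * (G $$ (j,j'))\<^sup>2)"
      by (simp add: c_def power_mult_distrib sum_Times)
    also have "\<dots> = (\<Sum>s<T. \<Sum>s'<T. \<Sum>j<N. \<Sum>j'<N. (A $$ (i,s))\<^sup>2 * (Y $$ (s',l))\<^sup>2 * (G $$ (j,j'))\<^sup>2)"
      by (intro sum.cong refl sum.swap)
    finally show ?thesis unfolding frob_norm_power2[OF G] by (simp only: sum_distrib_left[symmetric] sum_distrib_right[symmetric])
  qed
  let ?b = "\<lambda>i l. 2 * ((K + 2) * (\<Sum>p\<in>?I. \<Sum>q\<in>?I. (c i l p q)\<^sup>2)) + 2 * (tr * (A * Y) $$ (i,l))\<^sup>2"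
  have "(\<integral>\<^sup>+\<omega>. ennreal ((frob_norm (?Q \<omega>))\<^sup>2) \<partial>M) \<le> ennreal (\<Sum>i<m. \<Sum>l<k. ?b i l)"
  proof (rule nn_integral_frob_norm_le[OF R])
    fix i l assume il: "i < m" "l < k"
    let ?q = "\<lambda>\<omega>. \<Sum>p\<in>?I. \<Sum>q\<in>?I. c i l p q * (S \<omega> $$ p * S \<omega> $$ q - (if p = q then 1 else 0))"
    let ?t = "tr * (A * Y) $$ (i,l)"
    have qm: "?q \<in> borel_measurable M"
      using random_matrixD(2)[OF S]
      by (intro borel_measurable_sum borel_measurable_times borel_measurable_diff borel_measurable_const) auto
    have qi: "integrable M (\<lambda>\<omega>. (?q \<omega>)\<^sup>2)" using quad[of i l] by blast
    have I: "integrable M (\<lambda>\<omega>. (?q \<omega> + ?t)\<^sup>2)" by (rule square_integrable_add) (use qm qi in auto)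
    then show "integrable M (\<lambda>\<omega>. (?Q \<omega> $$ (i,l))\<^sup>2)"
      using il entry by (subst Bochner_Integration.integrable_cong[OF refl]) auto
    have "(\<integral>\<omega>. (?Q \<omega> $$ (i,l))\<^sup>2 \<partial>M) = (\<integral>\<omega>. (?q \<omega> + ?t)\<^sup>2 \<partial>M)"
      using il entry by (intro Bochner_Integration.integral_cong refl) auto
    also have "\<dots> \<le> (\<integral>\<omega>. 2 * (?q \<omega>)\<^sup>2 + 2 * ?t\<^sup>2 \<partial>M)"
    proof (rule integral_mono[OF I])
      show "integrable M (\<lambda>\<omega>. 2 * (?q \<omega>)\<^sup>2 + 2 * ?t\<^sup>2)" using qi by simp
      have "(x + y)\<^sup>2 \<le> 2 * x\<^sup>2 + 2 * y\<^sup>2" for x y :: real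
        using zero_le_power2[of "x - y"] by (simp add: power2_sum power2_diff)
      then show "(?q \<omega> + ?t)\<^sup>2 \<le> 2 * (?q \<omega>)\<^sup>2 + 2 * ?t\<^sup>2" for \<omega> .
    qed
    also have "\<dots> = 2 * (\<integral>\<omega>. (?q \<omega>)\<^sup>2 \<partial>M) + 2 * ?t\<^sup>2" using qi by (simp add: prob_space)
    also have "\<dots> \<le> ?b i l" using quad[of i l] by simp
    finally show "(\<integral>\<omega>. (?Q \<omega> $$ (i,l))\<^sup>2 \<partial>M) \<le> ?b i l" .
  qed
  also have "(\<Sum>i<m. \<Sum>l<k. ?b i l) = 2 * (K + 2) * (frob_norm G)\<^sup>2 * ((frob_norm A)\<^sup>2 * (frob_norm Y)\<^sup>2) + 2 * tr\<^sup>2 * (frob_norm (A * Y))\<^sup>2"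
  proof -
    have 1: "(\<Sum>i<m. \<Sum>l<k. (\<Sum>s<T. (A $$ (i,s))\<^sup>2) * (\<Sum>s<T. (Y $$ (s,l))\<^sup>2)) = (frob_norm A)\<^sup>2 * (frob_norm Y)\<^sup>2"
      unfolding frob_norm_power2[OF A] frob_norm_power2[OF Y] sum_product[symmetric] by (subst (4) sum.swap) simp
    have 2: "(\<Sum>i<m. \<Sum>l<k. ((A * Y) $$ (i,l))\<^sup>2) = (frob_norm (A * Y))\<^sup>2"
      using A Y by (subst frob_norm_power2[of _ m k]) auto
    have 3: "(\<Sum>i<m. \<Sum>l<k. 2 * ((K + 2) * (a i l * g)) + 2 * (tr * y i l)\<^sup>2)
        = 2 * (K + 2) * g * (\<Sum>i<m. \<Sum>l<k. a i l) + 2 * tr\<^sup>2 * (\<Sum>i<m. \<Sum>l<k. (y i l)\<^sup>2)" for a y g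
      by (simp only: sum.distrib sum_distrib_left power_mult_distrib mult_ac)
    show ?thesis unfolding cs 3 1 2 ..
  qed
  also have "ennreal \<dots> \<le> ennreal (2 * (K + 2) * (frob_norm G)\<^sup>2 * ((frob_norm A)\<^sup>2 * (frob_norm Y)\<^sup>2) + 2 * (real N * (frob_norm G)\<^sup>2) * (frob_norm (A * Y))\<^sup>2)"
    using trace_power2_le[OF G] by (intro ennreal_leI add_left_mono mult_right_mono) (auto simp: tr_def)
  finally show ?thesis .
qed


text \<open>For a frozen value of \<open>F\<close> these are the two deterministic bounds with A =
  F^T P. Independence is given for the families of entries on finite index sets, hence the matrices
  are rebuilt from such families before conditioning.\<close>

lemma
  assumes F: "random_matrix M T r F"
    and indepF: "indep_var (Pi\<^sub>M ({..<T} \<times> {..<N}) (\<lambda>_. borel)) (\<lambda>\<omega>. \<lambda>p\<in>{..<T} \<times> {..<N}. S \<omega> $$ p)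
          (Pi\<^sub>M ({..<T} \<times> {..<r}) (\<lambda>_. borel)) (\<lambda>\<omega>. \<lambda>p\<in>{..<T} \<times> {..<r}. F \<omega> $$ p)"
    and P: "P \<in> carrier_mat T T"
  shows nn_integral_linear_form_independent_le: "Y \<in> carrier_mat N k \<Longrightarrow>
      (\<integral>\<^sup>+\<omega>. ennreal ((frob_norm (transpose_mat (F \<omega>) * P * S \<omega> * Y))\<^sup>2) \<partial>M)
      \<le> (\<integral>\<^sup>+\<omega>. ennreal ((frob_norm (transpose_mat (F \<omega>) * P))\<^sup>2 * (frob_norm Y)\<^sup>2) \<partial>M)"
    and nn_integral_quadratic_form_independent_le: "G \<in> carrier_mat N N \<Longrightarrow> Z \<in> carrier_mat T k \<Longrightarrow>
      (\<integral>\<^sup>+\<omega>. ennreal ((frob_norm (transpose_mat (F \<omega>) * P * S \<omega> * G * transpose_mat (S \<omega>) * Z))\<^sup>2) \<partial>M)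
      \<le> (\<integral>\<^sup>+\<omega>. ennreal (2 * (K + 2) * (frob_norm G)\<^sup>2 * ((frob_norm (transpose_mat (F \<omega>) * P))\<^sup>2 * (frob_norm Z)\<^sup>2)
          + 2 * (real N * (frob_norm G)\<^sup>2) * (frob_norm (transpose_mat (F \<omega>) * P * Z))\<^sup>2) \<partial>M)"
proof -
  let ?MS = "Pi\<^sub>M ({..<T} \<times> {..<N}) (\<lambda>_. borel :: real measure)"
  let ?MF = "Pi\<^sub>M ({..<T} \<times> {..<r}) (\<lambda>_. borel :: real measure)"
  let ?s = "\<lambda>\<omega>. \<lambda>p\<in>{..<T} \<times> {..<N}. S \<omega> $$ p"
  let ?f = "\<lambda>\<omega>. \<lambda>p\<in>{..<T} \<times> {..<r}. F \<omega> $$ p"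
  let ?A = "\<lambda>x. transpose_mat (Matrix.mat T r x) * P"
  have Seq: "Matrix.mat T N (?s \<omega>) = S \<omega>" if "\<omega> \<in> space M" for \<omega>
    using S_carrier[OF that] by (intro eq_matI) auto
  have Feq: "Matrix.mat T r (?f \<omega>) = F \<omega>" if "\<omega> \<in> space M" for \<omega>
    using random_matrixD(1)[OF F that] by (intro eq_matI) auto
  have rS: "random_matrix (?MS \<Otimes>\<^sub>M ?MF) T N (\<lambda>z. Matrix.mat T N (fst z))"
    by (rule random_matrix_of_fun) (rule measurable_compose[OF measurable_fst measurable_component_singleton])
  have rF: "random_matrix (?MS \<Otimes>\<^sub>M ?MF) T r (\<lambda>z. Matrix.mat T r (snd z))"
    by (rule random_matrix_of_fun) (rule measurable_compose[OF measurable_snd measurable_component_singleton])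
  have rF': "random_matrix ?MF T r (\<lambda>x. Matrix.mat T r x)"
    by (rule random_matrix_of_fun) (rule measurable_component_singleton)
  have rA: "random_matrix (?MS \<Otimes>\<^sub>M ?MF) r T (\<lambda>z. ?A (snd z))"
    by (intro random_matrix_mult[where n=T] random_matrix_transpose rF random_matrix_const P)
  have rA': "random_matrix ?MF r T ?A"
    by (intro random_matrix_mult[where n=T] random_matrix_transpose rF' random_matrix_const P)
  have Ac: "?A x \<in> carrier_mat r T" for x by (rule mult_carrier_mat[OF _ P]) simp
  {
    assume Y: "Y \<in> carrier_mat N k"
    let ?g = "\<lambda>x y. ennreal ((frob_norm (?A x * Matrix.mat T N y * Y))\<^sup>2)"
    let ?h = "\<lambda>x. ennreal ((frob_norm (?A x))\<^sup>2 * (frob_norm Y)\<^sup>2)"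
    have "(\<integral>\<^sup>+\<omega>. ?g (?f \<omega>) (?s \<omega>) \<partial>M) \<le> (\<integral>\<^sup>+\<omega>. ?h (?f \<omega>) \<partial>M)"
    proof (rule indep_var_nn_integral_le[OF indepF])
      have "random_matrix (?MS \<Otimes>\<^sub>M ?MF) r k (\<lambda>z. ?A (snd z) * Matrix.mat T N (fst z) * Y)"
        by (intro random_matrix_mult[where n=N] random_matrix_mult[where A="\<lambda>z. ?A (snd z)" and n=T] rA rS random_matrix_const Y)
      from measurable_frob_norm_power2[OF this]
      show "(\<lambda>(y, x). ?g x y) \<in> borel_measurable (?MS \<Otimes>\<^sub>M ?MF)" by (simp add: case_prod_beta')
      show "?h \<in> borel_measurable ?MF" using measurable_frob_norm_power2[OF rA'] by simp
      fix x assume "x \<in> space ?MF"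
      have "(\<integral>\<^sup>+\<omega>. ?g x (?s \<omega>) \<partial>M) = (\<integral>\<^sup>+\<omega>. ennreal ((frob_norm (?A x * S \<omega> * Y))\<^sup>2) \<partial>M)"
        by (intro nn_integral_cong) (simp only: Seq)
      also have "\<dots> \<le> ?h x" by (rule nn_integral_linear_form_le[OF Ac Y])
      finally show "(\<integral>\<^sup>+\<omega>. ?g x (?s \<omega>) \<partial>M) \<le> ?h x" .
    qed
    also have "(\<integral>\<^sup>+\<omega>. ?g (?f \<omega>) (?s \<omega>) \<partial>M) = (\<integral>\<^sup>+\<omega>. ennreal ((frob_norm (transpose_mat (F \<omega>) * P * S \<omega> * Y))\<^sup>2) \<partial>M)"
      by (intro nn_integral_cong) (simp only: Seq Feq)
    also have "(\<integral>\<^sup>+\<omega>. ?h (?f \<omega>) \<partial>M) = (\<integral>\<^sup>+\<omega>. ennreal ((frob_norm (transpose_mat (F \<omega>) * P))\<^sup>2 * (frob_norm Y)\<^sup>2) \<partial>M)"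
      by (intro nn_integral_cong) (simp only: Feq)
    finally show "(\<integral>\<^sup>+\<omega>. ennreal ((frob_norm (transpose_mat (F \<omega>) * P * S \<omega> * Y))\<^sup>2) \<partial>M)
      \<le> (\<integral>\<^sup>+\<omega>. ennreal ((frob_norm (transpose_mat (F \<omega>) * P))\<^sup>2 * (frob_norm Y)\<^sup>2) \<partial>M)" .
  next
    assume G: "G \<in> carrier_mat N N" and Z: "Z \<in> carrier_mat T k"
    let ?g = "\<lambda>x y. ennreal ((frob_norm (?A x * Matrix.mat T N y * G * transpose_mat (Matrix.mat T N y) * Z))\<^sup>2)"
    let ?H = "\<lambda>A. ennreal (2 * (K + 2) * (frob_norm G)\<^sup>2 * ((frob_norm A)\<^sup>2 * (frob_norm Z)\<^sup>2)
          + 2 * (real N * (frob_norm G)\<^sup>2) * (frob_norm (A * Z))\<^sup>2)"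
    have "(\<integral>\<^sup>+\<omega>. ?g (?f \<omega>) (?s \<omega>) \<partial>M) \<le> (\<integral>\<^sup>+\<omega>. ?H (?A (?f \<omega>)) \<partial>M)"
    proof (rule indep_var_nn_integral_le[OF indepF, where h="\<lambda>x. ?H (?A x)"])
      have "random_matrix (?MS \<Otimes>\<^sub>M ?MF) r k (\<lambda>z. ?A (snd z) * Matrix.mat T N (fst z) * G * transpose_mat (Matrix.mat T N (fst z)) * Z)"
        by (intro random_matrix_mult[where n=T and B="\<lambda>_. Z"] random_matrix_mult[where n=N and B="\<lambda>z. transpose_mat (Matrix.mat T N (fst z))"]
            random_matrix_mult[where n=N and B="\<lambda>_. G"] random_matrix_mult[where n=T and B="\<lambda>z. Matrix.mat T N (fst z)"]
            rA rS random_matrix_const G Z random_matrix_transpose)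
      from measurable_frob_norm_power2[OF this]
      show "(\<lambda>(y, x). ?g x y) \<in> borel_measurable (?MS \<Otimes>\<^sub>M ?MF)" by (simp add: case_prod_beta')
      have "random_matrix ?MF r k (\<lambda>x. ?A x * Z)" by (intro random_matrix_mult[where n=T] rA' random_matrix_const Z)
      note [measurable] = measurable_frob_norm_power2[OF rA'] measurable_frob_norm_power2[OF this]
      show "(\<lambda>x. ?H (?A x)) \<in> borel_measurable ?MF" by measurable
      fix x assume "x \<in> space ?MF"
      have "(\<integral>\<^sup>+\<omega>. ?g x (?s \<omega>) \<partial>M) = (\<integral>\<^sup>+\<omega>. ennreal ((frob_norm (?A x * S \<omega> * G * transpose_mat (S \<omega>) * Z))\<^sup>2) \<partial>M)"
        by (intro nn_integral_cong) (simp only: Seq)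
      also have "\<dots> \<le> ?H (?A x)" by (rule nn_integral_quadratic_form_le[OF Ac G Z])
      finally show "(\<integral>\<^sup>+\<omega>. ?g x (?s \<omega>) \<partial>M) \<le> ?H (?A x)" .
    qed
    also have "(\<integral>\<^sup>+\<omega>. ?g (?f \<omega>) (?s \<omega>) \<partial>M) = (\<integral>\<^sup>+\<omega>. ennreal ((frob_norm (transpose_mat (F \<omega>) * P * S \<omega> * G * transpose_mat (S \<omega>) * Z))\<^sup>2) \<partial>M)"
      by (intro nn_integral_cong) (simp only: Seq Feq)
    also have "(\<integral>\<^sup>+\<omega>. ?H (?A (?f \<omega>)) \<partial>M) = (\<integral>\<^sup>+\<omega>. ?H (transpose_mat (F \<omega>) * P) \<partial>M)"
      by (intro nn_integral_cong) (simp only: Feq)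
    finally show "(\<integral>\<^sup>+\<omega>. ennreal ((frob_norm (transpose_mat (F \<omega>) * P * S \<omega> * G * transpose_mat (S \<omega>) * Z))\<^sup>2) \<partial>M)
      \<le> (\<integral>\<^sup>+\<omega>. ?H (transpose_mat (F \<omega>) * P) \<partial>M)" .
  }
qed

end

section \<open>Stochastic order\<close>

text \<open>
  Both notions speak about events inside the set where the property holds, so that neither the
  property nor the random variable has to be measurable.
\<close>

definition whp :: "'a measure \<Rightarrow> (nat \<Rightarrow> 'a \<Rightarrow> bool) \<Rightarrow> bool" where
  "whp M P \<longleftrightarrow> (\<forall>\<epsilon>>0. \<forall>\<^sub>F n in sequentially.
     \<exists>G\<in>sets M. measure M (space M - G) \<le> \<epsilon> \<and> (\<forall>\<omega>\<in>G. P n \<omega>))"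

definition bounded_in_prob :: "'a measure \<Rightarrow> (nat \<Rightarrow> 'a \<Rightarrow> real) \<Rightarrow> (nat \<Rightarrow> real) \<Rightarrow> bool" where
  "bounded_in_prob M Y a \<longleftrightarrow> (\<forall>\<epsilon>>0. \<exists>K>0. \<forall>\<^sub>F n in sequentially.
     \<exists>G\<in>sets M. measure M (space M - G) \<le> \<epsilon> \<and> (\<forall>\<omega>\<in>G. Y n \<omega> \<le> K * a n))"

context prob_space
begin

lemma event_conj:
  assumes "\<exists>G\<in>sets M. prob (space M - G) \<le> \<epsilon> / 2 \<and> (\<forall>\<omega>\<in>G. P \<omega>)"
    and "\<exists>G\<in>sets M. prob (space M - G) \<le> \<epsilon> / 2 \<and> (\<forall>\<omega>\<in>G. Q \<omega>)"
  shows "\<exists>G\<in>sets M. prob (space M - G) \<le> \<epsilon> \<and> (\<forall>\<omega>\<in>G. P \<omega> \<and> Q \<omega>)"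
proof -
  obtain G H where G: "G \<in> sets M" "prob (space M - G) \<le> \<epsilon> / 2" "\<forall>\<omega>\<in>G. P \<omega>"
    and H: "H \<in> sets M" "prob (space M - H) \<le> \<epsilon> / 2" "\<forall>\<omega>\<in>H. Q \<omega>" using assms by blast
  have "space M - (G \<inter> H) = (space M - G) \<union> (space M - H)" by auto
  then have "prob (space M - (G \<inter> H)) \<le> prob (space M - G) + prob (space M - H)"
    using G H measure_Un_le[of "space M - G" M "space M - H"] by simp
  then show ?thesis using G H by (intro bexI[of _ "G \<inter> H"]) auto
qed

lemma whp_conj:
  assumes "whp M P" "whp M Q"
  shows "whp M (\<lambda>n \<omega>. P n \<omega> \<and> Q n \<omega>)"
  unfolding whp_def
proof (intro allI impI)
  fix \<epsilon> :: real assume "\<epsilon> > 0"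
  then have "\<epsilon> / 2 > 0" by simp
  with assms have "\<forall>\<^sub>F n in sequentially. \<exists>G\<in>sets M. prob (space M - G) \<le> \<epsilon> / 2 \<and> (\<forall>\<omega>\<in>G. P n \<omega>)"
    "\<forall>\<^sub>F n in sequentially. \<exists>G\<in>sets M. prob (space M - G) \<le> \<epsilon> / 2 \<and> (\<forall>\<omega>\<in>G. Q n \<omega>)"
    unfolding whp_def by blast+
  then show "\<forall>\<^sub>F n in sequentially. \<exists>G\<in>sets M. prob (space M - G) \<le> \<epsilon> \<and> (\<forall>\<omega>\<in>G. P n \<omega> \<and> Q n \<omega>)"
    by eventually_elim (rule event_conj)
qed

lemma whp_mono:
  assumes "whp M P" and "\<forall>\<^sub>F n in sequentially. \<forall>\<omega>\<in>space M. P n \<omega> \<longrightarrow> Q n \<omega>"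
  shows "whp M Q"
  unfolding whp_def
proof (intro allI impI)
  fix \<epsilon> :: real assume "\<epsilon> > 0"
  with assms(1) have "\<forall>\<^sub>F n in sequentially. \<exists>G\<in>sets M. prob (space M - G) \<le> \<epsilon> \<and> (\<forall>\<omega>\<in>G. P n \<omega>)"
    unfolding whp_def by blast
  with assms(2) show "\<forall>\<^sub>F n in sequentially. \<exists>G\<in>sets M. prob (space M - G) \<le> \<epsilon> \<and> (\<forall>\<omega>\<in>G. Q n \<omega>)"
    by eventually_elim (metis sets.sets_into_space subsetD)
qed

lemma whp_sure:
  assumes "\<forall>\<^sub>F n in sequentially. \<forall>\<omega>\<in>space M. P n \<omega>"
  shows "whp M P"
  unfolding whp_def
proof (intro allI impI)
  fix \<epsilon> :: real assume e: "\<epsilon> > 0"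
  from assms show "\<forall>\<^sub>F n in sequentially. \<exists>G\<in>sets M. prob (space M - G) \<le> \<epsilon> \<and> (\<forall>\<omega>\<in>G. P n \<omega>)"
    by eventually_elim (use e in \<open>auto intro!: bexI[of _ "space M"]\<close>)
qed

lemma whp_AE:
  assumes "\<And>n. AE \<omega> in M. P n \<omega>"
  shows "whp M P"
  unfolding whp_def
proof (intro allI impI always_eventually)
  fix \<epsilon> :: real and n assume e: "\<epsilon> > 0"
  from assms[of n] obtain A where A: "{\<omega>\<in>space M. \<not> P n \<omega>} \<subseteq> A" "A \<in> sets M" "emeasure M A = 0"
    by (rule AE_E)
  have "space M - (space M - A) = A" using A(2) sets.sets_into_space by blast
  then have "prob (space M - (space M - A)) \<le> \<epsilon>" using A(3) e by (simp add: measure_def)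
  then show "\<exists>G\<in>sets M. prob (space M - G) \<le> \<epsilon> \<and> (\<forall>\<omega>\<in>G. P n \<omega>)"
    using A by (intro bexI[of _ "space M - A"]) auto
qed

text \<open>The comparison of the two variables has to hold only with high probability, which is how
  bounds valid on a good event are transferred.\<close>

lemma bounded_in_prob_mono:
  assumes Y: "bounded_in_prob M Y a" and ZY: "whp M (\<lambda>n \<omega>. Z n \<omega> \<le> Y n \<omega>)"
    and c: "0 < c" and ab: "\<forall>\<^sub>F n in sequentially. a n \<le> c * b n"
  shows "bounded_in_prob M Z b"
  unfolding bounded_in_prob_def
proof (intro allI impI)
  fix \<epsilon> :: real assume "\<epsilon> > 0"
  then have e: "\<epsilon> / 2 > 0" by simp
  obtain K where K: "K > 0" "\<forall>\<^sub>F n in sequentially. \<exists>G\<in>sets M. prob (space M - G) \<le> \<epsilon> / 2 \<and> (\<forall>\<omega>\<in>G. Y n \<omega> \<le> K * a n)"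
    using Y e unfolding bounded_in_prob_def by blast
  have "\<forall>\<^sub>F n in sequentially. \<exists>G\<in>sets M. prob (space M - G) \<le> \<epsilon> / 2 \<and> (\<forall>\<omega>\<in>G. Z n \<omega> \<le> Y n \<omega>)"
    using ZY e unfolding whp_def by blast
  with K(2) ab have "\<forall>\<^sub>F n in sequentially. \<exists>G\<in>sets M. prob (space M - G) \<le> \<epsilon> \<and> (\<forall>\<omega>\<in>G. Z n \<omega> \<le> (K * c) * b n)"
  proof eventually_elim
    case (elim n)
    have "K * a n \<le> K * c * b n" using elim(2) K(1) by (simp add: mult.assoc)
    moreover obtain G where "G \<in> sets M" "prob (space M - G) \<le> \<epsilon>" "\<forall>\<omega>\<in>G. Y n \<omega> \<le> K * a n \<and> Z n \<omega> \<le> Y n \<omega>"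
      using event_conj[OF elim(1,3)] by blast
    ultimately show ?case by (intro bexI[of _ G]) force+
  qed
  then show "\<exists>K>0. \<forall>\<^sub>F n in sequentially. \<exists>G\<in>sets M. prob (space M - G) \<le> \<epsilon> \<and> (\<forall>\<omega>\<in>G. Z n \<omega> \<le> K * b n)"
    using K(1) c by (intro exI[of _ "K * c"]) auto
qed

text \<open>On the intersection of the two events both bounds hold, so every pathwise implication
  between bounds transfers. Sums, products and rescalings are instances.\<close>

lemma bounded_in_prob_combine:
  assumes Y: "bounded_in_prob M Y a" and Z: "bounded_in_prob M Z b"
    and comb: "\<And>K L. 0 < K \<Longrightarrow> 0 < L \<Longrightarrow> \<exists>J>0. \<forall>\<^sub>F n in sequentially. \<forall>\<omega>\<in>space M. Y n \<omega> \<le> K * a n \<longrightarrow> Z n \<omega> \<le> L * b n \<longrightarrow> W n \<omega> \<le> J * d n"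
  shows "bounded_in_prob M W d"
  unfolding bounded_in_prob_def
proof (intro allI impI)
  fix \<epsilon> :: real assume "\<epsilon> > 0"
  then have e: "\<epsilon> / 2 > 0" by simp
  obtain K where K: "K > 0" "\<forall>\<^sub>F n in sequentially. \<exists>G\<in>sets M. prob (space M - G) \<le> \<epsilon> / 2 \<and> (\<forall>\<omega>\<in>G. Y n \<omega> \<le> K * a n)"
    using Y e unfolding bounded_in_prob_def by blast
  obtain L where L: "L > 0" "\<forall>\<^sub>F n in sequentially. \<exists>G\<in>sets M. prob (space M - G) \<le> \<epsilon> / 2 \<and> (\<forall>\<omega>\<in>G. Z n \<omega> \<le> L * b n)"
    using Z e unfolding bounded_in_prob_def by blast
  obtain J where J: "J > 0" "\<forall>\<^sub>F n in sequentially. \<forall>\<omega>\<in>space M. Y n \<omega> \<le> K * a n \<longrightarrow> Z n \<omega> \<le> L * b n \<longrightarrow> W n \<omega> \<le> J * d n"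
    using comb[OF K(1) L(1)] by blast
  from K(2) L(2) J(2) have "\<forall>\<^sub>F n in sequentially. \<exists>G\<in>sets M. prob (space M - G) \<le> \<epsilon> \<and> (\<forall>\<omega>\<in>G. W n \<omega> \<le> J * d n)"
  proof eventually_elim
    case (elim n)
    obtain G where G: "G \<in> sets M" "prob (space M - G) \<le> \<epsilon>" "\<forall>\<omega>\<in>G. Y n \<omega> \<le> K * a n \<and> Z n \<omega> \<le> L * b n"
      using event_conj[OF elim(1,2)] by blast
    then show ?case using elim(3) sets.sets_into_space[OF G(1)] by (intro bexI[of _ G]) auto
  qed
  then show "\<exists>K>0. \<forall>\<^sub>F n in sequentially. \<exists>G\<in>sets M. prob (space M - G) \<le> \<epsilon> \<and> (\<forall>\<omega>\<in>G. W n \<omega> \<le> K * d n)"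
    using J(1) by blast
qed

lemma bounded_in_prob_add:
  assumes "bounded_in_prob M Y a" "bounded_in_prob M Z a" and a: "\<forall>\<^sub>F n in sequentially. 0 \<le> a n"
  shows "bounded_in_prob M (\<lambda>n \<omega>. Y n \<omega> + Z n \<omega>) a"
proof (rule bounded_in_prob_combine[OF assms(1,2)])
  fix K L :: real assume "0 < K" "0 < L"
  then show "\<exists>J>0. \<forall>\<^sub>F n in sequentially. \<forall>\<omega>\<in>space M. Y n \<omega> \<le> K * a n \<longrightarrow> Z n \<omega> \<le> L * a n \<longrightarrow> Y n \<omega> + Z n \<omega> \<le> J * a n"
    by (intro exI[of _ "K + L"]) (auto simp: distrib_right)
qed

lemma bounded_in_prob_mult:
  assumes "bounded_in_prob M Y a" "bounded_in_prob M Z b"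
    and Y: "\<And>n \<omega>. 0 \<le> Y n \<omega>" and Z: "\<And>n \<omega>. 0 \<le> Z n \<omega>"
  shows "bounded_in_prob M (\<lambda>n \<omega>. Y n \<omega> * Z n \<omega>) (\<lambda>n. a n * b n)"
proof (rule bounded_in_prob_combine[OF assms(1,2)])
  fix K L :: real assume KL: "0 < K" "0 < L"
  have "Y n \<omega> * Z n \<omega> \<le> (K * L) * (a n * b n)" if "Y n \<omega> \<le> K * a n" "Z n \<omega> \<le> L * b n" for n \<omega>
  proof -
    have "Y n \<omega> * Z n \<omega> \<le> (K * a n) * (L * b n)"
      using that Y[of n \<omega>] Z[of n \<omega>] by (intro mult_mono) auto
    then show ?thesis by (simp add: mult_ac)
  qed
  then show "\<exists>J>0. \<forall>\<^sub>F n in sequentially. \<forall>\<omega>\<in>space M. Y n \<omega> \<le> K * a n \<longrightarrow> Z n \<omega> \<le> L * b n \<longrightarrow> Y n \<omega> * Z n \<omega> \<le> J * (a n * b n)"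
    using KL by (intro exI[of _ "K * L"]) auto
qed

lemma bounded_in_prob_Markov:
  assumes c: "0 < c" and ev: "\<forall>\<^sub>F n in sequentially. 0 < a n \<and> (\<lambda>\<omega>. (Y n \<omega>)\<^sup>2) \<in> borel_measurable M
      \<and> (\<integral>\<^sup>+\<omega>. ennreal ((Y n \<omega>)\<^sup>2) \<partial>M) \<le> ennreal (c * (a n)\<^sup>2)"
  shows "bounded_in_prob M Y a"
  unfolding bounded_in_prob_def
proof (intro allI impI)
  fix \<epsilon> :: real assume e: "\<epsilon> > 0"
  \<comment> \<open>Chosen so that the Markov bound c / K^2 equals \<epsilon>.\<close>
  define K where "K = sqrt (c / \<epsilon>)"
  have K: "K > 0" "c / K\<^sup>2 = \<epsilon>" using c e by (auto simp: K_def)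
  from ev have "\<forall>\<^sub>F n in sequentially. \<exists>G\<in>sets M. prob (space M - G) \<le> \<epsilon> \<and> (\<forall>\<omega>\<in>G. Y n \<omega> \<le> K * a n)"
  proof eventually_elim
    case (elim n)
    then have a: "0 < a n" and [measurable]: "(\<lambda>\<omega>. (Y n \<omega>)\<^sup>2) \<in> borel_measurable M" by auto
    define t where "t = (K * a n)\<^sup>2"
    have t: "t > 0" using K a by (simp add: t_def)
    let ?G = "{\<omega>\<in>space M. (Y n \<omega>)\<^sup>2 < t}"
    have G: "?G \<in> sets M" by measurable
    have "space M - ?G = {\<omega>\<in>space M. 1 \<le> ennreal (1 / t) * ennreal ((Y n \<omega>)\<^sup>2)}"
      using t by (auto simp: ennreal_mult[symmetric] field_simps simp flip: ennreal_1)
    then have "emeasure M (space M - ?G) \<le> ennreal (1 / t) * (\<integral>\<^sup>+\<omega>. ennreal ((Y n \<omega>)\<^sup>2) * indicator (space M) \<omega> \<partial>M)"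
      using nn_integral_Markov_inequality[of "\<lambda>\<omega>. ennreal ((Y n \<omega>)\<^sup>2)" "space M" M "ennreal (1 / t)"] by simp
    also have "(\<integral>\<^sup>+\<omega>. ennreal ((Y n \<omega>)\<^sup>2) * indicator (space M) \<omega> \<partial>M) = (\<integral>\<^sup>+\<omega>. ennreal ((Y n \<omega>)\<^sup>2) \<partial>M)"
      by (intro nn_integral_cong) simp
    also have "ennreal (1 / t) * \<dots> \<le> ennreal (1 / t) * ennreal (c * (a n)\<^sup>2)"
      using elim by (intro mult_left_mono) auto
    also have "\<dots> = ennreal (c / K\<^sup>2)"
      using t a K c by (subst ennreal_mult[symmetric]) (auto simp: t_def power_mult_distrib)
    finally have "prob (space M - ?G) \<le> \<epsilon>" using e unfolding K(2) emeasure_eq_measure by simp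
    moreover have "Y n \<omega> \<le> K * a n" if "\<omega> \<in> ?G" for \<omega>
      using that K(1) a unfolding t_def by (auto intro: power2_le_imp_le less_imp_le)
    ultimately show ?case using G by blast
  qed
  then show "\<exists>K>0. \<forall>\<^sub>F n in sequentially. \<exists>G\<in>sets M. prob (space M - G) \<le> \<epsilon> \<and> (\<forall>\<omega>\<in>G. Y n \<omega> \<le> K * a n)"
    using K(1) by blast
qed

lemma bounded_in_prob_tendsto_zero:
  assumes Y: "bounded_in_prob M Y a" and a: "a \<longlonglongrightarrow> 0" and d: "0 < d"
  shows "whp M (\<lambda>n \<omega>. Y n \<omega> \<le> d)"
  unfolding whp_def
proof (intro allI impI)
  fix \<epsilon> :: real assume "\<epsilon> > 0"
  then obtain K where K: "K > 0" "\<forall>\<^sub>F n in sequentially. \<exists>G\<in>sets M. prob (space M - G) \<le> \<epsilon> \<and> (\<forall>\<omega>\<in>G. Y n \<omega> \<le> K * a n)"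
    using Y unfolding bounded_in_prob_def by blast
  have "\<forall>\<^sub>F n in sequentially. a n < d / K" using a K(1) d by (intro order_tendstoD) auto
  with K(2) show "\<forall>\<^sub>F n in sequentially. \<exists>G\<in>sets M. prob (space M - G) \<le> \<epsilon> \<and> (\<forall>\<omega>\<in>G. Y n \<omega> \<le> d)"
  proof eventually_elim
    case (elim n)
    then have "K * a n \<le> d" using K(1) by (simp add: field_simps)
    then show ?case using elim by force
  qed
qed

text \<open>The exceedance event lies in the complement of a measurable good event, and monotonicity
  of the measure asks for measurability of the larger set only.\<close>

lemma big_O_prob_of_bounded_in_prob:
  assumes Y: "bounded_in_prob M (\<lambda>n \<omega>. eucl_norm (Y n \<omega>)) a"
  shows "big_O_prob M Y a"
  unfolding big_O_prob_def
proof (intro allI impI)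
  fix \<epsilon> :: real assume e: "\<epsilon> > 0"
  then obtain K where K: "K > 0" "\<forall>\<^sub>F n in sequentially. \<exists>G\<in>sets M. prob (space M - G) \<le> \<epsilon> \<and> (\<forall>\<omega>\<in>G. eucl_norm (Y n \<omega>) \<le> K * a n)"
    using Y unfolding bounded_in_prob_def by blast
  from K(2) have "\<forall>\<^sub>F n in sequentially. prob {\<omega>\<in>space M. eucl_norm (Y n \<omega>) > K * a n} \<le> \<epsilon>"
  proof eventually_elim
    case (elim n)
    then obtain G where G: "G \<in> sets M" "prob (space M - G) \<le> \<epsilon>" "\<forall>\<omega>\<in>G. eucl_norm (Y n \<omega>) \<le> K * a n" by blast
    let ?A = "{\<omega>\<in>space M. eucl_norm (Y n \<omega>) > K * a n}"
    have "?A \<subseteq> space M - G" using G(3) by force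
    then have "prob ?A \<le> prob (space M - G)" using G(1) by (intro finite_measure_mono) auto
    then show ?case using G(2) by simp
  qed
  then show "\<exists>K. \<forall>\<^sub>F n in sequentially. prob {\<omega>\<in>space M. eucl_norm (Y n \<omega>) > K * a n} \<le> \<epsilon>" by blast
qed

end

section \<open>Slutsky's theorem\<close>

lemma measurable_coords:
  assumes "\<And>\<omega>. \<omega> \<in> space M \<Longrightarrow> dim_vec (Y \<omega>) = r"
    and "\<And>i. i < r \<Longrightarrow> (\<lambda>\<omega>. vec_index (Y \<omega>) i) \<in> borel_measurable M"
  shows "(\<lambda>\<omega>. coords (Y \<omega>)) \<in> borel_measurable M"
proof (rule measurable_coordinatewise_then_product)
  fix i
  have "(\<lambda>\<omega>. if i < r then vec_index (Y \<omega>) i else 0) \<in> borel_measurable M" using assms(2) by (cases "i < r") auto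
  then show "(\<lambda>\<omega>. coords (Y \<omega>) i) \<in> borel_measurable M"
    by (rule measurable_cong[THEN iffD1, rotated]) (auto simp: coords_def assms(1))
qed

lemma coords_mult_mat_vec:
  assumes "A \<in> carrier_mat r r" "v \<in> carrier_vec r"
  shows "coords (A *\<^sub>v v) = (\<lambda>i. if i < r then \<Sum>j<r. A $$ (i,j) * coords v j else 0)"
  using assms by (auto simp: coords_def index_mult_mat_vec_sum[of A r r] simp del: index_mult_mat_vec intro!: ext sum.cong)

text \<open>The box, padded with zeros beyond r, is compact by Tychonoff, so \<open>g\<close> is
  uniformly continuous on it. What remains is to pass from coordinatewise closeness to closeness in
  the metric of the function space.\<close>

lemma uniformly_close_on_box:
  fixes g :: "(nat \<Rightarrow> real) \<Rightarrow> real"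
  assumes g: "continuous_on UNIV g" and e: "0 < e"
  shows "\<exists>d>0. \<forall>x y. (\<forall>i<r. \<bar>x i\<bar> \<le> R \<and> \<bar>y i\<bar> \<le> R \<and> \<bar>x i - y i\<bar> \<le> d) \<longrightarrow>
     (\<forall>i\<ge>r. x i = 0 \<and> y i = 0) \<longrightarrow> \<bar>g x - g y\<bar> < e"
proof -
  let ?C = "PiE UNIV (\<lambda>i::nat. if i < r then {-R..R} else {0::real})"
  have "compactin (product_topology (\<lambda>_. euclidean) UNIV) ?C" unfolding compactin_PiE by auto
  then have "compact ?C" by (simp add: euclidean_product_topology)
  then have "uniformly_continuous_on ?C g"
    by (rule compact_uniformly_continuous[OF continuous_on_subset[OF g subset_UNIV]])
  from mp[OF spec[OF this[unfolded uniformly_continuous_on_def], of e] e]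
  obtain d where d: "0 < d" "\<forall>x\<in>?C. \<forall>y\<in>?C. dist y x < d \<longrightarrow> dist (g y) (g x) < e" by (elim exE conjE)
  \<comment> \<open>The distance of two functions is at most twice the maximum over the first
    coordinates plus the tail (1/2)^n. Coordinates within d/8 contribute at most d/4, the tail less
    than d/2.\<close>
  obtain n where n: "(1/2::real) ^ n < d / 2" using d(1) real_arch_pow_inv[of "d / 2" "1 / 2"] by auto
  have "\<bar>g x - g y\<bar> < e" if 1: "\<forall>i<r. \<bar>x i\<bar> \<le> R \<and> \<bar>y i\<bar> \<le> R \<and> \<bar>x i - y i\<bar> \<le> d / 8" and 2: "\<forall>i\<ge>r. x i = 0 \<and> y i = 0" for x y
  proof -
    have "\<bar>x i - y i\<bar> \<le> d / 8" for i using 1 2 d(1) by (cases "i < r") auto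
    moreover have eq: "{dist (x (from_nat m)) (y (from_nat m)) |m. m \<le> n} = (\<lambda>m. dist (x (from_nat m)) (y (from_nat m))) ` {..n}"
      by auto
    ultimately have "Max {dist (x (from_nat m)) (y (from_nat m)) |m. m \<le> n} \<le> d / 8"
      unfolding eq by (intro Max.boundedI) (auto simp: dist_real_def)
    then have "dist x y < d"
      using dist_fun_le_dist_first_terms[of x y n] n d(1) by linarith
    moreover have "x \<in> ?C" "y \<in> ?C" using 1 2 by (auto simp: abs_le_iff)
    ultimately have "dist (g x) (g y) < e" using d(2)[rule_format, of y x] by simp
    then show ?thesis by (simp add: dist_real_def)
  qed
  then have "\<forall>x y. (\<forall>i<r. \<bar>x i\<bar> \<le> R \<and> \<bar>y i\<bar> \<le> R \<and> \<bar>x i - y i\<bar> \<le> d / 8) \<longrightarrow>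
     (\<forall>i\<ge>r. x i = 0 \<and> y i = 0) \<longrightarrow> \<bar>g x - g y\<bar> < e" by (intro allI impI)
  moreover have "0 < d / 8" using d(1) by simp
  ultimately show ?thesis by (intro exI conjI)
qed

lemma (in prob_space) abs_expectation_diff_le:
  fixes f g :: "'a \<Rightarrow> real"
  assumes [measurable]: "f \<in> borel_measurable M" "g \<in> borel_measurable M"
    and b: "\<And>\<omega>. \<bar>f \<omega>\<bar> \<le> b" "\<And>\<omega>. \<bar>g \<omega>\<bar> \<le> b"
    and G: "G \<in> sets M" "\<And>\<omega>. \<omega> \<in> G \<Longrightarrow> \<bar>f \<omega> - g \<omega>\<bar> \<le> e" and e: "0 \<le> e"
  shows "\<bar>expectation f - expectation g\<bar> \<le> e + 2 * b * prob (space M - G)"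
proof -
  have If: "integrable M f" "integrable M g"
    using b by (auto intro!: integrable_const_bound[where B=b])
  have "\<bar>expectation f - expectation g\<bar> = \<bar>expectation (\<lambda>\<omega>. f \<omega> - g \<omega>)\<bar>" using If by simp
  also have "\<dots> \<le> expectation (\<lambda>\<omega>. \<bar>f \<omega> - g \<omega>\<bar>)" by (rule integral_abs_bound)
  also have "\<dots> \<le> expectation (\<lambda>\<omega>. e + 2 * b * indicator (space M - G) \<omega>)"
  proof (rule integral_mono)
    show "integrable M (\<lambda>\<omega>. \<bar>f \<omega> - g \<omega>\<bar>)" using If by simp
    show "integrable M (\<lambda>\<omega>. e + 2 * b * indicator (space M - G) \<omega>)"
      using G(1) by (intro Bochner_Integration.integrable_add integrable_mult_right integrable_real_indicator) (auto simp: emeasure_eq_measure)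
    fix \<omega> assume "\<omega> \<in> space M"
    then show "\<bar>f \<omega> - g \<omega>\<bar> \<le> e + 2 * b * indicator (space M - G) \<omega>"
      using G(2)[of \<omega>] b[of \<omega>] e by (cases "\<omega> \<in> G") auto
  qed
  also have "\<dots> = e + 2 * b * prob (space M - G)" using G(1) by (simp add: prob_space emeasure_eq_measure)
  finally show ?thesis .
qed

text \<open>Continuous mapping handles \<open>A Z\<close>, since g composed with the linear map
  \<phi> is again bounded and continuous. Replacing \<open>A Z\<close> by \<open>Y\<close> costs
  little where \<open>Z\<close> is bounded and \<open>Y\<close> is close to \<open>A Z\<close>, by
  uniform continuity on a box, and at most twice the bound of g elsewhere. If A0 is a square root of
  V, then A A0 is one of A V A^T, which identifies the limit law.\<close>

lemma (in prob_space) converges_to_normal_Slutsky: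
  assumes Z: "converges_to_normal M r Z V" and A: "A \<in> carrier_mat r r"
    and Zc: "\<forall>\<^sub>F n in sequentially. \<forall>\<omega>\<in>space M. Z n \<omega> \<in> carrier_vec r"
    and Yc: "\<forall>\<^sub>F n in sequentially. \<forall>\<omega>\<in>space M. Y n \<omega> \<in> carrier_vec r"
    and Zm: "\<forall>\<^sub>F n in sequentially. (\<lambda>\<omega>. coords (Z n \<omega>)) \<in> borel_measurable M"
    and Ym: "\<forall>\<^sub>F n in sequentially. (\<lambda>\<omega>. coords (Y n \<omega>)) \<in> borel_measurable M"
    and tight: "bounded_in_prob M (\<lambda>n \<omega>. eucl_norm (Z n \<omega>)) (\<lambda>_. 1)"
    and close: "\<And>d. 0 < d \<Longrightarrow> whp M (\<lambda>n \<omega>. eucl_norm (Y n \<omega> - A *\<^sub>v Z n \<omega>) \<le> d)"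
  shows "converges_to_normal M r Y (A * V * transpose_mat A)"
proof -
  obtain \<nu> A0 where A0: "A0 \<in> carrier_mat r r" "A0 * transpose_mat A0 = V"
    and \<nu>: "\<nu> = distr (Pi\<^sub>M {..<r} (\<lambda>_. std_normal_distribution)) borel (\<lambda>z. coords (A0 *\<^sub>v Matrix.vec r z))"
    and conv: "weakly_converges (\<lambda>n. distr M borel (\<lambda>\<omega>. coords (Z n \<omega>))) \<nu>"
    using Z unfolding converges_to_normal_def centered_normal_law_def by blast
  let ?P = "Pi\<^sub>M {..<r} (\<lambda>_. std_normal_distribution)"
  define \<nu>' where "\<nu>' = distr ?P borel (\<lambda>z. coords ((A * A0) *\<^sub>v Matrix.vec r z))"
  define \<phi> where "\<phi> f = (\<lambda>i. if i < r then \<Sum>j<r. A $$ (i,j) * f j else 0)" for f :: "nat \<Rightarrow> real"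
  have \<phi>c: "continuous_on UNIV \<phi>"
  proof (rule continuous_on_coordinatewise_then_product)
    fix i
    show "continuous_on UNIV (\<lambda>f. \<phi> f i)"
    proof (cases "i < r")
      case True
      have "continuous_on UNIV (\<lambda>f. \<Sum>j<r. A $$ (i,j) * f j)"
        by (intro continuous_on_sum continuous_on_mult continuous_on_const continuous_on_product_coordinates)
      then show ?thesis using True by (simp add: \<phi>_def)
    qed (simp add: \<phi>_def continuous_on_const)
  qed
  have \<phi>: "coords (A *\<^sub>v v) = \<phi> (coords v)" if "v \<in> carrier_vec r" for v
    using coords_mult_mat_vec[OF A that] unfolding \<phi>_def .
  have law: "centered_normal_law r (A * V * transpose_mat A) \<nu>'"
    unfolding centered_normal_law_def
  proof (intro bexI[of _ "A * A0"] conjI)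
    have "A * A0 * transpose_mat (A * A0) = A * A0 * (transpose_mat A0 * transpose_mat A)"
      using A A0 by (simp add: transpose_mult[of _ r r _ r])
    also have "\<dots> = A * (A0 * transpose_mat A0) * transpose_mat A"
      using A A0(1) by (simp add: assoc_mult_mat[of _ r r _ r _ r])
    finally show "A * A0 * transpose_mat (A * A0) = A * V * transpose_mat A" unfolding A0(2) .
    show "A * A0 \<in> carrier_mat r r" using A A0(1) by simp
    show "\<nu>' = distr ?P borel (\<lambda>z. coords ((A * A0) *\<^sub>v Matrix.vec r z))" by (rule \<nu>'_def)
  qed
  have m: "(\<lambda>z. coords (D *\<^sub>v Matrix.vec r z)) \<in> borel_measurable ?P" if D: "D \<in> carrier_mat r r" for D
  proof (rule measurable_coords[where r=r])
    fix i assume i: "i < r"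
    have "(\<lambda>z. \<Sum>j<r. D $$ (i,j) * z j) \<in> borel_measurable ?P"
      by (intro borel_measurable_sum borel_measurable_times borel_measurable_const) measurable
    moreover have "(\<Sum>j<r. D $$ (i,j) * z j) = vec_index (D *\<^sub>v Matrix.vec r z) i" for z
      using i by (subst index_mult_mat_vec_sum[OF D]) auto
    ultimately show "(\<lambda>z. vec_index (D *\<^sub>v Matrix.vec r z) i) \<in> borel_measurable ?P" by simp
  qed (simp add: carrier_matD[OF D])
  have "weakly_converges (\<lambda>n. distr M borel (\<lambda>\<omega>. coords (Y n \<omega>))) \<nu>'"
    unfolding weakly_converges_def
  proof (intro allI impI, elim conjE)
    fix g :: "(nat \<Rightarrow> real) \<Rightarrow> real"
    assume g: "continuous_on UNIV g" and bg: "bounded (range g)"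
    obtain b where b: "\<And>x. \<bar>g x\<bar> \<le> b" using bg unfolding bounded_iff by auto
    have b0: "0 \<le> b" using b[of undefined] by linarith
    have h: "continuous_on UNIV (\<lambda>x. g (\<phi> x))"
      using continuous_on_compose2[OF g \<phi>c] by simp
    have gm[measurable]: "g \<in> borel_measurable borel" "(\<lambda>x. g (\<phi> x)) \<in> borel_measurable borel"
      using g h by (auto intro: borel_measurable_continuous_onI)
    have "bounded (range (\<lambda>x. g (\<phi> x)))" using bg by (rule bounded_subset) auto
    then have lim: "(\<lambda>n. integral\<^sup>L (distr M borel (\<lambda>\<omega>. coords (Z n \<omega>))) (\<lambda>x. g (\<phi> x))) \<longlonglongrightarrow> integral\<^sup>L \<nu> (\<lambda>x. g (\<phi> x))"
      using conv h unfolding weakly_converges_def by blast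
    have "integral\<^sup>L \<nu> (\<lambda>x. g (\<phi> x)) = (\<integral>z. g (\<phi> (coords (A0 *\<^sub>v Matrix.vec r z))) \<partial>?P)"
      unfolding \<nu> by (rule integral_distr[OF m[OF A0(1)] gm(2)])
    also have "\<dots> = (\<integral>z. g (coords ((A * A0) *\<^sub>v Matrix.vec r z)) \<partial>?P)"
    proof (rule Bochner_Integration.integral_cong[OF refl])
      fix z
      have "(A * A0) *\<^sub>v Matrix.vec r z = A *\<^sub>v (A0 *\<^sub>v Matrix.vec r z)"
        using A A0 by (intro assoc_mult_mat_vec) auto
      then show "g (\<phi> (coords (A0 *\<^sub>v Matrix.vec r z))) = g (coords ((A * A0) *\<^sub>v Matrix.vec r z))"
        using A0(1) by (simp add: \<phi>)
    qed
    also have "\<dots> = integral\<^sup>L \<nu>' g"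
      unfolding \<nu>'_def by (rule integral_distr[OF m gm(1), symmetric]) (use A A0 in simp)
    finally have lim': "(\<lambda>n. integral\<^sup>L (distr M borel (\<lambda>\<omega>. coords (Z n \<omega>))) (\<lambda>x. g (\<phi> x))) \<longlonglongrightarrow> integral\<^sup>L \<nu>' g"
      using lim by simp
    have "(\<lambda>n. integral\<^sup>L (distr M borel (\<lambda>\<omega>. coords (Y n \<omega>))) g
        - integral\<^sup>L (distr M borel (\<lambda>\<omega>. coords (Z n \<omega>))) (\<lambda>x. g (\<phi> x))) \<longlonglongrightarrow> 0"
    proof (rule LIMSEQ_I)
      fix e :: real assume e: "0 < e"
      \<comment> \<open>Two exceptional events of probability at most \<epsilon> each cost 2 b (2
        \<epsilon>) \<le> e/2; b + 1 in place of b avoids division by 0.\<close>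
      define \<epsilon> where "\<epsilon> = e / (8 * (b + 1))"
      have \<epsilon>: "0 < \<epsilon>" using e b0 by (simp add: \<epsilon>_def add_nonneg_pos)
      have "2 * b * (2 * \<epsilon>) \<le> e / 2" using e b0 by (simp add: \<epsilon>_def field_simps)
      define \<epsilon>' where "\<epsilon>' = e / 4"
      have \<epsilon>': "0 < \<epsilon>'" using e by (simp add: \<epsilon>'_def)
      have \<epsilon>'e: "\<epsilon>' + 2 * b * (2 * \<epsilon>) < e" using \<open>2 * b * (2 * \<epsilon>) \<le> e / 2\<close> e unfolding \<epsilon>'_def by linarith
      obtain K where K: "0 < K" and ev1: "\<forall>\<^sub>F n in sequentially. \<exists>G\<in>sets M. prob (space M - G) \<le> \<epsilon> \<and> (\<forall>\<omega>\<in>G. eucl_norm (Z n \<omega>) \<le> K * 1)"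
        using tight \<epsilon> unfolding bounded_in_prob_def by blast
      \<comment> \<open>\<open>A Z\<close> has norm at most |A| K; the extra 1 is room for
        \<open>Y\<close>, which is within \<open>min d 1\<close> of it.\<close>
      define R where "R = frob_norm A * K + 1"
      from uniformly_close_on_box[OF g \<epsilon>', of r R]
      obtain d where d: "0 < d" and close_g: "\<forall>x y. (\<forall>i<r. \<bar>x i\<bar> \<le> R \<and> \<bar>y i\<bar> \<le> R \<and> \<bar>x i - y i\<bar> \<le> d) \<longrightarrow>
         (\<forall>i\<ge>r. x i = 0 \<and> y i = 0) \<longrightarrow> \<bar>g x - g y\<bar> < \<epsilon>'" by (elim exE conjE)
      have "0 < min d 1" using d by simp
      then have ev2: "\<forall>\<^sub>F n in sequentially. \<exists>G\<in>sets M. prob (space M - G) \<le> \<epsilon> \<and> (\<forall>\<omega>\<in>G. eucl_norm (Y n \<omega> - A *\<^sub>v Z n \<omega>) \<le> min d 1)"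
        using close[of "min d 1"] \<epsilon> unfolding whp_def by blast
      have "\<forall>\<^sub>F n in sequentially. norm (integral\<^sup>L (distr M borel (\<lambda>\<omega>. coords (Y n \<omega>))) g
        - integral\<^sup>L (distr M borel (\<lambda>\<omega>. coords (Z n \<omega>))) (\<lambda>x. g (\<phi> x)) - 0) < e"
        using eventually_conj[OF ev1 eventually_conj[OF ev2 eventually_conj[OF Zc eventually_conj[OF Yc eventually_conj[OF Zm Ym]]]]]
      proof (rule eventually_mono, elim conjE)
        fix n
        assume elim: "\<exists>G\<in>sets M. prob (space M - G) \<le> \<epsilon> \<and> (\<forall>\<omega>\<in>G. eucl_norm (Z n \<omega>) \<le> K * 1)"
          "\<exists>G\<in>sets M. prob (space M - G) \<le> \<epsilon> \<and> (\<forall>\<omega>\<in>G. eucl_norm (Y n \<omega> - A *\<^sub>v Z n \<omega>) \<le> min d 1)"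
          "\<forall>\<omega>\<in>space M. Z n \<omega> \<in> carrier_vec r" "\<forall>\<omega>\<in>space M. Y n \<omega> \<in> carrier_vec r"
          and [measurable]: "(\<lambda>\<omega>. coords (Z n \<omega>)) \<in> borel_measurable M" "(\<lambda>\<omega>. coords (Y n \<omega>)) \<in> borel_measurable M"
        have half: "2 * \<epsilon> / 2 = \<epsilon>" by simp
        obtain G where G: "G \<in> sets M" "prob (space M - G) \<le> 2 * \<epsilon>"
          "\<forall>\<omega>\<in>G. eucl_norm (Z n \<omega>) \<le> K * 1 \<and> eucl_norm (Y n \<omega> - A *\<^sub>v Z n \<omega>) \<le> min d 1"
          using event_conj[of "2 * \<epsilon>", unfolded half, OF elim(1,2)] by (elim bexE conjE)
        have near: "\<bar>g (coords (Y n \<omega>)) - g (\<phi> (coords (Z n \<omega>)))\<bar> \<le> \<epsilon>'" if "\<omega> \<in> G" for \<omega>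
        proof -
          have \<omega>: "\<omega> \<in> space M" using that G(1) sets.sets_into_space by blast
          let ?y = "Y n \<omega>" and ?z = "A *\<^sub>v Z n \<omega>"
          have c: "Z n \<omega> \<in> carrier_vec r" "?y \<in> carrier_vec r" "?z \<in> carrier_vec r" using \<omega> elim(3,4) A by auto
          have nz: "eucl_norm ?z \<le> frob_norm A * K"
            using eucl_norm_mult_mat_vec_le[OF A c(1)] mult_left_mono[of "eucl_norm (Z n \<omega>)" K "frob_norm A"] G(3) that by fastforce
          have 1: "\<bar>coords ?y i - coords ?z i\<bar> \<le> min d 1" if "i < r" for i
          proof -
            have "\<bar>coords ?y i - coords ?z i\<bar> = \<bar>vec_index (?y - ?z) i\<bar>"
              using carrier_vecD[OF c(2)] carrier_vecD[OF c(3)] that by (simp add: coords_def del: index_mult_mat_vec dim_mult_mat_vec)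
            also have "\<dots> \<le> eucl_norm (?y - ?z)" using c that by (intro abs_index_le_eucl_norm) (simp del: dim_mult_mat_vec)
            finally show ?thesis using G(3) \<open>\<omega> \<in> G\<close> by force
          qed
          have 2: "\<bar>coords ?z i\<bar> \<le> frob_norm A * K" if "i < r" for i
            using abs_index_le_eucl_norm[of i ?z] nz carrier_vecD[OF c(3)] that by (simp add: coords_def del: index_mult_mat_vec dim_mult_mat_vec)
          have "\<bar>g (coords ?y) - g (coords ?z)\<bar> < \<epsilon>'"
          proof (rule close_g[rule_format])
            fix i assume i: "i < r"
            show "\<bar>coords ?y i\<bar> \<le> R \<and> \<bar>coords ?z i\<bar> \<le> R \<and> \<bar>coords ?y i - coords ?z i\<bar> \<le> d"
              using 1[OF i] 2[OF i] unfolding R_def by linarith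
          next
            fix i assume "r \<le> i"
            then show "coords ?y i = 0 \<and> coords ?z i = 0" using carrier_vecD[OF c(2)] carrier_vecD[OF c(3)] by (simp add: coords_def del: index_mult_mat_vec dim_mult_mat_vec)
          qed
          then show ?thesis unfolding \<phi>[OF c(1)] by simp
        qed
        have "\<bar>expectation (\<lambda>\<omega>. g (coords (Y n \<omega>))) - expectation (\<lambda>\<omega>. g (\<phi> (coords (Z n \<omega>))))\<bar> \<le> \<epsilon>' + 2 * b * prob (space M - G)"
          by (rule abs_expectation_diff_le[where b=b]) (use b G(1) near \<epsilon>' in auto)
        also have "\<dots> \<le> \<epsilon>' + 2 * b * (2 * \<epsilon>)" using G(2) b0 by (intro add_left_mono mult_left_mono) auto
        also have "\<dots> < e" by (rule \<epsilon>'e)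
        finally show "norm (integral\<^sup>L (distr M borel (\<lambda>\<omega>. coords (Y n \<omega>))) g
        - integral\<^sup>L (distr M borel (\<lambda>\<omega>. coords (Z n \<omega>))) (\<lambda>x. g (\<phi> x)) - 0) < e" by (simp add: integral_distr)
      qed
      then show "\<exists>no. \<forall>n\<ge>no. norm (integral\<^sup>L (distr M borel (\<lambda>\<omega>. coords (Y n \<omega>))) g
        - integral\<^sup>L (distr M borel (\<lambda>\<omega>. coords (Z n \<omega>))) (\<lambda>x. g (\<phi> x)) - 0) < e"
        unfolding eventually_sequentially .
    qed
    from tendsto_add[OF this lim'] show "(\<lambda>n. integral\<^sup>L (distr M borel (\<lambda>\<omega>. coords (Y n \<omega>))) g) \<longlonglongrightarrow> integral\<^sup>L \<nu>' g" by simp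
  qed
  then show ?thesis using law unfolding converges_to_normal_def by blast
qed

section \<open>Penalized principal components of one sample\<close>

lemma row_mult:
  fixes A :: "real Matrix.mat"
  assumes A: "A \<in> carrier_mat m n" and B: "B \<in> carrier_mat n k" and t: "t < m"
  shows "Matrix.row (A * B) t = transpose_mat B *\<^sub>v Matrix.row A t"
proof (rule eq_vecI)
  fix i assume "i < dim_vec (transpose_mat B *\<^sub>v Matrix.row A t)"
  then have i: "i < k" using B by simp
  have "col B i \<bullet> Matrix.row A t = Matrix.row A t \<bullet> col B i"
    using A B t i by (intro comm_scalar_prod[of _ n]) auto
  then show "vec_index (Matrix.row (A * B) t) i = vec_index (transpose_mat B *\<^sub>v Matrix.row A t) i"
    using A B t i by simp
qed (use A B t in simp)

lemma transpose_smult: "transpose_mat (c \<cdot>\<^sub>m A) = c \<cdot>\<^sub>m transpose_mat (A :: real Matrix.mat)"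
  by (intro eq_matI) auto

lemma mat_minus_eqI:
  fixes A :: "real Matrix.mat"
  assumes "B \<in> carrier_mat m n" "C \<in> carrier_mat m n" "A = B + C"
  shows "A - B = C"
  using assms by (intro eq_matI) auto

lemma row_minus:
  fixes A :: "real Matrix.mat"
  assumes "A \<in> carrier_mat m n" "B \<in> carrier_mat m n" "t < m"
  shows "Matrix.row (A - B) t = Matrix.row A t - Matrix.row B t"
  using assms by (intro eq_vecI) auto

lemma row_smult_add3:
  fixes A :: "real Matrix.mat"
  assumes "A \<in> carrier_mat m n" "B \<in> carrier_mat m n" "C \<in> carrier_mat m n" "t < m"
  shows "Matrix.row (c \<cdot>\<^sub>m (A + B + C)) t = c \<cdot>\<^sub>v (Matrix.row B t + (Matrix.row A t + Matrix.row C t))"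
  using assms by (intro eq_vecI) auto

lemma eigenvector_columns:
  fixes A :: "real Matrix.mat"
  assumes A: "A \<in> carrier_mat n n" and U: "U \<in> carrier_mat n r"
    and ev: "\<And>l. l < r \<Longrightarrow> eigenvector A (col U l) (d l)"
  shows "A * U = U * mat_diag r d"
proof (rule eq_matI)
  fix i l assume "i < dim_row (U * mat_diag r d)" "l < dim_col (U * mat_diag r d)"
  then have il: "i < n" "l < r" using U by (auto simp: mat_diag_def)
  have "A *\<^sub>v col U l = d l \<cdot>\<^sub>v col U l" using ev[OF il(2)] by (simp add: eigenvector_def)
  then have "vec_index (A *\<^sub>v col U l) i = d l * U $$ (i,l)" using il U by simp
  moreover have "(A * U) $$ (i,l) = vec_index (A *\<^sub>v col U l) i" using il A U by simp
  ultimately show "(A * U) $$ (i,l) = (U * mat_diag r d) $$ (i,l)"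
    unfolding mat_diag_mult_right[OF U] using il by simp
qed (use A U in \<open>auto simp: mat_diag_def\<close>)

lemma frob_norm_mat_diag_le:
  assumes "\<And>l. l < r \<Longrightarrow> \<bar>d l\<bar> \<le> c" "0 \<le> c"
  shows "frob_norm (mat_diag r d) \<le> sqrt (real r) * c"
proof (rule power2_le_imp_le)
  have "(frob_norm (mat_diag r d))\<^sup>2 = (\<Sum>i<r. \<Sum>j<r. if i = j then (d j)\<^sup>2 else 0)"
    unfolding frob_norm_power2[OF mat_diag_dim] by (intro sum.cong) (auto simp: mat_diag_def)
  also have "\<dots> = (\<Sum>i<r. (d i)\<^sup>2)" by (intro sum.cong) auto
  also have "\<dots> \<le> (\<Sum>i<r. c\<^sup>2)"
  proof (rule sum_mono)
    fix l assume "l \<in> {..<r}"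
    then show "(d l)\<^sup>2 \<le> c\<^sup>2" using power_mono[OF assms(1)[of l], of 2] by simp
  qed
  finally show "(frob_norm (mat_diag r d))\<^sup>2 \<le> (sqrt (real r) * c)\<^sup>2" by (simp add: power_mult_distrib)
qed (use assms in simp)

lemma frob_norm_isometry:
  assumes V: "V \<in> carrier_mat n r" "transpose_mat V * V = 1\<^sub>m r"
  shows "frob_norm V = sqrt (real r)"
proof -
  have "(frob_norm V)\<^sup>2 = (\<Sum>j<r. (transpose_mat V * V) $$ (j,j))"
    using V(1) unfolding frob_norm_power2[OF V(1)]
    by (subst sum.swap) (auto simp: scalar_prod_def power2_eq_square atLeast0LessThan intro!: sum.cong)
  also have "\<dots> = real r" unfolding V(2) by simp
  finally show ?thesis by (metis frob_norm_nonneg real_sqrt_abs abs_of_nonneg)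
qed

text \<open>One realization at fixed dimensions. Everything in this locale is an identity or an
  inequality between matrices; probability enters only when norms of the noise terms are estimated
  later.\<close>

locale ppca_sample =
  fixes N T r :: nat and lam :: real and B F E Fh :: "real Matrix.mat"
  assumes N: "0 < N" and T: "0 < T" and r: "1 \<le> r" and lam: "0 < lam"
    and B: "B \<in> carrier_mat N r" and F: "F \<in> carrier_mat T r" and E: "E \<in> carrier_mat T N"
    and fac: "ppca_factors r lam (F * transpose_mat B + E) Fh"
begin

abbreviation X where "X \<equiv> F * transpose_mat B + E"
abbreviation D where "D \<equiv> penalty_inv N lam"
abbreviation Om where "Om \<equiv> Omega_mat N lam B"
definition Sh where "Sh = (1 / (real N * real T)) \<cdot>\<^sub>m ppca_gram lam X"
abbreviation L where "L \<equiv> nth_eigenvalue Sh"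
definition U where "U = (1 / sqrt (real T)) \<cdot>\<^sub>m Fh"
definition EDB where "EDB = E * D * B"
definition EDE where "EDE = E * D * transpose_mat E"
definition Dl where "Dl = (1 / (real N * real T)) \<cdot>\<^sub>m (F * transpose_mat EDB + EDB * transpose_mat F + EDE)"
definition K where "K = (1 / real T) \<cdot>\<^sub>m (transpose_mat F * Fh)"
definition Li where "Li = mat_diag r (\<lambda>l. 1 / L l)"
abbreviation H where "H \<equiv> rotation_mat r lam X B F Fh"

lemma D: "D \<in> carrier_mat N N" "transpose_mat D = D"
  by (rule penalty_inv_carrier[OF N lam], rule penalty_inv_symmetric[OF N lam])

lemma X: "X \<in> carrier_mat T N" using B F E by simp

lemma Bt: "transpose_mat B \<in> carrier_mat r N" and Ft: "transpose_mat F \<in> carrier_mat r T"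
  and Et: "transpose_mat E \<in> carrier_mat N T" using B F E by auto

lemma ED: "E * D \<in> carrier_mat T N" using E D by simp

lemma EDB: "EDB \<in> carrier_mat T r" and EDBt: "transpose_mat EDB \<in> carrier_mat r T"
  using ED B by (auto simp: EDB_def)

lemma EDE: "EDE \<in> carrier_mat T T" using mult_carrier_mat[OF ED Et] by (simp add: EDE_def)

lemma Om: "Om \<in> carrier_mat r r" using B D by (auto simp: Omega_mat_def intro: mult_carrier_mat)

lemma Dl: "Dl \<in> carrier_mat T T"
  using mult_carrier_mat[OF F EDBt] mult_carrier_mat[OF EDB Ft] EDE by (simp add: Dl_def)

lemma EDE_sym: "transpose_mat EDE = EDE"
proof -
  have "transpose_mat (E * D * transpose_mat E) = E * (D * transpose_mat E)"
    unfolding transpose_mult[OF ED Et] transpose_mult[OF E D(1)] D(2) by simp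
  also have "\<dots> = E * D * transpose_mat E" by (rule assoc_mult_mat[symmetric, OF E D(1) Et])
  finally show ?thesis unfolding EDE_def .
qed

lemma Dl_sym: "transpose_mat Dl = Dl"
proof -
  note c = mult_carrier_mat[OF F EDBt] mult_carrier_mat[OF EDB Ft]
  have "transpose_mat Dl = (1 / (real N * real T)) \<cdot>\<^sub>m (EDB * transpose_mat F + F * transpose_mat EDB + EDE)"
    using c EDE unfolding Dl_def
    by (simp add: transpose_add[of _ T T] EDE_sym transpose_mult[OF F EDBt] transpose_mult[OF EDB Ft] transpose_smult)
  also have "EDB * transpose_mat F + F * transpose_mat EDB = F * transpose_mat EDB + EDB * transpose_mat F"
    by (rule comm_add_mat[OF c(2,1)])
  finally show ?thesis unfolding Dl_def .
qed

lemma gram_expand: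
  "ppca_gram lam X = F * (transpose_mat B * D * B) * transpose_mat F + (F * transpose_mat EDB + EDB * transpose_mat F + EDE)"
proof -
  have FB: "F * transpose_mat B \<in> carrier_mat T N" using F Bt by simp
  have BF: "B * transpose_mat F \<in> carrier_mat N T" using B Ft by simp
  have BD: "transpose_mat B * D \<in> carrier_mat r N" using Bt D by simp
  have BDB: "transpose_mat B * D * B \<in> carrier_mat r r" using BD B by simp
  have FBD: "F * transpose_mat B * D \<in> carrier_mat T N" using FB D by simp
  have Xt: "transpose_mat X = B * transpose_mat F + transpose_mat E"
    using transpose_add[OF FB E] transpose_mult[OF F Bt] by simp
  have XD: "X * D = F * transpose_mat B * D + E * D" by (rule add_mult_distrib_mat[OF FB E D(1)])
  have dim: "dim_col X = N" using carrier_matD[OF X] by blast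
  have EDBt': "transpose_mat EDB = transpose_mat B * D * transpose_mat E"
    unfolding EDB_def using transpose_mult[OF ED B] transpose_mult[OF E D(1)] D(2) assoc_mult_mat[OF Bt D(1) Et] by simp
  have 1: "F * transpose_mat B * D * (B * transpose_mat F) = F * (transpose_mat B * D * B) * transpose_mat F"
    using assoc_mult_mat[OF FBD B Ft] assoc_mult_mat[OF F Bt D(1)] assoc_mult_mat[OF F BD B] by simp
  have 2: "F * transpose_mat B * D * transpose_mat E = F * transpose_mat EDB"
    unfolding EDBt' using assoc_mult_mat[OF F Bt D(1)] assoc_mult_mat[OF F BD Et] by simp
  have 3: "E * D * (B * transpose_mat F) = EDB * transpose_mat F"
    unfolding EDB_def using assoc_mult_mat[OF ED B Ft] by simp
  have c1: "F * (transpose_mat B * D * B) * transpose_mat F \<in> carrier_mat T T"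
    using mult_carrier_mat[OF mult_carrier_mat[OF F BDB] Ft] .
  note c2 = mult_carrier_mat[OF F EDBt] and c3 = mult_carrier_mat[OF EDB Ft]
  have "ppca_gram lam X = (F * transpose_mat B * D + E * D) * (B * transpose_mat F + transpose_mat E)"
    unfolding ppca_gram_def dim Xt XD ..
  also have "\<dots> = F * transpose_mat B * D * (B * transpose_mat F + transpose_mat E) + E * D * (B * transpose_mat F + transpose_mat E)"
    using BF Et by (intro add_mult_distrib_mat[OF FBD ED]) auto
  also have "\<dots> = (F * (transpose_mat B * D * B) * transpose_mat F + F * transpose_mat EDB) + (EDB * transpose_mat F + EDE)"
    unfolding mult_add_distrib_mat[OF FBD BF Et] mult_add_distrib_mat[OF ED BF Et] 1 2 3 EDE_def ..
  also have "\<dots> = F * (transpose_mat B * D * B) * transpose_mat F + (F * transpose_mat EDB + EDB * transpose_mat F + EDE)"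
    using c1 c2 c3 EDE by (simp add: assoc_add_mat[of _ T T])
  finally show ?thesis .
qed

lemma Sh: "Sh \<in> carrier_mat T T" and Sh_expand: "Sh = (1 / real T) \<cdot>\<^sub>m (F * Om * transpose_mat F) + Dl"
proof -
  have BDB: "transpose_mat B * D * B \<in> carrier_mat r r" using Bt D B by (intro mult_carrier_mat) auto
  have c1: "F * (transpose_mat B * D * B) * transpose_mat F \<in> carrier_mat T T"
    using mult_carrier_mat[OF mult_carrier_mat[OF F BDB] Ft] .
  have c2: "F * transpose_mat EDB + EDB * transpose_mat F + EDE \<in> carrier_mat T T"
    using mult_carrier_mat[OF F EDBt] mult_carrier_mat[OF EDB Ft] EDE by simp
  have "F * Om * transpose_mat F = (1 / real N) \<cdot>\<^sub>m (F * (transpose_mat B * D * B) * transpose_mat F)"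
    unfolding Omega_mat_def
    using mult_smult_distrib[OF F BDB] mult_smult_assoc_mat[OF mult_carrier_mat[OF F BDB] Ft] by simp
  then have e: "(1 / real T) \<cdot>\<^sub>m (F * Om * transpose_mat F) = (1 / (real N * real T)) \<cdot>\<^sub>m (F * (transpose_mat B * D * B) * transpose_mat F)"
    using c1 by (intro eq_matI) auto
  show "Sh = (1 / real T) \<cdot>\<^sub>m (F * Om * transpose_mat F) + Dl"
    unfolding Sh_def gram_expand e Dl_def by (rule add_smult_distrib_left_mat[OF c1 c2])
  then show "Sh \<in> carrier_mat T T" unfolding e using c1 Dl by simp
qed

lemma Om_sym: "transpose_mat Om = Om"
proof -
  have "transpose_mat (transpose_mat B * D * B) = transpose_mat B * (D * B)"
    using transpose_mult[of "transpose_mat B * D" r N B r] transpose_mult[OF Bt D(1)] Bt D B by simp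
  also have "\<dots> = transpose_mat B * D * B" using assoc_mult_mat[OF Bt D(1) B] by simp
  finally show ?thesis by (simp add: Omega_mat_def transpose_smult)
qed

lemma Sh_sym: "transpose_mat Sh = Sh"
proof -
  note c = mult_carrier_mat[OF mult_carrier_mat[OF F Om] Ft]
  have "transpose_mat (F * Om * transpose_mat F) = F * (Om * transpose_mat F)"
    using transpose_mult[OF mult_carrier_mat[OF F Om] Ft] transpose_mult[OF F Om] Om_sym by simp
  also have "\<dots> = F * Om * transpose_mat F" using assoc_mult_mat[OF F Om Ft] by simp
  finally show ?thesis unfolding Sh_expand using c Dl by (simp add: transpose_add[of _ T T] Dl_sym transpose_smult)
qed

lemma gram: "ppca_gram lam X \<in> carrier_mat T T" "transpose_mat (ppca_gram lam X) = ppca_gram lam X"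
proof -
  have e: "ppca_gram lam X = (real N * real T) \<cdot>\<^sub>m Sh"
    unfolding Sh_def using N T by (intro eq_matI) auto
  show "ppca_gram lam X \<in> carrier_mat T T" unfolding e using Sh by simp
  show "transpose_mat (ppca_gram lam X) = ppca_gram lam X" unfolding e by (simp add: transpose_smult Sh_sym)
qed

lemma Fh: "Fh \<in> carrier_mat T r" and U: "U \<in> carrier_mat T r" "transpose_mat U * U = 1\<^sub>m r"
  and Fh_U: "Fh = sqrt (real T) \<cdot>\<^sub>m U"
  and gram_U: "ppca_gram lam X * U = U * mat_diag r (nth_eigenvalue (ppca_gram lam X))"
proof -
  have dim: "dim_row X = T" using carrier_matD[OF X] by blast
  obtain U' where U': "U' \<in> carrier_mat T r" "transpose_mat U' * U' = 1\<^sub>m r"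
    "\<And>l. l < r \<Longrightarrow> eigenvector (ppca_gram lam X) (col U' l) (nth_eigenvalue (ppca_gram lam X) l)"
    "Fh = sqrt (real T) \<cdot>\<^sub>m U'"
    using fac unfolding ppca_factors_def dim by blast
  have "U = U'" unfolding U_def by (subst U'(4)) (use T in \<open>auto intro!: eq_matI\<close>)
  then show "Fh \<in> carrier_mat T r" "U \<in> carrier_mat T r" "transpose_mat U * U = 1\<^sub>m r" "Fh = sqrt (real T) \<cdot>\<^sub>m U"
    "ppca_gram lam X * U = U * mat_diag r (nth_eigenvalue (ppca_gram lam X))"
    using U' eigenvector_columns[OF gram(1) U'(1,3)] by auto
qed

text \<open>The r columns of \<open>U\<close> are orthonormal in dimension T. The bound keeps
  eigenvalue indices below r within the range of the spectral theorem.\<close>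

lemma r_le_T: "r \<le> T"
proof (rule ccontr)
  assume "\<not> r \<le> T"
  then obtain v where v: "v \<in> carrier_vec r" "v \<noteq> 0\<^sub>v r" "U *\<^sub>v v = 0\<^sub>v T"
    using ex_nonzero_kernel_vec[OF U(1)] by auto
  have "v = transpose_mat U *\<^sub>v (U *\<^sub>v v)"
    using U v(1) by (subst assoc_mult_mat_vec[symmetric, of _ r T _ r]) auto
  also have "\<dots> = 0\<^sub>v r" unfolding v(3) using U(1) by (intro eq_vecI) (auto simp: scalar_prod_def)
  finally show False using v(2) by simp
qed

lemma L_eq: "l < r \<Longrightarrow> L l = 1 / (real N * real T) * nth_eigenvalue (ppca_gram lam X) l"
  unfolding Sh_def using r_le_T by (intro nth_eigenvalue_smult[OF gram]) auto

lemma Sh_U: "Sh * U = U * mat_diag r L"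
proof -
  have "Sh * U = (1 / (real N * real T)) \<cdot>\<^sub>m (U * mat_diag r (nth_eigenvalue (ppca_gram lam X)))"
    unfolding Sh_def gram_U[symmetric] by (rule mult_smult_assoc_mat[OF gram(1) U(1)])
  also have "\<dots> = U * mat_diag r L"
    unfolding mat_diag_mult_right[OF U(1)] by (intro eq_matI) (auto simp: L_eq)
  finally show ?thesis .
qed

text \<open>U^T (X D^-1 X^T) U is the diagonal matrix of eigenvalues. The resulting formula is
  polynomial in the entries of \<open>X\<close> and \<open>Fh\<close>, and this is how the
  eigenvalues are seen to be random variables.\<close>

lemma L_gram_form:
  assumes l: "l < r"
  shows "L l = 1 / (real N * real T) * (1 / real T) * (transpose_mat Fh * ppca_gram lam X * Fh) $$ (l,l)"
proof -
  let ?G = "ppca_gram lam X"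
  have Ut: "transpose_mat U \<in> carrier_mat r T" using U by simp
  have UG: "transpose_mat U * ?G \<in> carrier_mat r T" using Ut gram(1) by simp
  have "transpose_mat U * ?G * U = transpose_mat U * (U * mat_diag r (nth_eigenvalue ?G))"
    unfolding gram_U[symmetric] by (rule assoc_mult_mat[OF Ut gram(1) U(1)])
  also have "\<dots> = mat_diag r (nth_eigenvalue ?G)"
    using assoc_mult_mat[OF Ut U(1) mat_diag_dim] U(2) left_mult_one_mat[OF mat_diag_dim] by metis
  finally have e: "transpose_mat U * ?G * U = mat_diag r (nth_eigenvalue ?G)" .
  have "transpose_mat Fh * ?G * Fh = sqrt (real T) \<cdot>\<^sub>m transpose_mat U * ?G * (sqrt (real T) \<cdot>\<^sub>m U)"
    by (subst (1 2) Fh_U) (simp add: transpose_smult)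
  also have "\<dots> = sqrt (real T) \<cdot>\<^sub>m (sqrt (real T) \<cdot>\<^sub>m (transpose_mat U * ?G * U))"
    using mult_smult_assoc_mat[OF Ut gram(1)] mult_smult_assoc_mat[OF UG smult_carrier_mat[OF U(1)]] mult_smult_distrib[OF UG U(1)] by simp
  finally have "(transpose_mat Fh * ?G * Fh) $$ (l,l) = real T * nth_eigenvalue ?G l"
    unfolding e using l by (simp add: mat_diag_def)
  then show ?thesis using L_eq[OF l] T by simp
qed

lemma K: "K \<in> carrier_mat r r" using F Fh by (simp add: K_def)

lemma rotation_eq: "H = Om * K * inv_mat (mat_diag r L)"
proof -
  have "dim_row X = T" "dim_col X = N" using carrier_matD[OF X] by blast+
  then show ?thesis unfolding rotation_mat_def K_def Sh_def leading_eigenvalues_def by (simp add: Let_def)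
qed

lemma Sh_Fh: "Sh * Fh = Fh * mat_diag r L"
  by (subst (1 2) Fh_U) (use Sh_U mult_smult_distrib[OF Sh U(1)] mult_smult_assoc_mat[OF U(1) mat_diag_dim] in simp)

lemma Sh_Fh_expand: "Sh * Fh = F * (Om * K) + Dl * Fh"
proof -
  note FO = mult_carrier_mat[OF F Om]
  have "(1 / real T) \<cdot>\<^sub>m (F * Om * transpose_mat F) * Fh = F * Om * K"
    unfolding K_def
    using mult_smult_assoc_mat[OF mult_carrier_mat[OF FO Ft] Fh] mult_smult_distrib[OF FO mult_carrier_mat[OF Ft Fh]]
      assoc_mult_mat[OF FO Ft Fh] by simp
  also have "\<dots> = F * (Om * K)" by (rule assoc_mult_mat[OF F Om K])
  finally show ?thesis
    unfolding Sh_expand using mult_carrier_mat[OF FO Ft] by (subst add_mult_distrib_mat[OF _ Dl Fh]) auto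
qed

end

lemma frob_norm_le_entries:
  assumes A: "A \<in> carrier_mat m n" and b: "\<And>i j. i < m \<Longrightarrow> j < n \<Longrightarrow> \<bar>A $$ (i,j)\<bar> \<le> b" "0 \<le> b"
  shows "frob_norm A \<le> sqrt (real m * real n) * b"
proof (rule power2_le_imp_le)
  have "(A $$ (i,j))\<^sup>2 \<le> b\<^sup>2" if "i < m" "j < n" for i j
    using power_mono[OF b(1)[OF that], of 2] by simp
  then have "(frob_norm A)\<^sup>2 \<le> (\<Sum>i<m. \<Sum>j<n. b\<^sup>2)"
    unfolding frob_norm_power2[OF A] by (intro sum_mono) auto
  then show "(frob_norm A)\<^sup>2 \<le> (sqrt (real m * real n) * b)\<^sup>2" by (simp add: power_mult_distrib)
qed (use b in simp)

lemma frob_norm_mult_le':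
  assumes "A \<in> carrier_mat m n" "B \<in> carrier_mat n k" "frob_norm A \<le> a" "frob_norm B \<le> b"
  shows "frob_norm (A * B) \<le> a * b"
  using frob_norm_mult_le[OF assms(1,2)] mult_mono[OF assms(3,4)] assms(3) frob_norm_nonneg order_trans
  by (metis)

lemma eucl_norm_mult_mat_vec_le':
  assumes "A \<in> carrier_mat m n" "v \<in> carrier_vec n" "frob_norm A \<le> a" "eucl_norm v \<le> b"
  shows "eucl_norm (A *\<^sub>v v) \<le> a * b"
  using eucl_norm_mult_mat_vec_le[OF assms(1,2)] mult_mono[OF assms(3,4)] assms(3) frob_norm_nonneg eucl_norm_nonneg order_trans
  by (metis)

section \<open>Expansion of the score error\<close>

context ppca_sample
begin

lemma Li: "Li \<in> carrier_mat r r" "transpose_mat Li = Li"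
  by (simp_all add: Li_def, intro eq_matI) (auto simp: mat_diag_def)

context
  fixes k :: real
  assumes k: "0 < k" and L_ge: "\<And>l. l < r \<Longrightarrow> k \<le> L l"
begin

lemma diag_L_Li: "mat_diag r L * Li = 1\<^sub>m r"
  unfolding Li_def mat_diag_diag using k L_ge by (intro eq_matI) (force simp: mat_diag_def)+

lemma rotation_Li: "H = Om * K * Li"
proof -
  have "\<forall>l<r. L l \<noteq> 0" using k L_ge by force
  then show ?thesis unfolding rotation_eq Li_def inv_mat_diag by simp
qed

lemma H: "H \<in> carrier_mat r r"
  unfolding rotation_Li using mult_carrier_mat[OF mult_carrier_mat[OF Om K] Li(1)] .

text \<open>\<open>Sh_Fh_expand\<close> gives Fh \<Lambda> = F \<Omega> K + \<Delta> Fh. Multiplying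
  by \<Lambda>^-1 on the right produces F H, because H = \<Omega> K \<Lambda>^-1.\<close>

lemma factor_error: "Fh - F * H = Dl * Fh * Li" and factor_decomp: "Fh = F * H + Dl * Fh * Li"
proof -
  note OK = mult_carrier_mat[OF Om K] and DF = mult_carrier_mat[OF Dl Fh]
  note c = mult_carrier_mat[OF F H] mult_carrier_mat[OF DF Li(1)]
  have "Fh = Fh * (mat_diag r L * Li)" unfolding diag_L_Li using Fh by simp
  also have "\<dots> = Fh * mat_diag r L * Li" by (rule assoc_mult_mat[symmetric, OF Fh mat_diag_dim Li(1)])
  also have "\<dots> = F * (Om * K) * Li + Dl * Fh * Li"
    unfolding Sh_Fh[symmetric] Sh_Fh_expand by (rule add_mult_distrib_mat[OF mult_carrier_mat[OF F OK] DF Li(1)])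
  also have "F * (Om * K) * Li = F * H" unfolding rotation_Li by (rule assoc_mult_mat[OF F OK Li(1)])
  finally show e: "Fh = F * H + Dl * Fh * Li" .
  show "Fh - F * H = Dl * Fh * Li" by (rule mat_minus_eqI[OF c e])
qed

abbreviation "z t \<equiv> (transpose_mat B * D) *\<^sub>v Matrix.row E t"

lemma z: "z t \<in> carrier_vec r"
  using mult_carrier_mat[OF Bt D(1)] E by (intro mult_mat_vec_carrier) auto

text \<open>The three summands of \<Delta> have different roles in row t: F z_t carries the limit
  law, and the other two belong to the remainder.\<close>

lemma row_Dl:
  assumes t: "t < T"
  shows "Matrix.row Dl t = (1 / (real N * real T)) \<cdot>\<^sub>v (F *\<^sub>v z t + (EDB *\<^sub>v Matrix.row F t + Matrix.row EDE t))"
proof -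
  note c = mult_carrier_mat[OF F EDBt] mult_carrier_mat[OF EDB Ft]
  have et: "Matrix.row E t \<in> carrier_vec N" using E by auto
  have ft: "Matrix.row F t \<in> carrier_vec r" using F by auto
  have 1: "Matrix.row (F * transpose_mat EDB) t = EDB *\<^sub>v Matrix.row F t"
    using row_mult[OF F EDBt t] by simp
  have "Matrix.row EDB t = transpose_mat B *\<^sub>v (D *\<^sub>v Matrix.row E t)"
    unfolding EDB_def row_mult[OF ED B t] row_mult[OF E D(1) t] D(2) ..
  also have "\<dots> = z t" by (rule assoc_mult_mat_vec[symmetric, OF Bt D(1) et])
  finally have 2: "Matrix.row (EDB * transpose_mat F) t = F *\<^sub>v z t"
    using row_mult[OF EDB Ft t] by simp
  show ?thesis unfolding Dl_def row_smult_add3[OF c EDE t] 1 2 ..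
qed

lemma score_error:
  assumes t: "t < T"
  shows "Matrix.row Fh t - transpose_mat H *\<^sub>v Matrix.row F t = Li *\<^sub>v (transpose_mat Fh *\<^sub>v Matrix.row Dl t)"
proof -
  note DF = mult_carrier_mat[OF Dl Fh]
  have FH: "F * H \<in> carrier_mat T r" using F H by simp
  have "Matrix.row Fh t - transpose_mat H *\<^sub>v Matrix.row F t = Matrix.row (Fh - F * H) t"
    unfolding row_minus[OF Fh FH t] row_mult[OF F H t] ..
  also have "\<dots> = Li *\<^sub>v (transpose_mat Fh *\<^sub>v Matrix.row Dl t)"
    unfolding factor_error row_mult[OF DF Li(1) t] row_mult[OF Dl Fh t] Li(2) ..
  finally show ?thesis .
qed

text \<open>The direct estimate |Fh| |x| is too large by the order \<surd>T of |Fh|. Inserting Fh =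
  F H + \<Delta> Fh \<Lambda>^-1 leaves F^T x, to which moment bounds apply, and a term where the
  large factor is multiplied by |\<Delta>|.\<close>

lemma eucl_norm_Fh_transpose_le:
  assumes x: "x \<in> carrier_vec T"
  shows "eucl_norm (transpose_mat Fh *\<^sub>v x) \<le> frob_norm H * eucl_norm (transpose_mat F *\<^sub>v x)
     + frob_norm Dl * frob_norm Fh * frob_norm Li * eucl_norm x"
proof -
  note DF = mult_carrier_mat[OF Dl Fh]
  note DFL = mult_carrier_mat[OF DF Li(1)]
  have Ht: "transpose_mat H \<in> carrier_mat r r" using H by simp
  have Fx: "transpose_mat F *\<^sub>v x \<in> carrier_vec r" using mult_mat_vec_carrier[OF Ft x] .
  have DFLt: "transpose_mat (Dl * Fh * Li) \<in> carrier_mat r T" using DFL by simp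
  have "transpose_mat Fh = transpose_mat (F * H + Dl * Fh * Li)" using factor_decomp by simp
  also have "\<dots> = transpose_mat H * transpose_mat F + transpose_mat (Dl * Fh * Li)"
    using transpose_add[OF mult_carrier_mat[OF F H] DFL] transpose_mult[OF F H] by simp
  finally have "transpose_mat Fh *\<^sub>v x = transpose_mat H *\<^sub>v (transpose_mat F *\<^sub>v x) + transpose_mat (Dl * Fh * Li) *\<^sub>v x"
    using add_mult_distrib_mat_vec[OF mult_carrier_mat[OF Ht Ft] DFLt x] assoc_mult_mat_vec[OF Ht Ft x] by simp
  also have "eucl_norm \<dots> \<le> eucl_norm (transpose_mat H *\<^sub>v (transpose_mat F *\<^sub>v x)) + eucl_norm (transpose_mat (Dl * Fh * Li) *\<^sub>v x)"
    by (rule eucl_norm_add_le[OF mult_mat_vec_carrier[OF Ht Fx] mult_mat_vec_carrier[OF DFLt x]])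
  also have "\<dots> \<le> frob_norm H * eucl_norm (transpose_mat F *\<^sub>v x) + frob_norm Dl * frob_norm Fh * frob_norm Li * eucl_norm x"
  proof (rule add_mono)
    show "eucl_norm (transpose_mat H *\<^sub>v (transpose_mat F *\<^sub>v x)) \<le> frob_norm H * eucl_norm (transpose_mat F *\<^sub>v x)"
      using eucl_norm_mult_mat_vec_le[OF Ht Fx] by simp
    have "frob_norm (Dl * Fh * Li) \<le> frob_norm Dl * frob_norm Fh * frob_norm Li"
      using frob_norm_mult_le'[OF DF Li(1) frob_norm_mult_le[OF Dl Fh] order_refl] .
    then show "eucl_norm (transpose_mat (Dl * Fh * Li) *\<^sub>v x) \<le> frob_norm Dl * frob_norm Fh * frob_norm Li * eucl_norm x"
      using eucl_norm_mult_mat_vec_le'[OF DFLt x _ order_refl] by simp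
  qed
  finally show ?thesis .
qed

text \<open>The leading part is exact: \<Lambda>^-1 Fh^T F z_t / (\<surd>N T) equals \<Lambda>^-1
  K^T (z_t / \<surd>N), as K^T = Fh^T F / T. The right-hand side collects norms of forms in the
  noise, with \<open>Fh\<close> occurring only next to |\<Delta>|.\<close>

lemma score_error_expansion:
  assumes t: "t < T"
  shows "eucl_norm (sqrt (real N) \<cdot>\<^sub>v (Matrix.row Fh t - transpose_mat H *\<^sub>v Matrix.row F t)
      - (Li * transpose_mat K) *\<^sub>v ((1 / sqrt (real N)) \<cdot>\<^sub>v z t))
    \<le> 1 / (sqrt (real N) * real T) * (frob_norm Li *
      (frob_norm H * (frob_norm (transpose_mat F * EDB) * eucl_norm (Matrix.row F t) + eucl_norm (transpose_mat F *\<^sub>v Matrix.row EDE t))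
       + frob_norm Dl * frob_norm Fh * frob_norm Li * (frob_norm EDB * eucl_norm (Matrix.row F t) + eucl_norm (Matrix.row EDE t))))"
proof -
  have ft: "Matrix.row F t \<in> carrier_vec r" using F by auto
  have u: "Matrix.row EDE t \<in> carrier_vec T" using EDE by auto
  have Pf: "EDB *\<^sub>v Matrix.row F t \<in> carrier_vec T" using mult_mat_vec_carrier[OF EDB ft] .
  have Fz: "F *\<^sub>v z t \<in> carrier_vec T" using mult_mat_vec_carrier[OF F z] .
  let ?x = "EDB *\<^sub>v Matrix.row F t + Matrix.row EDE t"
  have x: "?x \<in> carrier_vec T" using Pf u by simp
  have Fht: "transpose_mat Fh \<in> carrier_mat r T" using Fh by simp
  have Kt: "transpose_mat K \<in> carrier_mat r r" using K by simp
  have Fhx: "transpose_mat Fh *\<^sub>v ?x \<in> carrier_vec r" using mult_mat_vec_carrier[OF Fht x] .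
  have FhFz: "transpose_mat Fh *\<^sub>v (F *\<^sub>v z t) \<in> carrier_vec r" using mult_mat_vec_carrier[OF Fht Fz] .
  note LFz = mult_mat_vec_carrier[OF Li(1) FhFz] and Lx = mult_mat_vec_carrier[OF Li(1) Fhx]
  define c where "c = 1 / (real N * real T)"
  have e1: "Matrix.row Fh t - transpose_mat H *\<^sub>v Matrix.row F t
     = c \<cdot>\<^sub>v (Li *\<^sub>v (transpose_mat Fh *\<^sub>v (F *\<^sub>v z t)) + Li *\<^sub>v (transpose_mat Fh *\<^sub>v ?x))"
    unfolding score_error[OF t] row_Dl[OF t] c_def[symmetric]
    unfolding mult_mat_vec[OF Fht add_carrier_vec[OF Fz x]] mult_add_distrib_mat_vec[OF Fht Fz x]
      mult_mat_vec[OF Li(1) add_carrier_vec[OF FhFz Fhx]] mult_add_distrib_mat_vec[OF Li(1) FhFz Fhx] ..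
  have Kt': "transpose_mat K = (1 / real T) \<cdot>\<^sub>m (transpose_mat Fh * F)"
    unfolding K_def using transpose_mult[OF Ft Fh] by (simp add: transpose_smult)
  have "(Li * transpose_mat K) *\<^sub>v ((1 / sqrt (real N)) \<cdot>\<^sub>v z t) = (1 / sqrt (real N)) \<cdot>\<^sub>v (Li *\<^sub>v (transpose_mat K *\<^sub>v z t))"
    using assoc_mult_mat_vec[OF Li(1) Kt z] mult_mat_vec[OF mult_carrier_mat[OF Li(1) Kt] z] by simp
  also have "transpose_mat K *\<^sub>v z t = (1 / real T) \<cdot>\<^sub>v (transpose_mat Fh *\<^sub>v (F *\<^sub>v z t))"
    unfolding Kt' using smult_mult_mat_vec[OF mult_carrier_mat[OF Fht F] z] assoc_mult_mat_vec[OF Fht F z] by simp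
  also have "Li *\<^sub>v ((1 / real T) \<cdot>\<^sub>v (transpose_mat Fh *\<^sub>v (F *\<^sub>v z t))) = (1 / real T) \<cdot>\<^sub>v (Li *\<^sub>v (transpose_mat Fh *\<^sub>v (F *\<^sub>v z t)))"
    by (rule mult_mat_vec[OF Li(1) FhFz])
  finally have e2: "(Li * transpose_mat K) *\<^sub>v ((1 / sqrt (real N)) \<cdot>\<^sub>v z t)
     = (1 / sqrt (real N)) \<cdot>\<^sub>v ((1 / real T) \<cdot>\<^sub>v (Li *\<^sub>v (transpose_mat Fh *\<^sub>v (F *\<^sub>v z t))))" .
  have sc: "sqrt (real N) * c = 1 / (sqrt (real N) * real T)"
    using N real_div_sqrt[of "real N"] by (simp add: c_def divide_simps mult_ac)
  have lin: "sqrt (real N) \<cdot>\<^sub>v (c \<cdot>\<^sub>v (v + w)) - (1 / sqrt (real N)) \<cdot>\<^sub>v ((1 / real T) \<cdot>\<^sub>v v) = (1 / (sqrt (real N) * real T)) \<cdot>\<^sub>v w"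
    if "v \<in> carrier_vec r" "w \<in> carrier_vec r" for v w :: "real Matrix.vec"
  proof (rule eq_vecI)
    fix i assume "i < dim_vec ((1 / (sqrt (real N) * real T)) \<cdot>\<^sub>v w)"
    then have i: "i < r" using that by simp
    have "sqrt (real N) * (c * (vec_index v i + vec_index w i)) = sqrt (real N) * c * (vec_index v i + vec_index w i)" by simp
    then show "vec_index (sqrt (real N) \<cdot>\<^sub>v (c \<cdot>\<^sub>v (v + w)) - (1 / sqrt (real N)) \<cdot>\<^sub>v ((1 / real T) \<cdot>\<^sub>v v)) i
       = vec_index ((1 / (sqrt (real N) * real T)) \<cdot>\<^sub>v w) i"
      using that i by (simp add: sc add_divide_distrib)
  qed (use that in simp)
  have "eucl_norm (sqrt (real N) \<cdot>\<^sub>v (Matrix.row Fh t - transpose_mat H *\<^sub>v Matrix.row F t)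
      - (Li * transpose_mat K) *\<^sub>v ((1 / sqrt (real N)) \<cdot>\<^sub>v z t))
     = 1 / (sqrt (real N) * real T) * eucl_norm (Li *\<^sub>v (transpose_mat Fh *\<^sub>v ?x))"
    unfolding e1 e2 lin[OF LFz Lx] eucl_norm_smult by simp
  also have "\<dots> \<le> 1 / (sqrt (real N) * real T) * (frob_norm Li *
     (frob_norm H * eucl_norm (transpose_mat F *\<^sub>v ?x) + frob_norm Dl * frob_norm Fh * frob_norm Li * eucl_norm ?x))"
    by (intro mult_left_mono eucl_norm_mult_mat_vec_le'[OF Li(1) Fhx order_refl eucl_norm_Fh_transpose_le[OF x]]) simp
  also have "\<dots> \<le> 1 / (sqrt (real N) * real T) * (frob_norm Li *
      (frob_norm H * (frob_norm (transpose_mat F * EDB) * eucl_norm (Matrix.row F t) + eucl_norm (transpose_mat F *\<^sub>v Matrix.row EDE t))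
       + frob_norm Dl * frob_norm Fh * frob_norm Li * (frob_norm EDB * eucl_norm (Matrix.row F t) + eucl_norm (Matrix.row EDE t))))"
  proof -
    have "eucl_norm ?x \<le> eucl_norm (EDB *\<^sub>v Matrix.row F t) + eucl_norm (Matrix.row EDE t)" by (rule eucl_norm_add_le[OF Pf u])
    then have 1: "eucl_norm ?x \<le> frob_norm EDB * eucl_norm (Matrix.row F t) + eucl_norm (Matrix.row EDE t)"
      using eucl_norm_mult_mat_vec_le[OF EDB ft] by linarith
    have FP: "transpose_mat F * EDB \<in> carrier_mat r r" using mult_carrier_mat[OF Ft EDB] .
    have "transpose_mat F *\<^sub>v ?x = (transpose_mat F * EDB) *\<^sub>v Matrix.row F t + transpose_mat F *\<^sub>v Matrix.row EDE t"
      using mult_add_distrib_mat_vec[OF Ft Pf u] assoc_mult_mat_vec[OF Ft EDB ft] by simp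
    then have "eucl_norm (transpose_mat F *\<^sub>v ?x) \<le> eucl_norm ((transpose_mat F * EDB) *\<^sub>v Matrix.row F t) + eucl_norm (transpose_mat F *\<^sub>v Matrix.row EDE t)"
      using eucl_norm_add_le[OF mult_mat_vec_carrier[OF FP ft] mult_mat_vec_carrier[OF Ft u]] by simp
    then have 2: "eucl_norm (transpose_mat F *\<^sub>v ?x) \<le> frob_norm (transpose_mat F * EDB) * eucl_norm (Matrix.row F t) + eucl_norm (transpose_mat F *\<^sub>v Matrix.row EDE t)"
      using eucl_norm_mult_mat_vec_le[OF FP ft] by linarith
    show ?thesis by (intro mult_left_mono add_mono 1 2 mult_nonneg_nonneg frob_norm_nonneg) auto
  qed
  finally show ?thesis .
qed

lemma frob_norm_Li_le: "frob_norm Li \<le> sqrt (real r) * (1 / k)"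
  unfolding Li_def using k L_ge
  by (intro frob_norm_mat_diag_le) (auto simp: abs_if divide_simps not_less dest!: L_ge intro: order_trans less_imp_le)

end

lemma frob_norm_Fh: "frob_norm Fh = sqrt (real T) * sqrt (real r)"
  by (subst Fh_U) (simp add: frob_norm_smult frob_norm_isometry[OF U])

lemma frob_norm_Dl_le:
  "frob_norm Dl \<le> 1 / (real N * real T) * (2 * (frob_norm F * frob_norm EDB) + frob_norm EDE)"
proof -
  note c = mult_carrier_mat[OF F EDBt] mult_carrier_mat[OF EDB Ft]
  have "frob_norm (F * transpose_mat EDB + EDB * transpose_mat F + EDE)
     \<le> frob_norm (F * transpose_mat EDB) + frob_norm (EDB * transpose_mat F) + frob_norm EDE"
    using frob_norm_add_le[OF add_carrier_mat[OF c(2)] EDE, of "F * transpose_mat EDB"] frob_norm_add_le[OF c] by linarith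
  also have "\<dots> \<le> 2 * (frob_norm F * frob_norm EDB) + frob_norm EDE"
    using frob_norm_mult_le[OF F EDBt] frob_norm_mult_le[OF EDB Ft] by (simp add: mult.commute)
  finally show ?thesis unfolding Dl_def frob_norm_smult by (simp add: divide_right_mono)
qed

end

text \<open>The normalization of the factors holds only almost surely. It is separated from the
  facts above, which are used at every sample point in the measurability proofs.\<close>

locale ppca_sample_orth = ppca_sample +
  assumes FF: "(1 / real T) \<cdot>\<^sub>m (transpose_mat F * F) = 1\<^sub>m r"
begin

definition V where "V = (1 / sqrt (real T)) \<cdot>\<^sub>m F"

lemma V: "V \<in> carrier_mat T r" and Vt: "transpose_mat V \<in> carrier_mat r T"
  and VV: "transpose_mat V * V = 1\<^sub>m r"
proof -
  show "V \<in> carrier_mat T r" "transpose_mat V \<in> carrier_mat r T" using F by (auto simp: V_def)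
  have "transpose_mat V * V = (1 / sqrt (real T)) \<cdot>\<^sub>m ((1 / sqrt (real T)) \<cdot>\<^sub>m (transpose_mat F * F))"
    unfolding V_def transpose_smult
    using mult_smult_assoc_mat[OF Ft smult_carrier_mat[OF F]] mult_smult_distrib[OF Ft F] by simp
  also have "\<dots> = (1 / real T) \<cdot>\<^sub>m (transpose_mat F * F)" using T by (intro eq_matI) auto
  finally show "transpose_mat V * V = 1\<^sub>m r" unfolding FF .
qed

lemma frob_norm_F: "frob_norm F = sqrt (real T) * sqrt (real r)"
proof -
  have "F = sqrt (real T) \<cdot>\<^sub>m V" using T by (intro eq_matI) (auto simp: V_def)
  then have "frob_norm F = sqrt (real T) * frob_norm V" by (metis frob_norm_smult abs_of_nonneg real_sqrt_ge_zero of_nat_0_le_iff)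
  then show ?thesis by (simp add: frob_norm_isometry[OF V VV])
qed

lemma K_eq: "K = transpose_mat V * U"
proof -
  have "transpose_mat V * U = (1 / sqrt (real T)) \<cdot>\<^sub>m ((1 / sqrt (real T)) \<cdot>\<^sub>m (transpose_mat F * Fh))"
    unfolding V_def U_def transpose_smult
    using mult_smult_assoc_mat[OF Ft smult_carrier_mat[OF Fh]] mult_smult_distrib[OF Ft Fh] by simp
  also have "\<dots> = K" unfolding K_def using T by (intro eq_matI) auto
  finally show ?thesis ..
qed

lemma frob_norm_K_le: "frob_norm K \<le> real r"
  unfolding K_eq using frob_norm_mult_le[OF Vt U(1)] by (simp add: frob_norm_isometry[OF V VV] frob_norm_isometry[OF U])

lemma Sh_V: "Sh = V * Om * transpose_mat V + Dl"
proof -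
  have "V * Om * transpose_mat V = (1 / sqrt (real T)) \<cdot>\<^sub>m ((1 / sqrt (real T)) \<cdot>\<^sub>m (F * Om * transpose_mat F))"
    unfolding V_def transpose_smult
    using mult_smult_assoc_mat[OF F Om] mult_smult_assoc_mat[OF mult_carrier_mat[OF F Om] smult_carrier_mat[OF Ft]]
      mult_smult_distrib[OF mult_carrier_mat[OF F Om] Ft] by simp
  also have "\<dots> = (1 / real T) \<cdot>\<^sub>m (F * Om * transpose_mat F)" using T by (intro eq_matI) auto
  finally show ?thesis unfolding Sh_expand by simp
qed

lemma VO: "V * Om \<in> carrier_mat T r" using V Om by simp

lemma VOV: "V * Om * transpose_mat V \<in> carrier_mat T T" using mult_carrier_mat[OF VO Vt] .

lemma L_sorted: "i \<le> j \<Longrightarrow> j < r \<Longrightarrow> L j \<le> L i"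
  using spectral_theorem_nth_eigenvalue[OF Sh Sh_sym] r_le_T by (metis order_less_le_trans)

text \<open>The range of \<open>V\<close> is the trial subspace for the min-max bound: on it the
  signal part reproduces the quadratic form of \<Omega>, and \<Delta> costs at most its Frobenius
  norm.\<close>

lemma L_ge:
  assumes \<kappa>: "\<kappa> \<le> nth_eigenvalue Om (r - 1)" and l: "l < r"
  shows "\<kappa> - frob_norm Dl \<le> L l"
proof -
  have "\<kappa> - frob_norm Dl \<le> L (r - 1)"
  proof (rule nth_eigenvalue_ge[OF Sh Sh_sym V VV r r_le_T])
    fix a :: "real Matrix.vec" assume a: "a \<in> carrier_vec r"
    have Va: "V *\<^sub>v a \<in> carrier_vec T" and Oa: "Om *\<^sub>v a \<in> carrier_vec r"
      using mult_mat_vec_carrier[OF V a] mult_mat_vec_carrier[OF Om a] by auto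
    have VOa: "V *\<^sub>v (Om *\<^sub>v a) \<in> carrier_vec T" and DVa: "Dl *\<^sub>v (V *\<^sub>v a) \<in> carrier_vec T"
      using mult_mat_vec_carrier[OF V Oa] mult_mat_vec_carrier[OF Dl Va] by auto
    have VVa: "transpose_mat V *\<^sub>v (V *\<^sub>v a) = a"
      using assoc_mult_mat_vec[OF Vt V a] a by (simp add: VV)
    have "Sh *\<^sub>v (V *\<^sub>v a) = V *\<^sub>v (Om *\<^sub>v a) + Dl *\<^sub>v (V *\<^sub>v a)"
      unfolding Sh_V add_mult_distrib_mat_vec[OF VOV Dl Va] assoc_mult_mat_vec[OF VO Vt Va] VVa assoc_mult_mat_vec[OF V Om a] ..
    then have "(V *\<^sub>v a) \<bullet> (Sh *\<^sub>v (V *\<^sub>v a)) = (V *\<^sub>v a) \<bullet> (V *\<^sub>v (Om *\<^sub>v a)) + (V *\<^sub>v a) \<bullet> (Dl *\<^sub>v (V *\<^sub>v a))"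
      using scalar_prod_add_distrib[OF Va VOa DVa] by simp
    also have "(V *\<^sub>v a) \<bullet> (V *\<^sub>v (Om *\<^sub>v a)) = a \<bullet> (Om *\<^sub>v a)"
      using transpose_vec_mult_scalar[OF V Oa Va] VVa by simp
    finally have e: "(V *\<^sub>v a) \<bullet> (Sh *\<^sub>v (V *\<^sub>v a)) = a \<bullet> (Om *\<^sub>v a) + (V *\<^sub>v a) \<bullet> (Dl *\<^sub>v (V *\<^sub>v a))" .
    have na: "eucl_norm (V *\<^sub>v a) = eucl_norm a" by (rule eucl_norm_isometry[OF V VV a])
    have "\<bar>(V *\<^sub>v a) \<bullet> (Dl *\<^sub>v (V *\<^sub>v a))\<bar> \<le> eucl_norm a * (frob_norm Dl * eucl_norm a)"
      using abs_scalar_prod_le[OF Va DVa] mult_left_mono[OF eucl_norm_mult_mat_vec_le[OF Dl Va], of "eucl_norm a"] by (simp add: na)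
    moreover have "\<kappa> * (eucl_norm a)\<^sup>2 \<le> a \<bullet> (Om *\<^sub>v a)"
      by (rule quad_form_ge_last_eigenvalue[OF Om Om_sym a \<kappa>])
    ultimately show "(\<kappa> - frob_norm Dl) * (eucl_norm a)\<^sup>2 \<le> (V *\<^sub>v a) \<bullet> (Sh *\<^sub>v (V *\<^sub>v a))"
      unfolding e by (simp add: power2_eq_square algebra_simps abs_le_iff)
  qed
  also have "\<dots> \<le> L l" using l by (intro L_sorted) auto
  finally show ?thesis .
qed

section \<open>Overlaps of the estimated eigenvectors with those of \<Omega>\<close>

context
  fixes k :: real and Gam :: "real Matrix.mat"
  assumes k: "0 < k" and Lk: "\<And>l. l < r \<Longrightarrow> k \<le> L l"
    and spec: "spectral_decomposition r Om Gam"
begin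

definition J where "J = transpose_mat Gam * K"

lemma Gam: "Gam \<in> carrier_mat r r" "transpose_mat Gam * Gam = 1\<^sub>m r" "Gam * transpose_mat Gam = 1\<^sub>m r"
  "Om = Gam * mat_diag r (nth_eigenvalue Om) * transpose_mat Gam"
  using spec orthogonal_matD[of Gam r] by (auto simp: spectral_decomposition_def leading_eigenvalues_def)

lemma Gamt: "transpose_mat Gam \<in> carrier_mat r r" using Gam by simp

lemma J: "J \<in> carrier_mat r r" using Gamt K by (simp add: J_def)

lemma K_J: "K = Gam * J"
  unfolding J_def using assoc_mult_mat[OF Gam(1) Gamt K] Gam(3) K by simp

text \<open>Multiplying the eigenvector equation of \<open>U\<close> by Gam^T V^T gives J \<Lambda>
  = W J + Gam^T V^T \<Delta> U, where W is the diagonal matrix of eigenvalues of \<Omega>. The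
  constant is the product of the Frobenius norms \<surd>r of Gam, V and U.\<close>

lemma commutator_bound:
  assumes i: "i < r" and j: "j < r"
  shows "\<bar>(nth_eigenvalue Om i - L j) * J $$ (i,j)\<bar> \<le> sqrt (real r) * real r * frob_norm Dl"
proof -
  let ?W = "mat_diag r (nth_eigenvalue Om)"
  have Vt': "transpose_mat V \<in> carrier_mat r T" by (rule Vt)
  have DU: "Dl * U \<in> carrier_mat T r" using Dl U by simp
  have VDU: "transpose_mat V * (Dl * U) \<in> carrier_mat r r" using Vt DU by simp
  have Q: "transpose_mat Gam * (transpose_mat V * (Dl * U)) \<in> carrier_mat r r" using Gamt VDU by simp
  have VU: "transpose_mat V * U \<in> carrier_mat r r" using Vt U by simp
  have "transpose_mat V * (Sh * U) = K * mat_diag r L"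
    unfolding Sh_U K_eq by (rule assoc_mult_mat[symmetric, OF Vt U(1) mat_diag_dim])
  moreover have "Sh * U = V * (Om * K) + Dl * U"
    unfolding Sh_V add_mult_distrib_mat[OF VOV Dl U(1)] assoc_mult_mat[OF VO Vt U(1)] K_eq assoc_mult_mat[OF V Om VU] ..
  moreover have "transpose_mat V * (V * (Om * K) + Dl * U) = Om * K + transpose_mat V * (Dl * U)"
    using mult_add_distrib_mat[OF Vt mult_carrier_mat[OF V mult_carrier_mat[OF Om K]] DU]
      assoc_mult_mat[OF Vt V mult_carrier_mat[OF Om K]] VV left_mult_one_mat[OF mult_carrier_mat[OF Om K]] by simp
  ultimately have e: "K * mat_diag r L = Om * K + transpose_mat V * (Dl * U)" by simp
  have OG: "transpose_mat Gam * (Om * K) = ?W * J"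
  proof -
    have W: "?W \<in> carrier_mat r r" by simp
    have "Om * K = Gam * (?W * (transpose_mat Gam * K))"
      using Gam(4) assoc_mult_mat[OF mult_carrier_mat[OF Gam(1) W] Gamt K] assoc_mult_mat[OF Gam(1) W mult_carrier_mat[OF Gamt K]] by simp
    then have "transpose_mat Gam * (Om * K) = transpose_mat Gam * Gam * (?W * J)"
      unfolding J_def using assoc_mult_mat[OF Gamt Gam(1) mult_carrier_mat[OF W mult_carrier_mat[OF Gamt K]]] by simp
    then show ?thesis unfolding Gam(2) using left_mult_one_mat[OF mult_carrier_mat[OF W J]] by simp
  qed
  have "J * mat_diag r L = transpose_mat Gam * (K * mat_diag r L)"
    unfolding J_def by (rule assoc_mult_mat[OF Gamt K mat_diag_dim])
  also have "\<dots> = ?W * J + transpose_mat Gam * (transpose_mat V * (Dl * U))"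
    unfolding e mult_add_distrib_mat[OF Gamt mult_carrier_mat[OF Om K] VDU] OG ..
  finally have "(J * mat_diag r L) $$ (i,j) = (?W * J + transpose_mat Gam * (transpose_mat V * (Dl * U))) $$ (i,j)" by simp
  also have "\<dots> = (?W * J) $$ (i,j) + (transpose_mat Gam * (transpose_mat V * (Dl * U))) $$ (i,j)"
    using carrier_matD[OF Q] i j by (intro index_add_mat) auto
  finally have "J $$ (i,j) * L j = nth_eigenvalue Om i * J $$ (i,j) + (transpose_mat Gam * (transpose_mat V * (Dl * U))) $$ (i,j)"
    unfolding mat_diag_mult_right[OF J] mat_diag_mult_left[OF J] using i j by simp
  then have "\<bar>(nth_eigenvalue Om i - L j) * J $$ (i,j)\<bar> = \<bar>(transpose_mat Gam * (transpose_mat V * (Dl * U))) $$ (i,j)\<bar>"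
    by (simp add: algebra_simps)
  also have "\<dots> \<le> frob_norm (transpose_mat Gam * (transpose_mat V * (Dl * U)))"
    using carrier_matD[OF Q] i j by (intro abs_entry_le_frob_norm) auto
  also have "\<dots> \<le> sqrt (real r) * (sqrt (real r) * (frob_norm Dl * sqrt (real r)))"
    by (intro frob_norm_mult_le'[OF Gamt VDU] frob_norm_mult_le'[OF Vt DU] frob_norm_mult_le'[OF Dl U(1)])
      (simp_all add: frob_norm_isometry[OF V VV] frob_norm_isometry[OF U] frob_norm_isometry[OF Gam(1,2)])
  also have "\<dots> = sqrt (real r) * real r * frob_norm Dl" using real_sqrt_mult_self[of "real r"] by (simp add: mult_ac)
  finally show ?thesis .
qed

text \<open>R = U - V K is the part of \<open>U\<close> orthogonal to the range of \<open>V\<close>,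
  so R^T R = I - K^T K = I - J^T J. The signal part of the eigenvector equation lies in that range,
  hence R \<Lambda> = (I - V V^T) \<Delta> U. So R is of the order of \<Delta>, and the defect is
  quadratic in it.\<close>

lemma near_isometry_bound:
  assumes i: "i < r" and j: "j < r"
  shows "\<bar>(\<Sum>l<r. J $$ (l,i) * J $$ (l,j)) - (if i = j then 1 else 0)\<bar> \<le> ((1 + real r) * real r * frob_norm Dl / k)\<^sup>2"
proof -
  define R where "R = U - V * K"
  have VK: "V * K \<in> carrier_mat T r" using V K by simp
  have R: "R \<in> carrier_mat T r" and Rt: "transpose_mat R \<in> carrier_mat r T" using minus_carrier_mat[OF VK] by (auto simp: R_def)
  have Ut: "transpose_mat U \<in> carrier_mat r T" and Kt: "transpose_mat K \<in> carrier_mat r r" using U K by auto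
  have DU: "Dl * U \<in> carrier_mat T r" using Dl U by simp
  have VDU: "transpose_mat V * (Dl * U) \<in> carrier_mat r r" using Vt DU by simp
  have VVDU: "V * (transpose_mat V * (Dl * U)) \<in> carrier_mat T r" using V VDU by simp
  have VU: "transpose_mat V * U \<in> carrier_mat r r" using Vt U by simp
  have OK: "Om * K \<in> carrier_mat r r" using Om K by simp
  have "transpose_mat V * (Sh * U) = K * mat_diag r L"
    unfolding Sh_U K_eq by (rule assoc_mult_mat[symmetric, OF Vt U(1) mat_diag_dim])
  moreover have ShU: "Sh * U = V * (Om * K) + Dl * U"
    unfolding Sh_V add_mult_distrib_mat[OF VOV Dl U(1)] assoc_mult_mat[OF VO Vt U(1)] K_eq assoc_mult_mat[OF V Om VU] ..
  moreover have "transpose_mat V * (V * (Om * K) + Dl * U) = Om * K + transpose_mat V * (Dl * U)"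
    using mult_add_distrib_mat[OF Vt mult_carrier_mat[OF V OK] DU] assoc_mult_mat[OF Vt V OK] VV left_mult_one_mat[OF OK] by simp
  ultimately have e: "K * mat_diag r L = Om * K + transpose_mat V * (Dl * U)" by simp
  have "R * mat_diag r L = U * mat_diag r L - V * K * mat_diag r L"
    unfolding R_def by (rule minus_mult_distrib_mat[OF U(1) VK mat_diag_dim])
  also have "\<dots> = (V * (Om * K) + Dl * U) - (V * (Om * K) + V * (transpose_mat V * (Dl * U)))"
    unfolding Sh_U[symmetric] ShU assoc_mult_mat[OF V K mat_diag_dim] e mult_add_distrib_mat[OF V OK VDU] ..
  also have "\<dots> = Dl * U - V * (transpose_mat V * (Dl * U))"
  proof -
    have "(A + B') - (A + C) = B' - C" if "A \<in> carrier_mat T r" "B' \<in> carrier_mat T r" "C \<in> carrier_mat T r" for A B' C :: "real Matrix.mat"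
      using that by (intro eq_matI) auto
    from this[OF mult_carrier_mat[OF V OK] DU VVDU] show ?thesis .
  qed
  finally have RL: "R * mat_diag r L = Dl * U - V * (transpose_mat V * (Dl * U))" .
  have LL: "mat_diag r L * Li = 1\<^sub>m r" by (rule diag_L_Li[OF k]) (rule Lk)
  have "R = R * (mat_diag r L * Li)" unfolding LL using R by simp
  also have "\<dots> = (Dl * U - V * (transpose_mat V * (Dl * U))) * Li"
    unfolding RL[symmetric] by (rule assoc_mult_mat[symmetric, OF R mat_diag_dim Li(1)])
  finally have R_eq: "R = (Dl * U - V * (transpose_mat V * (Dl * U))) * Li" .
  \<comment> \<open>The constant arises as follows: 1 + r bounds the effect of I - V V^T, one
    \<surd>r is the norm of \<open>U\<close>, and \<surd>r / k is the bound for
    \<open>Li\<close>.\<close>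
  have nDU: "frob_norm (Dl * U) \<le> frob_norm Dl * sqrt (real r)"
    using frob_norm_mult_le[OF Dl U(1)] by (simp add: frob_norm_isometry[OF U])
  have nV: "frob_norm V \<le> sqrt (real r)" "frob_norm (transpose_mat V) \<le> sqrt (real r)"
    by (simp_all add: frob_norm_isometry[OF V VV])
  have "frob_norm (Dl * U + (-1) \<cdot>\<^sub>m (V * (transpose_mat V * (Dl * U)))) \<le> frob_norm (Dl * U) + frob_norm ((-1) \<cdot>\<^sub>m (V * (transpose_mat V * (Dl * U))))"
    using DU VVDU by (intro frob_norm_add_le) auto
  also have "\<dots> \<le> frob_norm Dl * sqrt (real r) + sqrt (real r) * (sqrt (real r) * (frob_norm Dl * sqrt (real r)))"
    using frob_norm_mult_le'[OF V VDU nV(1) frob_norm_mult_le'[OF Vt DU nV(2) nDU]] nDU by (simp add: frob_norm_smult)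
  also have "\<dots> = (1 + real r) * (frob_norm Dl * sqrt (real r))" using real_sqrt_mult_self[of "real r"] by (simp add: algebra_simps)
  also have "Dl * U + (-1) \<cdot>\<^sub>m (V * (transpose_mat V * (Dl * U))) = Dl * U - V * (transpose_mat V * (Dl * U))"
  proof -
    have "A + (-1) \<cdot>\<^sub>m C = A - C" if "A \<in> carrier_mat T r" "C \<in> carrier_mat T r" for A C :: "real Matrix.mat"
      using that by (intro eq_matI) auto
    from this[OF DU VVDU] show ?thesis .
  qed
  finally have "frob_norm R \<le> (1 + real r) * (frob_norm Dl * sqrt (real r)) * (sqrt (real r) * (1 / k))"
    unfolding R_eq by (rule frob_norm_mult_le'[OF minus_carrier_mat[OF VVDU] Li(1)]) (rule frob_norm_Li_le[OF k], rule Lk)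
  also have "\<dots> = (1 + real r) * real r * frob_norm Dl / k" using real_sqrt_mult_self[of "real r"] by (simp add: mult_ac)
  finally have nR: "frob_norm R \<le> (1 + real r) * real r * frob_norm Dl / k" .
  have "transpose_mat R * R = 1\<^sub>m r - transpose_mat K * K"
  proof -
    have VtR: "transpose_mat V * R = 0\<^sub>m r r"
    proof -
      have "transpose_mat V * R = transpose_mat V * U - transpose_mat V * (V * K)"
        unfolding R_def by (rule mult_minus_distrib_mat[OF Vt U(1) VK])
      also have "transpose_mat V * (V * K) = K"
        using assoc_mult_mat[OF Vt V K] VV left_mult_one_mat[OF K] by simp
      finally show ?thesis unfolding K_eq[symmetric] using K by (simp add: minus_r_inv_mat)
    qed
    have RV: "transpose_mat R * V = 0\<^sub>m r r"
      using arg_cong[OF VtR, of transpose_mat] transpose_mult[OF Vt R] by simp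
    have "transpose_mat R * R = transpose_mat R * U - transpose_mat R * (V * K)"
      by (subst (2) R_def) (rule mult_minus_distrib_mat[OF Rt U(1) VK])
    also have "transpose_mat R * (V * K) = 0\<^sub>m r r"
      using assoc_mult_mat[OF Rt V K] RV K by simp
    also have "transpose_mat R * U = transpose_mat U * U - transpose_mat (V * K) * U"
    proof -
      have VKt: "transpose_mat (V * K) \<in> carrier_mat r T" using VK by simp
      have "transpose_mat R = transpose_mat U - transpose_mat (V * K)"
        unfolding R_def by (rule transpose_minus[OF U(1) VK])
      then show ?thesis using minus_mult_distrib_mat[OF Ut VKt U(1)] by simp
    qed
    also have "transpose_mat (V * K) * U = transpose_mat K * K"
      unfolding transpose_mult[OF V K] using assoc_mult_mat[OF Kt Vt U(1)] K_eq by simp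
    finally have "transpose_mat R * R = (1\<^sub>m r - transpose_mat K * K) - 0\<^sub>m r r" unfolding U(2) .
    moreover have "A - 0\<^sub>m r r = A" if "A \<in> carrier_mat r r" for A :: "real Matrix.mat"
      using that by (intro eq_matI) auto
    moreover have "1\<^sub>m r - transpose_mat K * K \<in> carrier_mat r r" using minus_carrier_mat[OF mult_carrier_mat[OF Kt K]] .
    ultimately show ?thesis by metis
  qed
  moreover have "transpose_mat J * J = transpose_mat K * K"
  proof -
    have Jt: "transpose_mat J = transpose_mat K * Gam" unfolding J_def using transpose_mult[OF Gamt K] by simp
    show ?thesis unfolding Jt using assoc_mult_mat[OF Kt Gam(1) J] K_J by simp
  qed
  ultimately have RR: "transpose_mat R * R = 1\<^sub>m r - transpose_mat J * J" by simp
  have Jt: "transpose_mat J \<in> carrier_mat r r" using J by simp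
  have "(transpose_mat J * J) $$ (i,j) = (\<Sum>l<r. J $$ (l,i) * J $$ (l,j))"
    unfolding index_mult_mat_sum[OF Jt J i j] using J i by (intro sum.cong) auto
  then have "(\<Sum>l<r. J $$ (l,i) * J $$ (l,j)) - (if i = j then 1 else 0) = - (1\<^sub>m r - transpose_mat J * J) $$ (i,j)"
    using carrier_matD[OF mult_carrier_mat[OF Jt J]] i j by (simp del: index_mult_mat(1))
  then have "\<bar>(\<Sum>l<r. J $$ (l,i) * J $$ (l,j)) - (if i = j then 1 else 0)\<bar> = \<bar>(transpose_mat R * R) $$ (i,j)\<bar>"
    unfolding RR by simp
  also have "\<dots> \<le> frob_norm (transpose_mat R * R)"
    using carrier_matD[OF mult_carrier_mat[OF Rt R]] i j by (intro abs_entry_le_frob_norm) auto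
  also have "\<dots> \<le> ((1 + real r) * real r * frob_norm Dl / k) * ((1 + real r) * real r * frob_norm Dl / k)"
    using nR by (intro frob_norm_mult_le'[OF Rt R]) auto
  finally show ?thesis by (simp add: power2_eq_square)
qed

end
end

section \<open>Rates along the triangular array\<close>

lemma frob_norm_one: "frob_norm (1\<^sub>m n) = sqrt (real n)"
  by (rule frob_norm_isometry) auto

lemma frob_norm_op_bound:
  assumes A: "A \<in> carrier_mat m n" and c: "0 \<le> c"
    and op: "\<And>v. v \<in> carrier_vec n \<Longrightarrow> eucl_norm (A *\<^sub>v v) \<le> c * eucl_norm v"
  shows "frob_norm A \<le> c * sqrt (real n)"
  using frob_norm_mult_le_op[OF A one_carrier_mat c op] A by (simp add: frob_norm_one)

text \<open>A unit vector encoded as a one-column matrix: selecting a row or a column becomes a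
  matrix product, so the bounds for A S Y and A S G S^T Y also cover a single time point.\<close>

definition unit_col :: "nat \<Rightarrow> nat \<Rightarrow> real Matrix.mat" where
  "unit_col n t = Matrix.mat n 1 (\<lambda>(s, _). if s = t then 1 else 0)"

lemma unit_col: "unit_col n t \<in> carrier_mat n 1" "transpose_mat (unit_col n t) \<in> carrier_mat 1 n"
  by (auto simp: unit_col_def)

lemma frob_norm_mult_unit_col:
  assumes A: "A \<in> carrier_mat m n" and t: "t < n"
  shows "frob_norm (A * unit_col n t) = eucl_norm (col A t)"
proof -
  have AU: "A * unit_col n t \<in> carrier_mat m 1" using A unit_col by simp
  have "(A * unit_col n t) $$ (i,0) = A $$ (i,t)" if "i < m" for i
  proof -
    have "(A * unit_col n t) $$ (i,0) = (\<Sum>l<n. if l = t then A $$ (i,l) else 0)"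
      using index_mult_mat_sum[OF A unit_col(1)[of n t] that, of 0] by (auto simp: unit_col_def if_distrib intro!: sum.cong simp del: index_mult_mat(1) cong: if_cong)
    then show ?thesis using t by simp
  qed
  then have "(frob_norm (A * unit_col n t))\<^sup>2 = (eucl_norm (col A t))\<^sup>2"
    using A t unfolding frob_norm_power2[OF AU] by (simp add: eucl_norm_power2 del: index_mult_mat(1))
  then show ?thesis by (simp add: power2_eq_iff_nonneg)
qed

lemma frob_norm_unit_col: "t < n \<Longrightarrow> frob_norm (unit_col n t) = 1"
  using frob_norm_mult_unit_col[of "1\<^sub>m n" n n t] left_mult_one_mat[OF unit_col(1), of n t]
  by (simp add: eucl_norm_def if_distrib[of "\<lambda>x. x\<^sup>2"] cong: if_cong)

locale ppca_asymptotics = prob_space M for M :: "'a measure" +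
  fixes N T :: "nat \<Rightarrow> nat" and r :: nat and lam :: "nat \<Rightarrow> real" and C :: real
    and B P1 P2 :: "nat \<Rightarrow> real Matrix.mat" and SigB :: "real Matrix.mat"
    and F S Fh :: "nat \<Rightarrow> 'a \<Rightarrow> real Matrix.mat"
  assumes r: "1 \<le> r" and C: "0 < C"
    and N: "filterlim N at_top sequentially" and T: "filterlim T at_top sequentially"
    and lam: "\<And>n. 0 < lam n"
    and factors: "factor_assumption M T r C F"
    and loadings: "loading_assumption N r C B SigB"
    and noise: "noise_assumption M N T r C P1 P2 S F"
    and Fh: "\<And>n. random_matrix M (T n) r (Fh n)"
    and fac: "\<And>n \<omega>. \<omega> \<in> space M \<Longrightarrow>
      ppca_factors r (lam n) (F n \<omega> * transpose_mat (B n) + P1 n * S n \<omega> * P2 n) (Fh n \<omega>)"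
begin

abbreviation E where "E n \<omega> \<equiv> P1 n * S n \<omega> * P2 n"
abbreviation D where "D n \<equiv> penalty_inv (N n) (lam n)"
abbreviation G where "G n \<equiv> P2 n * D n * transpose_mat (P2 n)"
definition d where "d n = frob_norm (D n)"
definition EDB where "EDB n \<omega> = E n \<omega> * D n * B n"
definition EDE where "EDE n \<omega> = E n \<omega> * D n * transpose_mat (E n \<omega>)"
text \<open>The dimensions tend to infinity but may be 0 for small n, where the formula for D^-1
  fails.\<close>

definition big where "big n \<longleftrightarrow> 0 < N n \<and> 0 < T n"

lemma eventually_big: "\<forall>\<^sub>F n in sequentially. big n"
  unfolding big_def
  by (intro eventually_conj eventually_compose_filterlim[OF eventually_gt_at_top N] eventually_compose_filterlim[OF eventually_gt_at_top T])

text \<open>The time point is fixed while T grows, so t is a valid row index only from some n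
  on.\<close>

lemma eventually_T_gt: "\<forall>\<^sub>F n in sequentially. t < T n"
  by (rule eventually_compose_filterlim[OF eventually_gt_at_top T])

lemma carriers: "P1 n \<in> carrier_mat (T n) (T n)" "P2 n \<in> carrier_mat (N n) (N n)" "B n \<in> carrier_mat (N n) r"
  and S: "random_matrix M (T n) (N n) (S n)" and F: "random_matrix M (T n) r (F n)"
  using noise loadings factors by (auto simp: noise_assumption_def loading_assumption_def factor_assumption_def)

lemma SF: "\<omega> \<in> space M \<Longrightarrow> S n \<omega> \<in> carrier_mat (T n) (N n)" "\<omega> \<in> space M \<Longrightarrow> F n \<omega> \<in> carrier_mat (T n) r"
  using random_matrixD(1)[OF S] random_matrixD(1)[OF F] by auto

lemma E: "\<omega> \<in> space M \<Longrightarrow> E n \<omega> \<in> carrier_mat (T n) (N n)"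
  by (intro mult_carrier_mat[of _ _ "N n"] mult_carrier_mat[of _ _ "T n"] carriers SF)

lemma noise_matrix: "noise_matrix M (T n) (N n) C (S n)"
  using noise C unfolding noise_assumption_def by unfold_locales auto

lemma indepSF: "indep_var (Pi\<^sub>M ({..<T n} \<times> {..<N n}) (\<lambda>_. borel)) (\<lambda>\<omega>. \<lambda>p\<in>{..<T n} \<times> {..<N n}. S n \<omega> $$ p)
          (Pi\<^sub>M ({..<T n} \<times> {..<r}) (\<lambda>_. borel)) (\<lambda>\<omega>. \<lambda>p\<in>{..<T n} \<times> {..<r}. F n \<omega> $$ p)"
  using noise unfolding noise_assumption_def by auto

lemma sample: "big n \<Longrightarrow> \<omega> \<in> space M \<Longrightarrow> ppca_sample (N n) (T n) r (lam n) (B n) (F n \<omega>) (E n \<omega>) (Fh n \<omega>)"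
  using r lam carriers SF E fac by unfold_locales (auto simp: big_def)

lemma AE_FF: "AE \<omega> in M. (1 / real (T n)) \<cdot>\<^sub>m (transpose_mat (F n \<omega>) * F n \<omega>) = 1\<^sub>m r"
  using factors unfolding factor_assumption_def by auto

lemma sample_orth: "big n \<Longrightarrow> \<omega> \<in> space M \<Longrightarrow> (1 / real (T n)) \<cdot>\<^sub>m (transpose_mat (F n \<omega>) * F n \<omega>) = 1\<^sub>m r \<Longrightarrow>
    ppca_sample_orth (N n) (T n) r (lam n) (B n) (F n \<omega>) (E n \<omega>) (Fh n \<omega>)"
  using sample by (auto simp: ppca_sample_orth_def ppca_sample_orth_axioms_def)

lemma AE_frob_F: "big n \<Longrightarrow> AE \<omega> in M. frob_norm (F n \<omega>) = sqrt (real (T n)) * sqrt (real r)"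
  using AE_FF[of n] AE_space by eventually_elim (rule ppca_sample_orth.frob_norm_F[OF sample_orth])

text \<open>One upper bound for the spectra of both Gram matrices and all n, chosen once so that all
  rates in the locale share a constant.\<close>

definition c1 where "c1 = (SOME c. 0 < c \<and> (\<forall>n.
        (\<forall>t<T n. nth_eigenvalue (transpose_mat (P1 n) * P1 n) t \<le> c) \<and>
        (\<forall>j<N n. nth_eigenvalue (transpose_mat (P2 n) * P2 n) j \<le> c)))"

lemma c1: "0 < c1" "t < T n \<Longrightarrow> nth_eigenvalue (transpose_mat (P1 n) * P1 n) t \<le> c1"
  "j < N n \<Longrightarrow> nth_eigenvalue (transpose_mat (P2 n) * P2 n) j \<le> c1"
proof -
  have "\<exists>c. 0 < c \<and> (\<forall>n. (\<forall>t<T n. nth_eigenvalue (transpose_mat (P1 n) * P1 n) t \<le> c) \<and>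
        (\<forall>j<N n. nth_eigenvalue (transpose_mat (P2 n) * P2 n) j \<le> c))"
    using noise unfolding noise_assumption_def by blast
  from someI_ex[OF this, folded c1_def]
  show "0 < c1" "t < T n \<Longrightarrow> nth_eigenvalue (transpose_mat (P1 n) * P1 n) t \<le> c1"
    "j < N n \<Longrightarrow> nth_eigenvalue (transpose_mat (P2 n) * P2 n) j \<le> c1" by auto
qed

lemma P1_op: "v \<in> carrier_vec (T n) \<Longrightarrow> eucl_norm (P1 n *\<^sub>v v) \<le> sqrt c1 * eucl_norm v"
  and P2_op: "w \<in> carrier_vec (N n) \<Longrightarrow> eucl_norm (P2 n *\<^sub>v w) \<le> sqrt c1 * eucl_norm w"
  by (rule eucl_norm_le_of_gram_eigenvalues[OF carriers(1) less_imp_le[OF c1(1)] c1(2)], assumption+)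
    (rule eucl_norm_le_of_gram_eigenvalues[OF carriers(2) less_imp_le[OF c1(1)] c1(3)], assumption+)

lemma P1t_op: "v \<in> carrier_vec (T n) \<Longrightarrow> eucl_norm (transpose_mat (P1 n) *\<^sub>v v) \<le> sqrt c1 * eucl_norm v"
  using c1(1) by (intro eucl_norm_transpose_le_op[OF carriers(1)] P1_op) auto

lemma P1_mult: "Y \<in> carrier_mat (T n) k \<Longrightarrow> frob_norm (P1 n * Y) \<le> sqrt c1 * frob_norm Y"
  and P2_mult: "Z \<in> carrier_mat (N n) k \<Longrightarrow> frob_norm (P2 n * Z) \<le> sqrt c1 * frob_norm Z"
  using c1(1) by (auto intro!: frob_norm_mult_le_op[OF carriers(1)] frob_norm_mult_le_op[OF carriers(2)] P1_op P2_op)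

lemma P1t_mult: "Y \<in> carrier_mat (T n) k \<Longrightarrow> frob_norm (transpose_mat (P1 n) * Y) \<le> sqrt c1 * frob_norm Y"
  using c1(1) carriers(1)[of n] by (intro frob_norm_mult_le_op[of _ "T n" "T n"] P1t_op) auto

lemma frob_P1: "frob_norm (P1 n) \<le> sqrt c1 * sqrt (real (T n))"
  using c1(1) by (intro frob_norm_op_bound[OF carriers(1)] P1_op) auto

lemma D: "big n \<Longrightarrow> D n \<in> carrier_mat (N n) (N n)" "big n \<Longrightarrow> transpose_mat (D n) = D n"
  using penalty_inv_carrier penalty_inv_symmetric lam by (auto simp: big_def)

lemma d: "big n \<Longrightarrow> 0 < d n" "big n \<Longrightarrow> d n \<le> sqrt (real (N n))"
  unfolding d_def using frob_norm_penalty_inv_pos frob_norm_penalty_inv_le lam by (auto simp: big_def)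

lemma frob_B: "frob_norm (B n) \<le> sqrt (real (N n) * real r) * C"
  using loadings C by (intro frob_norm_le_entries[OF carriers(3)]) (auto simp: loading_assumption_def)

lemma frob_DB:
  assumes b: "big n"
  shows "frob_norm (D n * B n) \<le> sqrt (real (N n) * real r) * C"
proof -
  have "frob_norm (D n * B n) \<le> 1 * frob_norm (B n)"
    using b lam by (intro frob_norm_mult_le_op[OF D(1)[OF b] carriers(3)] eucl_norm_penalty_inv_le) (auto simp: big_def)
  then show ?thesis using frob_B[of n] by linarith
qed

lemma P2DB: "big n \<Longrightarrow> P2 n * D n * B n \<in> carrier_mat (N n) r"
  by (intro mult_carrier_mat[of _ _ "N n"] carriers D)

lemma frob_P2DB: "big n \<Longrightarrow> (frob_norm (P2 n * D n * B n))\<^sup>2 \<le> c1 * (real r * C\<^sup>2) * real (N n)"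
proof -
  assume b: "big n"
  have DB: "D n * B n \<in> carrier_mat (N n) r" using D[OF b] carriers by simp
  have "frob_norm (P2 n * D n * B n) \<le> sqrt c1 * (sqrt (real (N n) * real r) * C)"
    unfolding assoc_mult_mat[OF carriers(2) D(1)[OF b] carriers(3)]
    by (rule order_trans[OF P2_mult[OF DB] mult_left_mono[OF frob_DB[OF b]]]) (use c1(1) in simp)
  from power_mono[OF this, of 2] show ?thesis using c1(1) by (simp add: power_mult_distrib mult_ac)
qed

lemma G: "big n \<Longrightarrow> G n \<in> carrier_mat (N n) (N n)"
  using mult_carrier_mat[OF mult_carrier_mat[OF carriers(2) D(1)]] carriers by auto

text \<open>One \<open>P2\<close> is removed on the left; transposing brings the other one to the
  left as well. Each costs only its operator bound, so the order d of D^-1 is preserved.\<close>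

lemma frob_G: "big n \<Longrightarrow> (frob_norm (G n))\<^sup>2 \<le> c1\<^sup>2 * (d n)\<^sup>2"
proof -
  assume b: "big n"
  note P2 = carriers(2)[of n] and Db = D[OF b]
  have P2t: "transpose_mat (P2 n) \<in> carrier_mat (N n) (N n)" using P2 by simp
  have DP: "D n * transpose_mat (P2 n) \<in> carrier_mat (N n) (N n)" using Db P2t by simp
  have "frob_norm (G n) \<le> sqrt c1 * frob_norm (D n * transpose_mat (P2 n))"
    using P2_mult[OF DP] assoc_mult_mat[OF P2 Db(1) P2t] by simp
  also have "frob_norm (D n * transpose_mat (P2 n)) = frob_norm (P2 n * D n)"
    using frob_norm_transpose[of "P2 n * D n"] transpose_mult[OF P2 Db(1)] Db(2) by simp
  also have "sqrt c1 * \<dots> \<le> sqrt c1 * (sqrt c1 * d n)"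
    using P2_mult[OF Db(1)] c1(1) by (intro mult_left_mono) (auto simp: d_def)
  also have "\<dots> = c1 * d n" using c1(1) by simp
  finally show ?thesis using power_mono[of "frob_norm (G n)" "c1 * d n" 2] by (simp add: power_mult_distrib)
qed

lemma EDB_eq: "big n \<Longrightarrow> \<omega> \<in> space M \<Longrightarrow> EDB n \<omega> = P1 n * S n \<omega> * (P2 n * D n * B n)"
proof -
  assume b: "big n" and w: "\<omega> \<in> space M"
  note P2 = carriers(2)[of n] and Bc = carriers(3)[of n] and Db = D(1)[OF b]
  have PS: "P1 n * S n \<omega> \<in> carrier_mat (T n) (N n)" by (rule mult_carrier_mat[OF carriers(1) SF(1)[OF w]])
  show ?thesis unfolding EDB_def
    using assoc_mult_mat[OF PS P2 Db] assoc_mult_mat[OF PS mult_carrier_mat[OF P2 Db] Bc] by simp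
qed

lemma EDE_eq: "big n \<Longrightarrow> \<omega> \<in> space M \<Longrightarrow> EDE n \<omega> = P1 n * S n \<omega> * G n * transpose_mat (S n \<omega>) * transpose_mat (P1 n)"
proof -
  assume b: "big n" and w: "\<omega> \<in> space M"
  note P1 = carriers(1)[of n] and P2 = carriers(2)[of n] and Db = D(1)[OF b] and Sw = SF(1)[OF w, of n]
  have PS: "P1 n * S n \<omega> \<in> carrier_mat (T n) (N n)" using P1 Sw by simp
  have t: "transpose_mat (P2 n) \<in> carrier_mat (N n) (N n)" "transpose_mat (S n \<omega>) \<in> carrier_mat (N n) (T n)"
    "transpose_mat (P1 n) \<in> carrier_mat (T n) (T n)" using P1 P2 Sw by auto
  note PSP = mult_carrier_mat[OF PS P2] and P2D = mult_carrier_mat[OF P2 Db]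
  have PSD: "P1 n * S n \<omega> * (P2 n * D n) \<in> carrier_mat (T n) (N n)" using mult_carrier_mat[OF PS P2D] .
  have Et: "transpose_mat (E n \<omega>) = transpose_mat (P2 n) * (transpose_mat (S n \<omega>) * transpose_mat (P1 n))"
    using transpose_mult[OF PS P2] transpose_mult[OF P1 Sw] by simp
  have "EDE n \<omega> = P1 n * S n \<omega> * (P2 n * D n) * (transpose_mat (P2 n) * (transpose_mat (S n \<omega>) * transpose_mat (P1 n)))"
    unfolding EDE_def Et assoc_mult_mat[OF PS P2 Db] ..
  also have "\<dots> = P1 n * S n \<omega> * (P2 n * D n) * transpose_mat (P2 n) * (transpose_mat (S n \<omega>) * transpose_mat (P1 n))"
    by (rule assoc_mult_mat[symmetric, OF PSD t(1) mult_carrier_mat[OF t(2,3)]])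
  also have "P1 n * S n \<omega> * (P2 n * D n) * transpose_mat (P2 n) = P1 n * S n \<omega> * G n"
    by (rule assoc_mult_mat[OF PS P2D t(1)])
  also have "P1 n * S n \<omega> * G n * (transpose_mat (S n \<omega>) * transpose_mat (P1 n)) = P1 n * S n \<omega> * G n * transpose_mat (S n \<omega>) * transpose_mat (P1 n)"
    by (rule assoc_mult_mat[symmetric, OF mult_carrier_mat[OF PS G[OF b]] t(2,3)])
  finally show ?thesis .
qed

lemma random_E: "random_matrix M (T n) (N n) (E n)"
  by (intro random_matrix_mult[where n="N n" and B="\<lambda>_. P2 n"] random_matrix_mult[where n="T n" and A="\<lambda>_. P1 n"] random_matrix_const S carriers)

lemma random_EDB: "big n \<Longrightarrow> random_matrix M (T n) r (EDB n)"
  unfolding EDB_def by (intro random_matrix_mult[where n="N n"] random_E random_matrix_const D carriers)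

lemma random_EDE: "big n \<Longrightarrow> random_matrix M (T n) (T n) (EDE n)"
  unfolding EDE_def by (intro random_matrix_mult[where n="N n"] random_matrix_transpose random_E random_matrix_const D)

lemma random_FEDB: "big n \<Longrightarrow> random_matrix M r r (\<lambda>\<omega>. transpose_mat (F n \<omega>) * EDB n \<omega>)"
  by (intro random_matrix_mult[where n="T n"] random_matrix_transpose F random_EDB)

lemma random_EDE_unit: "big n \<Longrightarrow> random_matrix M (T n) 1 (\<lambda>\<omega>. EDE n \<omega> * unit_col (T n) t)"
  by (intro random_matrix_mult[where n="T n"] random_EDE random_matrix_const unit_col)

lemma random_FEDE_unit: "big n \<Longrightarrow> random_matrix M r 1 (\<lambda>\<omega>. transpose_mat (F n \<omega>) * (EDE n \<omega> * unit_col (T n) t))"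
  by (intro random_matrix_mult[where n="T n"] random_matrix_transpose F random_EDE_unit)

lemma frob_P1_power2: "(frob_norm (P1 n))\<^sup>2 \<le> c1 * real (T n)"
  using power_mono[OF frob_P1[of n], of 2] c1(1) by (simp add: power_mult_distrib)

lemma frob_P1t_unit: "t < T n \<Longrightarrow> (frob_norm (transpose_mat (P1 n) * unit_col (T n) t))\<^sup>2 \<le> c1"
  using power_mono[OF P1t_mult[OF unit_col(1), of n t], of 2] c1(1) by (simp add: frob_norm_unit_col)

lemma AE_FP1:
  assumes b: "big n"
  shows "AE \<omega> in M. (frob_norm (transpose_mat (F n \<omega>) * P1 n))\<^sup>2 \<le> c1 * real r * real (T n)"
  using AE_frob_F[OF b] AE_space
proof eventually_elim
  fix \<omega> assume f: "frob_norm (F n \<omega>) = sqrt (real (T n)) * sqrt (real r)" and w: "\<omega> \<in> space M"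
  have Ft: "transpose_mat (F n \<omega>) \<in> carrier_mat r (T n)" using SF[OF w] by simp
  have "frob_norm (transpose_mat (F n \<omega>) * P1 n) = frob_norm (transpose_mat (P1 n) * F n \<omega>)"
    using frob_norm_transpose[of "transpose_mat (F n \<omega>) * P1 n"] transpose_mult[OF Ft carriers(1)] by simp
  also have "\<dots> \<le> sqrt c1 * (sqrt (real (T n)) * sqrt (real r))" using P1t_mult[OF SF(2)[OF w], of n] f by simp
  finally show "(frob_norm (transpose_mat (F n \<omega>) * P1 n))\<^sup>2 \<le> c1 * real r * real (T n)"
    using power_mono[of "frob_norm (transpose_mat (F n \<omega>) * P1 n)" "sqrt c1 * (sqrt (real (T n)) * sqrt (real r))" 2] c1(1)
    by (simp add: power_mult_distrib mult_ac)
qed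

lemma bounded_EDB: "bounded_in_prob M (\<lambda>n \<omega>. frob_norm (EDB n \<omega>)) (\<lambda>n. sqrt (real (N n) * real (T n)))"
proof (rule bounded_in_prob_Markov)
  show "0 < c1 * c1 * (real r * C\<^sup>2)" using c1(1) C r by simp
  show "\<forall>\<^sub>F n in sequentially. 0 < sqrt (real (N n) * real (T n)) \<and> (\<lambda>\<omega>. (frob_norm (EDB n \<omega>))\<^sup>2) \<in> borel_measurable M \<and>
     (\<integral>\<^sup>+ \<omega>. ennreal ((frob_norm (EDB n \<omega>))\<^sup>2) \<partial>M) \<le> ennreal (c1 * c1 * (real r * C\<^sup>2) * (sqrt (real (N n) * real (T n)))\<^sup>2)"
    using eventually_big
  proof eventually_elim
    case (elim n)
    interpret noise_matrix M "T n" "N n" C "S n" by (rule noise_matrix)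
    have "(\<integral>\<^sup>+ \<omega>. ennreal ((frob_norm (EDB n \<omega>))\<^sup>2) \<partial>M) = (\<integral>\<^sup>+ \<omega>. ennreal ((frob_norm (P1 n * S n \<omega> * (P2 n * D n * B n)))\<^sup>2) \<partial>M)"
      by (intro nn_integral_cong) (simp add: EDB_eq[OF elim])
    also have "\<dots> \<le> ennreal ((frob_norm (P1 n))\<^sup>2 * (frob_norm (P2 n * D n * B n))\<^sup>2)"
      by (rule nn_integral_linear_form_le[OF carriers(1) P2DB[OF elim]])
    also have "\<dots> \<le> ennreal ((c1 * real (T n)) * (c1 * (real r * C\<^sup>2) * real (N n)))"
      using c1(1) by (intro ennreal_leI mult_mono frob_P1_power2 frob_P2DB[OF elim]) auto
    also have "(c1 * real (T n)) * (c1 * (real r * C\<^sup>2) * real (N n)) = c1 * c1 * (real r * C\<^sup>2) * (sqrt (real (N n) * real (T n)))\<^sup>2" by simp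
    finally show ?case using measurable_frob_norm_power2[OF random_EDB[OF elim]] elim by (simp add: big_def)
  qed
qed

text \<open>The same rate as for \<open>EDB\<close> itself, although F has norm of order \<surd>T: F
  is independent of the centered noise, so F^T averages over time instead of adding up norms. The
  second moment involves |F^T P1|^2, which is of order T, just as |P1|^2 is.\<close>

lemma bounded_FEDB: "bounded_in_prob M (\<lambda>n \<omega>. frob_norm (transpose_mat (F n \<omega>) * EDB n \<omega>)) (\<lambda>n. sqrt (real (N n) * real (T n)))"
proof (rule bounded_in_prob_Markov)
  show "0 < c1 * real r * c1 * (real r * C\<^sup>2)" using c1(1) C r by simp
  show "\<forall>\<^sub>F n in sequentially. 0 < sqrt (real (N n) * real (T n)) \<and> (\<lambda>\<omega>. (frob_norm (transpose_mat (F n \<omega>) * EDB n \<omega>))\<^sup>2) \<in> borel_measurable M \<and>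
     (\<integral>\<^sup>+ \<omega>. ennreal ((frob_norm (transpose_mat (F n \<omega>) * EDB n \<omega>))\<^sup>2) \<partial>M) \<le> ennreal (c1 * real r * c1 * (real r * C\<^sup>2) * (sqrt (real (N n) * real (T n)))\<^sup>2)"
    using eventually_big
  proof eventually_elim
    case (elim n)
    interpret noise_matrix M "T n" "N n" C "S n" by (rule noise_matrix)
    have eq: "transpose_mat (F n \<omega>) * EDB n \<omega> = transpose_mat (F n \<omega>) * P1 n * S n \<omega> * (P2 n * D n * B n)" if w: "\<omega> \<in> space M" for \<omega>
    proof -
      have Ft: "transpose_mat (F n \<omega>) \<in> carrier_mat r (T n)" using SF[OF w] by simp
      show ?thesis unfolding EDB_eq[OF elim w]
        using assoc_mult_mat[OF Ft mult_carrier_mat[OF carriers(1) SF(1)[OF w]] P2DB[OF elim]] assoc_mult_mat[OF Ft carriers(1) SF(1)[OF w]] by simp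
    qed
    have "(\<integral>\<^sup>+ \<omega>. ennreal ((frob_norm (transpose_mat (F n \<omega>) * EDB n \<omega>))\<^sup>2) \<partial>M)
       = (\<integral>\<^sup>+ \<omega>. ennreal ((frob_norm (transpose_mat (F n \<omega>) * P1 n * S n \<omega> * (P2 n * D n * B n)))\<^sup>2) \<partial>M)"
      by (intro nn_integral_cong) (simp add: eq)
    also have "\<dots> \<le> (\<integral>\<^sup>+ \<omega>. ennreal ((frob_norm (transpose_mat (F n \<omega>) * P1 n))\<^sup>2 * (frob_norm (P2 n * D n * B n))\<^sup>2) \<partial>M)"
      by (rule nn_integral_linear_form_independent_le[OF F indepSF carriers(1) P2DB[OF elim]])
    also have "\<dots> \<le> (\<integral>\<^sup>+ \<omega>. ennreal ((c1 * real r * real (T n)) * (c1 * (real r * C\<^sup>2) * real (N n))) \<partial>M)"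
      using AE_FP1[OF elim] c1(1)
      by (intro nn_integral_mono_AE) (auto intro!: ennreal_leI mult_mono frob_P2DB[OF elim])
    also have "\<dots> = ennreal (c1 * real r * c1 * (real r * C\<^sup>2) * (sqrt (real (N n) * real (T n)))\<^sup>2)"
      by (simp add: emeasure_space_1 mult_ac)
    finally show ?case using measurable_frob_norm_power2[OF random_FEDB[OF elim]] elim by (simp add: big_def)
  qed
qed

text \<open>The order of \<Delta>, and of that part of the remainder which the ratio does not
  cover.\<close>

definition \<eta> where "\<eta> n = 1 / sqrt (real (N n)) + 1 / sqrt (real (T n))"

text \<open>Here d \<le> \<surd>N suffices: the fluctuation is of order d T \<le> \<surd>N T, the
  mean of order \<surd>N d \<surd>T \<le> N \<surd>T, and N T \<eta> is the sum of the two.\<close>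

lemma bounded_EDE: "bounded_in_prob M (\<lambda>n \<omega>. frob_norm (EDE n \<omega>)) (\<lambda>n. real (N n) * real (T n) * \<eta> n)"
proof (rule bounded_in_prob_Markov)
  let ?c = "2 * (C + 2) * c1 ^ 4"
  show "0 < ?c" using c1(1) C by simp
  show "\<forall>\<^sub>F n in sequentially. 0 < real (N n) * real (T n) * \<eta> n \<and> (\<lambda>\<omega>. (frob_norm (EDE n \<omega>))\<^sup>2) \<in> borel_measurable M \<and>
     (\<integral>\<^sup>+ \<omega>. ennreal ((frob_norm (EDE n \<omega>))\<^sup>2) \<partial>M) \<le> ennreal (?c * (real (N n) * real (T n) * \<eta> n)\<^sup>2)"
    using eventually_big
  proof eventually_elim
    case (elim n)
    interpret noise_matrix M "T n" "N n" C "S n" by (rule noise_matrix)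
    have P1t: "transpose_mat (P1 n) \<in> carrier_mat (T n) (T n)" using carriers by simp
    let ?N = "real (N n)" and ?T = "real (T n)"
    have NT: "0 < ?N" "0 < ?T" using elim by (auto simp: big_def)
    have g: "(frob_norm (G n))\<^sup>2 \<le> c1\<^sup>2 * ?N"
    proof -
      have "(d n)\<^sup>2 \<le> ?N" using power_mono[OF d(2)[OF elim], of 2] d(1)[OF elim] by simp
      then show ?thesis by (intro order_trans[OF frob_G[OF elim] mult_left_mono]) auto
    qed
    \<comment> \<open>The operator bound for the left factor gives order T; the product of the two
      Frobenius norms would give T^2 and spoil the mean part.\<close>
    have pp: "(frob_norm (P1 n * transpose_mat (P1 n)))\<^sup>2 \<le> c1 * (c1 * ?T)"
    proof -
      have "(frob_norm (P1 n * transpose_mat (P1 n)))\<^sup>2 \<le> c1 * (frob_norm (P1 n))\<^sup>2"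
        using power_mono[OF P1_mult[OF P1t], of 2] c1(1) by (simp add: power_mult_distrib)
      then show ?thesis using mult_left_mono[OF frob_P1_power2[of n], of c1] c1(1) by linarith
    qed
    have "(\<integral>\<^sup>+ \<omega>. ennreal ((frob_norm (EDE n \<omega>))\<^sup>2) \<partial>M)
       = (\<integral>\<^sup>+ \<omega>. ennreal ((frob_norm (P1 n * S n \<omega> * G n * transpose_mat (S n \<omega>) * transpose_mat (P1 n)))\<^sup>2) \<partial>M)"
      by (intro nn_integral_cong) (simp add: EDE_eq[OF elim])
    also have "\<dots> \<le> ennreal (2 * (C + 2) * (frob_norm (G n))\<^sup>2 * ((frob_norm (P1 n))\<^sup>2 * (frob_norm (transpose_mat (P1 n)))\<^sup>2)
        + 2 * (?N * (frob_norm (G n))\<^sup>2) * (frob_norm (P1 n * transpose_mat (P1 n)))\<^sup>2)"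
      by (rule nn_integral_quadratic_form_le[OF carriers(1) G[OF elim] P1t])
    also have "\<dots> \<le> ennreal (2 * (C + 2) * (c1\<^sup>2 * ?N) * ((c1 * ?T) * (c1 * ?T)) + 2 * (?N * (c1\<^sup>2 * ?N)) * (c1 * (c1 * ?T)))"
      using C c1(1) g pp frob_P1_power2[of n] by (intro ennreal_leI add_mono mult_mono) auto
    also have "\<dots> \<le> ennreal (?c * (?N * ?T * \<eta> n)\<^sup>2)"
    proof (rule ennreal_leI)
      have e: "(?N * ?T * \<eta> n)\<^sup>2 = ?N * ?T\<^sup>2 + ?N\<^sup>2 * ?T + 2 * (?N * ?T) * (sqrt ?N * sqrt ?T)"
      proof -
        have "?N * ?T * \<eta> n = sqrt ?N * ?T + ?N * sqrt ?T"
        proof -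
          have "?N * ?T * \<eta> n = (?N / sqrt ?N) * ?T + ?N * (?T / sqrt ?T)" by (simp add: \<eta>_def distrib_left)
          then show ?thesis using NT by (simp add: real_div_sqrt)
        qed
        then show ?thesis using NT by (simp add: power2_sum power_mult_distrib mult_ac)
      qed
      have "2 * (C + 2) * (c1\<^sup>2 * ?N) * ((c1 * ?T) * (c1 * ?T)) + 2 * (?N * (c1\<^sup>2 * ?N)) * (c1 * (c1 * ?T))
         = c1 ^ 4 * (2 * (C + 2) * (?N * ?T\<^sup>2) + 2 * (?N\<^sup>2 * ?T))"
        by (simp add: power2_eq_square eval_nat_numeral algebra_simps)
      also have "\<dots> \<le> c1 ^ 4 * (2 * (C + 2) * (?N * ?T\<^sup>2) + 2 * (C + 2) * (?N\<^sup>2 * ?T))"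
        using C c1(1) by (intro mult_left_mono add_mono mult_right_mono) auto
      also have "\<dots> = ?c * (?N * ?T\<^sup>2 + ?N\<^sup>2 * ?T)" by (simp add: algebra_simps)
      also have "\<dots> \<le> ?c * (?N * ?T * \<eta> n)\<^sup>2"
        unfolding e using C c1(1) NT by (intro mult_left_mono) auto
      finally show "2 * (C + 2) * (c1\<^sup>2 * ?N) * ((c1 * ?T) * (c1 * ?T)) + 2 * (?N * (c1\<^sup>2 * ?N)) * (c1 * (c1 * ?T)) \<le> ?c * (?N * ?T * \<eta> n)\<^sup>2" .
    qed
    finally show ?case using measurable_frob_norm_power2[OF random_EDE[OF elim]] NT by (simp add: \<eta>_def add_pos_pos)
  qed
qed

end

lemma frob_norm_single_col:
  assumes A: "A \<in> carrier_mat m 1"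
  shows "frob_norm A = eucl_norm (col A 0)"
proof -
  have "(frob_norm A)\<^sup>2 = (eucl_norm (col A 0))\<^sup>2" unfolding frob_norm_col_sum[OF A] by simp
  then show ?thesis by (simp add: power2_eq_iff_nonneg)
qed

section \<open>Rates at a single time point\<close>

context ppca_asymptotics
begin

text \<open>The order of column t of E D^-1 E^T: the mean contributes d \<surd>N, the fluctuation d
  \<surd>T. Divided by \<surd>N T it becomes the ratio of the theorem.\<close>

definition a where "a n = d n * max (sqrt (real (N n))) (sqrt (real (T n)))"

lemma a_pos: "big n \<Longrightarrow> 0 < a n"
  using d by (auto simp: a_def big_def less_max_iff_disj intro!: mult_pos_pos)

lemma a_power2_ge: "(d n)\<^sup>2 * (real (N n) + real (T n)) \<le> 2 * (a n)\<^sup>2"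
proof -
  have "real (N n) \<le> (max (sqrt (real (N n))) (sqrt (real (T n))))\<^sup>2" "real (T n) \<le> (max (sqrt (real (N n))) (sqrt (real (T n))))\<^sup>2"
    by (auto simp: max_def)
  then have "real (N n) + real (T n) \<le> 2 * (max (sqrt (real (N n))) (sqrt (real (T n))))\<^sup>2" by linarith
  from mult_left_mono[OF this, of "(d n)\<^sup>2"] show ?thesis by (simp add: a_def power_mult_distrib mult_ac)
qed

text \<open>The assumption on E|v^T F|^2 for unit vectors, rescaled to an arbitrary column.\<close>

lemma nn_integral_F_le:
  assumes b: "big n" and W: "W \<in> carrier_mat (T n) 1"
  shows "(\<integral>\<^sup>+ \<omega>. ennreal ((frob_norm (transpose_mat (F n \<omega>) * W))\<^sup>2) \<partial>M) \<le> ennreal (C * (frob_norm W)\<^sup>2)"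
proof -
  have m: "(\<lambda>\<omega>. (frob_norm (transpose_mat (F n \<omega>) * W'))\<^sup>2) \<in> borel_measurable M" if "W' \<in> carrier_mat (T n) 1" for W'
    using random_matrix_mult[OF random_matrix_transpose[OF F] random_matrix_const[OF that]] by (rule measurable_frob_norm_power2)
  have FW: "transpose_mat (F n \<omega>) * W \<in> carrier_mat r 1" if "\<omega> \<in> space M" for \<omega>
    using SF(2)[OF that, of n] by (intro mult_carrier_mat[OF _ W]) simp
  have cW: "col W 0 \<in> carrier_vec (T n)" using col_dim[of W 0] W by auto
  show ?thesis
  proof (cases "frob_norm W = 0")
    case True
    have "frob_norm (transpose_mat (F n \<omega>) * W) = 0" if "\<omega> \<in> space M" for \<omega>
    proof -
      have "frob_norm (transpose_mat (F n \<omega>) * W) \<le> frob_norm (transpose_mat (F n \<omega>)) * frob_norm W"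
        using SF(2)[OF that, of n] W by (intro frob_norm_mult_le[of _ r "T n"]) auto
      then show ?thesis using True frob_norm_nonneg[of "transpose_mat (F n \<omega>) * W"] by simp
    qed
    then have "(\<integral>\<^sup>+ \<omega>. ennreal ((frob_norm (transpose_mat (F n \<omega>) * W))\<^sup>2) \<partial>M) = (\<integral>\<^sup>+ \<omega>. 0 \<partial>M)" by (intro nn_integral_cong) simp
    then show ?thesis by simp
  next
    case False
    define w where "w = frob_norm W"
    have w: "0 < w" using False frob_norm_nonneg[of W] by (simp add: w_def order_less_le)
    define v where "v = (1 / w) \<cdot>\<^sub>v col W 0"
    have v: "v \<in> carrier_vec (T n)" "eucl_norm v = 1"
      using cW w by (auto simp: v_def eucl_norm_smult frob_norm_single_col[OF W] w_def)
    have eq: "(eucl_norm (transpose_mat (F n \<omega>) *\<^sub>v v))\<^sup>2 = (1 / w)\<^sup>2 * (frob_norm (transpose_mat (F n \<omega>) * W))\<^sup>2" if "\<omega> \<in> space M" for \<omega>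
    proof -
      have Ft: "transpose_mat (F n \<omega>) \<in> carrier_mat r (T n)" using SF[OF that] by simp
      have "transpose_mat (F n \<omega>) *\<^sub>v v = (1 / w) \<cdot>\<^sub>v (transpose_mat (F n \<omega>) *\<^sub>v col W 0)"
        unfolding v_def by (rule mult_mat_vec[OF Ft cW])
      also have "transpose_mat (F n \<omega>) *\<^sub>v col W 0 = col (transpose_mat (F n \<omega>) * W) 0"
        using Ft W by (intro col_mult2[symmetric]) auto
      finally show ?thesis using w by (simp add: eucl_norm_smult frob_norm_single_col[OF FW[OF that]] power_mult_distrib power_divide)
    qed
    have bnd: "(\<integral>\<omega>. (eucl_norm (transpose_mat (F n \<omega>) *\<^sub>v v))\<^sup>2 \<partial>M) \<le> C"
      using factors v unfolding factor_assumption_def by blast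
    \<comment> \<open>A Bochner integral is 0 by default for nonintegrable functions, so a bound on
      it is meaningful only together with integrability. Here the integrand is almost surely
      bounded, since the factors have almost surely constant norm.\<close>
    have int: "integrable M (\<lambda>\<omega>. (frob_norm (transpose_mat (F n \<omega>) * W))\<^sup>2)"
    proof (rule integrable_const_bound[OF _ m[OF W]])
      show "AE \<omega> in M. norm ((frob_norm (transpose_mat (F n \<omega>) * W))\<^sup>2) \<le> (sqrt (real (T n)) * sqrt (real r) * frob_norm W)\<^sup>2"
        using AE_frob_F[OF b] AE_space
      proof eventually_elim
        fix \<omega> assume f: "frob_norm (F n \<omega>) = sqrt (real (T n)) * sqrt (real r)" and w: "\<omega> \<in> space M"
        have Ft: "transpose_mat (F n \<omega>) \<in> carrier_mat r (T n)" using SF[OF w] by simp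
        have "frob_norm (transpose_mat (F n \<omega>) * W) \<le> sqrt (real (T n)) * sqrt (real r) * frob_norm W"
          using frob_norm_mult_le[OF Ft W] f by simp
        then show "norm ((frob_norm (transpose_mat (F n \<omega>) * W))\<^sup>2) \<le> (sqrt (real (T n)) * sqrt (real r) * frob_norm W)\<^sup>2"
          by (simp add: power_mono del: power_mult_distrib)
      qed
    qed
    have "(\<integral>\<omega>. (eucl_norm (transpose_mat (F n \<omega>) *\<^sub>v v))\<^sup>2 \<partial>M) = (\<integral>\<omega>. (1 / w)\<^sup>2 * (frob_norm (transpose_mat (F n \<omega>) * W))\<^sup>2 \<partial>M)"
      by (intro Bochner_Integration.integral_cong refl eq)
    also have "\<dots> = (1 / w)\<^sup>2 * (\<integral>\<omega>. (frob_norm (transpose_mat (F n \<omega>) * W))\<^sup>2 \<partial>M)"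
      by (rule Bochner_Integration.integral_mult_right_zero)
    finally have "(\<integral>\<omega>. (frob_norm (transpose_mat (F n \<omega>) * W))\<^sup>2 \<partial>M) \<le> C * w\<^sup>2"
      using mult_left_mono[OF bnd, of "w\<^sup>2"] w by (simp add: field_simps power_divide)
    then show ?thesis using int by (subst nn_integral_eq_integral) (auto simp: w_def intro!: ennreal_leI)
  qed
qed

lemma EDE_unit_eq:
  assumes b: "big n" and w: "\<omega> \<in> space M"
  shows "EDE n \<omega> * unit_col (T n) t = P1 n * S n \<omega> * G n * transpose_mat (S n \<omega>) * (transpose_mat (P1 n) * unit_col (T n) t)"
    and "transpose_mat (F n \<omega>) * (EDE n \<omega> * unit_col (T n) t)
      = transpose_mat (F n \<omega>) * P1 n * S n \<omega> * G n * transpose_mat (S n \<omega>) * (transpose_mat (P1 n) * unit_col (T n) t)"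
proof -
  note P1 = carriers(1)[of n] and Sw = SF(1)[OF w, of n]
  have t: "transpose_mat (S n \<omega>) \<in> carrier_mat (N n) (T n)" "transpose_mat (P1 n) \<in> carrier_mat (T n) (T n)"
    and Ft: "transpose_mat (F n \<omega>) \<in> carrier_mat r (T n)" using P1 Sw SF[OF w] by auto
  note PS = mult_carrier_mat[OF P1 Sw]
  note PSG = mult_carrier_mat[OF PS G[OF b]]
  note PSGS = mult_carrier_mat[OF PSG t(1)]
  note Y = mult_carrier_mat[OF t(2) unit_col(1)[of "T n" t]]
  show 1: "EDE n \<omega> * unit_col (T n) t = P1 n * S n \<omega> * G n * transpose_mat (S n \<omega>) * (transpose_mat (P1 n) * unit_col (T n) t)"
    unfolding EDE_eq[OF b w] by (rule assoc_mult_mat[OF PSGS t(2) unit_col(1)])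
  show "transpose_mat (F n \<omega>) * (EDE n \<omega> * unit_col (T n) t)
      = transpose_mat (F n \<omega>) * P1 n * S n \<omega> * G n * transpose_mat (S n \<omega>) * (transpose_mat (P1 n) * unit_col (T n) t)"
    unfolding 1 assoc_mult_mat[OF Ft PSGS Y, symmetric] assoc_mult_mat[OF Ft PSG t(1), symmetric]
      assoc_mult_mat[OF Ft PS G[OF b], symmetric] assoc_mult_mat[OF Ft P1 Sw, symmetric] ..
qed

text \<open>Arithmetic shared by the two estimates below: the fluctuation brings a factor T, the
  mean a factor N, and d^2 (N + T) \<le> 2 a^2 absorbs both.\<close>

lemma quadratic_bound_le_a:
  assumes "x \<le> c1\<^sup>2 * (d n)\<^sup>2" "y \<le> k * real (T n)" "u \<le> l" and "0 \<le> x" "0 \<le> y" "0 \<le> u" "0 \<le> k" "0 \<le> l"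
    and "p \<le> m" "0 \<le> p"
  shows "2 * (C + 2) * x * (y * u) + 2 * (real (N n) * x) * p \<le> 4 * (C + 2) * c1\<^sup>2 * (k * l + m) * (a n)\<^sup>2"
proof -
  have m: "0 \<le> m" using assms by linarith
  have h1: "2 * (C + 2) * x * (y * u) + 2 * (real (N n) * x) * p
      \<le> 2 * (C + 2) * (c1\<^sup>2 * (d n)\<^sup>2) * ((k * real (T n)) * l) + 2 * (real (N n) * (c1\<^sup>2 * (d n)\<^sup>2)) * m"
    using assms C by (intro add_mono mult_mono) auto
  have h2: "2 * (real (N n) * (c1\<^sup>2 * (d n)\<^sup>2)) * m \<le> 2 * (C + 2) * (c1\<^sup>2 * (d n)\<^sup>2) * (real (N n) * m)"
  proof -
    have "2 * (c1\<^sup>2 * (d n)\<^sup>2 * (real (N n) * m)) \<le> 2 * (C + 2) * (c1\<^sup>2 * (d n)\<^sup>2 * (real (N n) * m))"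
      using C m by (intro mult_right_mono) auto
    then show ?thesis by (simp add: mult_ac)
  qed
  have "2 * (C + 2) * x * (y * u) + 2 * (real (N n) * x) * p
      \<le> 2 * (C + 2) * (c1\<^sup>2 * (d n)\<^sup>2) * ((k * real (T n)) * l) + 2 * (C + 2) * (c1\<^sup>2 * (d n)\<^sup>2) * (real (N n) * m)"
    by (rule order_trans[OF h1 add_left_mono[OF h2]])
  also have "\<dots> = 2 * (C + 2) * c1\<^sup>2 * (d n)\<^sup>2 * (k * l * real (T n) + m * real (N n))" by (simp add: algebra_simps)
  also have "\<dots> \<le> 2 * (C + 2) * c1\<^sup>2 * (d n)\<^sup>2 * ((k * l + m) * (real (N n) + real (T n)))"
    using C assms m by (intro mult_left_mono) (auto simp: algebra_simps)
  also have "\<dots> = 2 * (C + 2) * c1\<^sup>2 * (k * l + m) * ((d n)\<^sup>2 * (real (N n) + real (T n)))" by (simp only: mult_ac)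
  also have "\<dots> \<le> 2 * (C + 2) * c1\<^sup>2 * (k * l + m) * (2 * (a n)\<^sup>2)"
    using C assms m by (intro mult_left_mono a_power2_ge) auto
  also have "\<dots> = 4 * (C + 2) * c1\<^sup>2 * (k * l + m) * (a n)\<^sup>2" by (simp only: mult_ac)
  finally show ?thesis .
qed

lemma bounded_EDE_unit: "bounded_in_prob M (\<lambda>n \<omega>. frob_norm (EDE n \<omega> * unit_col (T n) t)) a"
proof (rule bounded_in_prob_Markov)
  let ?c = "4 * (C + 2) * c1\<^sup>2 * (c1 * c1 + c1 * c1)"
  show "0 < ?c" using c1(1) C by (intro mult_pos_pos) auto
  show "\<forall>\<^sub>F n in sequentially. 0 < a n \<and> (\<lambda>\<omega>. (frob_norm (EDE n \<omega> * unit_col (T n) t))\<^sup>2) \<in> borel_measurable M \<and>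
     (\<integral>\<^sup>+ \<omega>. ennreal ((frob_norm (EDE n \<omega> * unit_col (T n) t))\<^sup>2) \<partial>M) \<le> ennreal (?c * (a n)\<^sup>2)"
    using eventually_big eventually_T_gt[of t]
  proof eventually_elim
    case (elim n)
    interpret noise_matrix M "T n" "N n" C "S n" by (rule noise_matrix)
    let ?Y = "transpose_mat (P1 n) * unit_col (T n) t"
    have Y: "?Y \<in> carrier_mat (T n) 1"
      using carriers(1)[of n] by (intro mult_carrier_mat[OF _ unit_col(1)]) simp
    have pY: "(frob_norm (P1 n * ?Y))\<^sup>2 \<le> c1 * c1"
    proof -
      have "(frob_norm (P1 n * ?Y))\<^sup>2 \<le> c1 * (frob_norm ?Y)\<^sup>2"
        using power_mono[OF P1_mult[OF Y], of 2] c1(1) by (simp add: power_mult_distrib)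
      then show ?thesis using mult_left_mono[OF frob_P1t_unit[OF elim(2)], of c1] c1(1) by linarith
    qed
    have "(\<integral>\<^sup>+ \<omega>. ennreal ((frob_norm (EDE n \<omega> * unit_col (T n) t))\<^sup>2) \<partial>M)
       = (\<integral>\<^sup>+ \<omega>. ennreal ((frob_norm (P1 n * S n \<omega> * G n * transpose_mat (S n \<omega>) * ?Y))\<^sup>2) \<partial>M)"
      by (intro nn_integral_cong) (simp add: EDE_unit_eq[OF elim(1)])
    also have "\<dots> \<le> ennreal (2 * (C + 2) * (frob_norm (G n))\<^sup>2 * ((frob_norm (P1 n))\<^sup>2 * (frob_norm ?Y)\<^sup>2)
        + 2 * (real (N n) * (frob_norm (G n))\<^sup>2) * (frob_norm (P1 n * ?Y))\<^sup>2)"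
      by (rule nn_integral_quadratic_form_le[OF carriers(1) G[OF elim(1)] Y])
    also have "\<dots> \<le> ennreal (?c * (a n)\<^sup>2)"
      using c1(1) by (intro ennreal_leI quadratic_bound_le_a frob_G[OF elim(1)] frob_P1_power2 frob_P1t_unit[OF elim(2)] pY) auto
    finally show ?case using measurable_frob_norm_power2[OF random_EDE_unit[OF elim(1)]] a_pos[OF elim(1)] by simp
  qed
qed

text \<open>Multiplication by F^T does not worsen the rate. In the mean part the fixed vector P1
  P1^T u_t meets F^T, and the second moment assumption keeps that product bounded; in the
  fluctuation |F^T P1|^2 has the order T that |P1|^2 has without F.\<close>

lemma bounded_FEDE_unit: "bounded_in_prob M (\<lambda>n \<omega>. frob_norm (transpose_mat (F n \<omega>) * (EDE n \<omega> * unit_col (T n) t))) a"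
proof (rule bounded_in_prob_Markov)
  let ?c = "4 * (C + 2) * c1\<^sup>2 * (c1 * real r * c1 + C * (c1 * c1))"
  show "0 < ?c" using c1(1) C r by (intro mult_pos_pos add_pos_pos) auto
  show "\<forall>\<^sub>F n in sequentially. 0 < a n \<and> (\<lambda>\<omega>. (frob_norm (transpose_mat (F n \<omega>) * (EDE n \<omega> * unit_col (T n) t)))\<^sup>2) \<in> borel_measurable M \<and>
     (\<integral>\<^sup>+ \<omega>. ennreal ((frob_norm (transpose_mat (F n \<omega>) * (EDE n \<omega> * unit_col (T n) t)))\<^sup>2) \<partial>M) \<le> ennreal (?c * (a n)\<^sup>2)"
    using eventually_big eventually_T_gt[of t]
  proof eventually_elim
    case (elim n)
    interpret noise_matrix M "T n" "N n" C "S n" by (rule noise_matrix)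
    let ?Y = "transpose_mat (P1 n) * unit_col (T n) t"
    let ?A = "\<lambda>\<omega>. transpose_mat (F n \<omega>) * P1 n"
    have Y: "?Y \<in> carrier_mat (T n) 1"
      using carriers(1)[of n] by (intro mult_carrier_mat[OF _ unit_col(1)]) simp
    have P1Y: "P1 n * ?Y \<in> carrier_mat (T n) 1" by (rule mult_carrier_mat[OF carriers(1) Y])
    have pY: "(frob_norm (P1 n * ?Y))\<^sup>2 \<le> c1 * c1"
    proof -
      have "(frob_norm (P1 n * ?Y))\<^sup>2 \<le> c1 * (frob_norm ?Y)\<^sup>2"
        using power_mono[OF P1_mult[OF Y], of 2] c1(1) by (simp add: power_mult_distrib)
      then show ?thesis using mult_left_mono[OF frob_P1t_unit[OF elim(2)], of c1] c1(1) by linarith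
    qed
    let ?x = "(frob_norm (G n))\<^sup>2" and ?y = "c1 * real r * real (T n)"
    have FAY: "?A \<omega> * ?Y = transpose_mat (F n \<omega>) * (P1 n * ?Y)" if "\<omega> \<in> space M" for \<omega>
      using SF(2)[OF that, of n] by (intro assoc_mult_mat[OF _ carriers(1) Y]) simp
    have m: "(\<lambda>\<omega>. (frob_norm (transpose_mat (F n \<omega>) * (P1 n * ?Y)))\<^sup>2) \<in> borel_measurable M"
      by (rule measurable_frob_norm_power2[OF random_matrix_mult[OF random_matrix_transpose[OF F] random_matrix_const[OF P1Y]]])
    have "(\<integral>\<^sup>+ \<omega>. ennreal ((frob_norm (transpose_mat (F n \<omega>) * (EDE n \<omega> * unit_col (T n) t)))\<^sup>2) \<partial>M)
       = (\<integral>\<^sup>+ \<omega>. ennreal ((frob_norm (?A \<omega> * S n \<omega> * G n * transpose_mat (S n \<omega>) * ?Y))\<^sup>2) \<partial>M)"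
      by (intro nn_integral_cong) (simp only: EDE_unit_eq(2)[OF elim(1)])
    also have "\<dots> \<le> (\<integral>\<^sup>+ \<omega>. ennreal (2 * (C + 2) * ?x * ((frob_norm (?A \<omega>))\<^sup>2 * (frob_norm ?Y)\<^sup>2)
        + 2 * (real (N n) * ?x) * (frob_norm (?A \<omega> * ?Y))\<^sup>2) \<partial>M)"
      by (rule nn_integral_quadratic_form_independent_le[OF F indepSF carriers(1) G[OF elim(1)] Y])
    \<comment> \<open>The fluctuation term is bounded almost surely through the norm of F, while the
      mean term stays random and is integrated over F afterwards.\<close>
    also have "\<dots> \<le> (\<integral>\<^sup>+ \<omega>. ennreal (2 * (C + 2) * ?x * (?y * (frob_norm ?Y)\<^sup>2))
        + ennreal (2 * (real (N n) * ?x)) * ennreal ((frob_norm (transpose_mat (F n \<omega>) * (P1 n * ?Y)))\<^sup>2) \<partial>M)"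
      using AE_FP1[OF elim(1)] AE_space
    proof (intro nn_integral_mono_AE, eventually_elim)
      fix \<omega> assume f: "(frob_norm (?A \<omega>))\<^sup>2 \<le> ?y" and w: "\<omega> \<in> space M"
      have "2 * (C + 2) * ?x * ((frob_norm (?A \<omega>))\<^sup>2 * (frob_norm ?Y)\<^sup>2) \<le> 2 * (C + 2) * ?x * (?y * (frob_norm ?Y)\<^sup>2)"
        using f C by (intro mult_left_mono mult_right_mono) auto
      then have "ennreal (2 * (C + 2) * ?x * ((frob_norm (?A \<omega>))\<^sup>2 * (frob_norm ?Y)\<^sup>2) + 2 * (real (N n) * ?x) * (frob_norm (?A \<omega> * ?Y))\<^sup>2)
         \<le> ennreal (2 * (C + 2) * ?x * (?y * (frob_norm ?Y)\<^sup>2) + 2 * (real (N n) * ?x) * (frob_norm (?A \<omega> * ?Y))\<^sup>2)"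
        by (intro ennreal_leI add_right_mono)
      also have "\<dots> = ennreal (2 * (C + 2) * ?x * (?y * (frob_norm ?Y)\<^sup>2)) + ennreal (2 * (real (N n) * ?x)) * ennreal ((frob_norm (?A \<omega> * ?Y))\<^sup>2)"
        using C c1(1) by (simp add: ennreal_plus[symmetric] ennreal_mult[symmetric] del: ennreal_plus)
      finally show "ennreal (2 * (C + 2) * ?x * ((frob_norm (?A \<omega>))\<^sup>2 * (frob_norm ?Y)\<^sup>2) + 2 * (real (N n) * ?x) * (frob_norm (?A \<omega> * ?Y))\<^sup>2)
         \<le> ennreal (2 * (C + 2) * ?x * (?y * (frob_norm ?Y)\<^sup>2)) + ennreal (2 * (real (N n) * ?x)) * ennreal ((frob_norm (transpose_mat (F n \<omega>) * (P1 n * ?Y)))\<^sup>2)"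
        unfolding FAY[OF w] .
    qed
    also have "\<dots> = ennreal (2 * (C + 2) * ?x * (?y * (frob_norm ?Y)\<^sup>2)) + ennreal (2 * (real (N n) * ?x)) * (\<integral>\<^sup>+ \<omega>. ennreal ((frob_norm (transpose_mat (F n \<omega>) * (P1 n * ?Y)))\<^sup>2) \<partial>M)"
      using m by (subst nn_integral_add, simp, simp, subst nn_integral_cmult) (auto simp: emeasure_space_1)
    also have "\<dots> \<le> ennreal (2 * (C + 2) * ?x * (?y * (frob_norm ?Y)\<^sup>2)) + ennreal (2 * (real (N n) * ?x)) * ennreal (C * (frob_norm (P1 n * ?Y))\<^sup>2)"
      by (intro add_left_mono mult_left_mono nn_integral_F_le[OF elim(1) P1Y]) simp
    also have "\<dots> = ennreal (2 * (C + 2) * ?x * (?y * (frob_norm ?Y)\<^sup>2) + 2 * (real (N n) * ?x) * (C * (frob_norm (P1 n * ?Y))\<^sup>2))"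
      using C c1(1) by (simp add: ennreal_plus[symmetric] ennreal_mult[symmetric] del: ennreal_plus)
    also have "\<dots> \<le> ennreal (?c * (a n)\<^sup>2)"
      using c1(1) C by (intro ennreal_leI quadratic_bound_le_a frob_G[OF elim(1)] frob_P1t_unit[OF elim(2)] mult_left_mono pY) auto
    finally show ?case using measurable_frob_norm_power2[OF random_FEDE_unit[OF elim(1)]] a_pos[OF elim(1)] by simp
  qed
qed

lemma bounded_F_row: "bounded_in_prob M (\<lambda>n \<omega>. frob_norm (transpose_mat (F n \<omega>) * unit_col (T n) t)) (\<lambda>_. 1)"
proof (rule bounded_in_prob_Markov[OF C])
  show "\<forall>\<^sub>F n in sequentially. 0 < (1::real) \<and> (\<lambda>\<omega>. (frob_norm (transpose_mat (F n \<omega>) * unit_col (T n) t))\<^sup>2) \<in> borel_measurable M \<and>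
     (\<integral>\<^sup>+ \<omega>. ennreal ((frob_norm (transpose_mat (F n \<omega>) * unit_col (T n) t))\<^sup>2) \<partial>M) \<le> ennreal (C * 1\<^sup>2)"
    using eventually_big eventually_T_gt[of t]
  proof eventually_elim
    case (elim n)
    have "random_matrix M r 1 (\<lambda>\<omega>. transpose_mat (F n \<omega>) * unit_col (T n) t)"
      by (rule random_matrix_mult[OF random_matrix_transpose[OF F] random_matrix_const[OF unit_col(1)]])
    then show ?case using nn_integral_F_le[OF elim(1) unit_col(1), of t] measurable_frob_norm_power2
      by (simp add: frob_norm_unit_col[OF elim(2)])
  qed
qed

text \<open>Up to the factor \<surd>N this row is \<open>Z\<close>, so a second moment provides the
  tightness that Slutsky's theorem asks for.\<close>

lemma bounded_EDB_row: "bounded_in_prob M (\<lambda>n \<omega>. frob_norm (transpose_mat (unit_col (T n) t) * EDB n \<omega>)) (\<lambda>n. sqrt (real (N n)))"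
proof (rule bounded_in_prob_Markov)
  show "0 < c1 * c1 * (real r * C\<^sup>2)" using c1(1) C r by simp
  show "\<forall>\<^sub>F n in sequentially. 0 < sqrt (real (N n)) \<and> (\<lambda>\<omega>. (frob_norm (transpose_mat (unit_col (T n) t) * EDB n \<omega>))\<^sup>2) \<in> borel_measurable M \<and>
     (\<integral>\<^sup>+ \<omega>. ennreal ((frob_norm (transpose_mat (unit_col (T n) t) * EDB n \<omega>))\<^sup>2) \<partial>M) \<le> ennreal (c1 * c1 * (real r * C\<^sup>2) * (sqrt (real (N n)))\<^sup>2)"
    using eventually_big eventually_T_gt[of t]
  proof eventually_elim
    case (elim n)
    interpret noise_matrix M "T n" "N n" C "S n" by (rule noise_matrix)
    let ?u = "transpose_mat (unit_col (T n) t)"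
    have uP: "?u * P1 n \<in> carrier_mat 1 (T n)" by (rule mult_carrier_mat[OF unit_col(2) carriers(1)])
    have "frob_norm (?u * P1 n) = frob_norm (transpose_mat (P1 n) * unit_col (T n) t)"
      using frob_norm_transpose[of "?u * P1 n"] transpose_mult[OF unit_col(2) carriers(1)] by simp
    then have uP': "(frob_norm (?u * P1 n))\<^sup>2 \<le> c1" using frob_P1t_unit[OF elim(2)] by simp
    have eq: "?u * EDB n \<omega> = ?u * P1 n * S n \<omega> * (P2 n * D n * B n)" if w: "\<omega> \<in> space M" for \<omega>
      unfolding EDB_eq[OF elim(1) w]
      using assoc_mult_mat[OF unit_col(2) mult_carrier_mat[OF carriers(1) SF(1)[OF w]] P2DB[OF elim(1)]] assoc_mult_mat[OF unit_col(2) carriers(1) SF(1)[OF w]] by simp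
    have "(\<integral>\<^sup>+ \<omega>. ennreal ((frob_norm (?u * EDB n \<omega>))\<^sup>2) \<partial>M) = (\<integral>\<^sup>+ \<omega>. ennreal ((frob_norm (?u * P1 n * S n \<omega> * (P2 n * D n * B n)))\<^sup>2) \<partial>M)"
      by (intro nn_integral_cong) (simp add: eq)
    also have "\<dots> \<le> ennreal ((frob_norm (?u * P1 n))\<^sup>2 * (frob_norm (P2 n * D n * B n))\<^sup>2)"
      by (rule nn_integral_linear_form_le[OF uP P2DB[OF elim(1)]])
    also have "\<dots> \<le> ennreal (c1 * (c1 * (real r * C\<^sup>2) * real (N n)))"
      using c1(1) by (intro ennreal_leI mult_mono uP' frob_P2DB[OF elim(1)]) auto
    also have "c1 * (c1 * (real r * C\<^sup>2) * real (N n)) = c1 * c1 * (real r * C\<^sup>2) * (sqrt (real (N n)))\<^sup>2" by simp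
    finally show ?case
      using measurable_frob_norm_power2[OF random_matrix_mult[OF random_matrix_const[OF unit_col(2)] random_EDB[OF elim(1)]]] elim(1) by (simp add: big_def)
  qed
qed

end

section \<open>Control of the remainder and the stochastic order of the score error\<close>

lemma zero_less_one_real: "0 < (1::real)"
  by simp

lemma (in prob_space) bounded_in_prob_scale:
  assumes Y: "bounded_in_prob M Y a" and c: "\<forall>\<^sub>F n in sequentially. 0 \<le> c n"
  shows "bounded_in_prob M (\<lambda>n \<omega>. c n * Y n \<omega>) (\<lambda>n. c n * a n)"
proof (rule bounded_in_prob_combine[OF Y Y])
  fix K L :: real assume K: "0 < K"
  from c have "\<forall>\<^sub>F n in sequentially. \<forall>\<omega>\<in>space M. Y n \<omega> \<le> K * a n \<longrightarrow> Y n \<omega> \<le> L * a n \<longrightarrow> c n * Y n \<omega> \<le> K * (c n * a n)"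
  proof eventually_elim
    case (elim n)
    have "c n * y \<le> K * (c n * a n)" if "y \<le> K * a n" for y
      using mult_left_mono[OF that elim] by (simp add: mult_ac)
    then show ?case by blast
  qed
  then show "\<exists>J>0. \<forall>\<^sub>F n in sequentially. \<forall>\<omega>\<in>space M. Y n \<omega> \<le> K * a n \<longrightarrow> Y n \<omega> \<le> L * a n \<longrightarrow> c n * Y n \<omega> \<le> J * (c n * a n)"
    using K by blast
qed

lemma (in prob_space) bounded_in_prob_le_rate:
  assumes Y: "bounded_in_prob M Y a" and c: "0 < c" and ab: "\<forall>\<^sub>F n in sequentially. a n \<le> c * b n"
  shows "bounded_in_prob M Y b"
  by (rule bounded_in_prob_mono[OF Y whp_sure c ab]) simp

text \<open>Separates the factors x and y, bounded by constants on the good event, from the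
  stochastic products, so that rates need to be computed for the latter only. The surplus cross
  terms are nonnegative and added for free.\<close>

lemma remainder_factorization:
  fixes c x l y h p q D s t :: real
  assumes "0 \<le> c" "0 \<le> x" "x \<le> l" "0 \<le> y" "y \<le> h" "0 \<le> p" "0 \<le> q" "0 \<le> D" "0 \<le> s" "0 \<le> t"
  shows "c * (x * (y * p + D * (s * t) * x * q)) \<le> (l * (h + t * l)) * (c * (p + D * s * q))"
proof -
  have l: "0 \<le> l" and h: "0 \<le> h" using assms by linarith+
  have Dsq: "0 \<le> D * s * q" using assms by simp
  have "y * p \<le> h * p" using assms by (intro mult_right_mono)
  moreover have "x * (t * (D * s * q)) \<le> l * (t * (D * s * q))" using assms Dsq by (intro mult_right_mono) auto
  moreover have "0 \<le> h * (D * s * q)" "0 \<le> t * l * p" using assms l h Dsq by simp_all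
  ultimately have 1: "y * p + D * (s * t) * x * q \<le> (h + t * l) * (p + D * s * q)" by (simp add: algebra_simps)
  have "0 \<le> (h + t * l) * (p + D * s * q)" using assms l h Dsq by simp
  then have "x * (y * p + D * (s * t) * x * q) \<le> l * ((h + t * l) * (p + D * s * q))"
    using mult_left_mono[OF 1 assms(2)] mult_right_mono[OF assms(3)] by (meson order_trans)
  from mult_left_mono[OF this assms(1)] show ?thesis by (simp add: mult_ac)
qed

text \<open>\<Omega> is a combination of B^T B / N with weight 1 / (1 + \<lambda>) and a matrix of
  rank one. For growing \<lambda> its smaller eigenvalues could vanish; the bound \<kappa> excludes
  this and keeps the inverse of the eigenvalue matrix bounded.\<close>

locale ppca_asymptotics_pd = ppca_asymptotics +
  fixes \<kappa> :: real
  assumes \<kappa>: "0 < \<kappa>"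
    and Om_pd: "\<forall>\<^sub>F n in sequentially. \<kappa> \<le> nth_eigenvalue (Omega_mat (N n) (lam n) (B n)) (r - 1)"
begin

definition ratio where "ratio n = d n / min (real (T n)) (sqrt (real (N n) * real (T n)))"
abbreviation X where "X n \<omega> \<equiv> F n \<omega> * transpose_mat (B n) + E n \<omega>"
abbreviation H where "H n \<omega> \<equiv> rotation_mat r (lam n) (X n \<omega>) (B n) (F n \<omega>) (Fh n \<omega>)"
definition Sh where "Sh n \<omega> = (1 / (real (N n) * real (T n))) \<cdot>\<^sub>m ppca_gram (lam n) (X n \<omega>)"
definition Li where "Li n \<omega> = mat_diag r (\<lambda>l. 1 / nth_eigenvalue (Sh n \<omega>) l)"
definition K where "K n \<omega> = (1 / real (T n)) \<cdot>\<^sub>m (transpose_mat (F n \<omega>) * Fh n \<omega>)"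
definition Dl where "Dl n \<omega> = (1 / (real (N n) * real (T n))) \<cdot>\<^sub>m
    (F n \<omega> * transpose_mat (EDB n \<omega>) + EDB n \<omega> * transpose_mat (F n \<omega>) + EDE n \<omega>)"
definition Z where "Z t n \<omega> = (1 / sqrt (real (N n))) \<cdot>\<^sub>v ((transpose_mat (B n) * D n) *\<^sub>v Matrix.row (E n \<omega>) t)"
definition err where "err t n \<omega> = Matrix.row (Fh n \<omega>) t - transpose_mat (H n \<omega>) *\<^sub>v Matrix.row (F n \<omega>) t"
definition rem where "rem t n \<omega> = eucl_norm (sqrt (real (N n)) \<cdot>\<^sub>v err t n \<omega> - (Li n \<omega> * transpose_mat (K n \<omega>)) *\<^sub>v Z t n \<omega>)"
text \<open>The event on which all pathwise bounds hold: normalized factors, and leading eigenvalues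
  at least \<kappa>/2, half of the bound for \<Omega>.\<close>

definition good where "good n \<omega> \<longleftrightarrow> big n \<and> \<omega> \<in> space M \<and> (1 / real (T n)) \<cdot>\<^sub>m (transpose_mat (F n \<omega>) * F n \<omega>) = 1\<^sub>m r \<and>
    (\<forall>l<r. \<kappa> / 2 \<le> nth_eigenvalue (Sh n \<omega>) l)"

lemma sample_eq:
  assumes s: "ppca_sample (N n) (T n) r (lam n) (B n) (F n \<omega>) (E n \<omega>) (Fh n \<omega>)"
  shows "ppca_sample.Sh (N n) (T n) (lam n) (B n) (F n \<omega>) (E n \<omega>) = Sh n \<omega>"
    and "ppca_sample.Li (N n) (T n) r (lam n) (B n) (F n \<omega>) (E n \<omega>) = Li n \<omega>"
    and "ppca_sample.K (T n) (F n \<omega>) (Fh n \<omega>) = K n \<omega>"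
    and "ppca_sample.EDB (N n) (lam n) (B n) (E n \<omega>) = EDB n \<omega>"
    and "ppca_sample.EDE (N n) (lam n) (E n \<omega>) = EDE n \<omega>"
    and "ppca_sample.Dl (N n) (T n) (lam n) (B n) (F n \<omega>) (E n \<omega>) = Dl n \<omega>"
  by (simp_all add: ppca_sample.Sh_def[OF s] ppca_sample.Li_def[OF s] ppca_sample.K_def[OF s] ppca_sample.EDB_def[OF s]
      ppca_sample.EDE_def[OF s] ppca_sample.Dl_def[OF s] Sh_def Li_def K_def EDB_def EDE_def Dl_def)

lemma goodD:
  assumes "good n \<omega>"
  shows "big n" "\<omega> \<in> space M" "ppca_sample_orth (N n) (T n) r (lam n) (B n) (F n \<omega>) (E n \<omega>) (Fh n \<omega>)"
    "ppca_sample (N n) (T n) r (lam n) (B n) (F n \<omega>) (E n \<omega>) (Fh n \<omega>)"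
    "\<And>l. l < r \<Longrightarrow> \<kappa> / 2 \<le> nth_eigenvalue (Sh n \<omega>) l"
  using assms sample_orth sample unfolding good_def by auto

lemma \<eta>_nonneg: "0 \<le> \<eta> n" by (simp add: \<eta>_def)

lemma \<eta>_le_2: "big n \<Longrightarrow> \<eta> n \<le> 2"
proof -
  assume "big n"
  then have "1 / sqrt (real (N n)) \<le> 1" "1 / sqrt (real (T n)) \<le> 1" by (auto simp: big_def)
  then show ?thesis unfolding \<eta>_def by linarith
qed

lemma \<eta>_tendsto: "\<eta> \<longlonglongrightarrow> 0"
proof -
  have "(\<lambda>n. 1 / sqrt (real (f n))) \<longlonglongrightarrow> 0" if f: "filterlim f at_top sequentially" for f :: "nat \<Rightarrow> nat"
  proof (rule tendsto_divide_0[OF tendsto_const filterlim_at_top_imp_at_infinity])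
    show "filterlim (\<lambda>n. sqrt (real (f n))) at_top sequentially"
      by (rule filterlim_compose[OF sqrt_at_top filterlim_compose[OF filterlim_real_sequentially f]])
  qed
  from tendsto_add[OF this[OF N] this[OF T]] show ?thesis unfolding \<eta>_def by simp
qed

lemma ratio_nonneg: "0 \<le> ratio n"
  by (simp add: ratio_def d_def)

text \<open>With x = \<surd>N and y = \<surd>T the minimum is y min(x, y), and min(x, y) max(x, y) =
  x y.\<close>

lemma ratio_eq: "big n \<Longrightarrow> ratio n = a n / (sqrt (real (N n)) * real (T n))"
proof -
  assume "big n"
  then have p: "0 < sqrt (real (N n))" "0 < sqrt (real (T n))" by (auto simp: big_def)
  define x y where "x = sqrt (real (N n))" and "y = sqrt (real (T n))"
  have T': "real (T n) = y * y" by (simp add: y_def)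
  have xy: "0 < x" "0 < y" using p by (auto simp: x_def y_def)
  have "d n / min (y * y) (x * y) = d n * max x y / (x * (y * y))"
  proof (cases "x \<le> y")
    case True
    then have "min (y * y) (x * y) = x * y" "max x y = y" using xy by (auto simp: min_def)
    then show ?thesis using xy by simp
  next
    case False
    then have "min (y * y) (x * y) = y * y" "max x y = x" using xy by (auto simp: min_def)
    then show ?thesis using xy by simp
  qed
  then show ?thesis unfolding ratio_def a_def T' real_sqrt_mult x_def[symmetric] using xy by (simp add: real_sqrt_mult y_def)
qed

text \<open>The two mixed terms are of order \<surd>T \<surd>(N T) / (N T) = 1 / \<surd>N, the pure
  noise term of order \<eta>.\<close>

lemma bounded_Dl: "bounded_in_prob M (\<lambda>n \<omega>. frob_norm (Dl n \<omega>)) \<eta>"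
proof -
  let ?W = "\<lambda>n \<omega>. 1 / (real (N n) * real (T n)) * (2 * (sqrt (real (T n)) * sqrt (real r) * frob_norm (EDB n \<omega>)) + frob_norm (EDE n \<omega>))"
  have W: "bounded_in_prob M ?W \<eta>"
  proof (rule bounded_in_prob_combine[OF bounded_EDB bounded_EDE])
    fix K L :: real assume KL: "0 < K" "0 < L"
    define J where "J = 2 * sqrt (real r) * K + L"
    have J: "0 < J" using KL by (simp add: J_def add_nonneg_pos)
    have ev: "\<forall>\<^sub>F n in sequentially. \<forall>\<omega>\<in>space M. frob_norm (EDB n \<omega>) \<le> K * sqrt (real (N n) * real (T n)) \<longrightarrow>
        frob_norm (EDE n \<omega>) \<le> L * (real (N n) * real (T n) * \<eta> n) \<longrightarrow> ?W n \<omega> \<le> J * \<eta> n"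
      using eventually_big
    proof eventually_elim
      case (elim n)
      then have NT: "0 < real (N n)" "0 < real (T n)" by (auto simp: big_def)
      have "1 / (real (N n) * real (T n)) * (2 * (sqrt (real (T n)) * sqrt (real r) * x) + y) \<le> J * \<eta> n"
        if x: "x \<le> K * sqrt (real (N n) * real (T n))" and y: "y \<le> L * (real (N n) * real (T n) * \<eta> n)" for x y
      proof -
        have "1 / (real (N n) * real (T n)) * (2 * (sqrt (real (T n)) * sqrt (real r) * x) + y)
          \<le> 1 / (real (N n) * real (T n)) * (2 * (sqrt (real (T n)) * sqrt (real r) * (K * sqrt (real (N n) * real (T n)))) + L * (real (N n) * real (T n) * \<eta> n))"
          using NT by (intro mult_left_mono add_mono x y) auto
        also have "\<dots> = 2 * sqrt (real r) * K * (sqrt (real (N n)) / real (N n)) + L * \<eta> n"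
          using NT by (simp add: real_sqrt_mult field_simps)
        also have "sqrt (real (N n)) / real (N n) = 1 / sqrt (real (N n))" using NT by (simp add: sqrt_divide_self_eq inverse_eq_divide)
        also have "2 * sqrt (real r) * K * (1 / sqrt (real (N n))) + L * \<eta> n \<le> 2 * sqrt (real r) * K * \<eta> n + L * \<eta> n"
          using KL by (intro add_right_mono mult_left_mono) (auto simp: \<eta>_def)
        finally show ?thesis by (simp add: J_def distrib_right)
      qed
      then show ?case by blast
    qed
    show "\<exists>J>0. \<forall>\<^sub>F n in sequentially. \<forall>\<omega>\<in>space M. frob_norm (EDB n \<omega>) \<le> K * sqrt (real (N n) * real (T n)) \<longrightarrow>
        frob_norm (EDE n \<omega>) \<le> L * (real (N n) * real (T n) * \<eta> n) \<longrightarrow> ?W n \<omega> \<le> J * \<eta> n"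
      using J ev by blast
  qed
  have "whp M (\<lambda>n \<omega>. frob_norm (Dl n \<omega>) \<le> ?W n \<omega>)"
  proof (rule whp_mono[OF whp_AE[OF AE_FF]])
    show "\<forall>\<^sub>F n in sequentially. \<forall>\<omega>\<in>space M. (1 / real (T n)) \<cdot>\<^sub>m (transpose_mat (F n \<omega>) * F n \<omega>) = 1\<^sub>m r \<longrightarrow> frob_norm (Dl n \<omega>) \<le> ?W n \<omega>"
      using eventually_big
    proof eventually_elim
      case (elim n)
      show ?case
      proof (intro ballI impI)
        fix \<omega> assume w: "\<omega> \<in> space M" and f: "(1 / real (T n)) \<cdot>\<^sub>m (transpose_mat (F n \<omega>) * F n \<omega>) = 1\<^sub>m r"
        show "frob_norm (Dl n \<omega>) \<le> ?W n \<omega>"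
          using ppca_sample.frob_norm_Dl_le[OF sample[OF elim w]] unfolding sample_eq[OF sample[OF elim w]]
            ppca_sample_orth.frob_norm_F[OF sample_orth[OF elim w f]] .
      qed
    qed
  qed
  from bounded_in_prob_mono[OF W this zero_less_one_real] show ?thesis by simp
qed

text \<open>|\<Delta>| \<le> \<kappa>/2 holds with high probability and lowers the eigenvalue bound
  from \<kappa> to \<kappa>/2.\<close>

lemma whp_good: "whp M good"
proof (rule whp_mono[OF whp_conj[OF whp_AE[OF AE_FF] bounded_in_prob_tendsto_zero[OF bounded_Dl \<eta>_tendsto]]])
  show "0 < \<kappa> / 2" using \<kappa> by simp
  show "\<forall>\<^sub>F n in sequentially. \<forall>\<omega>\<in>space M. (1 / real (T n)) \<cdot>\<^sub>m (transpose_mat (F n \<omega>) * F n \<omega>) = 1\<^sub>m r \<and> frob_norm (Dl n \<omega>) \<le> \<kappa> / 2 \<longrightarrow> good n \<omega>"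
    using eventually_big Om_pd
  proof eventually_elim
    case (elim n)
    show ?case
    proof (intro ballI impI, elim conjE)
      fix \<omega> assume w: "\<omega> \<in> space M" and f: "(1 / real (T n)) \<cdot>\<^sub>m (transpose_mat (F n \<omega>) * F n \<omega>) = 1\<^sub>m r"
        and D: "frob_norm (Dl n \<omega>) \<le> \<kappa> / 2"
      have "\<kappa> / 2 \<le> nth_eigenvalue (Sh n \<omega>) l" if "l < r" for l
        using ppca_sample_orth.L_ge[OF sample_orth[OF elim(1) w f] elim(2) that] D
        unfolding sample_eq[OF sample[OF elim(1) w]] by linarith
      then show "good n \<omega>" using elim(1) w f unfolding good_def by blast
    qed
  qed
qed

definition \<l> where "\<l> = sqrt (real r) * (1 / (\<kappa> / 2))"

lemma \<l>_pos: "0 < \<l>" using \<kappa> r by (simp add: \<l>_def)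

lemma good_bounds:
  assumes g: "good n \<omega>"
  shows "frob_norm (Li n \<omega>) \<le> \<l>" "frob_norm (K n \<omega>) \<le> real r" "frob_norm (H n \<omega>) \<le> real r * C\<^sup>2 * real r * \<l>"
    "frob_norm (Fh n \<omega>) = sqrt (real (T n)) * sqrt (real r)"
proof -
  note g' = goodD[OF g]
  interpret s: ppca_sample_orth "N n" "T n" r "lam n" "B n" "F n \<omega>" "E n \<omega>" "Fh n \<omega>" by (rule g'(3))
  note eq = sample_eq[OF g'(4)]
  have k: "0 < \<kappa> / 2" using \<kappa> by simp
  have Lk: "\<And>l. l < r \<Longrightarrow> \<kappa> / 2 \<le> nth_eigenvalue s.Sh l" unfolding eq by (rule g'(5))
  show Li: "frob_norm (Li n \<omega>) \<le> \<l>" using s.frob_norm_Li_le[OF k Lk] unfolding eq \<l>_def .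
  show K: "frob_norm (K n \<omega>) \<le> real r" using s.frob_norm_K_le unfolding eq .
  show "frob_norm (Fh n \<omega>) = sqrt (real (T n)) * sqrt (real r)" by (rule s.frob_norm_Fh)
  have Om: "frob_norm s.Om \<le> real r * C\<^sup>2"
  proof -
    have "frob_norm (transpose_mat (B n) * D n * B n) \<le> (sqrt (real (N n) * real r) * C) * (sqrt (real (N n) * real r) * C)"
      unfolding assoc_mult_mat[OF s.Bt s.D(1) s.B]
      using frob_B[of n] frob_DB[OF g'(1)] s.D(1) s.B by (intro frob_norm_mult_le'[OF s.Bt]) auto
    also have "\<dots> = real (N n) * (real r * C\<^sup>2)" using real_sqrt_mult_self[of "real (N n) * real r"] by (simp add: power2_eq_square mult_ac)
    finally show ?thesis using s.N unfolding Omega_mat_def frob_norm_smult by (simp add: field_simps)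
  qed
  have "frob_norm (s.Om * s.K * s.Li) \<le> (real r * C\<^sup>2 * real r) * \<l>"
    using Om K Li unfolding eq[symmetric]
    by (intro frob_norm_mult_le'[OF mult_carrier_mat[OF s.Om s.K] s.Li(1)] frob_norm_mult_le'[OF s.Om s.K])
  moreover have "H n \<omega> = s.Om * s.K * s.Li" by (rule s.rotation_Li[OF k Lk])
  ultimately show "frob_norm (H n \<omega>) \<le> real r * C\<^sup>2 * real r * \<l>" by simp
qed

text \<open>The bound on the remainder stripped of the factors that are bounded on the good event;
  it is measured by forms in the noise alone.\<close>

definition W where "W t n \<omega> = 1 / (sqrt (real (N n)) * real (T n)) *
   (frob_norm (transpose_mat (F n \<omega>) * EDB n \<omega>) * frob_norm (transpose_mat (F n \<omega>) * unit_col (T n) t)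
    + frob_norm (transpose_mat (F n \<omega>) * (EDE n \<omega> * unit_col (T n) t))
    + frob_norm (Dl n \<omega>) * sqrt (real (T n)) *
      (frob_norm (EDB n \<omega>) * frob_norm (transpose_mat (F n \<omega>) * unit_col (T n) t) + frob_norm (EDE n \<omega> * unit_col (T n) t)))"

lemma rem_le_W:
  assumes g: "good n \<omega>" and t: "t < T n"
  shows "rem t n \<omega> \<le> (\<l> * (real r * C\<^sup>2 * real r * \<l> + sqrt (real r) * \<l>)) * W t n \<omega>"
proof -
  note g' = goodD[OF g]
  interpret s: ppca_sample_orth "N n" "T n" r "lam n" "B n" "F n \<omega>" "E n \<omega>" "Fh n \<omega>" by (rule g'(3))
  note eq = sample_eq[OF g'(4)]
  have k: "0 < \<kappa> / 2" using \<kappa> by simp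
  have Lk: "\<And>l. l < r \<Longrightarrow> \<kappa> / 2 \<le> nth_eigenvalue s.Sh l" unfolding eq by (rule g'(5))
  note EDEc = s.EDE[unfolded eq]
  have FE: "transpose_mat (F n \<omega>) * EDE n \<omega> \<in> carrier_mat r (T n)" using mult_carrier_mat[OF s.Ft EDEc] .
  have sym: "col (EDE n \<omega>) t = Matrix.row (EDE n \<omega>) t"
    using row_transpose[of t "EDE n \<omega>"] s.EDE_sym[unfolded eq] carrier_matD[OF EDEc] t by simp
  have f: "eucl_norm (Matrix.row (F n \<omega>) t) = frob_norm (transpose_mat (F n \<omega>) * unit_col (T n) t)"
    using frob_norm_mult_unit_col[OF s.Ft t] s.F t by simp
  have u: "eucl_norm (Matrix.row (EDE n \<omega>) t) = frob_norm (EDE n \<omega> * unit_col (T n) t)"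
    unfolding sym[symmetric] using frob_norm_mult_unit_col[OF EDEc t] by simp
  have Fu: "eucl_norm (transpose_mat (F n \<omega>) *\<^sub>v Matrix.row (EDE n \<omega>) t) = frob_norm (transpose_mat (F n \<omega>) * (EDE n \<omega> * unit_col (T n) t))"
    unfolding assoc_mult_mat[OF s.Ft EDEc unit_col(1), symmetric] frob_norm_mult_unit_col[OF FE t] sym[symmetric]
    using col_mult2[OF s.Ft EDEc t] by simp
  define h where "h = real r * C\<^sup>2 * real r * \<l>"
  have h: "0 \<le> h" using \<l>_pos by (simp add: h_def)
  define p where "p = frob_norm (transpose_mat (F n \<omega>) * EDB n \<omega>) * frob_norm (transpose_mat (F n \<omega>) * unit_col (T n) t) + frob_norm (transpose_mat (F n \<omega>) * (EDE n \<omega> * unit_col (T n) t))"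
  define q where "q = frob_norm (EDB n \<omega>) * frob_norm (transpose_mat (F n \<omega>) * unit_col (T n) t) + frob_norm (EDE n \<omega> * unit_col (T n) t)"
  have pq: "0 \<le> p" "0 \<le> q" by (auto simp: p_def q_def intro!: add_nonneg_nonneg mult_nonneg_nonneg)
  define c where "c = 1 / (sqrt (real (N n)) * real (T n))"
  have c: "0 \<le> c" by (simp add: c_def)
  have "rem t n \<omega> \<le> c * (frob_norm (Li n \<omega>) * (frob_norm (H n \<omega>) * p + frob_norm (Dl n \<omega>) * frob_norm (Fh n \<omega>) * frob_norm (Li n \<omega>) * q))"
    using s.score_error_expansion[OF k Lk t] unfolding eq f u Fu rem_def err_def Z_def p_def q_def c_def .
  also have "\<dots> \<le> (\<l> * (h + sqrt (real r) * \<l>)) * (c * (p + frob_norm (Dl n \<omega>) * sqrt (real (T n)) * q))"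
    unfolding good_bounds(4)[OF g]
    by (rule remainder_factorization[OF c _ good_bounds(1)[OF g] _ good_bounds(3)[OF g, folded h_def] pq]) simp_all
  also have "c * (p + frob_norm (Dl n \<omega>) * sqrt (real (T n)) * q) = W t n \<omega>" by (simp add: W_def p_def q_def c_def add.assoc)
  finally show ?thesis unfolding h_def .
qed

text \<open>The four products have orders 1 / \<surd>T, ratio, \<eta> and \<eta> \<surd>T ratio.
  Only the last needs an argument.\<close>

lemma bounded_W: "bounded_in_prob M (W t) (\<lambda>n. ratio n + \<eta> n)"
proof -
  let ?c = "\<lambda>n. 1 / (sqrt (real (N n)) * real (T n))"
  let ?f = "\<lambda>n \<omega>. frob_norm (transpose_mat (F n \<omega>) * unit_col (T n) t)"
  have c: "\<forall>\<^sub>F n in sequentially. 0 \<le> ?c n" by simp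
  have cT: "\<forall>\<^sub>F n in sequentially. 0 \<le> ?c n * sqrt (real (T n))" by simp
  have nn: "0 \<le> frob_norm A * frob_norm A'" "0 \<le> frob_norm A" for A A' by auto
  have s1: "?c n * sqrt (real (N n) * real (T n)) = 1 / sqrt (real (T n))" if "big n" for n
  proof -
    define y where "y = sqrt (real (T n))"
    have "real (T n) = y * y" "0 < y" using that by (auto simp: y_def big_def)
    then show ?thesis using that unfolding real_sqrt_mult y_def[symmetric] by (simp add: big_def)
  qed
  \<comment> \<open>The left-hand side is ratio + \<surd>(T/N) ratio. As d \<le> \<surd>N, the
    second summand is at most 1 / min(\<surd>N, \<surd>T), hence at most \<eta>.\<close>
  have s2: "\<eta> n * (sqrt (real (T n)) * ratio n) \<le> ratio n + \<eta> n" if b: "big n" for n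
  proof -
    define x y where "x = sqrt (real (N n))" and "y = sqrt (real (T n))"
    have xy: "0 < x" "0 < y" and T': "real (T n) = y * y" using b by (auto simp: x_def y_def big_def)
    have "y * ratio n / x = (d n / x) * (max x y / (x * y))"
      unfolding ratio_eq[OF b] a_def x_def[symmetric] y_def[symmetric] unfolding T' using xy by simp
    also have "\<dots> \<le> 1 * (max x y / (x * y))"
      using d[OF b] xy by (intro mult_right_mono) (auto simp: x_def max_def)
    also have "\<dots> \<le> \<eta> n" unfolding \<eta>_def x_def[symmetric] y_def[symmetric] using xy by (auto simp: max_def)
    finally have "y * ratio n / x \<le> \<eta> n" .
    moreover have "\<eta> n * (y * ratio n) = y * ratio n / x + ratio n"
      unfolding \<eta>_def x_def[symmetric] y_def[symmetric] using xy by (simp add: distrib_right)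
    ultimately show ?thesis by (simp add: y_def)
  qed
  have t1: "bounded_in_prob M (\<lambda>n \<omega>. ?c n * (frob_norm (transpose_mat (F n \<omega>) * EDB n \<omega>) * ?f n \<omega>)) (\<lambda>n. ratio n + \<eta> n)"
  proof (rule bounded_in_prob_le_rate[OF bounded_in_prob_scale[OF bounded_in_prob_mult[OF bounded_FEDB bounded_F_row nn(2) nn(2)] c] zero_less_one_real])
    show "\<forall>\<^sub>F n in sequentially. ?c n * (sqrt (real (N n) * real (T n)) * 1) \<le> 1 * (ratio n + \<eta> n)"
      using eventually_big
    proof eventually_elim
      case (elim n)
      have "?c n * (sqrt (real (N n) * real (T n)) * 1) = 1 / sqrt (real (T n))" using s1[OF elim] by simp
      then show ?case using ratio_nonneg[of n] by (simp add: \<eta>_def)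
    qed
  qed
  have t2: "bounded_in_prob M (\<lambda>n \<omega>. ?c n * frob_norm (transpose_mat (F n \<omega>) * (EDE n \<omega> * unit_col (T n) t))) (\<lambda>n. ratio n + \<eta> n)"
  proof (rule bounded_in_prob_le_rate[OF bounded_in_prob_scale[OF bounded_FEDE_unit c] zero_less_one_real])
    show "\<forall>\<^sub>F n in sequentially. ?c n * a n \<le> 1 * (ratio n + \<eta> n)"
      using eventually_big by eventually_elim (use ratio_eq \<eta>_nonneg in simp)
  qed
  have t3: "bounded_in_prob M (\<lambda>n \<omega>. ?c n * sqrt (real (T n)) * (frob_norm (Dl n \<omega>) * (frob_norm (EDB n \<omega>) * ?f n \<omega>))) (\<lambda>n. ratio n + \<eta> n)"
  proof (rule bounded_in_prob_le_rate[OF bounded_in_prob_scale[OF bounded_in_prob_mult[OF bounded_Dl bounded_in_prob_mult[OF bounded_EDB bounded_F_row nn(2) nn(2)] nn(2) nn(1)] cT] zero_less_one_real])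
    show "\<forall>\<^sub>F n in sequentially. ?c n * sqrt (real (T n)) * (\<eta> n * (sqrt (real (N n) * real (T n)) * 1)) \<le> 1 * (ratio n + \<eta> n)"
      using eventually_big
    proof eventually_elim
      case (elim n)
      have "?c n * sqrt (real (T n)) * (\<eta> n * (sqrt (real (N n) * real (T n)) * 1)) = \<eta> n * (sqrt (real (T n)) * (?c n * sqrt (real (N n) * real (T n))))"
        by (simp only: mult_ac mult_1_right)
      also have "\<dots> = \<eta> n" unfolding s1[OF elim] using elim by (simp add: big_def)
      finally have e: "?c n * sqrt (real (T n)) * (\<eta> n * (sqrt (real (N n) * real (T n)) * 1)) = \<eta> n" .
      show ?case unfolding e using ratio_nonneg[of n] by simp
    qed
  qed
  have t4: "bounded_in_prob M (\<lambda>n \<omega>. ?c n * sqrt (real (T n)) * (frob_norm (Dl n \<omega>) * frob_norm (EDE n \<omega> * unit_col (T n) t))) (\<lambda>n. ratio n + \<eta> n)"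
  proof (rule bounded_in_prob_le_rate[OF bounded_in_prob_scale[OF bounded_in_prob_mult[OF bounded_Dl bounded_EDE_unit nn(2) nn(2)] cT] zero_less_one_real])
    show "\<forall>\<^sub>F n in sequentially. ?c n * sqrt (real (T n)) * (\<eta> n * a n) \<le> 1 * (ratio n + \<eta> n)"
      using eventually_big
    proof eventually_elim
      case (elim n)
      have "?c n * sqrt (real (T n)) * (\<eta> n * a n) = \<eta> n * (sqrt (real (T n)) * ratio n)" unfolding ratio_eq[OF elim] by (simp add: mult_ac)
      then show ?case using s2[OF elim] by simp
    qed
  qed
  have nn': "\<forall>\<^sub>F n in sequentially. 0 \<le> ratio n + \<eta> n" using ratio_nonneg \<eta>_nonneg by (simp add: add_nonneg_nonneg)
  have "W t = (\<lambda>n \<omega>. ((?c n * (frob_norm (transpose_mat (F n \<omega>) * EDB n \<omega>) * ?f n \<omega>) + ?c n * frob_norm (transpose_mat (F n \<omega>) * (EDE n \<omega> * unit_col (T n) t)))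
     + ?c n * sqrt (real (T n)) * (frob_norm (Dl n \<omega>) * (frob_norm (EDB n \<omega>) * ?f n \<omega>)))
     + ?c n * sqrt (real (T n)) * (frob_norm (Dl n \<omega>) * frob_norm (EDE n \<omega> * unit_col (T n) t)))"
    by (intro ext) (simp only: W_def distrib_left mult_ac add.assoc)
  with bounded_in_prob_add[OF bounded_in_prob_add[OF bounded_in_prob_add[OF t1 t2 nn'] t3 nn'] t4 nn'] show ?thesis by simp
qed

lemma bounded_rem: "bounded_in_prob M (rem t) (\<lambda>n. ratio n + \<eta> n)"
proof -
  let ?c = "\<l> * (real r * C\<^sup>2 * real r * \<l> + sqrt (real r) * \<l>)"
  have c: "0 < ?c" using \<l>_pos r by (intro mult_pos_pos add_nonneg_pos) auto
  have cW: "bounded_in_prob M (\<lambda>n \<omega>. ?c * W t n \<omega>) (\<lambda>n. ?c * (ratio n + \<eta> n))"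
    using c by (intro bounded_in_prob_scale[OF bounded_W]) auto
  have "whp M (\<lambda>n \<omega>. rem t n \<omega> \<le> ?c * W t n \<omega>)"
  proof (rule whp_mono[OF whp_good])
    show "\<forall>\<^sub>F n in sequentially. \<forall>\<omega>\<in>space M. good n \<omega> \<longrightarrow> rem t n \<omega> \<le> ?c * W t n \<omega>"
      using eventually_T_gt[of t] by eventually_elim (use rem_le_W in blast)
  qed
  from bounded_in_prob_mono[OF cW this c] show ?thesis by simp
qed


lemma Z_eq_row:
  assumes b: "big n" and w: "\<omega> \<in> space M" and t: "t < T n"
  shows "Z t n \<omega> = (1 / sqrt (real (N n))) \<cdot>\<^sub>v Matrix.row (EDB n \<omega>) t"
proof -
  interpret s: ppca_sample "N n" "T n" r "lam n" "B n" "F n \<omega>" "E n \<omega>" "Fh n \<omega>" by (rule sample[OF b w])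
  have et: "Matrix.row (E n \<omega>) t \<in> carrier_vec (N n)" using row_carrier[of "E n \<omega>" t] carrier_matD(2)[OF s.E] by simp
  have "Matrix.row (EDB n \<omega>) t = (transpose_mat (B n) * D n) *\<^sub>v Matrix.row (E n \<omega>) t"
    unfolding EDB_def row_mult[OF s.ED s.B t] row_mult[OF s.E s.D(1) t] s.D(2) by (rule assoc_mult_mat_vec[symmetric, OF s.Bt s.D(1) et])
  then show ?thesis unfolding Z_def by simp
qed

lemma eucl_norm_Z:
  assumes b: "big n" and w: "\<omega> \<in> space M" and t: "t < T n"
  shows "eucl_norm (Z t n \<omega>) = 1 / sqrt (real (N n)) * frob_norm (transpose_mat (unit_col (T n) t) * EDB n \<omega>)"
proof -
  interpret s: ppca_sample "N n" "T n" r "lam n" "B n" "F n \<omega>" "E n \<omega>" "Fh n \<omega>" by (rule sample[OF b w])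
  have EDB: "EDB n \<omega> \<in> carrier_mat (T n) r" "transpose_mat (EDB n \<omega>) \<in> carrier_mat r (T n)"
    using s.EDB s.EDBt unfolding sample_eq[OF sample[OF b w]] by blast+
  have "frob_norm (transpose_mat (unit_col (T n) t) * EDB n \<omega>) = frob_norm (transpose_mat (EDB n \<omega>) * unit_col (T n) t)"
    using frob_norm_transpose[of "transpose_mat (unit_col (T n) t) * EDB n \<omega>"] transpose_mult[OF unit_col(2) EDB(1)] by simp
  moreover have "\<dots> = eucl_norm (Matrix.row (EDB n \<omega>) t)"
    using frob_norm_mult_unit_col[OF EDB(2) t] EDB(1) t by simp
  ultimately show ?thesis unfolding Z_eq_row[OF b w t] eucl_norm_smult by simp
qed

lemma bounded_Z: "bounded_in_prob M (\<lambda>n \<omega>. eucl_norm (Z t n \<omega>)) (\<lambda>_. 1)"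
proof -
  let ?q = "\<lambda>n \<omega>. 1 / sqrt (real (N n)) * frob_norm (transpose_mat (unit_col (T n) t) * EDB n \<omega>)"
  have q: "bounded_in_prob M ?q (\<lambda>n. 1 / sqrt (real (N n)) * sqrt (real (N n)))"
    by (rule bounded_in_prob_scale[OF bounded_EDB_row]) simp
  have le: "whp M (\<lambda>n \<omega>. eucl_norm (Z t n \<omega>) \<le> ?q n \<omega>)"
  proof (rule whp_sure)
    show "\<forall>\<^sub>F n in sequentially. \<forall>\<omega>\<in>space M. eucl_norm (Z t n \<omega>) \<le> ?q n \<omega>"
      using eventually_big eventually_T_gt[of t] by eventually_elim (simp add: eucl_norm_Z)
  qed
  have "\<forall>\<^sub>F n in sequentially. 1 / sqrt (real (N n)) * sqrt (real (N n)) \<le> 1 * 1"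
    using eventually_big by eventually_elim (simp add: big_def)
  then show ?thesis by (rule bounded_in_prob_mono[OF q le zero_less_one_real])
qed

lemma err_carrier:
  assumes b: "big n" and w: "\<omega> \<in> space M" and t: "t < T n"
  shows "err t n \<omega> \<in> carrier_vec r" and "Z t n \<omega> \<in> carrier_vec r"
proof -
  interpret s: ppca_sample "N n" "T n" r "lam n" "B n" "F n \<omega>" "E n \<omega>" "Fh n \<omega>" by (rule sample[OF b w])
  have "inv_mat (mat_diag r (nth_eigenvalue s.Sh)) \<in> carrier_mat r r" unfolding inv_mat_diag by simp
  from mult_carrier_mat[OF mult_carrier_mat[OF s.Om s.K] this]
  have H: "H n \<omega> \<in> carrier_mat r r" unfolding s.rotation_eq .
  have row: "Matrix.row A t \<in> carrier_vec r" if "A \<in> carrier_mat (T n) r" for A :: "real Matrix.mat"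
    using row_carrier[of A t] carrier_matD(2)[OF that] by simp
  have Ht: "transpose_mat (H n \<omega>) \<in> carrier_mat r r" by (rule transpose_carrier_mat[THEN iffD2, OF H])
  show "err t n \<omega> \<in> carrier_vec r" unfolding err_def
    by (rule minus_carrier_vec[OF row[OF s.Fh] mult_mat_vec_carrier[OF Ht row[OF s.F]]])
  have e: "Matrix.row (E n \<omega>) t \<in> carrier_vec (N n)"
    using row_carrier[of "E n \<omega>" t] carrier_matD(2)[OF s.E] by simp
  show "Z t n \<omega> \<in> carrier_vec r" unfolding Z_def
    by (rule smult_carrier_vec[THEN iffD2, OF mult_mat_vec_carrier[OF mult_carrier_mat[OF s.Bt s.D(1)] e]])
qed

lemma sqrt_N_err_le:
  assumes g: "good n \<omega>" and t: "t < T n"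
  shows "sqrt (real (N n)) * eucl_norm (err t n \<omega>) \<le> rem t n \<omega> + \<l> * real r * eucl_norm (Z t n \<omega>)"
proof -
  note g' = goodD[OF g]
  interpret s: ppca_sample "N n" "T n" r "lam n" "B n" "F n \<omega>" "E n \<omega>" "Fh n \<omega>" by (rule g'(4))
  note eq = sample_eq[OF g'(4)]
  have LK: "Li n \<omega> * transpose_mat (K n \<omega>) \<in> carrier_mat r r"
    using s.Li(1) s.K unfolding eq by simp
  have nLK: "frob_norm (Li n \<omega> * transpose_mat (K n \<omega>)) \<le> \<l> * real r"
    using s.Li(1) s.K good_bounds[OF g] unfolding eq by (intro frob_norm_mult_le'[of _ r r _ r]) auto
  note e = err_carrier(1)[OF g'(1,2) t] and z = err_carrier(2)[OF g'(1,2) t]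
  let ?x = "sqrt (real (N n)) \<cdot>\<^sub>v err t n \<omega>" and ?y = "(Li n \<omega> * transpose_mat (K n \<omega>)) *\<^sub>v Z t n \<omega>"
  have y: "?y \<in> carrier_vec r" by (rule mult_mat_vec_carrier[OF LK z])
  have "?x = (?x - ?y) + ?y"
  proof -
    have "v = (v - w) + w" if "v \<in> carrier_vec r" "w \<in> carrier_vec r" for v w :: "real Matrix.vec"
      using that by (intro eq_vecI) auto
    from this[OF smult_carrier_vec[THEN iffD2, OF e] y] show ?thesis .
  qed
  then have "eucl_norm ?x \<le> eucl_norm (?x - ?y) + eucl_norm ?y"
    using eucl_norm_add_le[of "?x - ?y" r ?y] e y by simp
  moreover have "eucl_norm ?y \<le> \<l> * real r * eucl_norm (Z t n \<omega>)"
    by (rule eucl_norm_mult_mat_vec_le'[OF LK z nLK order_refl])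
  ultimately show ?thesis by (simp add: rem_def eucl_norm_smult)
qed

text \<open>Scaled by \<surd>N, the error is at most the remainder, of order ratio + \<eta>, plus a
  multiple of |Z|, of order 1. When the ratio stays above c, both \<eta> \<le> 2 and 1 are absorbed
  into a multiple of it.\<close>

lemma err_big_O_prob:
  assumes c: "0 < c" and ratio: "\<forall>\<^sub>F n in sequentially. c < ratio n"
  shows "big_O_prob M (err t) (\<lambda>n. d n / (sqrt (real (N n)) * min (real (T n)) (sqrt (real (N n) * real (T n)))))"
proof -
  let ?w = "\<lambda>n. 1 / sqrt (real (N n))"
  have r1: "bounded_in_prob M (rem t) ratio"
  proof (rule bounded_in_prob_le_rate[OF bounded_rem])
    show "0 < 1 + 2 / c" using c by (simp add: add_pos_pos)
    show "\<forall>\<^sub>F n in sequentially. ratio n + \<eta> n \<le> (1 + 2 / c) * ratio n"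
      using ratio eventually_big
    proof eventually_elim
      case (elim n)
      have "\<eta> n \<le> 2 / c * c" using \<eta>_le_2[OF elim(2)] c by simp
      also have "\<dots> \<le> 2 / c * ratio n" using elim(1) c by (intro mult_left_mono) auto
      finally show ?case by (simp add: distrib_right)
    qed
  qed
  have lr: "0 < \<l> * real r" using \<l>_pos r by simp
  have "bounded_in_prob M (\<lambda>n \<omega>. \<l> * real r * eucl_norm (Z t n \<omega>)) (\<lambda>n. \<l> * real r * 1)"
    by (rule bounded_in_prob_scale[OF bounded_Z]) (use lr in simp)
  then have r2: "bounded_in_prob M (\<lambda>n \<omega>. \<l> * real r * eucl_norm (Z t n \<omega>)) ratio"
  proof (rule bounded_in_prob_le_rate)
    show "0 < \<l> * real r / c" using lr c by simp
    show "\<forall>\<^sub>F n in sequentially. \<l> * real r * 1 \<le> \<l> * real r / c * ratio n"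
      using ratio
    proof eventually_elim
      case (elim n)
      have "\<l> * real r * 1 = \<l> * real r / c * c" using c by simp
      also have "\<dots> \<le> \<l> * real r / c * ratio n" using elim lr c by (intro mult_left_mono) auto
      finally show ?case .
    qed
  qed
  have nn: "\<forall>\<^sub>F n in sequentially. 0 \<le> ratio n" using ratio_nonneg by simp
  have sum: "bounded_in_prob M (\<lambda>n \<omega>. ?w n * (rem t n \<omega> + \<l> * real r * eucl_norm (Z t n \<omega>))) (\<lambda>n. ?w n * ratio n)"
  proof -
    from bounded_in_prob_add[OF r1 r2 nn]
    have "bounded_in_prob M (\<lambda>n \<omega>. rem t n \<omega> + \<l> * real r * eucl_norm (Z t n \<omega>)) ratio" .
    from bounded_in_prob_scale[OF this, of ?w] show ?thesis by simp
  qed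
  have le: "whp M (\<lambda>n \<omega>. eucl_norm (err t n \<omega>) \<le> ?w n * (rem t n \<omega> + \<l> * real r * eucl_norm (Z t n \<omega>)))"
  proof (rule whp_mono[OF whp_good])
    show "\<forall>\<^sub>F n in sequentially. \<forall>\<omega>\<in>space M. good n \<omega> \<longrightarrow> eucl_norm (err t n \<omega>) \<le> ?w n * (rem t n \<omega> + \<l> * real r * eucl_norm (Z t n \<omega>))"
      using eventually_T_gt[of t] eventually_big
    proof eventually_elim
      case (elim n)
      show ?case
      proof (intro ballI impI)
        fix \<omega> assume "good n \<omega>"
        have le: "e \<le> 1 / x * R" if "x * e \<le> R" "0 < x" for e x R :: real
          using that by (simp add: field_simps)
        from \<open>good n \<omega>\<close> have "sqrt (real (N n)) * eucl_norm (err t n \<omega>) \<le> rem t n \<omega> + \<l> * real r * eucl_norm (Z t n \<omega>)"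
          by (rule sqrt_N_err_le[OF _ elim(1)])
        moreover have "0 < sqrt (real (N n))" using elim(2) by (simp add: big_def)
        ultimately
        show "eucl_norm (err t n \<omega>) \<le> ?w n * (rem t n \<omega> + \<l> * real r * eucl_norm (Z t n \<omega>))"
          by (rule le)
      qed
    qed
  qed
  let ?b = "\<lambda>n. d n / (sqrt (real (N n)) * min (real (T n)) (sqrt (real (N n) * real (T n))))"
  have b: "(\<lambda>n. ?w n * ratio n) = ?b" by (rule ext) (simp add: ratio_def)
  have ev: "\<forall>\<^sub>F n in sequentially. ?b n \<le> 1 * ?b n" by simp
  have "bounded_in_prob M (\<lambda>n \<omega>. eucl_norm (err t n \<omega>)) ?b"
    by (rule bounded_in_prob_mono[where Z = "\<lambda>n \<omega>. eucl_norm (err t n \<omega>)", OF sum[unfolded b] le zero_less_one_real ev])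
  then show ?thesis by (rule big_O_prob_of_bounded_in_prob)
qed

end

section \<open>Limits of the estimated eigensystem\<close>

text \<open>The difference splits as (x - y) / L + y (l - L) / (L l). The two terms give the
  summands R / k and 2 R / k^2 of the constant.\<close>

lemma scaled_entry_close:
  fixes L l x y k R e :: real
  assumes k: "0 < k" "k \<le> L" "k \<le> l" and R: "0 \<le> R"
    and Ll: "\<bar>L - l\<bar> \<le> 2 * e" and xy: "\<bar>x - y\<bar> \<le> R * e" and y: "\<bar>y\<bar> \<le> R"
  shows "\<bar>1 / L * x - 1 / l * y\<bar> \<le> (R / k + 2 * R / k\<^sup>2) * e"
proof -
  have p: "0 < L" "0 < l" using k by linarith+
  have e: "0 \<le> e" using Ll by linarith
  have "1 / L * x - 1 / l * y = (x - y) / L + y * (l - L) / (L * l)" using p by (simp add: field_simps)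
  also have "\<bar>\<dots>\<bar> \<le> \<bar>(x - y) / L\<bar> + \<bar>y * (l - L) / (L * l)\<bar>" by (rule abs_triangle_ineq)
  also have "\<bar>(x - y) / L\<bar> \<le> R * e / k"
  proof -
    have "\<bar>(x - y) / L\<bar> = \<bar>x - y\<bar> / L" using p by (simp add: abs_divide)
    also have "\<dots> \<le> R * e / k" using xy k by (intro frac_le) auto
    finally show ?thesis .
  qed
  also have "\<bar>y * (l - L) / (L * l)\<bar> \<le> R * (2 * e) / k\<^sup>2"
  proof -
    have "\<bar>y * (l - L) / (L * l)\<bar> = (\<bar>y\<bar> * \<bar>L - l\<bar>) / (L * l)" using p by (simp add: abs_divide abs_mult abs_minus_commute)
    also have "\<dots> \<le> R * (2 * e) / k\<^sup>2"
    proof (rule frac_le)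
      show "\<bar>y\<bar> * \<bar>L - l\<bar> \<le> R * (2 * e)" by (rule mult_mono[OF y Ll R]) simp
      show "k\<^sup>2 \<le> L * l" unfolding power2_eq_square using k by (intro mult_mono) auto
    qed (use k R e in auto)
    finally show ?thesis .
  qed
  finally show ?thesis by (simp add: field_simps)
qed

text \<open>A variable that tends to 0 in probability times a tight one: on the event Z \<le> K, the
  bound e / K on the first factor suffices.\<close>

lemma (in prob_space) whp_mult_bounded:
  assumes X: "\<And>e. 0 < e \<Longrightarrow> whp M (\<lambda>n \<omega>. X n \<omega> \<le> e)" and Z: "bounded_in_prob M Z (\<lambda>_. 1)"
    and nn: "\<And>n \<omega>. 0 \<le> X n \<omega>" "\<And>n \<omega>. 0 \<le> Z n \<omega>" and e: "0 < e"
  shows "whp M (\<lambda>n \<omega>. X n \<omega> * Z n \<omega> \<le> e)"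
  unfolding whp_def
proof (intro allI impI)
  fix \<epsilon> :: real assume "\<epsilon> > 0"
  then have "\<epsilon> / 2 > 0" by simp
  with Z obtain K where K: "0 < K" "\<forall>\<^sub>F n in sequentially. \<exists>G\<in>sets M. prob (space M - G) \<le> \<epsilon> / 2 \<and> (\<forall>\<omega>\<in>G. Z n \<omega> \<le> K * 1)"
    unfolding bounded_in_prob_def by blast
  have "0 < e / K" using e K by simp
  from X[OF this] \<open>\<epsilon> / 2 > 0\<close> have "\<forall>\<^sub>F n in sequentially. \<exists>G\<in>sets M. prob (space M - G) \<le> \<epsilon> / 2 \<and> (\<forall>\<omega>\<in>G. X n \<omega> \<le> e / K)"
    unfolding whp_def by blast
  with K(2) show "\<forall>\<^sub>F n in sequentially. \<exists>G\<in>sets M. prob (space M - G) \<le> \<epsilon> \<and> (\<forall>\<omega>\<in>G. X n \<omega> * Z n \<omega> \<le> e)"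
  proof eventually_elim
    case (elim n)
    have "X n \<omega> * Z n \<omega> \<le> e" if "Z n \<omega> \<le> K * 1 \<and> X n \<omega> \<le> e / K" for \<omega>
    proof -
      have "X n \<omega> * Z n \<omega> \<le> e / K * K" using that nn K e by (intro mult_mono) auto
      then show ?thesis using K by simp
    qed
    then show ?case using event_conj[OF elim(1) elim(2)] by blast
  qed
qed

locale ppca_asymptotics_limit = ppca_asymptotics_pd +
  fixes Gam :: "nat \<Rightarrow> real Matrix.mat" and GamLim LamLim :: "real Matrix.mat"
  assumes limit: "limiting_eigensystem r (\<lambda>n. Omega_mat (N n) (lam n) (B n)) Gam GamLim LamLim"
    and signs: "compatible_signs M r Fh F Gam"
begin

abbreviation Om where "Om n \<equiv> Omega_mat (N n) (lam n) (B n)"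
abbreviation w where "w n \<equiv> nth_eigenvalue (Om n)"
abbreviation L where "L n \<omega> \<equiv> nth_eigenvalue (Sh n \<omega>)"
definition lim where "lim l = LamLim $$ (l, l)"

lemma spec: "spectral_decomposition r (Om n) (Gam n)"
  and lim_carrier: "GamLim \<in> carrier_mat r r" "LamLim \<in> carrier_mat r r"
  using limit by (auto simp: limiting_eigensystem_def)

lemma w_tendsto: "l < r \<Longrightarrow> (\<lambda>n. w n l) \<longlonglongrightarrow> lim l"
  and LamLim: "LamLim = mat_diag r lim"
proof -
  have t: "(\<lambda>n. mat_diag r (w n) $$ (i,j)) \<longlonglongrightarrow> LamLim $$ (i,j)" if "i < r" "j < r" for i j
    using limit that by (auto simp: limiting_eigensystem_def mat_tendsto_def leading_eigenvalues_def)
  show "(\<lambda>n. w n l) \<longlonglongrightarrow> lim l" if "l < r" for l using t[OF that that] that by (simp add: lim_def mat_diag_def)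
  have "LamLim $$ (i,j) = (if i = j then lim j else 0)" if "i < r" "j < r" for i j
  proof (cases "i = j")
    case False
    have "(\<lambda>n. 0 :: real) \<longlonglongrightarrow> LamLim $$ (i,j)" using t[OF that] that False by (simp add: mat_diag_def)
    then have "LamLim $$ (i,j) = 0" by (rule LIMSEQ_unique[OF _ tendsto_const])
    then show ?thesis using False by simp
  qed (simp add: lim_def)
  then show "LamLim = mat_diag r lim" using lim_carrier by (intro eq_matI) (auto simp: mat_diag_def)
qed

lemma w_ge: "\<forall>\<^sub>F n in sequentially. \<forall>l<r. \<kappa> \<le> w n l"
  using Om_pd eventually_big
proof eventually_elim
  case (elim n)
  \<comment> \<open>\<Omega> is deterministic; any sample point gives access to its dimensions and
    symmetry, which are proved for one sample.\<close>
  obtain \<omega> where w: "\<omega> \<in> space M" using not_empty by blast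
  interpret s: ppca_sample "N n" "T n" r "lam n" "B n" "F n \<omega>" "E n \<omega>" "Fh n \<omega>" by (rule sample[OF elim(2) w])
  have sorted: "\<And>i j. i \<le> j \<Longrightarrow> j < r \<Longrightarrow> w n j \<le> w n i"
    by (rule spectral_theorem_nth_eigenvalue[OF s.Om s.Om_sym])
  show ?case
  proof (intro allI impI)
    fix l assume "l < r"
    then have "w n (r - 1) \<le> w n l" by (intro sorted) auto
    with elim(1) show "\<kappa> \<le> w n l" by linarith
  qed
qed

lemma lim_ge: "l < r \<Longrightarrow> \<kappa> \<le> lim l"
  by (rule tendsto_lowerbound[OF w_tendsto _ trivial_limit_sequentially])
    (use w_ge in \<open>auto elim: eventually_mono\<close>)

lemma lim_decreasing: "i < k \<Longrightarrow> k < r \<Longrightarrow> lim k < lim i"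
proof (induction k)
  case (Suc k)
  have s: "lim (Suc k) < lim k" using limit Suc.prems by (auto simp: limiting_eigensystem_def lim_def)
  show ?case
  proof (cases "i = k")
    case False
    then have "lim k < lim i" using Suc by auto
    with s show ?thesis by linarith
  qed (use s in simp)
qed simp

text \<open>The limiting eigenvalues are strictly decreasing, so half of the smallest of finitely
  many gaps is a uniform gap along the sequence.\<close>

lemma eventually_gap: "\<exists>g>0. \<forall>\<^sub>F n in sequentially. \<forall>i k. i < k \<longrightarrow> k < r \<longrightarrow> w n k + g \<le> w n i"
proof -
  let ?P = "{..<r} \<times> {..<r} \<inter> {p. fst p < snd p}"
  let ?g = "\<lambda>p. (lim (fst p) - lim (snd p)) / 2"
  \<comment> \<open>The inserted 1 keeps the set nonempty when r = 1 and there are no pairs.\<close>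
  define g where "g = Min (insert 1 (?g ` ?P))"
  have fin: "finite ?P" by simp
  have g: "0 < g" unfolding g_def using fin lim_decreasing by (subst Min_gr_iff) auto
  have le: "g \<le> ?g p" if "p \<in> ?P" for p unfolding g_def using fin that by (intro Min_le) auto
  have "\<forall>\<^sub>F n in sequentially. \<forall>p\<in>?P. w n (snd p) + g \<le> w n (fst p)"
  proof (rule eventually_ball_finite[OF fin], rule ballI)
    fix p assume p: "p \<in> ?P"
    then have "(\<lambda>n. w n (fst p) - w n (snd p)) \<longlonglongrightarrow> lim (fst p) - lim (snd p)"
      by (intro tendsto_diff w_tendsto) auto
    moreover have "g < lim (fst p) - lim (snd p)" using le[OF p] g by simp
    ultimately have "\<forall>\<^sub>F n in sequentially. g < w n (fst p) - w n (snd p)" by (rule order_tendstoD(1))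
    then show "\<forall>\<^sub>F n in sequentially. w n (snd p) + g \<le> w n (fst p)" by eventually_elim linarith
  qed
  then have "\<forall>\<^sub>F n in sequentially. \<forall>i k. i < k \<longrightarrow> k < r \<longrightarrow> w n k + g \<le> w n i"
  proof eventually_elim
    case (elim n)
    show ?case
    proof (intro allI impI)
      fix i k assume "i < k" "k < r"
      then have "(i, k) \<in> ?P" by simp
      from bspec[OF elim this] show "w n k + g \<le> w n i" by simp
    qed
  qed
  with g show ?thesis by blast
qed

lemma eventually_eigensystem_close:
  assumes e: "0 < e"
  shows "\<forall>\<^sub>F n in sequentially. \<forall>i\<in>{..<r}. \<bar>w n i - lim i\<bar> \<le> e"
    and "\<forall>\<^sub>F n in sequentially. \<forall>p\<in>{..<r} \<times> {..<r}. \<bar>Gam n $$ p - GamLim $$ p\<bar> \<le> e"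
proof -
  have "\<forall>\<^sub>F n in sequentially. \<bar>f n - c\<bar> \<le> e" if "f \<longlonglongrightarrow> c" for f :: "nat \<Rightarrow> real" and c
    using tendstoD[OF that e] by eventually_elim (simp add: dist_real_def)
  note lim_close = this
  show "\<forall>\<^sub>F n in sequentially. \<forall>i\<in>{..<r}. \<bar>w n i - lim i\<bar> \<le> e"
    by (rule eventually_ball_finite) (auto intro!: lim_close w_tendsto)
  have "(\<lambda>n. Gam n $$ p) \<longlonglongrightarrow> GamLim $$ p" if "p \<in> {..<r} \<times> {..<r}" for p
    using limit that by (auto simp: limiting_eigensystem_def mat_tendsto_def)
  then show "\<forall>\<^sub>F n in sequentially. \<forall>p\<in>{..<r} \<times> {..<r}. \<bar>Gam n $$ p - GamLim $$ p\<bar> \<le> e"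
    by (intro eventually_ball_finite) (auto intro!: lim_close)
qed

lemma Gam_entry: "i < r \<Longrightarrow> j < r \<Longrightarrow> \<bar>Gam n $$ (i,j)\<bar> \<le> real r"
proof -
  assume ij: "i < r" "j < r"
  have G: "Gam n \<in> carrier_mat r r" "transpose_mat (Gam n) * Gam n = 1\<^sub>m r"
    using spec[of n] by (auto simp: spectral_decomposition_def)
  have "(Gam n $$ (i,j))\<^sup>2 \<le> (\<Sum>j<r. (Gam n $$ (i,j))\<^sup>2)" using ij by (intro member_le_sum) auto
  also have "\<dots> \<le> (\<Sum>i<r. \<Sum>j<r. (Gam n $$ (i,j))\<^sup>2)"
    using ij by (intro member_le_sum[of i "{..<r}" "\<lambda>i. \<Sum>j<r. (Gam n $$ (i,j))\<^sup>2"]) (auto intro: sum_nonneg)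
  also have "\<dots> = (frob_norm (Gam n))\<^sup>2" by (rule frob_norm_power2[OF G(1), symmetric])
  also have "\<dots> = real r" by (simp add: frob_norm_isometry[OF G])
  also have "\<dots> \<le> (real r)\<^sup>2" using r by (simp add: power2_eq_square)
  finally show ?thesis using power2_le_iff_abs_le[of "real r" "Gam n $$ (i,j)"] by simp
qed

lemma GamLim_entry: "i < r \<Longrightarrow> j < r \<Longrightarrow> \<bar>GamLim $$ (i,j)\<bar> \<le> real r"
proof -
  assume ij: "i < r" "j < r"
  then have "(\<lambda>n. Gam n $$ (i,j)) \<longlonglongrightarrow> GamLim $$ (i,j)"
    using limit by (auto simp: limiting_eigensystem_def mat_tendsto_def)
  from tendsto_rabs[OF this] show ?thesis
    by (rule tendsto_upperbound) (use Gam_entry[OF ij] in simp_all)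
qed

definition J where "J n \<omega> = transpose_mat (Gam n) * K n \<omega>"

text \<open>J_ll is (Gam^T F^T Fh)_ll / T, a transposed diagonal entry of Fh^T F Gam, and this is
  the quantity whose sign the orientation convention fixes.\<close>

lemma J_diag_nonneg:
  assumes b: "big n" and w: "\<omega> \<in> space M" and l: "l < r"
  shows "0 \<le> J n \<omega> $$ (l,l)"
proof -
  interpret s: ppca_sample "N n" "T n" r "lam n" "B n" "F n \<omega>" "E n \<omega>" "Fh n \<omega>" by (rule sample[OF b w])
  have G: "Gam n \<in> carrier_mat r r" "transpose_mat (Gam n) \<in> carrier_mat r r" using spec[of n] by (auto simp: spectral_decomposition_def)
  have FhF: "transpose_mat (F n \<omega>) * Fh n \<omega> \<in> carrier_mat r r" using s.Ft s.Fh by simp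
  have Fht: "transpose_mat (Fh n \<omega>) \<in> carrier_mat r (T n)" using s.Fh by simp
  have FG: "F n \<omega> * Gam n \<in> carrier_mat (T n) r" using s.F G by simp
  have JT: "J n \<omega> = (1 / real (T n)) \<cdot>\<^sub>m (transpose_mat (Gam n) * (transpose_mat (F n \<omega>) * Fh n \<omega>))"
    unfolding J_def K_def by (rule mult_smult_distrib[OF G(2) FhF])
  have "transpose_mat (transpose_mat (Fh n \<omega>) * (F n \<omega> * Gam n)) = transpose_mat (Gam n) * transpose_mat (F n \<omega>) * Fh n \<omega>"
    unfolding transpose_mult[OF Fht FG] transpose_mult[OF s.F G(1)] by simp
  also have "\<dots> = transpose_mat (Gam n) * (transpose_mat (F n \<omega>) * Fh n \<omega>)" by (rule assoc_mult_mat[OF G(2) s.Ft s.Fh])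
  finally have "(transpose_mat (Gam n) * (transpose_mat (F n \<omega>) * Fh n \<omega>)) $$ (l,l)
    = transpose_mat (transpose_mat (Fh n \<omega>) * (F n \<omega> * Gam n)) $$ (l,l)" by simp
  also have "\<dots> = (transpose_mat (Fh n \<omega>) * (F n \<omega> * Gam n)) $$ (l,l)"
    using mult_carrier_mat[OF Fht FG] l by (intro index_transpose_mat(1)) auto
  also have "\<dots> \<ge> 0" using signs w l by (auto simp: compatible_signs_def)
  finally have "0 \<le> (transpose_mat (Gam n) * (transpose_mat (F n \<omega>) * Fh n \<omega>)) $$ (l,l)" .
  moreover have "J n \<omega> $$ (l,l) = 1 / real (T n) * (transpose_mat (Gam n) * (transpose_mat (F n \<omega>) * Fh n \<omega>)) $$ (l,l)"
    unfolding JT using carrier_matD[OF mult_carrier_mat[OF G(2) FhF]] l by (intro index_smult_mat(1)) auto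
  ultimately show ?thesis by simp
qed

text \<open>The larger of the commutator and near isometry bounds at |\<Delta>| = x, since the
  perturbation lemma takes a single error parameter.\<close>

definition perturbation_bound where
  "perturbation_bound x = max (sqrt (real r) * real r * x) (((1 + real r) * real r * x / (\<kappa> / 2))\<^sup>2)"

lemma J_close:
  assumes g: "good n \<omega>" and x: "frob_norm (Dl n \<omega>) \<le> x" and q: "perturbation_bound x \<le> q"
    and gap: "0 < g" "\<forall>i k. i < k \<longrightarrow> k < r \<longrightarrow> w n k + g \<le> w n i"
    and small: "8 * real r * q \<le> g" "8 * q \<le> 1"
  shows "\<forall>i<r. \<forall>j<r. \<bar>J n \<omega> $$ (i,j) - (if i = j then 1 else 0)\<bar> \<le> q + 2 * q / g"
    and "\<forall>j<r. \<bar>L n \<omega> j - w n j\<bar> \<le> 2 * real r * q"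
proof -
  note g' = goodD[OF g]
  interpret s: ppca_sample_orth "N n" "T n" r "lam n" "B n" "F n \<omega>" "E n \<omega>" "Fh n \<omega>" by (rule g'(3))
  note eq = sample_eq[OF g'(4)]
  have k: "0 < \<kappa> / 2" using \<kappa> by simp
  have Lk: "\<And>l. l < r \<Longrightarrow> \<kappa> / 2 \<le> nth_eigenvalue s.Sh l" unfolding eq by (rule g'(5))
  have "s.J (Gam n) = transpose_mat (Gam n) * s.K" by (rule s.J_def[OF k Lk spec])
  then have sJ: "s.J (Gam n) = J n \<omega>" unfolding J_def eq .
  have q1: "sqrt (real r) * real r * frob_norm (Dl n \<omega>) \<le> q"
    using q mult_left_mono[OF x, of "sqrt (real r) * real r"] by (simp add: perturbation_bound_def)
  have q2: "((1 + real r) * real r * frob_norm (Dl n \<omega>) / (\<kappa> / 2))\<^sup>2 \<le> q"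
  proof -
    have "(1 + real r) * real r * frob_norm (Dl n \<omega>) / (\<kappa> / 2) \<le> (1 + real r) * real r * x / (\<kappa> / 2)"
      using x k by (intro divide_right_mono mult_left_mono) auto
    then have "((1 + real r) * real r * frob_norm (Dl n \<omega>) / (\<kappa> / 2))\<^sup>2 \<le> ((1 + real r) * real r * x / (\<kappa> / 2))\<^sup>2"
      using k by (intro power_mono) auto
    then show ?thesis using q by (simp add: perturbation_bound_def)
  qed
  have com: "\<bar>(w n i - L n \<omega> j) * J n \<omega> $$ (i,j)\<bar> \<le> q" if "i < r" "j < r" for i j
    using s.commutator_bound[OF k Lk spec that] q1 unfolding sJ eq by linarith
  have orth: "\<bar>(\<Sum>i<r. J n \<omega> $$ (i,j) * J n \<omega> $$ (i,k)) - (if j = k then 1 else 0)\<bar> \<le> q" if "j < r" "k < r" for j k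
    using s.near_isometry_bound[OF k Lk spec that] q2 unfolding sJ eq by linarith
  have srt: "L n \<omega> k \<le> L n \<omega> j" if "j \<le> k" "k < r" for j k
    using s.L_sorted[OF that] unfolding eq .
  have sgn: "0 \<le> J n \<omega> $$ (j,j)" if "j < r" for j by (rule J_diag_nonneg[OF g'(1,2) that])
  have gap': "w n k + g \<le> w n i" if "i < k" "k < r" for i k using gap(2) that by blast
  show "\<forall>i<r. \<forall>j<r. \<bar>J n \<omega> $$ (i,j) - (if i = j then 1 else 0)\<bar> \<le> q + 2 * q / g"
    using eigenvector_perturbation(1)[of g r q "w n" "L n \<omega>" "\<lambda>i j. J n \<omega> $$ (i,j)", OF gap(1) small com orth gap' srt sgn] by blast
  show "\<forall>j<r. \<bar>L n \<omega> j - w n j\<bar> \<le> 2 * real r * q"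
    using eigenvector_perturbation(2)[of g r q "w n" "L n \<omega>" "\<lambda>i j. J n \<omega> $$ (i,j)", OF gap(1) small com orth gap' srt sgn] by blast
qed

lemma whp_J_close:
  assumes e: "0 < e"
  shows "whp M (\<lambda>n \<omega>. good n \<omega> \<and> (\<forall>i<r. \<forall>j<r. \<bar>J n \<omega> $$ (i,j) - (if i = j then 1 else 0)\<bar> \<le> e) \<and>
    (\<forall>j<r. \<bar>L n \<omega> j - w n j\<bar> \<le> e))"
proof -
  obtain g where g: "0 < g" and gap: "\<forall>\<^sub>F n in sequentially. \<forall>i k. i < k \<longrightarrow> k < r \<longrightarrow> w n k + g \<le> w n i"
    using eventually_gap by blast
  have r0: "0 < real r" using r by simp
  \<comment> \<open>The first two entries are the smallness conditions of the perturbation lemma;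
    the last two bring its two conclusions below \<open>e\<close>.\<close>
  define q where "q = min (min (g / (8 * real r)) (1 / 8)) (min (e / (1 + 2 / g)) (e / (2 * real r)))"
  have g2: "0 < 1 + 2 / g" using g by (simp add: add_pos_pos)
  have q0: "0 < q" using g e r0 g2 by (simp add: q_def)
  have "q \<le> g / (8 * real r)" "q \<le> 1 / 8" "q \<le> e / (1 + 2 / g)" "q \<le> e / (2 * real r)"
    unfolding q_def by (simp_all only: min_le_iff_disj order_refl simp_thms)
  then have q: "8 * real r * q \<le> g" "8 * q \<le> 1" "q * (1 + 2 / g) \<le> e" "2 * real r * q \<le> e"
    using pos_le_divide_eq[of "8 * real r" q g] pos_le_divide_eq[OF g2, of q e] pos_le_divide_eq[of "2 * real r" q e] r0
    by (auto simp only: mult.commute[of q] zero_less_mult_iff zero_less_numeral)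
  have q3: "q + 2 * q / g \<le> e" using q(3) by (simp add: distrib_left mult.commute)
  \<comment> \<open>Solves \<open>perturbation_bound x\<close> \<le> \<open>q\<close>; the square
    root undoes the square in its second entry.\<close>
  define x where "x = min (q / (sqrt (real r) * real r)) (sqrt q * (\<kappa> / 2) / ((1 + real r) * real r))"
  have sr: "0 < sqrt (real r) * real r" "0 < (1 + real r) * real r" using r0 by auto
  have x0: "0 < x" using q0 sr \<kappa> by (simp add: x_def)
  have "x \<le> q / (sqrt (real r) * real r)" "x \<le> sqrt q * (\<kappa> / 2) / ((1 + real r) * real r)" by (simp_all add: x_def)
  then have x: "sqrt (real r) * real r * x \<le> q" "(1 + real r) * real r * x \<le> sqrt q * (\<kappa> / 2)"
    unfolding pos_le_divide_eq[OF sr(1)] pos_le_divide_eq[OF sr(2)] by (simp_all only: mult.commute)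
  have "((1 + real r) * real r * x / (\<kappa> / 2))\<^sup>2 \<le> (sqrt q)\<^sup>2"
  proof (rule power_mono)
    have k: "0 < \<kappa> / 2" using \<kappa> by simp
    show "(1 + real r) * real r * x / (\<kappa> / 2) \<le> sqrt q" unfolding pos_divide_le_eq[OF k] by (rule x(2))
    show "0 \<le> (1 + real r) * real r * x / (\<kappa> / 2)" using sr x0 k by simp
  qed
  then have pq: "perturbation_bound x \<le> q" using x(1) q0 by (simp add: perturbation_bound_def)
  show ?thesis
  proof (rule whp_mono[OF whp_conj[OF whp_good bounded_in_prob_tendsto_zero[OF bounded_Dl \<eta>_tendsto x0]]])
    show "\<forall>\<^sub>F n in sequentially. \<forall>\<omega>\<in>space M. good n \<omega> \<and> frob_norm (Dl n \<omega>) \<le> x \<longrightarrow>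
      good n \<omega> \<and> (\<forall>i<r. \<forall>j<r. \<bar>J n \<omega> $$ (i,j) - (if i = j then 1 else 0)\<bar> \<le> e) \<and> (\<forall>j<r. \<bar>L n \<omega> j - w n j\<bar> \<le> e)"
      using gap
    proof eventually_elim
      case (elim n)
      show ?case
      proof (rule ballI, rule impI, elim conjE)
        fix \<omega> assume gd: "good n \<omega>" and D: "frob_norm (Dl n \<omega>) \<le> x"
        note J = J_close[OF gd D pq g elim q(1,2)]
        have "\<bar>J n \<omega> $$ (i,j) - (if i = j then 1 else 0)\<bar> \<le> e" if "i < r" "j < r" for i j
          using J(1)[rule_format, OF that] q3 by linarith
        moreover have "\<bar>L n \<omega> j - w n j\<bar> \<le> e" if "j < r" for j
          using J(2)[rule_format, OF that] q(4) by linarith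
        ultimately show "good n \<omega> \<and> (\<forall>i<r. \<forall>j<r. \<bar>J n \<omega> $$ (i,j) - (if i = j then 1 else 0)\<bar> \<le> e) \<and> (\<forall>j<r. \<bar>L n \<omega> j - w n j\<bar> \<le> e)"
          using gd by blast
      qed
    qed
  qed
qed

text \<open>The limit in probability of \<Lambda>_r^-1 K^T: K = Gam J with J close to the identity,
  and the sample eigenvalues approach those of \<Omega>.\<close>

definition A where "A = inv_mat LamLim * transpose_mat GamLim"

lemma inv_LamLim: "inv_mat LamLim = mat_diag r (\<lambda>l. 1 / lim l)"
proof -
  have "\<forall>i<r. lim i \<noteq> 0" using lim_ge \<kappa> by force
  then have "inv_mat (mat_diag r lim) = mat_diag r (\<lambda>l. 1 / lim l)" unfolding inv_mat_diag by simp
  then show ?thesis unfolding LamLim[symmetric] .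
qed

lemma A: "A \<in> carrier_mat r r"
  unfolding A_def inv_LamLim using lim_carrier by (intro mult_carrier_mat[of _ r r]) auto

lemma A_entry: "i < r \<Longrightarrow> j < r \<Longrightarrow> A $$ (i,j) = 1 / lim i * GamLim $$ (j,i)"
  unfolding A_def inv_LamLim using lim_carrier by (subst mat_diag_mult_left[of _ r r]) auto

lemma whp_A_close:
  assumes e: "0 < e"
  shows "whp M (\<lambda>n \<omega>. frob_norm (Li n \<omega> * transpose_mat (K n \<omega>) - A) \<le> e)"
proof -
  \<comment> \<open>In K - GamLim = Gam (J - I) + (Gam - GamLim) an entry of the first summand has r
    terms of size at most r x, and the second summand adds x.\<close>
  define R where "R = real r * real r + 1"
  define k where "k = \<kappa> / 2"
  have k: "0 < k" "k \<le> \<kappa>" using \<kappa> by (auto simp: k_def)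
  have "1 * real r \<le> real r * real r" using r by (intro mult_right_mono) auto
  then have R: "0 < R" "real r \<le> R" using r unfolding R_def by linarith+
  define q where "q = R / k + 2 * R / k\<^sup>2"
  have q: "0 < q" using R k by (simp add: q_def add_pos_pos)
  \<comment> \<open>All r^2 entries will be within q x of the limit, so the Frobenius distance is at
    most r q x = e.\<close>
  define x where "x = e / (real r * q)"
  have x: "0 < x" "real r * (q * x) = e" using e q r by (auto simp: x_def)
  show ?thesis
  proof (rule whp_mono[OF whp_J_close[OF x(1)]])
    show "\<forall>\<^sub>F n in sequentially. \<forall>\<omega>\<in>space M. good n \<omega> \<and>
        (\<forall>i<r. \<forall>j<r. \<bar>J n \<omega> $$ (i,j) - (if i = j then 1 else 0)\<bar> \<le> x) \<and> (\<forall>j<r. \<bar>L n \<omega> j - w n j\<bar> \<le> x) \<longrightarrow>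
      frob_norm (Li n \<omega> * transpose_mat (K n \<omega>) - A) \<le> e"
      using eventually_eigensystem_close[OF x(1)]
    proof eventually_elim
      case (elim n)
      show ?case
      proof (rule ballI, rule impI, elim conjE)
        fix \<omega> assume gd: "good n \<omega>" and Jc: "\<forall>i<r. \<forall>j<r. \<bar>J n \<omega> $$ (i,j) - (if i = j then 1 else 0)\<bar> \<le> x"
          and Lc: "\<forall>j<r. \<bar>L n \<omega> j - w n j\<bar> \<le> x"
        note g' = goodD[OF gd]
        interpret s: ppca_sample_orth "N n" "T n" r "lam n" "B n" "F n \<omega>" "E n \<omega>" "Fh n \<omega>" by (rule g'(3))
        note eq = sample_eq[OF g'(4)]
        have K: "K n \<omega> \<in> carrier_mat r r" using s.K unfolding eq .
        then have Kt: "transpose_mat (K n \<omega>) \<in> carrier_mat r r" by simp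
        have Li: "Li n \<omega> \<in> carrier_mat r r" using s.Li(1) unfolding eq .
        have G: "Gam n \<in> carrier_mat r r" "transpose_mat (Gam n) * Gam n = 1\<^sub>m r"
          using spec[of n] by (auto simp: spectral_decomposition_def)
        have Gt: "transpose_mat (Gam n) \<in> carrier_mat r r" using G by simp
        have J: "J n \<omega> \<in> carrier_mat r r" unfolding J_def by (rule mult_carrier_mat[OF Gt K])
        have KJ: "K n \<omega> = Gam n * J n \<omega>"
          unfolding J_def using assoc_mult_mat[OF G(1) Gt K] orthogonal_matD[OF G] K by simp
        have Kc: "\<bar>K n \<omega> $$ (j,i) - GamLim $$ (j,i)\<bar> \<le> R * x" if ij: "i < r" "j < r" for i j
        proof -
          have "(\<Sum>l<r. Gam n $$ (j,l) * (if l = i then 1 else 0)) = Gam n $$ (j,i)"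
            using ij by (simp add: if_distrib cong: if_cong)
          then have split: "K n \<omega> $$ (j,i) - GamLim $$ (j,i) =
              (\<Sum>l<r. Gam n $$ (j,l) * (J n \<omega> $$ (l,i) - (if l = i then 1 else 0))) + (Gam n $$ (j,i) - GamLim $$ (j,i))"
            unfolding KJ index_mult_mat_sum[OF G(1) J ij(2,1)] by (simp add: right_diff_distrib sum_subtractf)
          have "\<bar>Gam n $$ (j,l) * (J n \<omega> $$ (l,i) - (if l = i then 1 else 0))\<bar> \<le> real r * x" if l: "l < r" for l
            unfolding abs_mult by (rule mult_mono[OF Gam_entry[OF ij(2) l] Jc[rule_format, OF l ij(1)]]) simp_all
          then have "(\<Sum>l<r. \<bar>Gam n $$ (j,l) * (J n \<omega> $$ (l,i) - (if l = i then 1 else 0))\<bar>) \<le> (\<Sum>l<r. real r * x)"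
            by (intro sum_mono) simp
          moreover note sum_abs[of "\<lambda>l. Gam n $$ (j,l) * (J n \<omega> $$ (l,i) - (if l = i then 1 else 0))" "{..<r}"]
          moreover have "\<bar>Gam n $$ (j,i) - GamLim $$ (j,i)\<bar> \<le> x" using bspec[OF elim(2), of "(j,i)"] ij by simp
          moreover have "(\<Sum>l<r. real r * x) + x = R * x" by (simp add: R_def distrib_right)
          ultimately show ?thesis unfolding split by linarith
        qed
        have ent: "\<bar>(Li n \<omega> * transpose_mat (K n \<omega>) - A) $$ (i,j)\<bar> \<le> q * x" if ij: "i < r" "j < r" for i j
        proof -
          have "(Li n \<omega> * transpose_mat (K n \<omega>)) $$ (i,j) = 1 / L n \<omega> i * K n \<omega> $$ (j,i)"
            unfolding Li_def mat_diag_mult_left[OF Kt] using ij K by simp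
          then have e: "(Li n \<omega> * transpose_mat (K n \<omega>) - A) $$ (i,j) = 1 / L n \<omega> i * K n \<omega> $$ (j,i) - 1 / lim i * GamLim $$ (j,i)"
            using A ij A_entry[OF ij] by simp
          have Ll: "\<bar>L n \<omega> i - lim i\<bar> \<le> 2 * x"
            using Lc[rule_format, OF ij(1)] bspec[OF elim(1), of i] ij by simp
          show ?thesis unfolding e q_def
          proof (rule scaled_entry_close[OF k(1) _ _ _ Ll Kc[OF ij]])
            show "k \<le> L n \<omega> i" using g'(5)[OF ij(1)] by (simp add: k_def)
            show "k \<le> lim i" using lim_ge[OF ij(1)] k by linarith
            show "0 \<le> R" using R by simp
            show "\<bar>GamLim $$ (j,i)\<bar> \<le> R" using GamLim_entry[OF ij(2,1)] R by linarith
          qed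
        qed
        have "frob_norm (Li n \<omega> * transpose_mat (K n \<omega>) - A) \<le> sqrt (real r * real r) * (q * x)"
          by (rule frob_norm_le_entries[OF minus_carrier_mat[OF A] ent]) (use q x in auto)
        also have "\<dots> = e" using x(2) by simp
        finally show "frob_norm (Li n \<omega> * transpose_mat (K n \<omega>) - A) \<le> e" .
      qed
    qed
  qed
qed

end

lemma mult_minus_distrib_mat_vec:
  fixes A B :: "real Matrix.mat"
  assumes "A \<in> carrier_mat m n" "B \<in> carrier_mat m n" "v \<in> carrier_vec n"
  shows "(A - B) *\<^sub>v v = A *\<^sub>v v - B *\<^sub>v v"
  using assms by (intro eq_vecI) (auto simp: row_minus[of _ m n] minus_scalar_prod_distrib[of _ n])

section \<open>Measurability of the scaled error\<close>

context ppca_asymptotics_pd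
begin

lemma random_matrix_E: "random_matrix M (T n) (N n) (E n)"
  by (rule random_matrix_mult[OF random_matrix_mult[OF random_matrix_const[OF carriers(1)] S] random_matrix_const[OF carriers(2)]])

lemma random_matrix_D: "big n \<Longrightarrow> random_matrix M (N n) (N n) (\<lambda>_. D n)"
  by (rule random_matrix_const[OF penalty_inv_carrier]) (auto simp: big_def lam)

lemma random_matrix_X: "random_matrix M (T n) (N n) (X n)"
  by (rule random_matrix_add[OF random_matrix_mult[OF F random_matrix_transpose[OF random_matrix_const[OF carriers(3)]]] random_matrix_E])

text \<open>The eigenvectors supplied by \<open>Fh\<close> are measurable by assumption, and through
  \<open>L_gram_form\<close> the eigenvalue is a polynomial in the entries of \<open>Fh\<close> and
  \<open>X\<close>. Roots of the characteristic polynomial are thereby avoided.\<close>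

lemma measurable_Sh_eigenvalue:
  assumes b: "big n" and l: "l < r"
  shows "(\<lambda>\<omega>. nth_eigenvalue (Sh n \<omega>) l) \<in> borel_measurable M"
proof -
  let ?Q = "\<lambda>\<omega>. transpose_mat (Fh n \<omega>) * (X n \<omega> * D n * transpose_mat (X n \<omega>)) * Fh n \<omega>"
  have Q: "random_matrix M r r ?Q"
    by (rule random_matrix_mult[OF random_matrix_mult[OF random_matrix_transpose[OF Fh]
          random_matrix_mult[OF random_matrix_mult[OF random_matrix_X random_matrix_D[OF b]] random_matrix_transpose[OF random_matrix_X]]] Fh])
  have "(\<lambda>\<omega>. 1 / (real (N n) * real (T n)) * (1 / real (T n)) * ?Q \<omega> $$ (l,l)) \<in> borel_measurable M"
    by (rule borel_measurable_times[OF borel_measurable_const random_matrixD(2)[OF Q l l]])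
  moreover have "nth_eigenvalue (Sh n \<omega>) l = 1 / (real (N n) * real (T n)) * (1 / real (T n)) * ?Q \<omega> $$ (l,l)" if w: "\<omega> \<in> space M" for \<omega>
  proof -
    interpret s: ppca_sample "N n" "T n" r "lam n" "B n" "F n \<omega>" "E n \<omega>" "Fh n \<omega>" by (rule sample[OF b w])
    have "dim_col (X n \<omega>) = N n" using carrier_matD(2)[OF s.X] .
    then show ?thesis using s.L_gram_form[OF l] unfolding sample_eq[OF sample[OF b w]] ppca_gram_def by simp
  qed
  ultimately show ?thesis by (subst measurable_cong) auto
qed

text \<open>Off the good event an eigenvalue may be 0, where the inverse jumps to the zero matrix;
  the measurable event that none vanishes separates the two formulas.\<close>

lemma random_matrix_inv_eigenvalues:
  assumes b: "big n"
  shows "random_matrix M r r (\<lambda>\<omega>. inv_mat (mat_diag r (nth_eigenvalue (Sh n \<omega>))))"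
  unfolding random_matrix_def
proof (intro conjI ballI allI impI)
  let ?P = "\<lambda>\<omega>. \<forall>i\<in>{..<r}. nth_eigenvalue (Sh n \<omega>) i \<noteq> 0"
  show "inv_mat (mat_diag r (nth_eigenvalue (Sh n \<omega>))) \<in> carrier_mat r r" for \<omega> unfolding inv_mat_diag by simp
  fix i j assume ij: "i < r" "j < r"
  have "{\<omega>\<in>space M. nth_eigenvalue (Sh n \<omega>) i \<noteq> 0} \<in> sets M" if "i < r" for i
    using measurable_Sh_eigenvalue[OF b that] by measurable
  then have P: "{\<omega>\<in>space M. ?P \<omega>} \<in> sets M" by (intro sets.sets_Collect_finite_All) auto
  have "(\<lambda>\<omega>. if ?P \<omega> then (if i = j then 1 / nth_eigenvalue (Sh n \<omega>) j else 0) else 0) \<in> borel_measurable M"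
    using measurable_Sh_eigenvalue[OF b ij(2)] by (intro measurable_If[OF _ _ P]) (cases "i = j", auto)
  moreover have "inv_mat (mat_diag r (nth_eigenvalue (Sh n \<omega>))) $$ (i,j) = (if ?P \<omega> then (if i = j then 1 / nth_eigenvalue (Sh n \<omega>) j else 0) else 0)" for \<omega>
    using ij unfolding inv_mat_diag by (auto simp: mat_diag_def)
  ultimately show "(\<lambda>\<omega>. inv_mat (mat_diag r (nth_eigenvalue (Sh n \<omega>))) $$ (i,j)) \<in> borel_measurable M" by simp
qed

lemma random_matrix_FH:
  assumes b: "big n"
  shows "random_matrix M (T n) r (\<lambda>\<omega>. F n \<omega> * (Omega_mat (N n) (lam n) (B n) * K n \<omega> * inv_mat (mat_diag r (nth_eigenvalue (Sh n \<omega>)))))"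
proof -
  have K: "random_matrix M r r (K n)"
    unfolding K_def by (rule random_matrix_smult[OF random_matrix_mult[OF random_matrix_transpose[OF F] Fh]])
  obtain \<omega> where w: "\<omega> \<in> space M" using not_empty by blast
  interpret s: ppca_sample "N n" "T n" r "lam n" "B n" "F n \<omega>" "E n \<omega>" "Fh n \<omega>" by (rule sample[OF b w])
  show ?thesis
    by (rule random_matrix_mult[OF F random_matrix_mult[OF random_matrix_mult[OF random_matrix_const[OF s.Om] K] random_matrix_inv_eigenvalues[OF b]]])
qed

text \<open>Convergence in distribution speaks about the pushforward of M, which is the intended law
  only for a measurable map. The rotation H is therefore treated at every sample point, not only on
  the good event.\<close>

lemma measurable_coords_err:
  assumes b: "big n" and t: "t < T n"
  shows "(\<lambda>\<omega>. coords (sqrt (real (N n)) \<cdot>\<^sub>v err t n \<omega>)) \<in> borel_measurable M"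
proof (rule measurable_coords)
  fix \<omega> assume w: "\<omega> \<in> space M"
  show "dim_vec (sqrt (real (N n)) \<cdot>\<^sub>v err t n \<omega>) = r" using carrier_vecD[OF err_carrier(1)[OF b w t]] by simp
next
  fix i assume i: "i < r"
  let ?Q = "\<lambda>\<omega>. F n \<omega> * (Omega_mat (N n) (lam n) (B n) * K n \<omega> * inv_mat (mat_diag r (nth_eigenvalue (Sh n \<omega>))))"
  have "(\<lambda>\<omega>. sqrt (real (N n)) * (Fh n \<omega> $$ (t,i) - ?Q \<omega> $$ (t,i))) \<in> borel_measurable M"
    by (rule borel_measurable_times[OF borel_measurable_const borel_measurable_diff[OF random_matrixD(2)[OF Fh t i] random_matrixD(2)[OF random_matrix_FH[OF b] t i]]])
  moreover have "vec_index (sqrt (real (N n)) \<cdot>\<^sub>v err t n \<omega>) i = sqrt (real (N n)) * (Fh n \<omega> $$ (t,i) - ?Q \<omega> $$ (t,i))" if w: "\<omega> \<in> space M" for \<omega>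
  proof -
    interpret s: ppca_sample "N n" "T n" r "lam n" "B n" "F n \<omega>" "E n \<omega>" "Fh n \<omega>" by (rule sample[OF b w])
    let ?H = "Omega_mat (N n) (lam n) (B n) * K n \<omega> * inv_mat (mat_diag r (nth_eigenvalue (Sh n \<omega>)))"
    have H: "H n \<omega> = ?H" using s.rotation_eq unfolding sample_eq[OF sample[OF b w]] .
    have "inv_mat (mat_diag r (nth_eigenvalue (Sh n \<omega>))) \<in> carrier_mat r r" unfolding inv_mat_diag by simp
    from mult_carrier_mat[OF mult_carrier_mat[OF s.Om s.K[unfolded sample_eq[OF sample[OF b w]]]] this]
    have Hc: "?H \<in> carrier_mat r r" .
    have FH: "?Q \<omega> \<in> carrier_mat (T n) r" by (rule mult_carrier_mat[OF s.F Hc])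
    have "err t n \<omega> = Matrix.row (Fh n \<omega>) t - Matrix.row (?Q \<omega>) t"
      unfolding err_def H row_mult[OF s.F Hc t] by (rule refl)
    then show ?thesis using carrier_matD[OF FH] carrier_matD[OF s.Fh] i t by (simp del: index_mult_mat)
  qed
  ultimately show "(\<lambda>\<omega>. vec_index (sqrt (real (N n)) \<cdot>\<^sub>v err t n \<omega>) i) \<in> borel_measurable M"
    by (subst measurable_cong) auto
qed

lemma measurable_coords_Z:
  assumes b: "big n" and t: "t < T n"
  shows "(\<lambda>\<omega>. coords (Z t n \<omega>)) \<in> borel_measurable M"
proof (rule measurable_coords)
  fix \<omega> assume w: "\<omega> \<in> space M"
  show "dim_vec (Z t n \<omega>) = r" using carrier_vecD[OF err_carrier(2)[OF b w t]] .
next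
  fix i assume i: "i < r"
  have EDB: "random_matrix M (T n) r (EDB n)"
    unfolding EDB_def by (rule random_matrix_mult[OF random_matrix_mult[OF random_matrix_E random_matrix_D[OF b]] random_matrix_const[OF carriers(3)]])
  have "(\<lambda>\<omega>. 1 / sqrt (real (N n)) * EDB n \<omega> $$ (t,i)) \<in> borel_measurable M"
    by (rule borel_measurable_times[OF borel_measurable_const random_matrixD(2)[OF EDB t i]])
  moreover have "vec_index (Z t n \<omega>) i = 1 / sqrt (real (N n)) * EDB n \<omega> $$ (t,i)" if w: "\<omega> \<in> space M" for \<omega>
    unfolding Z_eq_row[OF b w t] using carrier_matD[OF random_matrixD(1)[OF EDB w]] t i by simp
  ultimately show "(\<lambda>\<omega>. vec_index (Z t n \<omega>) i) \<in> borel_measurable M" by (subst measurable_cong) auto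
qed

end

section \<open>Convergence in distribution of the scores\<close>

context ppca_asymptotics_limit
begin

text \<open>The distance to A Z is at most the remainder, which is small because its rate ratio +
  \<eta> tends to 0, plus |\<Lambda>_r^-1 K^T - A| |Z|, a vanishing factor times a tight
  one.\<close>

lemma whp_err_close:
  assumes ratio: "ratio \<longlonglongrightarrow> 0" and e: "0 < e"
  shows "whp M (\<lambda>n \<omega>. eucl_norm (sqrt (real (N n)) \<cdot>\<^sub>v err t n \<omega> - A *\<^sub>v Z t n \<omega>) \<le> e)"
proof -
  let ?P = "\<lambda>n \<omega>. Li n \<omega> * transpose_mat (K n \<omega>)"
  have e2: "0 < e / 2" using e by simp
  have "(\<lambda>n. ratio n + \<eta> n) \<longlonglongrightarrow> 0" using tendsto_add[OF ratio \<eta>_tendsto] by simp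
  then have rm: "whp M (\<lambda>n \<omega>. rem t n \<omega> \<le> e / 2)" by (rule bounded_in_prob_tendsto_zero[OF bounded_rem _ e2])
  have pr: "whp M (\<lambda>n \<omega>. frob_norm (?P n \<omega> - A) * eucl_norm (Z t n \<omega>) \<le> e / 2)"
    by (rule whp_mult_bounded[OF whp_A_close bounded_Z _ _ e2]) simp_all
  show ?thesis
  proof (rule whp_mono[OF whp_conj[OF rm pr]])
    show "\<forall>\<^sub>F n in sequentially. \<forall>\<omega>\<in>space M. rem t n \<omega> \<le> e / 2 \<and> frob_norm (?P n \<omega> - A) * eucl_norm (Z t n \<omega>) \<le> e / 2 \<longrightarrow>
      eucl_norm (sqrt (real (N n)) \<cdot>\<^sub>v err t n \<omega> - A *\<^sub>v Z t n \<omega>) \<le> e"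
      using eventually_big eventually_T_gt[of t]
    proof eventually_elim
      case (elim n)
      show ?case
      proof (rule ballI, rule impI, elim conjE)
        fix \<omega> assume w: "\<omega> \<in> space M" and 1: "rem t n \<omega> \<le> e / 2" and 2: "frob_norm (?P n \<omega> - A) * eucl_norm (Z t n \<omega>) \<le> e / 2"
        interpret s: ppca_sample "N n" "T n" r "lam n" "B n" "F n \<omega>" "E n \<omega>" "Fh n \<omega>" by (rule sample[OF elim(1) w])
        note eq = sample_eq[OF sample[OF elim(1) w]]
        have Kt: "transpose_mat (K n \<omega>) \<in> carrier_mat r r" using s.K unfolding eq by simp
        have P: "?P n \<omega> \<in> carrier_mat r r" using mult_carrier_mat[OF s.Li(1)[unfolded eq] Kt] .
        note y = err_carrier(1)[OF elim(1) w elim(2)] and z = err_carrier(2)[OF elim(1) w elim(2)]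
        let ?x = "sqrt (real (N n)) \<cdot>\<^sub>v err t n \<omega>" and ?p = "?P n \<omega> *\<^sub>v Z t n \<omega>" and ?a = "A *\<^sub>v Z t n \<omega>"
        have c: "?x \<in> carrier_vec r" "?p \<in> carrier_vec r" "?a \<in> carrier_vec r"
          using smult_carrier_vec[THEN iffD2, OF y] mult_mat_vec_carrier[OF P z] mult_mat_vec_carrier[OF A z] by blast+
        have split: "u - v = (u - q) + (q - v)" if "u \<in> carrier_vec r" "q \<in> carrier_vec r" "v \<in> carrier_vec r" for u q v :: "real Matrix.vec"
          using that by (intro eq_vecI) auto
        have "eucl_norm (?x - ?a) \<le> eucl_norm (?x - ?p) + eucl_norm (?p - ?a)"
          unfolding split[OF c] by (rule eucl_norm_add_le[of _ r]) (use c in auto)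
        moreover have "eucl_norm (?p - ?a) \<le> frob_norm (?P n \<omega> - A) * eucl_norm (Z t n \<omega>)"
          unfolding mult_minus_distrib_mat_vec[OF P A z, symmetric] by (rule eucl_norm_mult_mat_vec_le[OF minus_carrier_mat[OF A] z])
        ultimately show "eucl_norm (?x - ?a) \<le> e" using 1 2 unfolding rem_def by linarith
      qed
    qed
  qed
qed

theorem scores_converge:
  assumes ratio: "ratio \<longlonglongrightarrow> 0" and Z: "converges_to_normal M r (Z t) V" and V: "V \<in> carrier_mat r r"
  shows "converges_to_normal M r (\<lambda>n \<omega>. sqrt (real (N n)) \<cdot>\<^sub>v err t n \<omega>)
    (inv_mat LamLim * transpose_mat GamLim * V * GamLim * inv_mat LamLim)"
proof -
  have ev: "\<forall>\<^sub>F n in sequentially. big n \<and> t < T n" by (rule eventually_conj[OF eventually_big eventually_T_gt])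
  have Li: "inv_mat LamLim \<in> carrier_mat r r" "transpose_mat (inv_mat LamLim) = inv_mat LamLim"
    unfolding inv_LamLim by (simp, intro eq_matI) (auto simp: mat_diag_def)
  have G: "GamLim \<in> carrier_mat r r" "transpose_mat GamLim \<in> carrier_mat r r" using lim_carrier by auto
  \<comment> \<open>The inverse of the diagonal limit is symmetric, so A V A^T takes the sandwich
    form of the stated covariance.\<close>
  have At: "transpose_mat A = GamLim * inv_mat LamLim"
    unfolding A_def transpose_mult[OF Li(1) G(2)] Li(2) by simp
  have "A * V * transpose_mat A = inv_mat LamLim * transpose_mat GamLim * V * GamLim * inv_mat LamLim"
    unfolding At using assoc_mult_mat[OF mult_carrier_mat[OF A V] G(1) Li(1)] unfolding A_def by simp
  moreover have "converges_to_normal M r (\<lambda>n \<omega>. sqrt (real (N n)) \<cdot>\<^sub>v err t n \<omega>) (A * V * transpose_mat A)"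
  proof (rule converges_to_normal_Slutsky[OF Z A])
    show "\<forall>\<^sub>F n in sequentially. \<forall>\<omega>\<in>space M. Z t n \<omega> \<in> carrier_vec r"
      using ev by eventually_elim (use err_carrier(2) in blast)
    show "\<forall>\<^sub>F n in sequentially. \<forall>\<omega>\<in>space M. sqrt (real (N n)) \<cdot>\<^sub>v err t n \<omega> \<in> carrier_vec r"
      using ev by eventually_elim (use err_carrier(1) smult_carrier_vec in blast)
    show "\<forall>\<^sub>F n in sequentially. (\<lambda>\<omega>. coords (Z t n \<omega>)) \<in> borel_measurable M"
      using ev by eventually_elim (use measurable_coords_Z in blast)
    show "\<forall>\<^sub>F n in sequentially. (\<lambda>\<omega>. coords (sqrt (real (N n)) \<cdot>\<^sub>v err t n \<omega>)) \<in> borel_measurable M"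
      using ev by eventually_elim (use measurable_coords_err in blast)
    show "bounded_in_prob M (\<lambda>n \<omega>. eucl_norm (Z t n \<omega>)) (\<lambda>_. 1)" by (rule bounded_Z)
    show "whp M (\<lambda>n \<omega>. eucl_norm (sqrt (real (N n)) \<cdot>\<^sub>v err t n \<omega> - A *\<^sub>v Z t n \<omega>) \<le> d)" if "0 < d" for d
      by (rule whp_err_close[OF ratio that])
  qed
  ultimately show ?thesis by simp
qed

end

theorem theorem3p2:
  fixes M :: "'a measure"
    and N T :: "nat \<Rightarrow> nat" and r :: nat
    and lam :: "nat \<Rightarrow> real" and C :: real
    and B P1 P2 V :: "nat \<Rightarrow> real Matrix.mat" and SigB :: "real Matrix.mat"
    and F S E X Fh H :: "nat \<Rightarrow> 'a \<Rightarrow> real Matrix.mat"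
    and ratio :: "nat \<Rightarrow> real"
  defines "E \<equiv> \<lambda>n \<omega>. P1 n * S n \<omega> * P2 n"
    and "X \<equiv> \<lambda>n \<omega>. F n \<omega> * transpose_mat (B n) + E n \<omega>"
    and "H \<equiv> \<lambda>n \<omega>. rotation_mat r (lam n) (X n \<omega>) (B n) (F n \<omega>) (Fh n \<omega>)"
    and "ratio \<equiv> \<lambda>n. frob_norm (penalty_inv (N n) (lam n)) /
                       min (real (T n)) (sqrt (real (N n) * real (T n)))"
  assumes "prob_space M" and "1 \<le> r" and "0 < C"
    and "filterlim N at_top sequentially" and "filterlim T at_top sequentially"
    and "\<And>n. 0 < lam n"
    and "factor_assumption M T r C F"
    and "loading_assumption N r C B SigB"
    and "noise_assumption M N T r C P1 P2 S F"
    and "clt_assumption M N r lam B P1 P2 E V"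
    and "\<exists>\<kappa>>0. \<forall>\<^sub>F n in sequentially. \<kappa> \<le> nth_eigenvalue (Omega_mat (N n) (lam n) (B n)) (r - 1)"
    and "\<And>n. random_matrix M (T n) r (Fh n)"
    and "\<And>n \<omega>. \<omega> \<in> space M \<Longrightarrow> ppca_factors r (lam n) (X n \<omega>) (Fh n \<omega>)"
  shows
    "(ratio \<longlonglongrightarrow> 0 \<longrightarrow>
        (\<forall>Gam GamLim LamLim.
           limiting_eigensystem r (\<lambda>n. Omega_mat (N n) (lam n) (B n)) Gam GamLim LamLim \<longrightarrow>
           compatible_signs M r Fh F Gam \<longrightarrow>
           (\<forall>t. converges_to_normal M r
              (\<lambda>n \<omega>. sqrt (real (N n)) \<cdot>\<^sub>v
                 (row (Fh n \<omega>) t - transpose_mat (H n \<omega>) *\<^sub>v row (F n \<omega>) t))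
              (inv_mat LamLim * transpose_mat GamLim * V t * GamLim * inv_mat LamLim)))) \<and>
     ((\<exists>c>0. \<forall>\<^sub>F n in sequentially. c < ratio n) \<longrightarrow>
        (\<forall>t. big_O_prob M
           (\<lambda>n \<omega>. row (Fh n \<omega>) t - transpose_mat (H n \<omega>) *\<^sub>v row (F n \<omega>) t)
           (\<lambda>n. frob_norm (penalty_inv (N n) (lam n)) /
                 (sqrt (real (N n)) * min (real (T n)) (sqrt (real (N n) * real (T n)))))))"
proof -
  obtain \<kappa> where \<kappa>: "0 < \<kappa>" "\<forall>\<^sub>F n in sequentially. \<kappa> \<le> nth_eigenvalue (Omega_mat (N n) (lam n) (B n)) (r - 1)"
    using assms(15) by blast
  interpret prob_space M by (rule assms(5))
  interpret ppca: ppca_asymptotics_pd M N T r lam C B P1 P2 SigB F S Fh \<kappa>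
    using assms(6-13) assms(16,17) \<kappa> unfolding E_def X_def by unfold_locales
  have ratio: "ratio = ppca.ratio" by (rule ext) (simp add: ratio_def ppca.ratio_def ppca.d_def)
  have err: "row (Fh n \<omega>) t - transpose_mat (H n \<omega>) *\<^sub>v row (F n \<omega>) t = ppca.err t n \<omega>" for t n \<omega>
    unfolding ppca.err_def H_def X_def E_def by (rule refl)
  show ?thesis unfolding err
  proof (intro conjI impI allI)
    fix Gam GamLim LamLim t
    assume lim: "ratio \<longlonglongrightarrow> 0" and eig: "limiting_eigensystem r (\<lambda>n. Omega_mat (N n) (lam n) (B n)) Gam GamLim LamLim"
      and signs: "compatible_signs M r Fh F Gam"
    \<comment> \<open>The limiting eigensystem and the choice of signs are premises of the first
      claim only; the second claim is obtained without this locale.\<close>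
    interpret limit: ppca_asymptotics_limit M N T r lam C B P1 P2 SigB F S Fh \<kappa> Gam GamLim LamLim
      by unfold_locales (rule eig, rule signs)
    have V: "V t \<in> carrier_mat r r" and Z: "converges_to_normal M r (ppca.Z t) (V t)"
      using assms(14) unfolding clt_assumption_def ppca.Z_def E_def by auto
    from limit.scores_converge[OF lim[unfolded ratio] Z V]
    show "converges_to_normal M r (\<lambda>n \<omega>. sqrt (real (N n)) \<cdot>\<^sub>v ppca.err t n \<omega>)
      (inv_mat LamLim * transpose_mat GamLim * V t * GamLim * inv_mat LamLim)" .
  next
    fix t assume "\<exists>c>0. \<forall>\<^sub>F n in sequentially. c < ratio n"
    then obtain c where "0 < c" "\<forall>\<^sub>F n in sequentially. c < ppca.ratio n" unfolding ratio by blast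
    from ppca.err_big_O_prob[OF this]
    show "big_O_prob M (\<lambda>n \<omega>. ppca.err t n \<omega>) (\<lambda>n. frob_norm (penalty_inv (N n) (lam n)) /
      (sqrt (real (N n)) * min (real (T n)) (sqrt (real (N n) * real (T n)))))" unfolding ppca.d_def .
  qed
qed

end
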